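(* Let $u_0\in H^1(\mathbb{R})$ be such that $u_0'\in L^1(\mathbb{R})$ and $u_0'(x)\leqslant M$ for all $x$, for some $M\in\mathbb{R}$. For $\ell>0$ let $u^\ell$ be the dissipative solution, constructed as in the context, of the regularised Burgers equation $u_t+uu_x+\ell^2P_x=0$ with initial datum $u_0$. Then there exist a function $u$, with $u\in L^\infty([0,T],BV(\mathbb{R}))$ for all $T>0$, and a subsequence of $u^\ell$ as $\ell\to+\infty$ (still denoted $u^\ell$), such that for all $T>0$ and every bounded interval $\mathcal{I}\subset\mathbb{R}$ $$u^\ell\ \xrightarrow{\ \ell\to+\infty\ }\ u\quad\text{in }\mathcal{C}([0,T],L^1(\mathcal{I})),$$ and $u$ satisfies (in the sense of distributions) the equation $$\left[u_t+\tfrac12(u^2)_x\right]_x=\nu$$ for some measure $\nu$ with $0\leqslant\nu\in L^\infty([0,+\infty[,\mathcal{M}^1(\mathbb{R}))$. Moreover, $u$ satisfies the Oleinik inequality $$u_x(t,x)\ \leqslant\ \frac{2M}{Mt+2}\quad\text{in }\mathcal{D}'(\mathbb{R}).$$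
   Context: $\mathcal{M}^1(\mathbb{R})$ is the space of finite Radon measures on $\mathbb{R}$; $BV(\mathbb{R})$ is understood as (bounded) functions with finite total variation on $\mathbb{R}$. In the equation, $P=\mathfrak{G}\ast\tfrac12u_x^2$ with $\mathfrak{G}(x)=(2\ell)^{-1}e^{-|x|/\ell}$. Construction of the dissipative solution $u^\ell$. Define $y_0(\xi)$, $\xi\in\mathbb{R}$, by $\int_0^{y_0(\xi)}(1+u_0'(x)^2)\,\mathrm{d}x=\xi$. Let $(v,q)$, with $(v,q)\in\mathcal{C}([0,T],L^\infty(\mathbb{R},\mathbb{R}^2))$ for every $T>0$, be the global solution of $$v_t=\begin{cases}-P(1+\cos v)-\sin^2(v/2),&v>-\pi,\\0,&v\leqslant-\pi,\end{cases}\qquad q_t=\begin{cases}q(\tfrac12-P)\sin v,&v>-\pi,\\0,&v\leqslant-\pi,\end{cases}$$ with $v(0,\xi)=2\arctan(u_0'(y_0(\xi)))$, $q(0,\xi)=1$, where, with $\bar q=q$ if $v>-\pi$ and $\bar q=0$ if $v\leqslant-\pi$, and $k(t,\xi,\xi')=\exp\{-\tfrac1\ell|\int_\xi^{\xi'}\bar q(t,s)\cos^2\tfrac{v(t,s)}2\,\mathrm{d}s|\}$, $$P(t,\xi)=\frac1{4\ell}\int_{\mathbb{R}}k(t,\xi,\xi')\,\bar q(t,\xi')\sin^2\tfrac{v(t,\xi')}2\,\mathrm{d}\xi',$$ $$P_x(t,\xi)=\frac1{4\ell^2}\Big(\int_\xi^{+\infty}-\int_{-\infty}^\xi\Big)k(t,\xi,\xi')\,\bar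 q(t,\xi')\sin^2\tfrac{v(t,\xi')}2\,\mathrm{d}\xi'.$$ Let $u(t,\xi)=u_0(y_0(\xi))-\int_0^t\ell^2P_x(s,\xi)\,\mathrm{d}s$ and $y(t,\xi)=y_0(\xi)+\int_0^tu(s,\xi)\,\mathrm{d}s$. Then $u^\ell$ is defined by $u^\ell(t,x)=u(t,\xi)$ whenever $x=y(t,\xi)$. It is known that this is well defined and gives a global dissipative solution: $u^\ell\in\mathrm{Lip}([0,T],L^2_{\rm loc})$, $u^\ell_x\in L^\infty([0,T],L^2_{\rm loc})$ for all $T$; the equation holds weakly with $u^\ell(0,\cdot)=u_0$; $[\tfrac12u^2+\tfrac12\ell^2u_x^2]_t+[\tfrac13u^3+\ell^2uP+\tfrac12\ell^2uu_x^2]_x\leqslant0$ in the sense of distributions; $u^\ell_x\leqslant 2/t$ (and $u^\ell_x\leqslant 2M/(Mt+2)$ when $u_0'\leqslant M$); and, since $u_0\in H^1$, $\int[u^2+\ell^2u_x^2]\,\mathrm{d}x\leqslant\int[u_0^2+\ell^2u_0'^2]\,\mathrm{d}x$ for a.e. $t>0$. *)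

theory Defs
  imports "HOL-Analysis.Analysis"
begin

section \<open>Test functions, Sobolev and BV spaces\<close>

text \<open>A function is of class \<open>C\<^sup>n\<^sup>+\<^sup>1\<close> iff it is differentiable and all its directional
  derivatives are of class \<open>C\<^sup>n\<close>.\<close>

primrec Ck :: "nat \<Rightarrow> ('a::euclidean_space \<Rightarrow> real) \<Rightarrow> bool" where
  "Ck 0 f \<longleftrightarrow> continuous_on UNIV f"
| "Ck (Suc n) f \<longleftrightarrow>
     (\<exists>f'. (\<forall>x. (f has_derivative f' x) (at x)) \<and> (\<forall>h. Ck n (\<lambda>x. f' x h)))"

definition test_fun :: "'a::euclidean_space set \<Rightarrow> ('a \<Rightarrow> real) \<Rightarrow> bool" where
  "test_fun \<Omega> \<phi> \<longleftrightarrow> (\<forall>n. Ck n \<phi>) \<and> compact (closure {x. \<phi> x \<noteq> 0}) \<and> closure {x. \<phi> x \<noteq> 0} \<subseteq> \<Omega>"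

definition d_t :: "(real \<times> real \<Rightarrow> real) \<Rightarrow> real \<times> real \<Rightarrow> real" where
  "d_t \<phi> z = frechet_derivative \<phi> (at z) (1, 0)"

definition d_x :: "(real \<times> real \<Rightarrow> real) \<Rightarrow> real \<times> real \<Rightarrow> real" where
  "d_x \<phi> z = frechet_derivative \<phi> (at z) (0, 1)"

definition L2 :: "(real \<Rightarrow> real) \<Rightarrow> bool" where
  "L2 f \<longleftrightarrow> f \<in> borel_measurable lebesgue \<and> integrable lebesgue (\<lambda>x. (f x)\<^sup>2)"

text \<open>\<open>f\<close> is the continuous representative of an element of \<open>H\<^sup>1(\<real>)\<close> and \<open>f'\<close> is a representative
  of its weak derivative (which is determined only almost everywhere).\<close>

definition H1 :: "(real \<Rightarrow> real) \<Rightarrow> (real \<Rightarrow> real) \<Rightarrow> bool" where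
  "H1 f f' \<longleftrightarrow> L2 f \<and> L2 f' \<and> continuous_on UNIV f \<and>
     (\<forall>\<phi>. test_fun UNIV \<phi> \<longrightarrow>
        (LINT x|lebesgue. f x * deriv \<phi> x) = - (LINT x|lebesgue. f' x * \<phi> x))"

definition total_variation :: "(real \<Rightarrow> real) \<Rightarrow> ennreal" where
  "total_variation f =
     (SUP (n, x) \<in> {(n :: nat, x :: nat \<Rightarrow> real). mono x}. \<Sum>i<n. ennreal \<bar>f (x (Suc i)) - f (x i)\<bar>)"

text \<open>\<open>L\<^sup>\<infinity>([0,T], BV(\<real>))\<close>, where \<open>BV(\<real>)\<close> consists of the bounded functions of finite total
  variation. Since \<open>BV(\<real>)\<close> is not separable, measurability is that of the function of \<open>(t,x)\<close>.\<close>

definition Linf_BV :: "real \<Rightarrow> (real \<Rightarrow> real \<Rightarrow> real) \<Rightarrow> bool" where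
  "Linf_BV T u \<longleftrightarrow>
     set_borel_measurable lebesgue ({0..T} \<times> UNIV) (\<lambda>(t, x). u t x) \<and>
     (\<exists>C. AE t in lebesgue. t \<in> {0..T} \<longrightarrow>
        (\<forall>x. \<bar>u t x\<bar> \<le> C) \<and> total_variation (u t) \<le> ennreal C)"

text \<open>\<open>C([0,T], L\<^sup>1(I))\<close> and convergence in it.\<close>

definition C_L1 :: "real \<Rightarrow> real set \<Rightarrow> (real \<Rightarrow> real \<Rightarrow> real) \<Rightarrow> bool" where
  "C_L1 T I f \<longleftrightarrow>
     (\<forall>t\<in>{0..T}. set_integrable lebesgue I (f t)) \<and>
     (\<forall>t\<^sub>0\<in>{0..T}. ((\<lambda>t. LINT x:I|lebesgue. \<bar>f t x - f t\<^sub>0 x\<bar>) \<longlongrightarrow> 0) (at t\<^sub>0 within {0..T}))"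

definition C_L1_tendsto ::
    "real \<Rightarrow> real set \<Rightarrow> (nat \<Rightarrow> real \<Rightarrow> real \<Rightarrow> real) \<Rightarrow> (real \<Rightarrow> real \<Rightarrow> real) \<Rightarrow> bool" where
  "C_L1_tendsto T I f g \<longleftrightarrow>
     (\<forall>n. C_L1 T I (f n)) \<and> C_L1 T I g \<and>
     uniform_limit {0..T} (\<lambda>n t. LINT x:I|lebesgue. \<bar>f n t x - g t x\<bar>) (\<lambda>t. 0) sequentially"

text \<open>Non-negative elements of \<open>L\<^sup>\<infinity>([0,\<infinity>[, M\<^sup>1(\<real>))\<close>; every finite Borel measure on the line is
  Radon, and setwise measurability in \<open>t\<close> is equivalent to weak-* measurability.\<close>

definition Linf_M1_nonneg :: "(real \<Rightarrow> real measure) \<Rightarrow> bool" where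
  "Linf_M1_nonneg \<nu> \<longleftrightarrow>
     (\<forall>t\<ge>0. finite_measure (\<nu> t) \<and> sets (\<nu> t) = sets borel) \<and>
     (\<forall>A\<in>sets borel. set_borel_measurable lebesgue {0..} (\<lambda>t. measure (\<nu> t) A)) \<and>
     (\<exists>C. AE t in lebesgue. t \<ge> 0 \<longrightarrow> measure (\<nu> t) UNIV \<le> C)"

text \<open>\<open>C([0,T], L\<^sup>\<infinity>(\<real>))\<close> for every \<open>T > 0\<close>.\<close>

definition C_Linf :: "(real \<Rightarrow> real \<Rightarrow> real) \<Rightarrow> bool" where
  "C_Linf w \<longleftrightarrow>
     (\<forall>t\<ge>0. w t \<in> borel_measurable lebesgue \<and> (\<exists>C. AE \<xi> in lebesgue. \<bar>w t \<xi>\<bar> \<le> C)) \<and>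
     (\<forall>t\<^sub>0\<ge>0. \<forall>\<epsilon>>0. \<forall>\<^sub>F t in at t\<^sub>0 within {0..}. AE \<xi> in lebesgue. \<bar>w t \<xi> - w t\<^sub>0 \<xi>\<bar> \<le> \<epsilon>)"


section \<open>The dissipative solution of the regularised Burgers equation\<close>

text \<open>In the next five definitions \<open>v\<close> and \<open>q\<close> are the Lagrangian unknowns at a fixed time.\<close>

definition qbar :: "(real \<Rightarrow> real) \<Rightarrow> (real \<Rightarrow> real) \<Rightarrow> real \<Rightarrow> real" where
  "qbar v q \<xi> = (if v \<xi> > - pi then q \<xi> else 0)"

definition kern :: "real \<Rightarrow> (real \<Rightarrow> real) \<Rightarrow> (real \<Rightarrow> real) \<Rightarrow> real \<Rightarrow> real \<Rightarrow> real" where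
  "kern l v q \<xi> \<xi>' =
     exp (- (1 / l) * \<bar>LINT s=\<xi>..\<xi>'|lebesgue. (qbar v q s * (cos (v s / 2))\<^sup>2)\<bar>)"

definition P_integrand :: "real \<Rightarrow> (real \<Rightarrow> real) \<Rightarrow> (real \<Rightarrow> real) \<Rightarrow> real \<Rightarrow> real \<Rightarrow> real" where
  "P_integrand l v q \<xi> \<xi>' = kern l v q \<xi> \<xi>' * qbar v q \<xi>' * (sin (v \<xi>' / 2))\<^sup>2"

definition Pfun :: "real \<Rightarrow> (real \<Rightarrow> real) \<Rightarrow> (real \<Rightarrow> real) \<Rightarrow> real \<Rightarrow> real" where
  "Pfun l v q \<xi> = 1 / (4 * l) * (LINT \<xi>'|lebesgue. P_integrand l v q \<xi> \<xi>')"

definition Pxfun :: "real \<Rightarrow> (real \<Rightarrow> real) \<Rightarrow> (real \<Rightarrow> real) \<Rightarrow> real \<Rightarrow> real" where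
  "Pxfun l v q \<xi> = 1 / (4 * l\<^sup>2) *
     ((LINT \<xi>':{\<xi>..}|lebesgue. P_integrand l v q \<xi> \<xi>')
      - (LINT \<xi>':{..\<xi>}|lebesgue. P_integrand l v q \<xi> \<xi>'))"

definition v_rhs :: "real \<Rightarrow> (real \<Rightarrow> real) \<Rightarrow> (real \<Rightarrow> real) \<Rightarrow> real \<Rightarrow> real" where
  "v_rhs l v q \<xi> =
     (if v \<xi> > - pi then - Pfun l v q \<xi> * (1 + cos (v \<xi>)) - (sin (v \<xi> / 2))\<^sup>2 else 0)"

definition q_rhs :: "real \<Rightarrow> (real \<Rightarrow> real) \<Rightarrow> (real \<Rightarrow> real) \<Rightarrow> real \<Rightarrow> real" where
  "q_rhs l v q \<xi> = (if v \<xi> > - pi then q \<xi> * (1 / 2 - Pfun l v q \<xi>) * sin (v \<xi>) else 0)"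

text \<open>The right-hand sides jump at \<open>v = -\<pi>\<close>, so the system is understood in integrated form, for
  almost every \<open>\<xi>\<close>. The integrability conditions only say that all the integrals exist: a Bochner
  integral of a non-integrable function is \<open>0\<close> by convention.\<close>

definition lagrangian_solution ::
    "real \<Rightarrow> (real \<Rightarrow> real) \<Rightarrow> (real \<Rightarrow> real \<Rightarrow> real) \<Rightarrow> (real \<Rightarrow> real \<Rightarrow> real) \<Rightarrow> bool" where
  "lagrangian_solution l v\<^sub>0 v q \<longleftrightarrow>
     C_Linf v \<and> C_Linf q \<and>
     (\<forall>t\<ge>0. \<forall>\<xi>. integrable lebesgue (P_integrand l (v t) (q t) \<xi>)) \<and>
     (AE \<xi> in lebesgue. \<forall>t\<ge>0.
        set_integrable lebesgue {0..t} (\<lambda>s. v_rhs l (v s) (q s) \<xi>) \<and>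
        set_integrable lebesgue {0..t} (\<lambda>s. q_rhs l (v s) (q s) \<xi>) \<and>
        v t \<xi> = v\<^sub>0 \<xi> + (LINT s:{0..t}|lebesgue. v_rhs l (v s) (q s) \<xi>) \<and>
        q t \<xi> = 1 + (LINT s:{0..t}|lebesgue. q_rhs l (v s) (q s) \<xi>))"

definition u_lag :: "real \<Rightarrow> (real \<Rightarrow> real) \<Rightarrow> (real \<Rightarrow> real) \<Rightarrow> (real \<Rightarrow> real \<Rightarrow> real) \<Rightarrow>
    (real \<Rightarrow> real \<Rightarrow> real) \<Rightarrow> real \<Rightarrow> real \<Rightarrow> real" where
  "u_lag l u\<^sub>0 y\<^sub>0 v q t \<xi> =
     u\<^sub>0 (y\<^sub>0 \<xi>) - (LINT s:{0..t}|lebesgue. l\<^sup>2 * Pxfun l (v s) (q s) \<xi>)"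

definition y_lag :: "real \<Rightarrow> (real \<Rightarrow> real) \<Rightarrow> (real \<Rightarrow> real) \<Rightarrow> (real \<Rightarrow> real \<Rightarrow> real) \<Rightarrow>
    (real \<Rightarrow> real \<Rightarrow> real) \<Rightarrow> real \<Rightarrow> real \<Rightarrow> real" where
  "y_lag l u\<^sub>0 y\<^sub>0 v q t \<xi> = y\<^sub>0 \<xi> + (LINT s:{0..t}|lebesgue. u_lag l u\<^sub>0 y\<^sub>0 v q s \<xi>)"

text \<open>\<open>U\<close> is the solution with parameter \<open>l\<close> obtained from the Lagrangian construction; \<open>u\<^sub>0'\<close>
  is the weak derivative of the initial datum \<open>u\<^sub>0\<close>. The map \<open>y\<^sub>0\<close> is uniquely determined.\<close>

definition dissipative_solution ::
    "real \<Rightarrow> (real \<Rightarrow> real) \<Rightarrow> (real \<Rightarrow> real) \<Rightarrow> (real \<Rightarrow> real \<Rightarrow> real) \<Rightarrow> bool" where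
  "dissipative_solution l u\<^sub>0 u\<^sub>0' U \<longleftrightarrow>
     (\<exists>y\<^sub>0 v q.
        (\<forall>\<xi>. (LINT x=0..y\<^sub>0 \<xi>|lebesgue. (1 + (u\<^sub>0' x)\<^sup>2)) = \<xi>) \<and>
        lagrangian_solution l (\<lambda>\<xi>. 2 * arctan (u\<^sub>0' (y\<^sub>0 \<xi>))) v q \<and>
        (\<forall>t\<ge>0. \<forall>\<xi>. U t (y_lag l u\<^sub>0 y\<^sub>0 v q t \<xi>) = u_lag l u\<^sub>0 y\<^sub>0 v q t \<xi>))"


section \<open>The limit equation and the Oleinik inequality\<close>

text \<open>\<open>[u\<^sub>t + (u\<^sup>2)\<^sub>x / 2]\<^sub>x = \<nu>\<close> in the sense of distributions on \<open>]0,\<infinity>[ \<times> \<real>\<close>: both derivatives of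
  each term are moved to the test function.\<close>

definition limit_equation :: "(real \<Rightarrow> real \<Rightarrow> real) \<Rightarrow> (real \<Rightarrow> real measure) \<Rightarrow> bool" where
  "limit_equation u \<nu> \<longleftrightarrow>
     (\<forall>\<phi>. test_fun ({0<..} \<times> UNIV) \<phi> \<longrightarrow>
        (LINT z:{0<..} \<times> UNIV|lebesgue.
           u (fst z) (snd z) * d_t (d_x \<phi>) z + 1 / 2 * (u (fst z) (snd z))\<^sup>2 * d_x (d_x \<phi>) z)
        = (LINT t:{0<..}|lebesgue. LINT x|\<nu> t. \<phi> (t, x)))"

text \<open>The distributional derivative of \<open>f\<close> is at most the constant \<open>c\<close> in \<open>D'(\<real>)\<close>.\<close>

definition distr_deriv_le :: "(real \<Rightarrow> real) \<Rightarrow> real \<Rightarrow> bool" where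
  "distr_deriv_le f c \<longleftrightarrow>
     (\<forall>\<phi>. test_fun UNIV \<phi> \<and> (\<forall>x. 0 \<le> \<phi> x) \<longrightarrow>
        - (LINT x|lebesgue. f x * deriv \<phi> x) \<le> (LINT x|lebesgue. c * \<phi> x))"

end

(* In Lagrangian coordinates the pressure of the regularised equation is
   of order 1/l, and l^2 P_x converges to a signed integral of the energy
   density, since the exponential kernel tends to 1. The limit system is
   the dissipative Hunter-Saxton flow, which decouples over the particles
   and has the explicit solution y_xi = max(0, 1 + w0 t / 2)^2 / (1 + w0^2)
   with w0 the initial slope. So no compactness argument is needed: the
   Lagrangian unknowns of the regularised equation converge pointwise to
   explicit functions, along every sequence l -> infinity. A modulus of
   continuity shared by all these flows, (u(xi) - u(eta))^2 <= E |y(xi) - y(eta)|,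
   turns this into locally uniform convergence in Eulerian coordinates.
   The measure nu is half the energy density transported by y, and the
   Oleinik bound is the inequality u_xi <= 2M / (Mt + 2) y_xi. *)

theory Submission
  imports Defs
begin

section \<open>Absolutely continuous functions\<close>

text \<open>The definition of a dissipative solution provides essentially bounded \<open>v\<close>,
  \<open>q\<close> solving the integrated system almost everywhere, so finite energy, positivity of
  \<open>q\<close> and a bound on the pressure have to be extracted from it. Each rests on the
  others: P is controlled by the energy, the energy changes at the rate -2 P u_xi, and positivity of
  \<open>q\<close> follows from a bound on P. The circle is broken by continuation in time, with
  steps whose length comes from the continuity of \<open>v\<close>. The resulting bound depends on
  l. A second argument makes it uniform: P is at most energy / (4 l), the L1 norm of u_xi is finite
  at time 0 because u_0' is integrable, and so the energy created up to time T is O(1/l). The other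
  obstacle is that the energy density of a particle jumps to zero when it dies. Pressure only
  hastens death, so a particle dead in the limit is dead for every l; conversely one that is alive
  in the limit is alive once l is large. Hence the jumps are consistent and the densities converge
  at every time for almost every particle.\<close>

text \<open>The right-hand sides of the system jump at blow-up, so time derivatives exist only
  almost everywhere. Carrying the density explicitly, as a function and not as a class, keeps later
  identities pointwise and avoids differentiating integrals.\<close>

definition AC_on :: "real \<Rightarrow> real \<Rightarrow> (real \<Rightarrow> real) \<Rightarrow> (real \<Rightarrow> real) \<Rightarrow> bool" where
  "AC_on a b F f \<longleftrightarrow> f absolutely_integrable_on {a..b} \<and> (\<forall>t\<in>{a..b}. F t = F a + integral {a..t} f)"

lemma AC_onD:
  assumes "AC_on a b F f"
  shows "f absolutely_integrable_on {a..b}" "f integrable_on {a..b}"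
    "\<And>t. a \<le> t \<Longrightarrow> t \<le> b \<Longrightarrow> F t = F a + integral {a..t} f"
proof -
  show 1: "f absolutely_integrable_on {a..b}" using assms unfolding AC_on_def by blast
  then show "f integrable_on {a..b}" unfolding absolutely_integrable_on_def by blast
  show "F t = F a + integral {a..t} f" if "a \<le> t" "t \<le> b" for t
    using assms that unfolding AC_on_def by (metis atLeastAtMost_iff)
qed

lemma AC_on_subset:
  assumes "AC_on a b F f" "a \<le> c" "c \<le> d" "d \<le> b"
  shows "AC_on c d F f"
proof -
  have i: "f absolutely_integrable_on {c..d}"
    using absolutely_integrable_on_subinterval[OF AC_onD(1)[OF assms(1)], of c d] assms by auto
  have "F t = F c + integral {c..t} f" if "t \<in> {c..d}" for t
  proof -
    have "f integrable_on {a..t}"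
      using integrable_on_subinterval[OF AC_onD(2)[OF assms(1)]] that assms by auto
    then have "integral {a..c} f + integral {c..t} f = integral {a..t} f"
      using Henstock_Kurzweil_Integration.integral_combine[of a c t f] that assms by auto
    then show ?thesis
      using AC_onD(3)[OF assms(1), of t] AC_onD(3)[OF assms(1), of c] that assms by auto
  qed
  with i show ?thesis unfolding AC_on_def by blast
qed

lemma AC_on_diff:
  assumes "AC_on a b F f" "a \<le> s" "s \<le> t" "t \<le> b"
  shows "F t - F s = integral {s..t} f"
  using AC_onD(3)[OF AC_on_subset[OF assms], of t] assms(3) by simp

lemma AC_on_continuous:
  assumes "AC_on a b F f" shows "continuous_on {a..b} F"
proof -
  have "continuous_on {a..b} (\<lambda>t. F a + integral {a..t} f)"
    by (intro continuous_intros indefinite_integral_continuous_1 AC_onD(2)[OF assms])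
  then show ?thesis
    by (rule continuous_on_eq) (metis AC_onD(3)[OF assms] atLeastAtMost_iff)
qed

lemma AC_on_const: "AC_on a b (\<lambda>_. c) (\<lambda>_. 0)"
  unfolding AC_on_def by (auto simp: absolutely_integrable_on_def)

lemma AC_on_add:
  assumes "AC_on a b F f" "AC_on a b G g"
  shows "AC_on a b (\<lambda>t. F t + G t) (\<lambda>t. f t + g t)"
  unfolding AC_on_def
proof (intro conjI ballI)
  show "(\<lambda>t. f t + g t) absolutely_integrable_on {a..b}"
    using AC_onD(1)[OF assms(1)] AC_onD(1)[OF assms(2)] by (rule set_integral_add)
  fix t assume t: "t \<in> {a..b}"
  have "f integrable_on {a..t}" "g integrable_on {a..t}"
    using integrable_on_subinterval[OF AC_onD(2)] assms t by auto
  then have "integral {a..t} (\<lambda>t. f t + g t) = integral {a..t} f + integral {a..t} g"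
    by (rule integral_add)
  then show "F t + G t = F a + G a + integral {a..t} (\<lambda>t. f t + g t)"
    using AC_onD(3)[OF assms(1), of t] AC_onD(3)[OF assms(2), of t] t by auto
qed

lemma AC_on_cmult:
  assumes "AC_on a b F f"
  shows "AC_on a b (\<lambda>t. c * F t) (\<lambda>t. c * f t)"
  unfolding AC_on_def
proof (intro conjI ballI)
  show "(\<lambda>t. c * f t) absolutely_integrable_on {a..b}"
    using set_integrable_mult_right[OF AC_onD(1)[OF assms(1)], of c] by simp
  fix t assume t: "t \<in> {a..b}"
  show "c * F t = c * F a + integral {a..t} (\<lambda>t. c * f t)"
    using AC_onD(3)[OF assms(1), of t] t by (simp add: algebra_simps)
qed

lemma AC_on_diff_fun:
  assumes "AC_on a b F f" "AC_on a b G g"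
  shows "AC_on a b (\<lambda>t. F t - G t) (\<lambda>t. f t - g t)"
  using AC_on_add[OF assms(1) AC_on_cmult[OF assms(2), of "-1"]] by simp

lemma AC_on_cong:
  assumes "AC_on a b F f" "\<And>t. a \<le> t \<Longrightarrow> t \<le> b \<Longrightarrow> F t = G t" "\<And>t. a \<le> t \<Longrightarrow> t \<le> b \<Longrightarrow> f t = g t"
  shows "AC_on a b G g"
  unfolding AC_on_def
proof (intro conjI ballI)
  show "g absolutely_integrable_on {a..b}"
    using AC_onD(1)[OF assms(1)] assms(3) set_integrable_cong[of lebesgue lebesgue "{a..b}" "{a..b}" f g] by auto
  fix t assume t: "t \<in> {a..b}"
  have "integral {a..t} g = integral {a..t} f"
    by (rule integral_cong) (use assms(3) t in auto)
  then show "G t = G a + integral {a..t} g"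
    using AC_onD(3)[OF assms(1), of t] t assms(2)[of t] assms(2)[of a] by auto
qed

lemma AC_on_C1:
  assumes "\<And>t. a \<le> t \<Longrightarrow> t \<le> b \<Longrightarrow> (F has_real_derivative f t) (at t within {a..b})" "continuous_on {a..b} f"
  shows "AC_on a b F f"
  unfolding AC_on_def
proof (intro conjI ballI)
  show "f absolutely_integrable_on {a..b}" by (rule absolutely_integrable_continuous_real[OF assms(2)])
  fix t assume t: "t \<in> {a..b}"
  have "(f has_integral (F t - F a)) {a..t}"
  proof (rule fundamental_theorem_of_calculus)
    fix s assume "s \<in> {a..t}"
    then have "(F has_real_derivative f s) (at s within {a..b})" using t by (intro assms(1)) auto
    then have "(F has_real_derivative f s) (at s within {a..t})" by (rule DERIV_subset) (use t in auto)
    then show "(F has_vector_derivative f s) (at s within {a..t})"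
      by (simp add: has_real_derivative_iff_has_vector_derivative)
  qed (use t in auto)
  then show "F t = F a + integral {a..t} f" by (simp add: integral_unique)
qed

section \<open>Chain rule and product rule for indefinite integrals\<close>

text \<open>Cut [a, b] into equal pieces shorter than \<delta> and add up: both sides
  telescope.\<close>

lemma small_scale_bound:
  fixes D H :: "real \<Rightarrow> real"
  assumes "\<delta> > 0" "a \<le> b"
    and loc: "\<And>s t. a \<le> s \<Longrightarrow> s \<le> t \<Longrightarrow> t \<le> b \<Longrightarrow> t - s < \<delta> \<Longrightarrow> \<bar>D t - D s\<bar> \<le> H t - H s"
  shows "\<bar>D b - D a\<bar> \<le> H b - H a"
proof -
  obtain n :: nat where n: "n > 0" "(b - a) / n < \<delta>"
  proof -
    obtain n :: nat where "(b - a) / \<delta> < n" using reals_Archimedean2 by blast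
    then have "b - a < real (Suc n) * \<delta>" using assms(1)
      by (simp add: field_simps)
    then have "(b - a) / (Suc n) < \<delta>"
      by (simp add: divide_less_eq mult.commute)
    then show thesis using that[of "Suc n"] by auto
  qed
  define p where "p i = a + real i * ((b - a) / n)" for i :: nat
  have "\<bar>D (p i) - D a\<bar> \<le> H (p i) - H a" if "i \<le> n" for i
    using that
  proof (induction i)
    case 0 then show ?case by (simp add: p_def)
  next
    case (Suc i)
    have st: "p (Suc i) - p i = (b - a) / n" by (simp add: p_def add_divide_distrib distrib_right)
    have "real (Suc i) * ((b - a) / n) \<le> real n * ((b - a) / n)"
      using Suc.prems assms(2) by (intro mult_right_mono) auto
    then have "p (Suc i) \<le> b" using n by (simp add: p_def)
    moreover have "a \<le> p i" using assms(2) by (simp add: p_def)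
    moreover have "p i \<le> p (Suc i)"
      using st assms(2) by (smt (verit) divide_nonneg_nonneg of_nat_0_le_iff)
    ultimately have "\<bar>D (p (Suc i)) - D (p i)\<bar> \<le> H (p (Suc i)) - H (p i)"
      using loc[of "p i" "p (Suc i)"] n(2) st by auto
    then show ?case using Suc by auto
  qed
  from this[of n] show ?thesis using n by (simp add: p_def)
qed

text \<open>On a short interval the mean value theorem replaces G (F r) - G (F s) by G' (F \<theta>)
  times the integral of f, and uniform continuity of G' along F makes the error at most \<epsilon>
  times the integral of |f|. Adding up and letting \<epsilon> tend to 0 gives the chain rule with no
  differentiation almost everywhere.\<close>

lemma AC_on_comp:
  assumes F: "AC_on a b F f"
    and G: "\<And>x. x \<in> F ` {a..b} \<Longrightarrow> (G has_real_derivative G' x) (at x)"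
    and G': "continuous_on (F ` {a..b}) G'"
  shows "AC_on a b (\<lambda>t. G (F t)) (\<lambda>t. G' (F t) * f t)"
proof -
  have cF: "continuous_on {a..b} F" using F by (rule AC_on_continuous)
  have cGF: "continuous_on {a..b} (\<lambda>t. G' (F t))"
    using continuous_on_compose[OF cF G'] by (simp add: o_def)
  have int: "(\<lambda>t. G' (F t) * f t) absolutely_integrable_on {a..b}"
  proof (rule absolutely_integrable_bounded_measurable_product_real)
    show "(\<lambda>t. G' (F t)) \<in> borel_measurable (lebesgue_on {a..b})"
      by (rule continuous_imp_measurable_on_sets_lebesgue[OF cGF]) simp
    show "bounded ((\<lambda>t. G' (F t)) ` {a..b})"
      by (intro compact_imp_bounded compact_continuous_image cGF) simp
  qed (use AC_onD(1)[OF F] in auto)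
  have "G (F t) = G (F a) + integral {a..t} (\<lambda>t. G' (F t) * f t)" if t: "t \<in> {a..b}" for t
  proof -
    define D where "D s = G (F s) - integral {a..s} (\<lambda>t. G' (F t) * f t)" for s
    define H where "H s = integral {a..s} (\<lambda>r. \<bar>f r\<bar>)" for s
    have aif: "(\<lambda>r. \<bar>f r\<bar>) integrable_on {a..b}"
      using AC_onD(1)[OF F] unfolding absolutely_integrable_on_def by auto
    have small: "\<bar>D t - D a\<bar> \<le> \<epsilon> * H t - \<epsilon> * H a" if "\<epsilon> > 0" for \<epsilon>
    proof -
      have "uniformly_continuous_on {a..b} (\<lambda>t. G' (F t))"
        by (rule compact_uniformly_continuous[OF cGF]) simp
      then obtain \<delta> where \<delta>: "\<delta> > 0" 
        "\<And>s r. s \<in> {a..b} \<Longrightarrow> r \<in> {a..b} \<Longrightarrow> dist r s < \<delta> \<Longrightarrow> dist (G' (F r)) (G' (F s)) < \<epsilon>"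
        using \<open>\<epsilon> > 0\<close> unfolding uniformly_continuous_on_def by (elim allE[of _ \<epsilon>]) auto
      show ?thesis
      proof (rule small_scale_bound[OF \<delta>(1)])
        show "a \<le> t" using t by auto
        fix s r assume sr: "a \<le> s" "s \<le> r" "r \<le> t" "r - s < \<delta>"
        have rb: "r \<le> b" using t sr by auto
        have i1: "(\<lambda>t. G' (F t) * f t) integrable_on {a..r}"
          using int sr rb integrable_on_subinterval[of "\<lambda>t. G' (F t) * f t" "{a..b}" a r]
          unfolding absolutely_integrable_on_def by auto
        have i2: "(\<lambda>t. G' (F t) * f t) integrable_on {s..r}"
          using integrable_on_subinterval[OF i1, of s r] sr by auto
        have i3: "(\<lambda>r. \<bar>f r\<bar>) integrable_on {a..r}"
          using integrable_on_subinterval[OF aif, of a r] sr rb by auto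
        have i4: "f integrable_on {s..r}"
          using integrable_on_subinterval[OF AC_onD(2)[OF F], of s r] sr rb by auto
        have i5: "(\<lambda>r. \<bar>f r\<bar>) integrable_on {s..r}"
          using integrable_on_subinterval[OF i3, of s r] sr rb by auto
        have e1: "D r - D s = G (F r) - G (F s) - integral {s..r} (\<lambda>t. G' (F t) * f t)"
          unfolding D_def using Henstock_Kurzweil_Integration.integral_combine[OF sr(1,2) i1] by simp
        have e2: "H r - H s = integral {s..r} (\<lambda>r. \<bar>f r\<bar>)"
          unfolding H_def using Henstock_Kurzweil_Integration.integral_combine[OF sr(1,2) i3] by simp
        have csr: "continuous_on {s..r} F" using cF by (rule continuous_on_subset) (use sr rb in auto)
        \<comment> \<open>The mean value theorem gives a point between F s and F r; as F is
          continuous, this point is a value of F inside [s, r], where uniform continuity in time can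
          be used.\<close>
        have "\<exists>\<theta>\<in>{s..r}. G (F r) - G (F s) = G' (F \<theta>) * (F r - F s)"
        proof (cases "F r = F s")
          case True then show ?thesis using sr by auto
        next
          case False
          have con: "is_interval (F ` {s..r})"
            using connected_continuous_image[OF csr] by (simp add: is_interval_connected_1)
          have sub: "x \<in> F ` {s..r}" if "min (F s) (F r) \<le> x" "x \<le> max (F s) (F r)" for x
          proof -
            have "F s \<in> F ` {s..r}" "F r \<in> F ` {s..r}" using sr by auto
            then show ?thesis using con that unfolding is_interval_1
              by (metis max_def min_def)
          qed
          have G2: "(G has_real_derivative G' x) (at x)" if "min (F s) (F r) \<le> x" "x \<le> max (F s) (F r)" for x
            using sub[OF that] G[of x] sr rb by auto
          have "min (F s) (F r) < max (F s) (F r)" using False by auto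
          from MVT2[OF this G2] obtain z where z: "min (F s) (F r) < z" "z < max (F s) (F r)"
            "G (max (F s) (F r)) - G (min (F s) (F r)) = (max (F s) (F r) - min (F s) (F r)) * G' z"
            by blast
          obtain \<theta> where \<theta>: "\<theta> \<in> {s..r}" "z = F \<theta>" using sub[of z] z by auto
          have "G (F r) - G (F s) = G' z * (F r - F s)"
            using z(3) by (auto simp: max_def min_def algebra_simps split: if_splits)
          then show ?thesis using \<theta> by auto
        qed
        then obtain \<theta> where \<theta>: "\<theta> \<in> {s..r}" "G (F r) - G (F s) = G' (F \<theta>) * (F r - F s)" by auto
        have "G (F r) - G (F s) = integral {s..r} (\<lambda>t. G' (F \<theta>) * f t)"
          using \<theta>(2) AC_on_diff[OF F sr(1,2) rb] by simp
        then have "D r - D s = integral {s..r} (\<lambda>t. G' (F \<theta>) * f t - G' (F t) * f t)"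
          using e1 i4 i2 by (subst integral_diff) (auto intro: integrable_on_mult_right)
        also have "\<bar>\<dots>\<bar> \<le> integral {s..r} (\<lambda>t. \<epsilon> * \<bar>f t\<bar>)"
        proof (rule Henstock_Kurzweil_Integration.integral_norm_bound_integral[where
          f="\<lambda>t. G' (F \<theta>) * f t - G' (F t) * f t", unfolded real_norm_def])
          show "(\<lambda>t. G' (F \<theta>) * f t - G' (F t) * f t) integrable_on {s..r}"
            using i4 i2 by (intro integrable_diff integrable_on_mult_right) auto
          show "(\<lambda>t. \<epsilon> * \<bar>f t\<bar>) integrable_on {s..r}" using i5 by (rule integrable_on_mult_right)
          fix x assume x: "x \<in> {s..r}"
          have "dist (G' (F \<theta>)) (G' (F x)) < \<epsilon>"
            by (rule \<delta>(2)) (use x \<theta>(1) sr rb in \<open>auto simp: dist_real_def\<close>)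
          then have "\<bar>G' (F \<theta>) - G' (F x)\<bar> * \<bar>f x\<bar> \<le> \<epsilon> * \<bar>f x\<bar>"
            by (intro mult_right_mono) (auto simp: dist_real_def)
          then show "\<bar>G' (F \<theta>) * f x - G' (F x) * f x\<bar> \<le> \<epsilon> * \<bar>f x\<bar>"
            by (simp add: abs_mult[symmetric] left_diff_distrib)
        qed
        also have "\<dots> = \<epsilon> * H r - \<epsilon> * H s" using e2 by (simp add: algebra_simps)
        finally show "\<bar>D r - D s\<bar> \<le> \<epsilon> * H r - \<epsilon> * H s" .
      qed
    qed
    have "\<bar>D t - D a\<bar> \<le> 0"
    proof (rule field_le_epsilon)
      fix e :: real assume "e > 0"
      have Ht: "H t \<ge> 0" unfolding H_def
        by (rule integral_nonneg) (use integrable_on_subinterval[OF aif, of a t] t in auto)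
      \<comment> \<open>The summand 1 keeps the quotient defined when the integral of |f| is
        0.\<close>
      have "\<bar>D t - D a\<bar> \<le> e / (H t + 1) * H t" using small[of "e / (H t + 1)"] \<open>e > 0\<close> Ht
        by (simp add: H_def)
      also have "\<dots> \<le> e" using Ht \<open>e > 0\<close> by (simp add: field_simps)
      finally show "\<bar>D t - D a\<bar> \<le> 0 + e" by simp
    qed
    then show ?thesis unfolding D_def by simp
  qed
  with int show ?thesis unfolding AC_on_def by blast
qed

text \<open>Polarisation reduces the product to squares, to which the chain rule applies.\<close>

lemma AC_on_mult:
  assumes F: "AC_on a b F f" and G: "AC_on a b G g"
  shows "AC_on a b (\<lambda>t. F t * G t) (\<lambda>t. f t * G t + F t * g t)"
proof -
  have sq: "AC_on a b (\<lambda>t. (X t)\<^sup>2) (\<lambda>t. (2 * X t) * x t)" if "AC_on a b X x" for X x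
    by (rule AC_on_comp[OF that]) (auto intro!: derivative_eq_intros continuous_intros)
  have "AC_on a b (\<lambda>t. (1/4) * ((F t + G t)\<^sup>2 - (F t - G t)\<^sup>2))
     (\<lambda>t. (1/4) * ((2 * (F t + G t)) * (f t + g t) - (2 * (F t - G t)) * (f t - g t)))"
    by (intro AC_on_cmult AC_on_diff_fun sq AC_on_add F G)
  then show ?thesis by (rule AC_on_cong) (auto simp: algebra_simps power2_eq_square)
qed

section \<open>Integrals of Borel functions\<close>

text \<open>The definitions integrate against \<open>lebesgue\<close>, Fubini and densities live on
  \<open>lborel\<close>, and the fundamental theorem uses the gauge integral; this is the bridge
  between the three.\<close>

lemma bounded_Borel_integrable:
  fixes f :: "real \<Rightarrow> real"
  assumes f: "f \<in> borel_measurable borel" and C: "\<And>x. a \<le> x \<Longrightarrow> x \<le> b \<Longrightarrow> \<bar>f x\<bar> \<le> C"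
  shows "set_integrable lborel {a..b} f" "f absolutely_integrable_on {a..b}" "f integrable_on {a..b}"
    "(LBINT x:{a..b}. f x) = integral {a..b} f" "(LINT x:{a..b}|lebesgue. f x) = integral {a..b} f"
proof -
  show 1: "set_integrable lborel {a..b} f"
    unfolding set_integrable_def
  proof (rule Bochner_Integration.integrable_bound)
    show "integrable lborel (\<lambda>x. indicator {a..b} x *\<^sub>R C)"
      by (rule integrable_real_indicator[THEN integrable_scaleR_left]) (auto simp: emeasure_lborel_Icc_eq)
    show "AE x in lborel. norm (indicator {a..b} x *\<^sub>R f x) \<le> norm (indicator {a..b} x *\<^sub>R C)"
      using C by (auto simp: indicator_def intro: order_trans[OF _ abs_ge_self])
  qed (use f in measurable)
  show 2: "f absolutely_integrable_on {a..b}"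
    using 1 unfolding set_integrable_def by (rule integrable_completion[THEN iffD2, rotated]) (use f in measurable)
  show "f integrable_on {a..b}" using 2 by (simp add: absolutely_integrable_on_def)
  show 3: "(LBINT x:{a..b}. f x) = integral {a..b} f" using 1 by (rule set_borel_integral_eq_integral)
  show "(LINT x:{a..b}|lebesgue. f x) = integral {a..b} f"
    using 2 by (rule set_lebesgue_integral_eq_integral)
qed

abbreviation jointly_Borel :: "(real \<Rightarrow> real \<Rightarrow> real) \<Rightarrow> bool" where
  "jointly_Borel f \<equiv> (\<lambda>(t, x). f t x) \<in> borel_measurable (borel \<Otimes>\<^sub>M borel)"

text \<open>A variable endpoint becomes a condition inside the integrand, after which measurability
  of integrals with parameters applies.\<close>

lemma LBINT_interval_measurable [measurable]:
  fixes f :: "real \<Rightarrow> real \<Rightarrow> real"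
  assumes "jointly_Borel f"
  shows "(\<lambda>(t, x). LBINT s:{c..x}. f t s) \<in> borel_measurable (borel \<Otimes>\<^sub>M (borel::real measure))"
    "(\<lambda>(t, x). LBINT s:{x..c}. f t s) \<in> borel_measurable (borel \<Otimes>\<^sub>M (borel::real measure))"
proof -
  have *: "(\<lambda>(p, s). f (fst p) s) \<in> borel_measurable ((borel \<Otimes>\<^sub>M borel) \<Otimes>\<^sub>M lborel)"
    using measurable_compose[OF _ assms, of "\<lambda>(p, s). (fst p, s)" "(borel \<Otimes>\<^sub>M borel) \<Otimes>\<^sub>M lborel"]
    by (auto simp: split_beta')
  have "(\<lambda>p. LINT s|lborel. (if c \<le> s \<and> s \<le> snd p then 1 else 0) *\<^sub>R f (fst p) s)
    \<in> borel_measurable (borel \<Otimes>\<^sub>M (borel::real measure))"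
    by (rule lborel.borel_measurable_lebesgue_integral) (use * in \<open>simp add: split_beta', measurable\<close>)
  then show "(\<lambda>(t, x). LBINT s:{c..x}. f t s) \<in> borel_measurable (borel \<Otimes>\<^sub>M (borel::real measure))"
    by (simp only: set_lebesgue_integral_def split_beta' indicator_def of_bool_def atLeastAtMost_iff)
  have "(\<lambda>p. LINT s|lborel. (if snd p \<le> s \<and> s \<le> c then 1 else 0) *\<^sub>R f (fst p) s)
    \<in> borel_measurable (borel \<Otimes>\<^sub>M (borel::real measure))"
    by (rule lborel.borel_measurable_lebesgue_integral) (use * in \<open>simp add: split_beta', measurable\<close>)
  then show "(\<lambda>(t, x). LBINT s:{x..c}. f t s) \<in> borel_measurable (borel \<Otimes>\<^sub>M (borel::real measure))"
    by (simp only: set_lebesgue_integral_def split_beta' indicator_def of_bool_def atLeastAtMost_iff)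
qed

text \<open>Signed primitive vanishing at 0. One of the two set integrals ranges over at most a
  point, so no case distinction is needed and measurability in a parameter is inherited.\<close>

definition prim :: "(real \<Rightarrow> real) \<Rightarrow> real \<Rightarrow> real" where
  "prim f x = (LBINT s:{0..x}. f s) - (LBINT s:{x..0}. f s)"

lemma prim_measurable [measurable]:
  fixes f :: "real \<Rightarrow> real \<Rightarrow> real"
  assumes [measurable]: "jointly_Borel f"
  shows "(\<lambda>(t, x). prim (f t) x) \<in> borel_measurable (borel \<Otimes>\<^sub>M (borel::real measure))"
  using borel_measurable_diff[OF LBINT_interval_measurable[OF assms, of 0]]
  by (simp add: prim_def split_beta')

lemma prim_diff_general:
  assumes i: "\<And>a b. set_integrable lborel {a..b} f" and "x \<le> y"
  shows "prim f y - prim f x = integral {x..y} f"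
proof -
  have i': "f integrable_on {a..b}" for a b by (rule set_borel_integral_eq_integral(1)[OF i])
  have e: "(LBINT s:{a..b}. f s) = integral {a..b} f" for a b by (rule set_borel_integral_eq_integral(2)[OF i])
  have z: "integral {0..x} f = 0" if "x \<le> 0" for x
    using that by (cases "x = 0") auto
  have z': "integral {x..0} f = 0" if "x \<ge> 0" for x
    using that by (cases "x = 0") auto
  note c = Henstock_Kurzweil_Integration.integral_combine
  consider "0 \<le> x" | "x \<le> 0" "0 \<le> y" | "y \<le> 0" by linarith
  then show ?thesis
  proof cases
    case 1 then show ?thesis unfolding prim_def e
      using c[of 0 x y f] i' assms(2) z' by auto
  next
    case 2 then show ?thesis unfolding prim_def e
      using c[of x 0 y f] i' assms(2) z z' by auto
  next
    case 3 then show ?thesis unfolding prim_def e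
      using c[of x y 0 f] i' assms(2) z by auto
  qed
qed

lemma prim_diff:
  assumes f: "f \<in> borel_measurable borel" and C: "\<And>x. \<bar>f x\<bar> \<le> C" and "x \<le> y"
  shows "prim f y - prim f x = integral {x..y} f"
  by (rule prim_diff_general[OF bounded_Borel_integrable(1)[OF f C] assms(3)])

lemma AC_on_prim:
  assumes f: "f \<in> borel_measurable borel" and C: "\<And>x. \<bar>f x\<bar> \<le> C"
  shows "AC_on a b (prim f) f"
  unfolding AC_on_def
proof (intro conjI ballI)
  show "f absolutely_integrable_on {a..b}" using bounded_Borel_integrable(2)[OF f C] .
  fix t assume "t \<in> {a..b}" then show "prim f t = prim f a + integral {a..t} f"
    using prim_diff[OF f C, of a t] by auto
qed

text \<open>Fubini in the form used throughout. Multiplication by the indicators of the two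
  intervals reduces gauge integrals to the product measure, and the bound on the rectangle gives
  integrability.\<close>

lemma interval_swap:
  fixes f :: "real \<Rightarrow> real \<Rightarrow> real"
  assumes f[measurable]: "jointly_Borel f"
    and C: "\<And>s x. a \<le> s \<Longrightarrow> s \<le> b \<Longrightarrow> c \<le> x \<Longrightarrow> x \<le> d \<Longrightarrow> \<bar>f s x\<bar> \<le> C"
  shows "integral {a..b} (\<lambda>s. integral {c..d} (f s)) = integral {c..d} (\<lambda>x. integral {a..b} (\<lambda>s. f s x))"
proof (cases "a \<le> b \<and> c \<le> d")
  case False
  then show ?thesis by auto
next
  case True
  have C0: "C \<ge> 0" using C[of a c] True by auto
  define h where "h s x = indicator {a..b} s * indicator {c..d} x * f s x" for s x :: real
  have hm[measurable]: "(\<lambda>(s, x). h s x) \<in> borel_measurable (lborel \<Otimes>\<^sub>M lborel)"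
    unfolding h_def by (simp add: split_beta')
  have hi: "integrable (lborel \<Otimes>\<^sub>M lborel) (\<lambda>(s, x). h s x)"
  proof (rule Bochner_Integration.integrable_bound)
    show "integrable (lborel \<Otimes>\<^sub>M lborel) (\<lambda>p::real\<times>real. indicator ({a..b} \<times> {c..d}) p *\<^sub>R C)"
      by (rule integrable_real_indicator[THEN integrable_scaleR_left])
        (auto simp: lborel.emeasure_pair_measure_Times ennreal_mult_less_top emeasure_lborel_Icc_eq)
    show "AE p in lborel \<Otimes>\<^sub>M lborel. norm (case p of (s, x) \<Rightarrow> h s x) \<le> norm (indicator ({a..b} \<times> {c..d}) p *\<^sub>R C)"
      using C C0 by (auto simp: h_def indicator_def)
  qed (use hm in auto)
  have m1: "f s \<in> borel_measurable borel" for s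
    using f by measurable
  have m2: "(\<lambda>s. f s x) \<in> borel_measurable borel" for x
    using f by measurable
  have "(LINT s|lborel. LINT x|lborel. h s x) = (LINT x|lborel. LINT s|lborel. h s x)"
    using lborel_pair.Fubini_integral[OF hi] by simp
  moreover have "(LINT x|lborel. h s x) = indicator {a..b} s * integral {c..d} (f s)" for s
  proof (cases "s \<in> {a..b}")
    case True
    then have "(LINT x|lborel. h s x) = (LBINT x:{c..d}. f s x)"
      unfolding h_def set_lebesgue_integral_def by simp
    also have "\<dots> = integral {c..d} (f s)"
      by (rule bounded_Borel_integrable(4)[OF m1]) (use C True in auto)
    finally show ?thesis using True by simp
  qed (simp add: h_def)
  moreover have "(LINT s|lborel. h s x) = indicator {c..d} x * integral {a..b} (\<lambda>s. f s x)" for x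
  proof (cases "x \<in> {c..d}")
    case True
    then have "(LINT s|lborel. h s x) = (LBINT s:{a..b}. f s x)"
      unfolding h_def set_lebesgue_integral_def by simp
    also have "\<dots> = integral {a..b} (\<lambda>s. f s x)"
      by (rule bounded_Borel_integrable(4)[OF m2]) (use C True in auto)
    finally show ?thesis using True by simp
  qed (simp add: h_def)
  ultimately have eq: "(LBINT s:{a..b}. integral {c..d} (f s)) = (LBINT x:{c..d}. integral {a..b} (\<lambda>s. f s x))"
    unfolding set_lebesgue_integral_def by simp
  have i1: "set_integrable lborel {a..b} (\<lambda>s. integral {c..d} (f s))"
    unfolding set_integrable_def
    using lborel_pair.integrable_fst'[OF hi] \<open>\<And>s. (LINT x|lborel. h s x) = _\<close> by simp
  have hi': "integrable (lborel \<Otimes>\<^sub>M lborel) (\<lambda>(x, s). h s x)"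
    using hi lborel_pair.integrable_product_swap[of "\<lambda>(s, x). h s x"] by (simp add: split_beta')
  have i2: "set_integrable lborel {c..d} (\<lambda>x. integral {a..b} (\<lambda>s. f s x))"
    unfolding set_integrable_def
    using lborel_pair.integrable_fst'[OF hi'] \<open>\<And>x. (LINT s|lborel. h s x) = _\<close> by simp
  show ?thesis
    using eq set_borel_integral_eq_integral(2)[OF i1] set_borel_integral_eq_integral(2)[OF i2] by simp
qed

text \<open>Monotone convergence along growing windows. Energies are first controlled on [-n, n],
  where bounded functions are integrable, with a constant independent of n.\<close>

lemma nn_integral_le_intervals:
  assumes f[measurable]: "f \<in> borel_measurable borel"
    and C: "\<And>n::nat. (\<integral>\<^sup>+x. f x * indicator {- real n..real n} x \<partial>lborel) \<le> C"
  shows "(\<integral>\<^sup>+x. f x \<partial>lborel) \<le> C"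
proof -
  have "(\<integral>\<^sup>+x. f x \<partial>lborel) = (\<integral>\<^sup>+x. (SUP n. f x * indicator {- real n..real n} x) \<partial>lborel)"
  proof (rule nn_integral_cong)
    fix x :: real
    obtain n :: nat where n: "\<bar>x\<bar> \<le> n" using real_arch_simple by blast
    have "f x \<le> (SUP n. f x * indicator {- real n..real n} x)"
      by (rule SUP_upper2[of n]) (use n in \<open>auto simp: indicator_def\<close>)
    moreover have "(SUP n. f x * indicator {- real n..real n} x) \<le> f x"
      by (rule SUP_least) (auto simp: indicator_def)
    ultimately show "f x = (SUP n. f x * indicator {- real n..real n} x)" by (rule antisym)
  qed
  also have "\<dots> = (SUP n. (\<integral>\<^sup>+x. f x * indicator {- real n..real n} x \<partial>lborel))"
    by (rule nn_integral_monotone_convergence_SUP)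
      (auto simp: incseq_def le_fun_def indicator_def)
  also have "\<dots> \<le> C" by (rule SUP_least) (rule C)
  finally show ?thesis .
qed

text \<open>The quadratic Taylor bound for exp |y| already dominates (1 + y^2) / 2.\<close>

lemma exp_minus_abs_le: "exp (- \<bar>y\<bar>) \<le> 2 / (1 + y\<^sup>2)" for y :: real
proof -
  have "1 + \<bar>y\<bar> + \<bar>y\<bar>\<^sup>2 / 2 \<le> exp \<bar>y\<bar>"
    by (rule exp_lower_Taylor_quadratic) simp
  then have "1 + y\<^sup>2 \<le> 2 * exp \<bar>y\<bar>" by (simp add: field_simps)
  moreover have "1 + y\<^sup>2 > 0" by (simp add: add_pos_nonneg)
  ultimately show ?thesis
    by (simp add: exp_minus field_simps)
qed

text \<open>The sharp constant is \<open>2 * l\<close>; comparing the exponential with the derivative of \<open>arctan\<close> keeps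
  the antiderivative smooth.\<close>

lemma kernel_integral_le:
  assumes \<alpha>[measurable]: "\<alpha> \<in> borel_measurable borel" and C: "\<And>x. \<bar>\<alpha> x\<bar> \<le> C"
    and pos: "\<And>x. 0 \<le> \<alpha> x" and l: "l > 0"
  shows "(\<integral>\<^sup>+x. ennreal (exp (- (1 / l) * \<bar>prim \<alpha> x - z\<bar>) * \<alpha> x) \<partial>lborel) \<le> ennreal (2 * pi * l)"
proof -
  define G where "G y = 2 * l * arctan ((y - z) / l)" for y
  define G' where "G' y = 2 / (1 + ((y - z) / l)\<^sup>2)" for y
  have pos1: "0 < 1 + ((y - z) / l)\<^sup>2" for y by (simp add: add_pos_nonneg)
  have dG: "(G has_real_derivative G' y) (at y)" for y
  proof -
    have "(G has_real_derivative 2 * l * (inverse (1 + ((y - z) / l)\<^sup>2) * (1 / l))) (at y)"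
      unfolding G_def by (rule DERIV_cmult DERIV_chain2[OF DERIV_arctan] | use l in \<open>auto intro!: derivative_eq_intros\<close>)+
    moreover have "2 * l * (inverse (1 + ((y - z) / l)\<^sup>2) * (1 / l)) = G' y"
      using l by (simp add: G'_def inverse_eq_divide)
    ultimately show ?thesis by simp
  qed
  have cG: "continuous_on UNIV G'"
    unfolding G'_def using pos1 l by (auto intro!: continuous_intros simp: less_imp_neq[symmetric])
  have G'0: "0 \<le> G' y" "G' y \<le> 2" for y using pos1[of y] unfolding G'_def by (auto simp: divide_le_eq)
  have cp: "continuous_on UNIV (prim \<alpha>)"
  proof (rule continuous_at_imp_continuous_on, rule ballI)
    fix x :: real
    have "continuous_on {x - 1..x + 1} (prim \<alpha>)" by (rule AC_on_continuous[OF AC_on_prim[OF \<alpha> C]])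
    then show "isCont (prim \<alpha>) x"
      by (rule continuous_on_interior) auto
  qed
  have [measurable]: "prim \<alpha> \<in> borel_measurable borel" "G' \<in> borel_measurable borel"
    using borel_measurable_continuous_onI[OF cp] borel_measurable_continuous_onI[OF cG] by auto
  have "(\<integral>\<^sup>+x. ennreal (exp (- (1 / l) * \<bar>prim \<alpha> x - z\<bar>) * \<alpha> x) \<partial>lborel)
      \<le> (\<integral>\<^sup>+x. ennreal (G' (prim \<alpha> x) * \<alpha> x) \<partial>lborel)"
  proof (intro nn_integral_mono ennreal_leI mult_right_mono pos)
    fix x
    have "exp (- \<bar>(prim \<alpha> x - z) / l\<bar>) \<le> G' (prim \<alpha> x)"
      unfolding G'_def by (rule exp_minus_abs_le)
    then show "exp (- (1 / l) * \<bar>prim \<alpha> x - z\<bar>) \<le> G' (prim \<alpha> x)"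
      using l by (simp add: abs_mult)
  qed
  also have "\<dots> \<le> ennreal (2 * pi * l)"
  proof (rule nn_integral_le_intervals)
    fix n :: nat
    have bd: "\<bar>G' (prim \<alpha> x) * \<alpha> x\<bar> \<le> 2 * C" for x
      unfolding abs_mult by (rule mult_mono) (use G'0 C in auto)
    have m: "(\<lambda>x. G' (prim \<alpha> x) * \<alpha> x) \<in> borel_measurable borel" by measurable
    note i = bounded_Borel_integrable[OF m bd, of "- real n" "real n"]
    have "(\<integral>\<^sup>+x. ennreal (G' (prim \<alpha> x) * \<alpha> x) * indicator {- real n..real n} x \<partial>lborel)
        = (\<integral>\<^sup>+x. ennreal (indicator {- real n..real n} x *\<^sub>R (G' (prim \<alpha> x) * \<alpha> x)) \<partial>lborel)"
      by (intro nn_integral_cong) (auto simp: indicator_def)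
    also have "\<dots> = ennreal (LBINT x:{- real n..real n}. G' (prim \<alpha> x) * \<alpha> x)"
      unfolding set_lebesgue_integral_def
      by (rule nn_integral_eq_integral) (use i(1) G'0 pos in \<open>auto simp: set_integrable_def\<close>)
    \<comment> \<open>Since \<open>prim \<alpha>\<close> has density \<open>\<alpha>\<close>, the
      window integral is an increment of G along it, and the total oscillation of 2 l arctan is 2 pi
      l whatever the window.\<close>
    also have "(LBINT x:{- real n..real n}. G' (prim \<alpha> x) * \<alpha> x) = G (prim \<alpha> n) - G (prim \<alpha> (- n))"
      using AC_on_diff[OF AC_on_comp[OF AC_on_prim[OF \<alpha> C] dG, of "- real n" "real n"], of "- real n" "real n"]
        continuous_on_subset[OF cG] i(4) by auto
    also have "\<dots> \<le> 2 * pi * l"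
    proof -
      have "\<bar>G y\<bar> \<le> pi * l" for y
      proof -
        have "\<bar>2 * arctan ((y - z) / l)\<bar> * l \<le> pi * l"
          using arctan_bounded[of "(y - z) / l"] l by (intro mult_right_mono) (auto simp: abs_le_iff)
        then show ?thesis using l by (simp add: G_def abs_mult ac_simps)
      qed
      from this[of "prim \<alpha> n"] this[of "prim \<alpha> (- n)"] show ?thesis by linarith
    qed
    finally show "(\<integral>\<^sup>+x. ennreal (G' (prim \<alpha> x) * \<alpha> x) * indicator {- real n..real n} x \<partial>lborel) \<le> ennreal (2 * pi * l)"
      by (simp add: ennreal_leI)
  qed measurable
  finally show ?thesis .
qed

section \<open>Test functions and the weak derivative of the initial datum\<close>

lemma Ck_Suc_imp: "Ck (Suc n) f \<Longrightarrow> Ck n f"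
proof (induction n arbitrary: f)
  case 0
  then obtain f' where "\<And>x. (f has_derivative f' x) (at x)" by auto
  then show ?case by (auto intro!: continuous_at_imp_continuous_on has_derivative_continuous)
next
  case (Suc n)
  then obtain f' where f': "\<And>x. (f has_derivative f' x) (at x)" "\<And>h. Ck (Suc n) (\<lambda>x. f' x h)" by auto
  have "Ck n (\<lambda>x. f' x h)" for h by (rule Suc.IH[OF f'(2)])
  then show ?case using f'(1) by auto
qed

lemma Ck_add: "Ck n f \<Longrightarrow> Ck n g \<Longrightarrow> Ck n (\<lambda>x. f x + g x)"
proof (induction n arbitrary: f g)
  case 0
  then show ?case by (auto intro: continuous_intros)
next
  case (Suc n)
  obtain f' g' where "\<And>x. (f has_derivative f' x) (at x)" "\<And>h. Ck n (\<lambda>x. f' x h)"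
    "\<And>x. (g has_derivative g' x) (at x)" "\<And>h. Ck n (\<lambda>x. g' x h)" using Suc.prems by auto
  then show ?case using Suc.IH
    by (auto intro!: exI[of _ "\<lambda>x h. f' x h + g' x h"] derivative_intros)
qed

lemma Ck_mult: "Ck n f \<Longrightarrow> Ck n g \<Longrightarrow> Ck n (\<lambda>x. f x * g x)"
proof (induction n arbitrary: f g)
  case 0
  then show ?case by (auto intro: continuous_intros)
next
  case (Suc n)
  obtain f' g' where d: "\<And>x. (f has_derivative f' x) (at x)" "\<And>h. Ck n (\<lambda>x. f' x h)"
    "\<And>x. (g has_derivative g' x) (at x)" "\<And>h. Ck n (\<lambda>x. g' x h)" using Suc.prems by auto
  have "Ck n (\<lambda>x. f x * g' x h + f' x h * g x)" for h
    using Suc.IH Ck_Suc_imp[OF Suc.prems(1)] Ck_Suc_imp[OF Suc.prems(2)] d by (intro Ck_add) auto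
  then show ?case using has_derivative_mult[OF d(1) d(3)]
    by (auto intro!: exI[of _ "\<lambda>x h. f x * g' x h + f' x h * g x"])
qed

lemma Ck_const: "Ck n (\<lambda>_. c)"
proof (induction n arbitrary: c)
  case (Suc n)
  then show ?case by (auto intro!: exI[of _ "\<lambda>_ _. 0"] derivative_intros)
qed auto

lemma Ck_cmult: "Ck n f \<Longrightarrow> Ck n (\<lambda>x. c * f x)"
  by (intro Ck_mult Ck_const)

lemma Ck_diff: "Ck n f \<Longrightarrow> Ck n g \<Longrightarrow> Ck n (\<lambda>x. f x - g x)"
  using Ck_add[of n f "\<lambda>x. -1 * g x"] Ck_cmult[of n g "-1"] by simp

lemma Ck_SucI:
  fixes f :: "real \<Rightarrow> real"
  assumes "\<And>x. (f has_real_derivative f' x) (at x)" "Ck n f'"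
  shows "Ck (Suc n) f"
proof -
  have "Ck n (\<lambda>x. f' x * h)" for h using Ck_mult[OF assms(2) Ck_const] .
  with assms(1) show ?thesis
    by (auto simp: has_field_derivative_def intro!: exI[of _ "\<lambda>x h. f' x * h"])
qed

lemma Ck_SucE:
  fixes f :: "real \<Rightarrow> real"
  assumes "Ck (Suc n) f"
  obtains f' where "\<And>x. (f has_real_derivative f' x) (at x)" "Ck n f'"
proof -
  obtain f' where f': "\<And>x. (f has_derivative f' x) (at x)" "\<And>h. Ck n (\<lambda>x. f' x h)" using assms by auto
  have "(f has_real_derivative f' x 1) (at x)" for x
  proof -
    have "f' x = (\<lambda>h. f' x 1 * h)"
    proof
      fix h
      have "linear (f' x)" using f'(1)[of x] has_derivative_linear by blast
      then have "f' x (h *\<^sub>R 1) = h *\<^sub>R f' x 1" by (rule linear_scale)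
      then show "f' x h = f' x 1 * h" by simp
    qed
    then show ?thesis using f'(1)[of x] unfolding has_field_derivative_def by simp
  qed
  then show thesis using that[of "\<lambda>x. f' x 1"] f'(2) by auto
qed

lemma Ck_affine:
  fixes f :: "real \<Rightarrow> real"
  shows "Ck n f \<Longrightarrow> Ck n (\<lambda>x. f (c * x + d))"
proof (induction n arbitrary: f)
  case 0
  then show ?case
    by (auto intro!: continuous_on_compose2[of UNIV f] continuous_intros)
next
  case (Suc n)
  from Ck_SucE[OF Suc.prems] obtain f' where f': "\<And>x. (f has_real_derivative f' x) (at x)" "Ck n f'" by blast
  have lin: "((\<lambda>x. c * x + d) has_real_derivative c) (at x)" for x
    by (auto intro!: derivative_eq_intros)
  have "((\<lambda>x. f (c * x + d)) has_real_derivative c * f' (c * x + d)) (at x)" for x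
    unfolding mult.commute[of c "f' (c * x + d)"] by (rule DERIV_chain2[OF f'(1) lin])
  then show ?case by (rule Ck_SucI) (use Suc.IH[OF f'(2)] in \<open>auto intro: Ck_cmult\<close>)
qed

section \<open>A smooth step built from exp (-1/x)\<close>

text \<open>The weights (1/x)^n make the family closed under differentiation up to linear
  combinations, so smoothness of every order is one induction with \<open>n\<close> left
  arbitrary.\<close>

definition flat :: "nat \<Rightarrow> real \<Rightarrow> real" where
  "flat n x = (if x > 0 then (1 / x) ^ n * exp (- (1 / x)) else 0)"

text \<open>A single term of the exponential series, that of degree n + 2, bounds exp (1/x) from
  below. The factor x^2 is what makes the difference quotient at 0 vanish.\<close>

lemma flat_bound: "0 \<le> flat n x" "flat n x \<le> fact (n + 2) * x\<^sup>2"
proof -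
  show "0 \<le> flat n x" by (simp add: flat_def)
  show "flat n x \<le> fact (n + 2) * x\<^sup>2"
  proof (cases "x > 0")
    case True
    have "(\<Sum>k\<in>{n + 2}. (1 / x) ^ k /\<^sub>R fact k) \<le> (\<Sum>k. (1 / x) ^ k /\<^sub>R fact k)"
      by (rule sum_le_suminf) (use True summable_exp[of "1 / x"] in \<open>auto simp: summable_exp\<close>)
    then have "(1 / x) ^ (n + 2) / fact (n + 2) \<le> exp (1 / x)"
      by (simp add: exp_def divide_inverse mult.commute)
    then have "(1 / x) ^ (n + 2) \<le> exp (1 / x) * fact (n + 2)"
      by (subst (asm) pos_divide_le_eq) auto
    then have "(1 / x) ^ (n + 2) * exp (- (1 / x)) \<le> exp (1 / x) * fact (n + 2) * exp (- (1 / x))"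
      by (rule mult_right_mono) simp
    also have "\<dots> = fact (n + 2) * (exp (1 / x) * exp (- (1 / x)))" by (simp only: ac_simps)
    also have "\<dots> = fact (n + 2)" by (simp only: exp_minus_inverse mult_1_right)
    finally have le: "(1 / x) ^ (n + 2) * exp (- (1 / x)) \<le> fact (n + 2)" .
    have eq: "(1 / x) ^ n = (1 / x) ^ (n + 2) * x\<^sup>2"
      using True by (simp add: power_add power_divide power2_eq_square)
    have "flat n x = (1 / x) ^ n * exp (- (1 / x))" using True by (simp add: flat_def)
    also have "\<dots> = (1 / x) ^ (n + 2) * exp (- (1 / x)) * x\<^sup>2"
      by (subst eq) (simp only: ac_simps)
    also have "\<dots> \<le> fact (n + 2) * x\<^sup>2" by (rule mult_right_mono[OF le zero_le_power2])
    finally show ?thesis .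
  qed (simp add: flat_def)
qed

lemma flat_deriv: "(flat n has_real_derivative flat (n + 2) x - real n * flat (n + 1) x) (at x)"
proof -
  consider "x > 0" | "x < 0" | "x = 0" by linarith
  then show ?thesis
  proof cases
    case 1
    have "((\<lambda>x. (1 / x) ^ n * exp (- (1 / x))) has_real_derivative
       (real n * (1 / x) ^ (n - 1) * (- 1 / x\<^sup>2)) * exp (- (1 / x)) + (1 / x) ^ n * (exp (- (1 / x)) * (1 / x\<^sup>2))) (at x)"
      using 1 by (auto intro!: derivative_eq_intros simp: power2_eq_square)
    moreover have "(real n * (1 / x) ^ (n - 1) * (- 1 / x\<^sup>2)) * exp (- (1 / x)) + (1 / x) ^ n * (exp (- (1 / x)) * (1 / x\<^sup>2))
        = flat (n + 2) x - real n * flat (n + 1) x"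
      using 1 by (cases n) (auto simp: flat_def power2_eq_square field_simps)
    ultimately have "((\<lambda>x. (1 / x) ^ n * exp (- (1 / x))) has_real_derivative flat (n + 2) x - real n * flat (n +
      1) x) (at x)"
      by simp
    then show ?thesis
      by (rule has_field_derivative_transform_within_open[where S="{0<..}"]) (use 1 in \<open>auto simp: flat_def\<close>)
  next
    case 2
    have "((\<lambda>x. 0) has_real_derivative 0) (at x)" by simp
    then have "(flat n has_real_derivative 0) (at x)"
      by (rule has_field_derivative_transform_within_open[where S="{..<0}"]) (use 2 in \<open>auto simp: flat_def\<close>)
    then show ?thesis using 2 by (simp add: flat_def)
  next
    case 3
    have "((\<lambda>h. flat n h / h) \<longlongrightarrow> 0) (at 0)"
    proof (rule Lim_null_comparison)
      show "\<forall>\<^sub>F h in at 0. norm (flat n h / h) \<le> fact (n + 2) * \<bar>h\<bar>"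
      proof (rule always_eventually, rule allI)
        fix h :: real
        show "norm (flat n h / h) \<le> fact (n + 2) * \<bar>h\<bar>"
        proof (cases "h = 0")
          case False
          have "\<bar>flat n h\<bar> \<le> fact (n + 2) * \<bar>h\<bar> * \<bar>h\<bar>"
            using flat_bound[of n h] by (simp add: power2_eq_square abs_mult[symmetric] mult.assoc)
          then show ?thesis using False by (simp add: divide_le_eq)
        qed simp
      qed
      show "((\<lambda>h. fact (n + 2) * \<bar>h\<bar>) \<longlongrightarrow> 0) (at (0::real))"
        by (auto intro!: tendsto_eq_intros)
    qed
    then show ?thesis using 3 by (simp add: DERIV_def flat_def)
  qed
qed

lemma Ck_flat: "Ck k (flat n)"
proof (induction k arbitrary: n)
  case 0
  show ?case using flat_deriv by (auto intro!: continuous_at_imp_continuous_on DERIV_isCont)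
next
  case (Suc k)
  show ?case
    by (rule Ck_SucI[OF flat_deriv]) (intro Ck_diff Ck_cmult Suc.IH)
qed

text \<open>Primitive of the bump \<open>flat 0 x * flat 0 (1 - x)\<close>, normalised to total mass
  one. The derivative \<open>r\<close> is exported too, because its rescalings serve as one-sided
  mollifiers.\<close>

lemma smooth_step_exists:
  obtains s r :: "real \<Rightarrow> real" where "\<And>n. Ck n s" "\<And>x. (s has_real_derivative r x) (at x)"
    "continuous_on UNIV r" "\<And>x. x \<le> 0 \<Longrightarrow> s x = 0" "\<And>x. x \<ge> 1 \<Longrightarrow> s x = 1" "\<And>x. 0 \<le> s x" "\<And>x. s x \<le> 1"
    "\<And>x. 0 \<le> r x" "\<And>x. x \<notin> {0..1} \<Longrightarrow> r x = 0" "(LBINT x. r x) = 1" "integrable lborel r"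
proof -
  define B where "B x = flat 0 x * flat 0 (- 1 * x + 1)" for x
  have CkB: "Ck n B" for n unfolding B_def by (intro Ck_mult Ck_affine Ck_flat)
  from CkB[of 0] have cB: "continuous_on S B" for S by (auto intro: continuous_on_subset)
  have B0: "0 \<le> B x" for x unfolding B_def by (intro mult_nonneg_nonneg flat_bound)
  have Bz: "B x = 0" if "x \<le> 0 \<or> 1 \<le> x" for x using that by (auto simp: B_def flat_def)
  define c where "c = integral {0..1} B"
  have iB: "B integrable_on {a..b}" for a b by (intro integrable_continuous_interval cB)
  have "c \<noteq> 0"
  proof
    assume "c = 0"
    then have "\<forall>x\<in>{0..1}. B x = 0"
      using integral_eq_0_iff[OF cB zero_less_one B0] unfolding c_def by blast
    then have "B (1/2) = 0" by (rule bspec) auto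
    then show False by (simp add: B_def flat_def)
  qed
  then have c: "c > 0" using integral_nonneg[OF iB, of 0 1] B0 unfolding c_def by (metis less_eq_real_def)
  define s where "s x = integral {0..x} B / c" for x
  have s0: "s x = 0" if "x \<le> 0" for x using that by (cases "x = 0") (auto simp: s_def)
  have s1: "s x = 1" if "x \<ge> 1" for x
  proof -
    have "integral {1..x} B = integral {1..x} (\<lambda>_. 0)"
      by (rule integral_cong) (use Bz in auto)
    then show ?thesis
      using Henstock_Kurzweil_Integration.integral_combine[of 0 1 x B] iB that c
      by (simp add: s_def c_def)
  qed
  have der: "(s has_real_derivative B x / c) (at x)" for x
  proof (cases "x > 0")
    case True
    have "((\<lambda>x. integral {0..x} B) has_real_derivative B x) (at x within {0..x + 1})"
      by (rule integral_has_real_derivative[OF cB]) (use True in auto)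
    moreover have "at x within {0..x + 1} = at x"
      by (rule at_within_interior) (use True in auto)
    ultimately have "((\<lambda>x. integral {0..x} B) has_real_derivative B x) (at x)" by simp
    then show ?thesis unfolding s_def using DERIV_cdivide by blast
  next
    case False
    \<comment> \<open>For x \<le> 0 the integral over {0..y} does not start to the left of x;
      starting at x - 1 instead changes nothing, since \<open>B\<close> vanishes on the negative
      axis.\<close>
    have 1: "((\<lambda>y. integral {x - 1..y} B / c) has_real_derivative B x / c) (at x within {x - 1..x + 1})"
      by (rule DERIV_cdivide[OF integral_has_real_derivative[OF cB]]) auto
    moreover have "at x within {x - 1..x + 1} = at x"
      by (rule at_within_interior) auto
    ultimately have 1: "((\<lambda>y. integral {x - 1..y} B / c) has_real_derivative B x / c) (at x)" by simp
    have "integral {x - 1..y} B / c = s y" if "y \<in> {x - 1<..}" for y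
    proof (cases "y \<le> 0")
      case True
      have "integral {x - 1..y} B = integral {x - 1..y} (\<lambda>_. 0)"
        by (rule integral_cong) (use Bz True in auto)
      then show ?thesis using s0 True by simp
    next
      case y: False
      have "integral {x - 1..0} B = integral {x - 1..0} (\<lambda>_. 0)"
        by (rule integral_cong) (use Bz in auto)
      then show ?thesis
        using Henstock_Kurzweil_Integration.integral_combine[of "x - 1" 0 y B] iB y False
        by (simp add: s_def)
    qed
    then show ?thesis
      by (intro has_field_derivative_transform_within_open[OF 1, where S="{x - 1<..}"]) auto
  qed
  have CkBc: "Ck n (\<lambda>x. B x / c)" for n using Ck_cmult[OF CkB, of n "1 / c"] by simp
  have Cks: "Ck n s" for n
    by (rule Ck_Suc_imp) (rule Ck_SucI[OF der CkBc])
  have mono: "s x \<le> s y" if "x \<le> y" for x y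
    by (rule DERIV_nonneg_imp_nondecreasing[OF that]) (use der B0 c in \<open>auto intro!: exI[of _ "B _ / c"]\<close>)
  have sb: "0 \<le> s x" "s x \<le> 1" for x
    using mono[of 0 x] mono[of x 0] mono[of x 1] mono[of 1 x] s0[of 0] s1[of 1] s0[of x] s1[of x] by linarith+
  have Bm[measurable]: "B \<in> borel_measurable borel" using cB by (rule borel_measurable_continuous_onI)
  have si: "set_integrable lborel {0..1} (\<lambda>x. B x / c)"
    by (rule borel_integrable_atLeastAtMost') (use c in \<open>auto intro!: continuous_intros cB\<close>)
  have eq: "indicator {0..1} x *\<^sub>R (B x / c) = B x / c" for x
    using Bz[of x] by (cases "x \<le> 0 \<or> 1 \<le> x") (auto simp: indicator_def)
  have i: "integrable lborel (\<lambda>x. B x / c)" using si unfolding set_integrable_def eq .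
  have "(LBINT x. B x / c) = (LBINT x:{0..1}. B x / c)" unfolding set_lebesgue_integral_def eq ..
  also have "\<dots> = integral {0..1} (\<lambda>x. B x / c)" by (rule set_borel_integral_eq_integral(2)[OF si])
  also have "\<dots> = 1" using c by (simp add: c_def)
  finally have one: "(LBINT x. B x / c) = 1" .
  show thesis
    by (rule that[of s "\<lambda>x. B x / c"]) (use Cks der s0 s1 sb B0 Bz c i one in \<open>auto intro!: continuous_intros cB\<close>)
qed

section \<open>The fundamental theorem for the weak derivative\<close>

text \<open>Substituting x = a + z / (n + 1) moves the concentration into the argument of u, where
  continuity acts; the support of r keeps that argument in [a, a + 1], which gives the dominating
  constant.\<close>

lemma mollify_limit:
  fixes u r :: "real \<Rightarrow> real"
  assumes u: "continuous_on UNIV u" and r: "continuous_on UNIV r" "\<And>x. x \<notin> {0..1} \<Longrightarrow> r x = 0"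
    "integrable lborel r" "\<And>x. 0 \<le> r x"
  shows "(\<lambda>n. LBINT x. u x * (real (Suc n) * r (real (Suc n) * (x - a)))) \<longlonglongrightarrow> (LBINT x. u a * r x)"
proof -
  have [measurable]: "u \<in> borel_measurable borel" "r \<in> borel_measurable borel"
    using u r(1) by (auto intro: borel_measurable_continuous_onI)
  have "bounded (u ` {a..a + 1})"
    by (intro compact_imp_bounded compact_continuous_image continuous_on_subset[OF u]) auto
  then obtain K where "\<forall>y\<in>u ` {a..a + 1}. norm y \<le> K" unfolding bounded_iff by blast
  then have K: "\<And>x. x \<in> {a..a + 1} \<Longrightarrow> \<bar>u x\<bar> \<le> K" by auto
  have "(LBINT x. u x * (real (Suc n) * r (real (Suc n) * (x - a)))) = (LBINT z. u (a + z / Suc n) * r z)" for n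
  proof -
    have e: "\<bar>1 / real (Suc n)\<bar> *\<^sub>R (u (a + (1 / real (Suc n)) * z) * (real (Suc n) * r (real (Suc n) * (a + (1 /
      real (Suc n)) * z - a))))
      = u (a + z / Suc n) * r z" for z by (simp del: of_nat_Suc)
    have "(LBINT x. u x * (real (Suc n) * r (real (Suc n) * (x - a)))) =
      \<bar>1 / real (Suc n)\<bar> *\<^sub>R (LBINT z. u (a + (1 / real (Suc n)) * z) * (real (Suc n) * r (real (Suc n) * (a + (1 /
        real (Suc n)) * z - a))))"
      by (rule lborel_integral_real_affine) simp
    also have "\<dots> = (LBINT z. \<bar>1 / real (Suc n)\<bar> *\<^sub>R (u (a + (1 / real (Suc n)) * z) * (real (Suc n) * r (real (Suc
      n) * (a + (1 / real (Suc n)) * z - a)))))"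
      by (rule Bochner_Integration.integral_scaleR_right[symmetric])
    also have "\<dots> = (LBINT z. u (a + z / Suc n) * r z)"
      unfolding e ..
    finally show ?thesis .
  qed
  moreover have "(\<lambda>n. LBINT z. u (a + z / Suc n) * r z) \<longlonglongrightarrow> (LBINT z. u a * r z)"
  proof (rule integral_dominated_convergence)
    show "integrable lborel (\<lambda>z. K * r z)" using r(3) by simp
    show "AE z in lborel. (\<lambda>n. u (a + z / Suc n) * r z) \<longlonglongrightarrow> u a * r z"
    proof (rule AE_I2)
      fix z
      have "(\<lambda>n. a + z / Suc n) \<longlonglongrightarrow> a + 0"
        by (intro tendsto_add tendsto_const LIMSEQ_Suc[OF lim_const_over_n])
      then have "(\<lambda>n. u (a + z / Suc n)) \<longlonglongrightarrow> u a"
        using continuous_on_tendsto_compose[OF u, of "\<lambda>n. a + z / Suc n" a sequentially] by simp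
      then show "(\<lambda>n. u (a + z / Suc n) * r z) \<longlonglongrightarrow> u a * r z" by (intro tendsto_intros)
    qed
    show "AE z in lborel. norm (u (a + z / Suc n) * r z) \<le> K * r z" for n
    proof (rule AE_I2)
      fix z
      show "norm (u (a + z / Suc n) * r z) \<le> K * r z"
      proof (cases "z \<in> {0..1}")
        case True
        then have "z / Suc n \<le> 1" by (simp add: divide_le_eq)
        then have "\<bar>u (a + z / Suc n)\<bar> \<le> K" using True by (intro K) auto
        then show ?thesis using r(4)[of z] by (simp add: abs_mult mult_right_mono)
      qed (use r(2) in simp)
    qed
  qed measurable
  ultimately show ?thesis by simp
qed

text \<open>The weak derivative is tested with the difference of two steepening smooth steps at a
  and b. The derivative of the test function concentrates to point evaluations at a and b, while the
  test function itself tends to the indicator of ]a, b].\<close>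

lemma H1_FTC:
  assumes H: "H1 u u'" and i: "integrable lebesgue u'" and "a < b"
  shows "u b - u a = (LINT x:{a..b}|lebesgue. u' x)"
proof -
  obtain s r where s: "\<And>n. Ck n s" "\<And>x. (s has_real_derivative r x) (at x)"
    "continuous_on UNIV r" "\<And>x. x \<le> 0 \<Longrightarrow> s x = 0" "\<And>x. x \<ge> 1 \<Longrightarrow> s x = 1" "\<And>x. 0 \<le> s x" "\<And>x. s x \<le> 1"
    "\<And>x. 0 \<le> r x" "\<And>x. x \<notin> {0..1} \<Longrightarrow> r x = 0" "(LBINT x. r x) = 1" "integrable lborel r"
    using smooth_step_exists by blast
  have cu: "continuous_on UNIV u" using H by (simp add: H1_def)
  have [measurable]: "u \<in> borel_measurable borel" "r \<in> borel_measurable borel"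
    using cu s(3) by (auto intro: borel_measurable_continuous_onI)
  \<comment> \<open>The steps rise just to the right of a and of b, which is why the limit interval
    is left-open and right-closed. The arguments are written in the affine form that
    \<open>Ck_affine\<close> expects.\<close>
  define \<phi> where "\<phi> n x = s (real (Suc n) * x + (- (real (Suc n) * a))) - s (real (Suc n) * x + (- (real (Suc n) *
    b)))" for n x
  define d where "d n x = real (Suc n) * r (real (Suc n) * (x - a)) - real (Suc n) * r (real (Suc n) * (x - b))" for n x
  have aff: "real (Suc n) * x + (- (real (Suc n) * c)) = real (Suc n) * (x - c)" for n x c by (simp add: algebra_simps)
  have d: "(\<phi> n has_real_derivative d n x) (at x)" for n x
    unfolding \<phi>_def d_def aff
    by (auto intro!: derivative_eq_intros DERIV_chain2[OF s(2)] simp del: of_nat_Suc)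
  have phz: "\<phi> n x = 0" if x: "x \<notin> {a..b + 1}" for n x
  proof -
    consider "x < a" | "x > b + 1" using x by fastforce
    then show ?thesis
    proof cases
      case 1
      then have "real (Suc n) * (x - a) \<le> 0" "real (Suc n) * (x - b) \<le> 0"
        using \<open>a < b\<close> by (auto intro!: mult_nonneg_nonpos)
      then show ?thesis by (simp only: \<phi>_def aff s(4) diff_self)
    next
      case 2
      then have "1 * 1 \<le> real (Suc n) * (x - a)" "1 * 1 \<le> real (Suc n) * (x - b)"
        using \<open>a < b\<close> by (intro mult_mono; simp)+
      then show ?thesis by (simp only: \<phi>_def aff s(5) diff_self mult_1)
    qed
  qed
  have tf: "test_fun UNIV (\<phi> n)" for n
    unfolding test_fun_def
  proof (intro conjI allI)
    show "Ck k (\<phi> n)" for k unfolding \<phi>_def by (intro Ck_diff Ck_affine s(1))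
    have "{x. \<phi> n x \<noteq> 0} \<subseteq> {a..b + 1}" using phz by blast
    then have "closure {x. \<phi> n x \<noteq> 0} \<subseteq> {a..b + 1}" by (rule closure_minimal) simp
    then show "compact (closure {x. \<phi> n x \<noteq> 0})"
      by (auto simp: compact_eq_bounded_closed intro: bounded_subset[OF bounded_closed_interval])
  qed auto
  have intr: "integrable lborel (\<lambda>x. u x * (real (Suc n) * r (real (Suc n) * (x - c))))" for n c
  proof -
    have "set_integrable lborel {c..c + 1} (\<lambda>x. u x * (real (Suc n) * r (real (Suc n) * (x - c))))"
      by (rule borel_integrable_atLeastAtMost') (auto intro!: continuous_intros continuous_on_subset[OF cu]
        continuous_on_compose2[OF s(3)])
    moreover have "indicator {c..c + 1} x *\<^sub>R (u x * (real (Suc n) * r (real (Suc n) * (x - c))))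
      = u x * (real (Suc n) * r (real (Suc n) * (x - c)))" for x
    proof (cases "x \<in> {c..c + 1}")
      case False
      have "real (Suc n) * (x - c) \<notin> {0..1}"
      proof
        assume *: "real (Suc n) * (x - c) \<in> {0..1}"
        then have "0 \<le> x - c" using zero_le_mult_iff[of "real (Suc n)" "x - c"] by (auto simp del: of_nat_Suc)
        moreover have "x - c \<le> real (Suc n) * (x - c)"
          using mult_right_mono[of 1 "real (Suc n)" "x - c"] \<open>0 \<le> x - c\<close> by simp
        ultimately show False using False * by auto
      qed
      then show ?thesis by (simp add: s(9) del: of_nat_Suc)
    qed simp
    ultimately show ?thesis unfolding set_integrable_def by (simp only:)
  qed
  have eq: "(LBINT x. u x * (real (Suc n) * r (real (Suc n) * (x - a)))) - (LBINT x. u x * (real (Suc n) * r (real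
    (Suc n) * (x - b))))
     = - (LINT x|lebesgue. u' x * \<phi> n x)" for n
  proof -
    have "(LINT x|lebesgue. u x * deriv (\<phi> n) x) = - (LINT x|lebesgue. u' x * \<phi> n x)"
      using H tf by (auto simp: H1_def)
    moreover have "deriv (\<phi> n) = d n" using DERIV_imp_deriv[OF d] by auto
    moreover have "(LINT x|lebesgue. u x * d n x) = (LBINT x. u x * d n x)"
      by (rule integral_completion) (simp add: d_def)
    moreover have "(LBINT x. u x * d n x) = (LBINT x. u x * (real (Suc n) * r (real (Suc n) * (x - a)))) - (LBINT
      x. u x * (real (Suc n) * r (real (Suc n) * (x - b))))"
      unfolding d_def right_diff_distrib[of "u _"] by (rule Bochner_Integration.integral_diff[OF intr intr])
    ultimately show ?thesis by simp
  qed
  have "(\<lambda>n. - (LINT x|lebesgue. u' x * \<phi> n x)) \<longlonglongrightarrow> (LBINT x. u a * r x) - (LBINT x. u b * r x)"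
    unfolding eq[symmetric] by (intro tendsto_diff mollify_limit cu s)
  moreover have "(\<lambda>n. LINT x|lebesgue. u' x * \<phi> n x) \<longlonglongrightarrow> (LINT x|lebesgue. u' x * indicator {a<..b} x)"
  proof (rule integral_dominated_convergence)
    show "integrable lebesgue (\<lambda>x. \<bar>u' x\<bar>)" using i by simp
    have b: "\<bar>\<phi> n x\<bar> \<le> 1" for n x
      using s(6,7)[of "real (Suc n) * (x - a)"] s(6,7)[of "real (Suc n) * (x - b)"]
      unfolding \<phi>_def aff by linarith
    show "AE x in lebesgue. norm (u' x * \<phi> n x) \<le> \<bar>u' x\<bar>" for n
      using b by (auto simp: abs_mult intro!: mult_left_le)
    have "\<phi> n \<in> borel_measurable borel" for n
      by (intro borel_measurable_continuous_onI continuous_at_imp_continuous_on ballI DERIV_isCont[OF d])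
    then have "\<phi> n \<in> borel_measurable lebesgue" for n by (simp add: measurable_completion)
    then show "(\<lambda>x. u' x * \<phi> n x) \<in> borel_measurable lebesgue" for n using i by measurable
    have lim: "(\<lambda>n. s (real (Suc n) * (x - c))) \<longlonglongrightarrow> (if x > c then 1 else 0)" for x c
    proof (cases "x > c")
      case True
      obtain N :: nat where N: "1 / (x - c) < N" using reals_Archimedean2 by blast
      have "s (real (Suc n) * (x - c)) = 1" if "n \<ge> N" for n
      proof (rule s(5))
        have "1 / (x - c) \<le> real (Suc n)" using N that by simp
        then show "1 \<le> real (Suc n) * (x - c)" using True by (simp add: divide_le_eq)
      qed
      then have "\<forall>\<^sub>F n in sequentially. s (real (Suc n) * (x - c)) = 1" by (auto simp: eventually_sequentially)
      then show ?thesis using True by (auto simp del: of_nat_Suc intro: tendsto_eventually)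
    next
      case False
      then have "s (real (Suc n) * (x - c)) = 0" for n by (intro s(4)) (auto intro!: mult_nonneg_nonpos)
      then show ?thesis using False by (simp del: of_nat_Suc)
    qed
    show "AE x in lebesgue. (\<lambda>n. u' x * \<phi> n x) \<longlonglongrightarrow> u' x * indicator {a<..b} x"
    proof (rule AE_I2, rule tendsto_mult[OF tendsto_const])
      fix x
      have "(\<lambda>n. \<phi> n x) \<longlonglongrightarrow> (if x > a then 1 else 0) - (if x > b then 1 else 0)"
        unfolding \<phi>_def aff by (intro tendsto_diff lim)
      then show "(\<lambda>n. \<phi> n x) \<longlonglongrightarrow> indicator {a<..b} x"
        using \<open>a < b\<close> by (auto simp: indicator_def split: if_splits)
    qed
  qed (use borel_measurable_integrable[OF i] in \<open>auto intro!: borel_measurable_times borel_measurable_indicator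
    borel_measurable_scaleR\<close>)
  then have "(\<lambda>n. - (LINT x|lebesgue. u' x * \<phi> n x)) \<longlonglongrightarrow> - (LINT x|lebesgue. u' x * indicator {a<..b} x)"
    by (rule tendsto_minus)
  ultimately have "(LBINT x. u a * r x) - (LBINT x. u b * r x) = - (LINT x|lebesgue. u' x * indicator {a<..b} x)"
    by (rule LIMSEQ_unique)
  then have "u b - u a = (LINT x|lebesgue. u' x * indicator {a<..b} x)" using s(10) by simp
  also have "\<dots> = (LINT x|lebesgue. indicator {a..b} x *\<^sub>R u' x)"
  proof (rule integral_cong_AE)
    have "AE x in lborel. x \<noteq> a" by (rule AE_lborel_singleton)
    then have "AE x in lebesgue. x \<noteq> a" by (rule AE_completion)
    then show "AE x in lebesgue. u' x * indicator {a<..b} x = indicator {a..b} x *\<^sub>R u' x"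
      by eventually_elim (auto simp: indicator_def)
  qed (use borel_measurable_integrable[OF i] in \<open>auto intro!: borel_measurable_times borel_measurable_indicator
    borel_measurable_scaleR\<close>)
  finally show ?thesis unfolding set_lebesgue_integral_def .
qed

section \<open>The Lagrangian coordinate\<close>

lemma lebesgue_measurable_indicator:
  fixes g :: "real \<Rightarrow> real"
  assumes "g \<in> borel_measurable lebesgue" "S \<in> sets borel"
  shows "(\<lambda>x. indicator S x *\<^sub>R g x) \<in> borel_measurable lebesgue"
  using assms by (intro borel_measurable_scaleR borel_measurable_indicator) (auto intro: sets_completionI_sets)

text \<open>Interval integrals may be oriented either way, and their integrand is known only up to a
  Lebesgue null set; increments of \<open>prim\<close> of a Borel version absorb both.\<close>

lemma interval_LINT_eq_prim:
  assumes f[measurable]: "f \<in> borel_measurable borel" and i: "\<And>a b. set_integrable lborel {a..b} f"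
    and g: "g \<in> borel_measurable lebesgue" and ae: "AE x in lebesgue. g x = f x"
  shows "(LINT x=ereal a..ereal b|lebesgue. g x) = prim f b - prim f a"
proof -
  have *: "(LINT x:einterval (ereal a) (ereal b)|lebesgue. g x) = integral {a..b} f" if "a \<le> b" for a b
  proof -
    have "(LINT x:einterval (ereal a) (ereal b)|lebesgue. g x) = (LINT x:einterval (ereal a) (ereal b)|lebesgue. f x)"
      unfolding set_lebesgue_integral_def
    proof (rule integral_cong_AE)
      show "AE x in lebesgue. indicator (einterval (ereal a) (ereal b)) x *\<^sub>R g x
        = indicator (einterval (ereal a) (ereal b)) x *\<^sub>R f x"
        using ae by eventually_elim simp
      have "f \<in> borel_measurable lebesgue" using f by (simp add: measurable_completion)
      then show "(\<lambda>x. indicator (einterval (ereal a) (ereal b)) x *\<^sub>R g x) \<in> borel_measurable lebesgue"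
        "(\<lambda>x. indicator (einterval (ereal a) (ereal b)) x *\<^sub>R f x) \<in> borel_measurable lebesgue"
        using g by (auto intro!: lebesgue_measurable_indicator simp del: real_scaleR_def simp: einterval_eq)
    qed
    also have "\<dots> = (LBINT x:einterval (ereal a) (ereal b). f x)"
      unfolding set_lebesgue_integral_def by (rule integral_completion) (simp add: einterval_eq)
    also have "\<dots> = (LBINT x=ereal a..ereal b. f x)"
      using that by (simp add: interval_lebesgue_integral_def)
    also have "\<dots> = integral {a..b} f" by (rule interval_integral_eq_integral[OF that i])
    finally show ?thesis .
  qed
  show ?thesis
  proof (cases "a \<le> b")
    case True
    then show ?thesis using *[OF True] prim_diff_general[OF i True] by (simp add: interval_lebesgue_integral_def)
  next
    case False
    then have "b \<le> a" by simp
    then show ?thesis using *[OF \<open>b \<le> a\<close>] prim_diff_general[OF i \<open>b \<le> a\<close>] False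
      by (simp add: interval_lebesgue_integral_def)
  qed
qed

text \<open>The initial datum seen from the particles: \<open>w0\<close> is a Borel version of u_0'
  at the position y0. As d xi = (1 + u_0'^2) dx, the two integrability assumptions express u_0' in
  L2 and u_0' in L1, and the quotients are the energy density, u_xi and y_xi at time 0.\<close>

locale lagrangian_datum =
  fixes w0 ub0 y0 :: "real \<Rightarrow> real"
  assumes w0_meas [measurable]: "w0 \<in> borel_measurable borel"
    and e0_int: "integrable lborel (\<lambda>\<xi>. (w0 \<xi>)\<^sup>2 / (1 + (w0 \<xi>)\<^sup>2))"
    and g0_int: "integrable lborel (\<lambda>\<xi>. w0 \<xi> / (1 + (w0 \<xi>)\<^sup>2))"
    and y0_inc: "\<And>\<xi> \<eta>. \<xi> \<le> \<eta> \<Longrightarrow> y0 \<eta> - y0 \<xi> = integral {\<xi>..\<eta>} (\<lambda>\<xi>. 1 / (1 + (w0 \<xi>)\<^sup>2))"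
    and ub0_inc: "\<And>\<xi> \<eta>. \<xi> \<le> \<eta> \<Longrightarrow> ub0 \<eta> - ub0 \<xi> = integral {\<xi>..\<eta>} (\<lambda>\<xi>. w0 \<xi> / (1 + (w0 \<xi>)\<^sup>2))"
    and y0_surj: "surj y0"

text \<open>The map Z x = integral of 1 + p^2 from 0 to x expands distances, y0 is its only inverse,
  and Lebesgue measure is the image under Z of the density 1 + p^2. The integral clauses are changes
  of variables under this image. Uniqueness is exported because every l brings a \<open>y0\<close>
  of its own.\<close>

lemma lagrangian_coordinate:
  assumes H: "H1 u\<^sub>0 u\<^sub>0'" and i: "integrable lebesgue u\<^sub>0'"
    and y0: "\<And>\<xi>. (LINT x=0..y0 \<xi>|lebesgue. (1 + (u\<^sub>0' x)\<^sup>2)) = \<xi>"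
  obtains w0 where "lagrangian_datum w0 (\<lambda>\<xi>. u\<^sub>0 (y0 \<xi>)) y0" "AE \<xi> in lborel. u\<^sub>0' (y0 \<xi>) = w0 \<xi>"
    "\<And>M. AE x in lebesgue. u\<^sub>0' x \<le> M \<Longrightarrow> AE \<xi> in lborel. w0 \<xi> \<le> M"
    "\<And>y1 :: real \<Rightarrow> real. (\<And>\<xi>. (LINT x=0..y1 \<xi>|lebesgue. (1 + (u\<^sub>0' x)\<^sup>2)) = \<xi>) \<Longrightarrow> y1 = y0"
proof -
  have um: "u\<^sub>0' \<in> borel_measurable lebesgue" using i by auto
  obtain p where p[measurable]: "p \<in> borel_measurable borel" and pae: "AE x in lborel. u\<^sub>0' x = p x"
    using completion_ex_borel_measurable_real[OF um] by auto
  have pae': "AE x in lebesgue. u\<^sub>0' x = p x" using pae by (rule AE_completion)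
  have pl: "p \<in> borel_measurable lebesgue" using p by (simp add: measurable_completion)
  have pint: "integrable lborel p"
  proof -
    have "integrable lebesgue p"
      using integrable_cong_AE[OF um pl pae'] i by blast
    then show ?thesis by (subst (asm) integrable_completion) auto
  qed
  have p2int: "integrable lborel (\<lambda>x. (p x)\<^sup>2)"
  proof -
    have "integrable lebesgue (\<lambda>x. (u\<^sub>0' x)\<^sup>2)" using H by (simp add: H1_def L2_def)
    moreover have "AE x in lebesgue. (u\<^sub>0' x)\<^sup>2 = (p x)\<^sup>2" using pae' by eventually_elim simp
    ultimately have "integrable lebesgue (\<lambda>x. (p x)\<^sup>2)"
      using integrable_cong_AE[of "\<lambda>x. (u\<^sub>0' x)\<^sup>2" lebesgue "\<lambda>x. (p x)\<^sup>2"] um pl by auto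
    then show ?thesis by (subst (asm) integrable_completion) auto
  qed
  define f where "f x = 1 + (p x)\<^sup>2" for x
  have fm[measurable]: "f \<in> borel_measurable borel" unfolding f_def by measurable
  have f1: "1 \<le> f x" for x by (simp add: f_def)
  have fi: "set_integrable lborel {a..b} f" for a b
    unfolding f_def set_integrable_def scaleR_add_right
  proof (rule Bochner_Integration.integrable_add)
    show "integrable lborel (\<lambda>x. indicat_real {a..b} x *\<^sub>R 1)"
      by (simp add: emeasure_lborel_Icc_eq)
    show "integrable lborel (\<lambda>x. indicat_real {a..b} x *\<^sub>R (p x)\<^sup>2)"
      using integrable_mult_indicator[OF _ p2int, of "{a..b}"] by simp
  qed
  define Z where "Z = prim f"
  have Zd: "Z y - Z x = integral {x..y} f" if "x \<le> y" for x y
    unfolding Z_def by (rule prim_diff_general[OF fi that])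
  have fhk: "f integrable_on {a..b}" for a b by (rule set_borel_integral_eq_integral(1)[OF fi])
  have Zge: "Z y - Z x \<ge> y - x" if "x \<le> y" for x y
  proof -
    have "integral {x..y} (\<lambda>_. 1::real) \<le> integral {x..y} f"
      by (rule integral_le) (use f1 fhk in auto)
    then show ?thesis using Zd[OF that] that by simp
  qed
  have Zstrict: "x < y \<Longrightarrow> Z x < Z y" for x y using Zge[of x y] by linarith
  have Zle: "Z x \<le> Z y \<longleftrightarrow> x \<le> y" for x y using Zstrict[of x y] Zstrict[of y x] by (cases x y rule: linorder_cases) auto
  have Zinj: "Z x = Z y \<longleftrightarrow> x = y" for x y using Zle[of x y] Zle[of y x] by auto
  have Z0: "Z 0 = 0" by (simp add: Z_def prim_def)
  have LZ: "(LINT x=0..y|lebesgue. (1 + (u\<^sub>0' x)\<^sup>2)) = Z y" for y :: real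
  proof -
    have "(LINT x=ereal 0..ereal y|lebesgue. (1 + (u\<^sub>0' x)\<^sup>2)) = prim f y - prim f 0"
    proof (rule interval_LINT_eq_prim[OF fm fi])
      show "AE x in lebesgue. 1 + (u\<^sub>0' x)\<^sup>2 = f x" using pae' by eventually_elim (simp add: f_def)
    qed (use um in auto)
    then show ?thesis using Z0 by (simp add: Z_def zero_ereal_def)
  qed
  have Zy: "Z (y0 \<xi>) = \<xi>" for \<xi> using y0[of \<xi>] LZ by simp
  have yZ: "y0 (Z x) = x" for x using Zy[of "Z x"] Zinj by blast
  have uniq: "y1 = y0" if "\<And>\<xi>. (LINT x=0..y1 \<xi>|lebesgue. (1 + (u\<^sub>0' x)\<^sup>2)) = \<xi>" for y1 :: "real \<Rightarrow> real"
  proof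
    fix \<xi> have "Z (y1 \<xi>) = \<xi>" using that[of \<xi>] LZ by simp
    then show "y1 \<xi> = y0 \<xi>" using Zy[of \<xi>] Zinj by metis
  qed
  have ymono: "mono y0" by (rule monoI) (use Zle Zy in metis)
  have ym[measurable]: "y0 \<in> borel_measurable borel" by (rule borel_measurable_mono[OF ymono])
  have Zmono: "mono Z" by (rule monoI) (use Zle in auto)
  have Zm[measurable]: "Z \<in> borel_measurable borel" by (rule borel_measurable_mono[OF Zmono])
  have f_Icc: "(\<integral>\<^sup>+x. ennreal (f x) * indicator {a..b} x \<partial>lborel) = ennreal (Z b - Z a)" if "a \<le> b" for a b
  proof -
    have "(\<integral>\<^sup>+x. ennreal (f x) * indicator {a..b} x \<partial>lborel) = (\<integral>\<^sup>+x. ennreal (indicator {a..b} x *\<^sub>R f x) \<partial>lborel)"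
      by (intro nn_integral_cong) (auto simp: indicator_def)
    also have "\<dots> = ennreal (LBINT x:{a..b}. f x)"
      unfolding set_lebesgue_integral_def
      by (rule nn_integral_eq_integral) (use fi f1 in \<open>auto simp: set_integrable_def indicator_def intro!:
        order_trans[OF zero_le_one f1]\<close>)
    also have "(LBINT x:{a..b}. f x) = Z b - Z a"
      using set_borel_integral_eq_integral(2)[OF fi] Zd[OF that] by simp
    finally show ?thesis .
  qed
  \<comment> \<open>Lebesgue measure is determined by the volume of boxes, and over an interval the
    density 1 + p^2 integrates to an increment of Z.\<close>
  have lb: "lborel = distr (density lborel (\<lambda>x. ennreal (f x))) lborel Z"
  proof (rule lborel_eqI)
    fix l u :: real assume "\<And>b. b \<in> Basis \<Longrightarrow> l \<bullet> b \<le> u \<bullet> b"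
    then have lu: "l \<le> u" by simp
    have ylu: "y0 l \<le> y0 u" using ymono lu by (rule monoD)
    have "emeasure (distr (density lborel (\<lambda>x. ennreal (f x))) lborel Z) (box l u)
       = emeasure (density lborel (\<lambda>x. ennreal (f x))) (Z -` box l u)"
      by (subst emeasure_distr) auto
    also have "\<dots> = (\<integral>\<^sup>+x. ennreal (f x) * indicator (Z -` box l u) x \<partial>lborel)"
      by (subst emeasure_density) (auto intro!: measurable_sets_borel[OF Zm])
    also have "\<dots> = (\<integral>\<^sup>+x. ennreal (f x) * indicator {y0 l..y0 u} x \<partial>lborel)"
    proof (rule nn_integral_cong_AE)
      have "AE x in lborel. x \<noteq> y0 l" "AE x in lborel. x \<noteq> y0 u" by (rule AE_lborel_singleton)+
      then show "AE x in lborel. ennreal (f x) * indicator (Z -` box l u) x = ennreal (f x) * indicator {y0 l..y0 u} x"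
      proof eventually_elim
        case (elim x)
        have "l \<le> Z x \<longleftrightarrow> y0 l \<le> x" "Z x \<le> u \<longleftrightarrow> x \<le> y0 u" "Z x \<noteq> l" "Z x \<noteq> u"
          using Zle[of "y0 l" x] Zle[of x "y0 u"] Zy[of l] Zy[of u] elim yZ by auto
        then show ?case by (auto simp: indicator_def box_real)
      qed
    qed
    also have "\<dots> = ennreal (u - l)" using f_Icc[OF ylu] Zy by simp
    finally show "emeasure (distr (density lborel (\<lambda>x. ennreal (f x))) lborel Z) (box l u) = (\<Prod>b\<in>Basis. (u - l) \<bullet> b)"
      by simp
  qed simp
  have nncov: "(\<integral>\<^sup>+\<xi>. h (y0 \<xi>) \<partial>lborel) = (\<integral>\<^sup>+x. ennreal (f x) * h x \<partial>lborel)"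
    if [measurable]: "h \<in> borel_measurable borel" for h :: "real \<Rightarrow> ennreal"
    by (subst lb, subst nn_integral_distr) (auto simp: nn_integral_density yZ)
  have intcov: "integrable lborel (\<lambda>\<xi>. h (y0 \<xi>)) \<longleftrightarrow> integrable lborel (\<lambda>x. f x * h x)"
    "(LBINT \<xi>. h (y0 \<xi>)) = (LBINT x. f x * h x)"
    if [measurable]: "h \<in> borel_measurable borel" for h :: "real \<Rightarrow> real"
  proof -
    have f0: "AE x in lborel. 0 \<le> f x" using f1 order_trans[OF zero_le_one] by auto
    have "integrable lborel (\<lambda>\<xi>. h (y0 \<xi>)) \<longleftrightarrow> integrable (density lborel (\<lambda>x. ennreal (f x))) (\<lambda>x. h (y0 (Z x)))"
      by (subst lb, subst integrable_distr_eq) auto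
    then show "integrable lborel (\<lambda>\<xi>. h (y0 \<xi>)) \<longleftrightarrow> integrable lborel (\<lambda>x. f x * h x)"
      using f0 by (simp add: yZ integrable_density)
    have "(LBINT \<xi>. h (y0 \<xi>)) = (\<integral>x. h (y0 (Z x)) \<partial>density lborel (\<lambda>x. ennreal (f x)))"
      by (subst lb, subst integral_distr) auto
    then show "(LBINT \<xi>. h (y0 \<xi>)) = (LBINT x. f x * h x)"
      using f0 by (simp add: yZ integral_density)
  qed
  \<comment> \<open>The preimage of a null set under y0 is null because the image measure has a
    density; thus statements about u_0' almost everywhere transfer to particles.\<close>
  have AEcov: "AE \<xi> in lborel. R (y0 \<xi>)" if "AE x in lborel. R x" for R
  proof -
    from AE_E[OF that] obtain N where N: "{x \<in> space lborel. \<not> R x} \<subseteq> N" "emeasure lborel N = 0" "N \<in> sets lborel" .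
    have Nb: "N \<in> sets borel" using N by simp
    have "emeasure lborel (y0 -` N) = (\<integral>\<^sup>+\<xi>. indicator (y0 -` N) \<xi> \<partial>lborel)"
      using measurable_sets_borel[OF ym Nb] by simp
    also have "\<dots> = (\<integral>\<^sup>+\<xi>. indicator N (y0 \<xi>) \<partial>lborel)"
      by (intro nn_integral_cong) (auto simp: indicator_def)
    also have "\<dots> = (\<integral>\<^sup>+x. ennreal (f x) * indicator N x \<partial>lborel)"
      by (rule nncov) (use Nb in measurable)
    also have "\<dots> = 0"
    proof -
      have "AE x in lborel. x \<notin> N" using N by (intro AE_not_in) (auto simp: null_sets_def)
      then have "AE x in lborel. ennreal (f x) * indicator N x = 0" by eventually_elim simp
      then show ?thesis using Nb by (subst nn_integral_0_iff_AE) auto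
    qed
    finally have "y0 -` N \<in> null_sets lborel" using measurable_sets_borel[OF ym Nb] by (auto simp: null_sets_def)
    then have "AE \<xi> in lborel. \<xi> \<notin> y0 -` N" by (rule AE_not_in)
    then show ?thesis by eventually_elim (use N(1) in auto)
  qed
  define w0 where "w0 \<xi> = p (y0 \<xi>)" for \<xi>
  have cov_Icc: "integral {\<xi>..\<eta>} (\<lambda>\<xi>. h (y0 \<xi>)) = (LBINT x:{y0 \<xi>..y0 \<eta>}. f x * h x)"
    if h[measurable]: "h \<in> borel_measurable borel" and "\<xi> \<le> \<eta>" and hb: "\<And>x. \<bar>h x\<bar> \<le> 1" for h \<xi> \<eta>
  proof -
    have "integral {\<xi>..\<eta>} (\<lambda>\<xi>. h (y0 \<xi>)) = (LBINT s:{\<xi>..\<eta>}. h (y0 s))"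
      by (rule bounded_Borel_integrable(4)[symmetric, of _ _ _ 1]) (use hb in auto)
    also have "\<dots> = (LBINT s. (indicator {y0 \<xi>..y0 \<eta>} (y0 s) * h (y0 s)))"
    proof -
      have "s \<in> {\<xi>..\<eta>} \<longleftrightarrow> y0 s \<in> {y0 \<xi>..y0 \<eta>}" for s
        using Zle[of "y0 \<xi>" "y0 s"] Zle[of "y0 s" "y0 \<eta>"] Zy by auto
      then show ?thesis unfolding set_lebesgue_integral_def
        by (intro Bochner_Integration.integral_cong) (auto simp: indicator_def)
    qed
    also have "\<dots> = (LBINT x. f x * (indicator {y0 \<xi>..y0 \<eta>} x * h x))" by (rule intcov(2)) measurable
    finally show ?thesis unfolding set_lebesgue_integral_def by (simp add: mult.left_commute)
  qed
  have fnz: "f x \<noteq> 0" for x using f1[of x] by auto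
  have fr: "1 + (w0 \<xi>)\<^sup>2 = f (y0 \<xi>)" for \<xi> by (simp add: f_def w0_def)
  have pf: "\<bar>p x\<bar> \<le> f x" for x
  proof (cases "\<bar>p x\<bar> \<le> 1")
    case False
    then have "\<bar>p x\<bar> * 1 \<le> \<bar>p x\<bar> * \<bar>p x\<bar>" by (intro mult_left_mono) auto
    then show ?thesis by (simp add: f_def power2_eq_square abs_mult_self_eq)
  qed (use f1[of x] in linarith)
  have "lagrangian_datum w0 (\<lambda>\<xi>. u\<^sub>0 (y0 \<xi>)) y0"
  proof
    show "w0 \<in> borel_measurable borel" unfolding w0_def by measurable
    have "integrable lborel (\<lambda>\<xi>. (\<lambda>x. (p x)\<^sup>2 / f x) (y0 \<xi>))"
      by (subst intcov(1)) (use p2int fnz in auto)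
    then show "integrable lborel (\<lambda>\<xi>. (w0 \<xi>)\<^sup>2 / (1 + (w0 \<xi>)\<^sup>2))" unfolding fr by (simp add: w0_def)
    have "integrable lborel (\<lambda>\<xi>. (\<lambda>x. p x / f x) (y0 \<xi>))"
      by (subst intcov(1)) (use pint fnz in auto)
    then show "integrable lborel (\<lambda>\<xi>. w0 \<xi> / (1 + (w0 \<xi>)\<^sup>2))" unfolding fr by (simp add: w0_def)
    show "surj y0" using yZ by (metis surjI)
    fix \<xi> \<eta> :: real assume le: "\<xi> \<le> \<eta>"
    have yle: "y0 \<xi> \<le> y0 \<eta>" using ymono le by (rule monoD)
    have "integral {\<xi>..\<eta>} (\<lambda>\<xi>. (\<lambda>x. 1 / f x) (y0 \<xi>)) = (LBINT x:{y0 \<xi>..y0 \<eta>}. f x * (1 / f x))"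
    proof (rule cov_Icc[OF _ le])
      fix x show "\<bar>1 / f x\<bar> \<le> 1" using f1[of x] by (simp add: divide_le_eq_1)
    qed measurable
    also have "\<dots> = y0 \<eta> - y0 \<xi>" using yle by (simp add: fnz set_lebesgue_integral_def)
    finally show "y0 \<eta> - y0 \<xi> = integral {\<xi>..\<eta>} (\<lambda>\<xi>. 1 / (1 + (w0 \<xi>)\<^sup>2))" unfolding fr by simp
    have "integral {\<xi>..\<eta>} (\<lambda>\<xi>. (\<lambda>x. p x / f x) (y0 \<xi>)) = (LBINT x:{y0 \<xi>..y0 \<eta>}. f x * (p x / f x))"
    proof (rule cov_Icc[OF _ le])
      fix x show "\<bar>p x / f x\<bar> \<le> 1" using pf[of x] f1[of x] by (simp add: divide_le_eq_1)
    qed measurable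
    also have "\<dots> = (LBINT x:{y0 \<xi>..y0 \<eta>}. p x)" by (simp add: fnz)
    also have "\<dots> = (LINT x:{y0 \<xi>..y0 \<eta>}|lebesgue. p x)"
      unfolding set_lebesgue_integral_def by (rule integral_completion[symmetric]) measurable
    also have "\<dots> = (LINT x:{y0 \<xi>..y0 \<eta>}|lebesgue. u\<^sub>0' x)"
      unfolding set_lebesgue_integral_def
    proof (rule integral_cong_AE)
      show "AE x in lebesgue. indicat_real {y0 \<xi>..y0 \<eta>} x *\<^sub>R p x = indicat_real {y0 \<xi>..y0 \<eta>} x *\<^sub>R u\<^sub>0' x"
        using pae' by eventually_elim simp
    qed (use um pl in \<open>auto intro!: lebesgue_measurable_indicator[unfolded real_scaleR_def]\<close>)
    also have "\<dots> = u\<^sub>0 (y0 \<eta>) - u\<^sub>0 (y0 \<xi>)"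
    proof (cases "y0 \<xi> = y0 \<eta>")
      case True
      have "(LINT x:{y0 \<xi>..y0 \<eta>}|lebesgue. u\<^sub>0' x) = integral {y0 \<xi>..y0 \<eta>} u\<^sub>0'"
        by (rule set_lebesgue_integral_eq_integral(2))
          (use integrable_mult_indicator[OF _ i, of "{y0 \<xi>..y0 \<eta>}"] in \<open>auto simp: set_integrable_def\<close>)
      then show ?thesis using True by simp
    next
      case False
      then show ?thesis using H1_FTC[OF H i, of "y0 \<xi>" "y0 \<eta>"] yle by simp
    qed
    finally show "u\<^sub>0 (y0 \<eta>) - u\<^sub>0 (y0 \<xi>) = integral {\<xi>..\<eta>} (\<lambda>\<xi>. w0 \<xi> / (1 + (w0 \<xi>)\<^sup>2))"
      unfolding fr by (simp add: w0_def)
  qed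
  moreover have "AE \<xi> in lborel. u\<^sub>0' (y0 \<xi>) = w0 \<xi>" unfolding w0_def by (rule AEcov[OF pae])
  moreover have "AE \<xi> in lborel. w0 \<xi> \<le> M" if "AE x in lebesgue. u\<^sub>0' x \<le> M" for M
  proof -
    have "AE x in lebesgue. p x \<le> M" using that pae' by eventually_elim simp
    then have "AE x in lborel. p x \<le> M" by (simp add: AE_completion_iff)
    then show ?thesis unfolding w0_def by (rule AEcov)
  qed
  ultimately show thesis using that uniq by blast
qed

section \<open>Lagrangian flows\<close>

text \<open>\<open>D\<close> is the acceleration of the particles, that is -l^2 P_x or its limit, so
  that both systems fit the same two definitions.\<close>

definition flow_u :: "(real \<Rightarrow> real) \<Rightarrow> (real \<Rightarrow> real \<Rightarrow> real) \<Rightarrow> real \<Rightarrow> real \<Rightarrow> real" where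
  "flow_u ub0 D t \<xi> = ub0 \<xi> + integral {0..t} (\<lambda>s. D s \<xi>)"

definition flow_y :: "(real \<Rightarrow> real) \<Rightarrow> (real \<Rightarrow> real) \<Rightarrow> (real \<Rightarrow> real \<Rightarrow> real) \<Rightarrow> real \<Rightarrow> real \<Rightarrow> real" where
  "flow_y y0 ub0 D t \<xi> = y0 \<xi> + integral {0..t} (\<lambda>s. flow_u ub0 D s \<xi>)"

text \<open>Cauchy-Schwarz recovered from Young's inequality with a free parameter, whose optimum is
  c = x / A. It allows the Hoelder estimate to be proved by comparing integrals linearly.\<close>

lemma square_le_if_young:
  fixes x A E :: real
  assumes "0 \<le> x" "0 \<le> A" "0 \<le> E" and y: "\<And>c. c > 0 \<Longrightarrow> 2 * x \<le> c * A + E / c"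
  shows "x\<^sup>2 \<le> E * A"
proof (cases "x = 0")
  case False
  then have x: "x > 0" using assms by simp
  show ?thesis
  proof (cases "A = 0")
    case True
    \<comment> \<open>For A = 0 the optimum is at infinity; this c already makes E / c at most x,
      against 2 x \<le> E / c.\<close>
    have "2 * x \<le> E / ((E + 1) / x)" using y[of "(E + 1) / x"] x assms True by simp
    moreover have "E / ((E + 1) / x) \<le> x" using x assms by (simp add: field_simps)
    ultimately show ?thesis using x by linarith
  next
    case False
    then have A: "A > 0" using assms by simp
    have "2 * x \<le> x + E * A / x" using y[of "x / A"] x A by simp
    then have "x \<le> E * A / x" by simp
    then show ?thesis using x by (simp add: field_simps power2_eq_square)
  qed
qed (use assms in simp)

text \<open>Common interface of the regularised flows and their limit: \<open>a\<close> = y_xi,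
  \<open>g\<close> = u_xi, \<open>e\<close> the energy density, \<open>h\<close> = D_xi = g_t, each
  relation in integrated form. The moduli derived below depend only on T, C and E, so uniformity in
  l amounts to uniformity of these constants.\<close>

locale lagrangian_flow =
  fixes T C E :: real and a g e h D :: "real \<Rightarrow> real \<Rightarrow> real" and ub0 y0 :: "real \<Rightarrow> real"
  assumes T0: "0 \<le> T"
    and D_meas [measurable]: "jointly_Borel D"
    and h_meas [measurable]: "jointly_Borel h"
    and g_meas [measurable]: "jointly_Borel g"
    and a_meas [measurable]: "jointly_Borel a"
    and D_bd: "\<And>t \<xi>. 0 \<le> t \<Longrightarrow> t \<le> T \<Longrightarrow> \<bar>D t \<xi>\<bar> \<le> C"
    and h_bd: "\<And>t \<xi>. 0 \<le> t \<Longrightarrow> t \<le> T \<Longrightarrow> \<bar>h t \<xi>\<bar> \<le> C"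
    and g_bd: "\<And>t \<xi>. 0 \<le> t \<Longrightarrow> t \<le> T \<Longrightarrow> \<bar>g t \<xi>\<bar> \<le> C"
    and a_bd: "\<And>t \<xi>. 0 \<le> t \<Longrightarrow> t \<le> T \<Longrightarrow> \<bar>a t \<xi>\<bar> \<le> C"
    and ub0_bd: "\<And>\<xi>. \<bar>ub0 \<xi>\<bar> \<le> C"
    and a_nonneg: "\<And>t \<xi>. 0 \<le> t \<Longrightarrow> t \<le> T \<Longrightarrow> 0 \<le> a t \<xi>"
    and e_nonneg: "\<And>t \<xi>. 0 \<le> t \<Longrightarrow> t \<le> T \<Longrightarrow> 0 \<le> e t \<xi>"
    and g_sq: "\<And>t \<xi>. 0 \<le> t \<Longrightarrow> t \<le> T \<Longrightarrow> (g t \<xi>)\<^sup>2 \<le> a t \<xi> * e t \<xi>"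
    and e_int: "\<And>t. 0 \<le> t \<Longrightarrow> t \<le> T \<Longrightarrow> integrable lborel (e t)"
    and e_le: "\<And>t. 0 \<le> t \<Longrightarrow> t \<le> T \<Longrightarrow> (LBINT \<xi>. e t \<xi>) \<le> E"
    and D_inc: "\<And>t \<xi> \<eta>. 0 \<le> t \<Longrightarrow> t \<le> T \<Longrightarrow> \<xi> \<le> \<eta> \<Longrightarrow> D t \<eta> - D t \<xi> = integral {\<xi>..\<eta>} (h t)"
    and g_eq: "\<And>t \<xi>. 0 \<le> t \<Longrightarrow> t \<le> T \<Longrightarrow> g t \<xi> = g 0 \<xi> + integral {0..t} (\<lambda>s. h s \<xi>)"
    and a_eq: "\<And>t \<xi>. 0 \<le> t \<Longrightarrow> t \<le> T \<Longrightarrow> a t \<xi> = a 0 \<xi> + integral {0..t} (\<lambda>s. g s \<xi>)"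
    and y0_inc: "\<And>\<xi> \<eta>. \<xi> \<le> \<eta> \<Longrightarrow> y0 \<eta> - y0 \<xi> = integral {\<xi>..\<eta>} (a 0)"
    and ub0_inc: "\<And>\<xi> \<eta>. \<xi> \<le> \<eta> \<Longrightarrow> ub0 \<eta> - ub0 \<xi> = integral {\<xi>..\<eta>} (g 0)"
    and y0_surj: "surj y0"
begin

abbreviation "u \<equiv> flow_u ub0 D"
abbreviation "y \<equiv> flow_y y0 ub0 D"

lemma C0: "0 \<le> C" using ub0_bd[of 0] by linarith

lemma sec_meas [measurable]:
  "a t \<in> borel_measurable borel" "g t \<in> borel_measurable borel" "h t \<in> borel_measurable borel" "D t \<in> borel_measurable borel"
  "(\<lambda>s. a s \<xi>) \<in> borel_measurable borel" "(\<lambda>s. g s \<xi>) \<in> borel_measurable borel"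
  "(\<lambda>s. h s \<xi>) \<in> borel_measurable borel" "(\<lambda>s. D s \<xi>) \<in> borel_measurable borel"
  by measurable

lemma time_integrable:
  assumes "t \<le> T" "0 \<le> s"
  shows "(\<lambda>s. D s \<xi>) integrable_on {s..t}" "(\<lambda>s. g s \<xi>) integrable_on {s..t}" "(\<lambda>s. h s \<xi>) integrable_on {s..t}"
  using assms D_bd g_bd h_bd by (auto intro!: bounded_Borel_integrable(3)[where C=C] sec_meas)

lemma space_integrable:
  assumes "0 \<le> t" "t \<le> T"
  shows "a t integrable_on {\<xi>..\<eta>}" "g t integrable_on {\<xi>..\<eta>}" "h t integrable_on {\<xi>..\<eta>}"
  using assms a_bd g_bd h_bd by (auto intro!: bounded_Borel_integrable(3)[where C=C] sec_meas)

lemma u_lip: assumes "0 \<le> s" "s \<le> t" "t \<le> T" shows "\<bar>u t \<xi> - u s \<xi>\<bar> \<le> C * (t - s)"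
proof -
  have "u t \<xi> - u s \<xi> = integral {s..t} (\<lambda>s. D s \<xi>)"
    using Henstock_Kurzweil_Integration.integral_combine[OF assms(1,2) time_integrable(1)[OF assms(3) order_refl,
      of \<xi>]] by (simp add: flow_u_def)
  moreover have "norm (integral {s..t} (\<lambda>s. D s \<xi>)) \<le> integral {s..t} (\<lambda>_. C)"
    by (rule Henstock_Kurzweil_Integration.integral_norm_bound_integral) (use time_integrable(1) assms D_bd in auto)
  ultimately show ?thesis using assms by (simp add: mult.commute)
qed

lemma u_bd: assumes "0 \<le> t" "t \<le> T" shows "\<bar>u t \<xi>\<bar> \<le> C + C * T"
proof -
  have "\<bar>u t \<xi> - u 0 \<xi>\<bar> \<le> C * (t - 0)" by (rule u_lip) (use assms in auto)
  moreover have "C * t \<le> C * T" using assms C0 by (intro mult_left_mono)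
  moreover have "u 0 \<xi> = ub0 \<xi>" by (simp add: flow_u_def)
  ultimately show ?thesis using ub0_bd[of \<xi>] by (simp only: diff_0_right)
qed

lemma u_cont: "continuous_on {0..T} (\<lambda>t. u t \<xi>)"
  unfolding flow_u_def
  by (intro continuous_intros indefinite_integral_continuous_1 time_integrable) auto

lemma u_time_integrable: "0 \<le> s \<Longrightarrow> t \<le> T \<Longrightarrow> (\<lambda>s. u s \<xi>) integrable_on {s..t}"
  by (intro integrable_continuous_interval continuous_on_subset[OF u_cont]) auto

lemma y_lip: assumes "0 \<le> s" "s \<le> t" "t \<le> T" shows "\<bar>y t \<xi> - y s \<xi>\<bar> \<le> (C + C * T) * (t - s)"
proof -
  have "y t \<xi> - y s \<xi> = integral {s..t} (\<lambda>s. u s \<xi>)"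
    using Henstock_Kurzweil_Integration.integral_combine[OF assms(1,2) u_time_integrable[OF order_refl assms(3), of
      \<xi>]] by (simp add: flow_y_def)
  moreover have "norm (integral {s..t} (\<lambda>s. u s \<xi>)) \<le> integral {s..t} (\<lambda>_. C + C * T)"
    by (rule Henstock_Kurzweil_Integration.integral_norm_bound_integral) (use u_time_integrable assms u_bd in auto)
  ultimately show ?thesis using assms by (simp add: mult.commute)
qed

text \<open>Integrating D_xi = h over time and exchanging the integrals turns the evolution of g
  into u_xi = g, with no derivative in xi. The same argument once more gives y_xi = a.\<close>

lemma u_inc: assumes t: "0 \<le> t" "t \<le> T" and "\<xi> \<le> \<eta>" shows "u t \<eta> - u t \<xi> = integral {\<xi>..\<eta>} (g t)"
proof -
  have "u t \<eta> - u t \<xi> = integral {\<xi>..\<eta>} (g 0) + (integral {0..t} (\<lambda>s. D s \<eta>) - integral {0..t} (\<lambda>s. D s \<xi>))"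
    using ub0_inc[OF assms(3)] by (simp add: flow_u_def)
  also have "integral {0..t} (\<lambda>s. D s \<eta>) - integral {0..t} (\<lambda>s. D s \<xi>) = integral {0..t} (\<lambda>s. D s \<eta> - D s \<xi>)"
    by (rule integral_diff[symmetric]) (use time_integrable t in auto)
  also have "\<dots> = integral {0..t} (\<lambda>s. integral {\<xi>..\<eta>} (h s))"
    by (rule integral_cong) (use D_inc assms in auto)
  also have "\<dots> = integral {\<xi>..\<eta>} (\<lambda>x. integral {0..t} (\<lambda>s. h s x))"
    by (rule interval_swap[OF h_meas, where C=C]) (use h_bd t in auto)
  also have "\<dots> = integral {\<xi>..\<eta>} (\<lambda>x. g t x - g 0 x)"
    by (rule integral_cong) (use g_eq[OF t] in simp)
  also have "\<dots> = integral {\<xi>..\<eta>} (g t) - integral {\<xi>..\<eta>} (g 0)"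
    by (rule integral_diff) (use space_integrable T0 t in auto)
  finally show ?thesis by simp
qed

lemma y_inc: assumes t: "0 \<le> t" "t \<le> T" and "\<xi> \<le> \<eta>" shows "y t \<eta> - y t \<xi> = integral {\<xi>..\<eta>} (a t)"
proof -
  have "y t \<eta> - y t \<xi> = integral {\<xi>..\<eta>} (a 0) + (integral {0..t} (\<lambda>s. u s \<eta>) - integral {0..t} (\<lambda>s. u s \<xi>))"
    using y0_inc[OF assms(3)] by (simp add: flow_y_def)
  also have "integral {0..t} (\<lambda>s. u s \<eta>) - integral {0..t} (\<lambda>s. u s \<xi>) = integral {0..t} (\<lambda>s. u s \<eta> - u s \<xi>)"
    by (rule integral_diff[symmetric]) (use u_time_integrable t in auto)
  also have "\<dots> = integral {0..t} (\<lambda>s. integral {\<xi>..\<eta>} (g s))"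
    by (rule integral_cong) (use u_inc assms in auto)
  also have "\<dots> = integral {\<xi>..\<eta>} (\<lambda>x. integral {0..t} (\<lambda>s. g s x))"
    by (rule interval_swap[OF g_meas, where C=C]) (use g_bd t in auto)
  also have "\<dots> = integral {\<xi>..\<eta>} (\<lambda>x. a t x - a 0 x)"
    by (rule integral_cong) (use a_eq[OF t] in simp)
  also have "\<dots> = integral {\<xi>..\<eta>} (a t) - integral {\<xi>..\<eta>} (a 0)"
    by (rule integral_diff) (use space_integrable T0 t in auto)
  finally show ?thesis by simp
qed

lemma y_AC: assumes "0 \<le> t" "t \<le> T" shows "AC_on \<alpha> \<beta> (y t) (a t)"
  unfolding AC_on_def
proof (intro conjI ballI)
  show "a t absolutely_integrable_on {\<alpha>..\<beta>}"
    by (rule bounded_Borel_integrable(2)[where C=C]) (use a_bd assms in auto)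
  fix x assume "x \<in> {\<alpha>..\<beta>}" then show "y t x = y t \<alpha> + integral {\<alpha>..x} (a t)"
    using y_inc[OF assms, of \<alpha> x] by auto
qed

lemma u_AC: assumes "0 \<le> t" "t \<le> T" shows "AC_on \<alpha> \<beta> (u t) (g t)"
  unfolding AC_on_def
proof (intro conjI ballI)
  show "g t absolutely_integrable_on {\<alpha>..\<beta>}"
    by (rule bounded_Borel_integrable(2)[where C=C]) (use g_bd assms in auto)
  fix x assume "x \<in> {\<alpha>..\<beta>}" then show "u t x = u t \<alpha> + integral {\<alpha>..x} (g t)"
    using u_inc[OF assms, of \<alpha> x] by auto
qed

lemma y_mono: assumes "0 \<le> t" "t \<le> T" "\<xi> \<le> \<eta>" shows "y t \<xi> \<le> y t \<eta>"
proof -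
  have "0 \<le> integral {\<xi>..\<eta>} (a t)"
    by (rule integral_nonneg) (use space_integrable a_nonneg assms in auto)
  then show ?thesis using y_inc[OF assms] by linarith
qed

lemma y_far: assumes "0 \<le> t" "t \<le> T" shows "\<bar>y t \<xi> - y0 \<xi>\<bar> \<le> (C + C * T) * T"
proof -
  have "\<bar>y t \<xi> - y 0 \<xi>\<bar> \<le> (C + C * T) * (t - 0)" by (rule y_lip) (use assms in auto)
  also have "\<dots> \<le> (C + C * T) * T" using assms C0 by (intro mult_left_mono) auto
  finally show ?thesis by (simp add: flow_y_def)
qed

text \<open>Particles stay within a fixed distance of y0, which is onto, so the intermediate value
  theorem applies.\<close>

lemma y_surj: assumes t: "0 \<le> t" "t \<le> T" shows "surj (y t)"
proof -
  have "\<exists>\<xi>. y t \<xi> = x" for x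
  proof -
    let ?K = "(C + C * T) * T"
    have K: "0 \<le> ?K" using C0 T0 by simp
    obtain \<xi>1 where 1: "y0 \<xi>1 = x - ?K" using y0_surj by (metis surjD)
    obtain \<xi>2 where 2: "y0 \<xi>2 = x + ?K" using y0_surj by (metis surjD)
    have le: "y t \<xi>1 \<le> x" "x \<le> y t \<xi>2" using y_far[OF t, of \<xi>1] y_far[OF t, of \<xi>2] 1 2 by linarith+
    show ?thesis
    proof (cases "\<xi>1 \<le> \<xi>2")
      case True
      from IVT'[OF le True] show ?thesis using AC_on_continuous[OF y_AC[OF t]] by blast
    next
      case False
      then have "y t \<xi>2 \<le> y t \<xi>1" using y_mono[OF t, of \<xi>2 \<xi>1] by simp
      then show ?thesis using le by (intro exI[of _ \<xi>1]) linarith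
    qed
  qed
  then show ?thesis by (metis surjI surj_def)
qed

lemma E0: "0 \<le> E"
proof -
  have "0 \<le> (LBINT \<xi>. e 0 \<xi>)" by (rule Bochner_Integration.integral_nonneg) (use e_nonneg T0 in auto)
  then show ?thesis using e_le[of 0] T0 by linarith
qed

text \<open>Cauchy-Schwarz on |g| \<le> sqrt (a e): a integrates to the increment of y and e to at
  most E. Consequently particles at the same place have the same velocity, even where y is constant
  on an interval.\<close>

lemma u_hoelder:
  assumes t: "0 \<le> t" "t \<le> T" shows "(u t \<eta> - u t \<xi>)\<^sup>2 \<le> E * \<bar>y t \<eta> - y t \<xi>\<bar>"
proof -
  have *: "(u t \<eta> - u t \<xi>)\<^sup>2 \<le> E * \<bar>y t \<eta> - y t \<xi>\<bar>" if "\<xi> \<le> \<eta>" for \<xi> \<eta>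
  proof -
    have ei: "set_integrable lborel {\<xi>..\<eta>} (e t)"
      unfolding set_integrable_def using integrable_mult_indicator[OF _ e_int[OF t], of "{\<xi>..\<eta>}"] by simp
    have ehk: "e t integrable_on {\<xi>..\<eta>}" by (rule set_borel_integral_eq_integral(1)[OF ei])
    have eE: "integral {\<xi>..\<eta>} (e t) \<le> E"
    proof -
      have "integral {\<xi>..\<eta>} (e t) = (LBINT x:{\<xi>..\<eta>}. e t x)" by (rule set_borel_integral_eq_integral(2)[OF ei, symmetric])
      also have "\<dots> \<le> (LBINT x. e t x)" unfolding set_lebesgue_integral_def
        by (rule integral_mono) (use ei e_int[OF t] e_nonneg[OF t] in \<open>auto simp: set_integrable_def indicator_def\<close>)
      finally show ?thesis using e_le[OF t] by linarith
    qed
    have Dy: "0 \<le> y t \<eta> - y t \<xi>" using y_mono[OF t that] by simp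
    have "\<bar>u t \<eta> - u t \<xi>\<bar>\<^sup>2 \<le> E * (y t \<eta> - y t \<xi>)"
    proof (rule square_le_if_young)
      fix c :: real assume c: "c > 0"
      \<comment> \<open>Young's inequality for g^2 \<le> a e: the squared arithmetic mean of c a and
        e / c exceeds their product by a square.\<close>
      have pt: "\<bar>g t x\<bar> \<le> (c * a t x + e t x / c) / 2" for x
      proof (rule abs_le_square_iff[THEN iffD2, THEN order_trans])
        let ?s = "(c * a t x + e t x / c) / 2"
        have "?s\<^sup>2 - a t x * e t x = ((c * a t x - e t x / c) / 2)\<^sup>2"
          using c by (simp add: power2_eq_square field_simps)
        then have "a t x * e t x \<le> ?s\<^sup>2" by (metis diff_ge_0_iff_ge zero_le_power2)
        then show "(g t x)\<^sup>2 \<le> ?s\<^sup>2" using g_sq[OF t, of x] by linarith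
        show "\<bar>?s\<bar> \<le> ?s" using a_nonneg[OF t, of x] e_nonneg[OF t, of x] c by simp
      qed
      have "norm (integral {\<xi>..\<eta>} (g t)) \<le> integral {\<xi>..\<eta>} (\<lambda>x. (c * a t x + e t x / c) / 2)"
        by (rule Henstock_Kurzweil_Integration.integral_norm_bound_integral)
          (use pt space_integrable[OF t] ehk in \<open>auto intro!: integrable_add integrable_on_mult_right integrable_on_divide\<close>)
      also have "\<dots> = (c * integral {\<xi>..\<eta>} (a t) + integral {\<xi>..\<eta>} (e t) / c) / 2"
        using space_integrable(1)[OF t, of \<xi> \<eta>] ehk
        by (simp add: Henstock_Kurzweil_Integration.integral_add integrable_on_mult_right integrable_on_divide)
      finally have "2 * \<bar>u t \<eta> - u t \<xi>\<bar> \<le> c * (y t \<eta> - y t \<xi>) + integral {\<xi>..\<eta>} (e t) / c"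
        using u_inc[OF t that] y_inc[OF t that] by simp
      also have "\<dots> \<le> c * (y t \<eta> - y t \<xi>) + E / c" using eE c by (simp add: divide_right_mono)
      finally show "2 * \<bar>u t \<eta> - u t \<xi>\<bar> \<le> c * (y t \<eta> - y t \<xi>) + E / c" .
    qed (use Dy E0 in auto)
    then show ?thesis using Dy by simp
  qed
  show ?thesis
    using *[of \<xi> \<eta>] *[of \<eta> \<xi>] by (cases "\<xi> \<le> \<eta>") (auto simp: power2_commute abs_minus_commute)
qed

text \<open>Follow the particle at x' from time s to time t: its velocity changes by at most C |t -
  s| and its position by (C + C T) |t - s|; the Hoelder estimate at time t covers the remaining
  distance.\<close>

lemma Eulerian_modulus:
  assumes W: "\<And>t \<xi>. 0 \<le> t \<Longrightarrow> t \<le> T \<Longrightarrow> W t (y t \<xi>) = u t \<xi>"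
    and t: "0 \<le> t" "t \<le> T" and s: "0 \<le> s" "s \<le> T"
  shows "\<bar>W t x - W s x'\<bar> \<le> C * \<bar>t - s\<bar> + sqrt (E * (\<bar>x - x'\<bar> + (C + C * T) * \<bar>t - s\<bar>))"
proof -
  obtain \<xi> where \<xi>: "x' = y s \<xi>" using y_surj[OF s] by (metis surjD)
  obtain \<eta> where \<eta>: "x = y t \<eta>" using y_surj[OF t] by (metis surjD)
  have ut: "\<bar>u t \<xi> - u s \<xi>\<bar> \<le> C * \<bar>t - s\<bar>"
    using u_lip[of s t \<xi>] u_lip[of t s \<xi>] t s by (cases "s \<le> t") (auto simp: abs_minus_commute)
  have yt: "\<bar>y t \<xi> - y s \<xi>\<bar> \<le> (C + C * T) * \<bar>t - s\<bar>"
    using y_lip[of s t \<xi>] y_lip[of t s \<xi>] t s by (cases "s \<le> t") (auto simp: abs_minus_commute)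
  have "\<bar>u t \<eta> - u t \<xi>\<bar> = sqrt ((u t \<eta> - u t \<xi>)\<^sup>2)" by simp
  also have "\<dots> \<le> sqrt (E * \<bar>y t \<eta> - y t \<xi>\<bar>)" using u_hoelder[OF t] by (rule real_sqrt_le_mono)
  also have "\<dots> \<le> sqrt (E * (\<bar>x - x'\<bar> + (C + C * T) * \<bar>t - s\<bar>))"
    using yt unfolding \<xi> \<eta> by (intro real_sqrt_le_mono mult_left_mono E0) linarith
  finally show ?thesis using ut W[OF t] W[OF s] unfolding \<xi> \<eta> by simp
qed

end

section \<open>The limit flow\<close>

text \<open>Where the regularising pressure vanishes the Lagrangian system is solvable in closed form:
  \<open>y\<^sub>\<xi>\<close> is a square that stays at zero after its first zero, and the energy carried by a particle is
  constant up to that moment and lost afterwards.\<close>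

lemma integral_ramp:
  fixes c t :: real
  assumes "0 \<le> t"
  shows "integral {0..t} (\<lambda>s. if 0 < 1 + c * s then c else 0) = max 0 (1 + c * t) - 1"
proof (cases "0 \<le> c")
  case True
  have "integral {0..t} (\<lambda>s. if 0 < 1 + c * s then c else 0) = integral {0..t} (\<lambda>s. c)"
    by (rule integral_cong) (use True in \<open>auto simp: add_pos_nonneg\<close>)
  also have "\<dots> = c * t" using assms by simp
  finally show ?thesis using True assms by (simp add: max_def)
next
  case False
  define z where "z = - 1 / c"
  have z: "z > 0" "1 + c * z = 0" using False by (auto simp: z_def)
  have pos: "0 < 1 + c * s \<longleftrightarrow> s < z" for s
  proof -
    have "s < - 1 / c \<longleftrightarrow> - 1 < s * c" using False by (intro neg_less_divide_eq) simp
    then show ?thesis unfolding z_def mult.commute[of c] by linarith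
  qed
  have A: "integral {0..t} (\<lambda>s. if 0 < 1 + c * s then c else 0) = c * t" if "0 \<le> t" "t \<le> z" for t
  proof -
    have "integral {0..t} (\<lambda>s. if 0 < 1 + c * s then c else 0) = integral {0..t} (\<lambda>s. c)"
      by (rule integral_spike[of "{z}"]) (use that pos in auto)
    then show ?thesis using that by simp
  qed
  show ?thesis
  proof (cases "t \<le> z")
    case True
    have "0 \<le> 1 + c * t" using pos[of t] True z by (cases "t = z") auto
    then show ?thesis using A[OF assms True] by simp
  next
    case F: False
    have i: "(\<lambda>s. if 0 < 1 + c * s then c else 0) integrable_on {0..t}"
      by (rule bounded_Borel_integrable(3)[where C="\<bar>c\<bar>"]) auto
    have "integral {z..t} (\<lambda>s. if 0 < 1 + c * s then c else 0) = integral {z..t} (\<lambda>s. 0)"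
      by (rule integral_cong) (use pos in auto)
    then have "integral {0..t} (\<lambda>s. if 0 < 1 + c * s then c else 0) = c * z"
      using Henstock_Kurzweil_Integration.integral_combine[of 0 z t, OF _ _ i] F z A[of z] by simp
    moreover have "1 + c * t < 0" using pos[of t] F z False by (smt (verit) mult_less_cancel_left)
    ultimately show ?thesis using z(2) by simp
  qed
qed

context lagrangian_datum
begin

text \<open>Without pressure the slope w = tan (v / 2) solves w_t = - w^2 / 2, so 1 / w = 1 / w0 + t
  / 2 and w = w0 / (1 + w0 t / 2). A particle lives while this denominator is positive;
  \<open>ramp\<close> is the denominator cut off at 0, and y_xi is proportional to its
  square.\<close>

definition alive :: "real \<Rightarrow> real \<Rightarrow> bool" where "alive t \<xi> \<longleftrightarrow> 0 < 1 + w0 \<xi> / 2 * t"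
definition ramp :: "real \<Rightarrow> real \<Rightarrow> real" where "ramp t \<xi> = max 0 (1 + w0 \<xi> / 2 * t)"
definition e_lim :: "real \<Rightarrow> real \<Rightarrow> real" where
  "e_lim t \<xi> = (if alive t \<xi> then (w0 \<xi>)\<^sup>2 / (1 + (w0 \<xi>)\<^sup>2) else 0)"
definition g_lim :: "real \<Rightarrow> real \<Rightarrow> real" where "g_lim t \<xi> = w0 \<xi> / (1 + (w0 \<xi>)\<^sup>2) * ramp t \<xi>"
definition a_lim :: "real \<Rightarrow> real \<Rightarrow> real" where "a_lim t \<xi> = (ramp t \<xi>)\<^sup>2 / (1 + (w0 \<xi>)\<^sup>2)"
text \<open>The expression for -l^2 P_x with the exponential kernel replaced by 1.\<close>

definition D_lim :: "real \<Rightarrow> real \<Rightarrow> real" where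
  "D_lim t \<xi> = 1 / 4 * (LBINT \<eta>. sgn (\<xi> - \<eta>) * e_lim t \<eta>)"
definition e_total :: real where "e_total = (LBINT \<xi>. (w0 \<xi>)\<^sup>2 / (1 + (w0 \<xi>)\<^sup>2))"
definition g_total :: real where "g_total = (LBINT \<xi>. \<bar>w0 \<xi> / (1 + (w0 \<xi>)\<^sup>2)\<bar>)"

lemma w_pos: "0 < 1 + (w0 \<xi>)\<^sup>2" by (simp add: add_pos_nonneg)

lemma lim_meas [measurable]:
  "jointly_Borel ramp"
  "jointly_Borel e_lim"
  "jointly_Borel g_lim"
  "jointly_Borel a_lim"
proof -
  show 1: "jointly_Borel ramp"
    unfolding ramp_def split_beta' by measurable
  show "jointly_Borel e_lim"
    unfolding e_lim_def alive_def split_beta' by measurable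
  show "jointly_Borel g_lim"
    unfolding g_lim_def using 1 by (simp add: split_beta')
  show "jointly_Borel a_lim"
    unfolding a_lim_def using 1 by (simp add: split_beta')
qed

lemma e_lim_meas1 [measurable]: "e_lim t \<in> borel_measurable borel"
  using lim_meas(2) by measurable

lemma D_lim_meas [measurable]: "jointly_Borel D_lim"
proof -
  have "(\<lambda>p. LINT \<eta>|lborel. sgn (snd p - \<eta>) * e_lim (fst p) \<eta>) \<in> borel_measurable (borel \<Otimes>\<^sub>M borel)"
    by (rule lborel.borel_measurable_lebesgue_integral)
      (use measurable_compose[OF _ lim_meas(2), of "\<lambda>(p, s). (fst p, s)" "(borel \<Otimes>\<^sub>M borel) \<Otimes>\<^sub>M lborel"] in
        \<open>auto simp: split_beta' intro!: borel_measurable_times\<close>)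
  then show ?thesis by (simp add: D_lim_def split_beta')
qed

lemma e_lim_bd: "0 \<le> e_lim t \<xi>" "e_lim t \<xi> \<le> (w0 \<xi>)\<^sup>2 / (1 + (w0 \<xi>)\<^sup>2)" "e_lim t \<xi> \<le> 1"
  using w_pos[of \<xi>] by (auto simp: e_lim_def divide_le_eq_1)

lemma e_lim_int: "integrable lborel (e_lim t)"
  by (rule Bochner_Integration.integrable_bound[OF e0_int]) (use e_lim_bd in \<open>auto simp: abs_of_nonneg\<close>)

lemma e_lim_total: "(LBINT \<xi>. e_lim t \<xi>) \<le> e_total"
  unfolding e_total_def by (rule integral_mono[OF e_lim_int e0_int]) (rule e_lim_bd)

lemma e_total_nonneg: "0 \<le> e_total"
  unfolding e_total_def by (rule Bochner_Integration.integral_nonneg) simp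

text \<open>Integrability of u_0' enters here: u_0 differs from a reference value by at most the
  integral of |u_0'|.\<close>

lemma ub0_bd: "\<bar>ub0 \<xi>\<bar> \<le> \<bar>ub0 0\<bar> + g_total"
proof -
  let ?g = "\<lambda>\<xi>. w0 \<xi> / (1 + (w0 \<xi>)\<^sup>2)"
  have *: "\<bar>ub0 \<eta> - ub0 \<xi>\<bar> \<le> g_total" if "\<xi> \<le> \<eta>" for \<xi> \<eta>
  proof -
    have si: "set_integrable lborel {\<xi>..\<eta>} ?g"
      unfolding set_integrable_def using integrable_mult_indicator[OF _ g0_int, of "{\<xi>..\<eta>}"] by simp
    have "\<bar>ub0 \<eta> - ub0 \<xi>\<bar> = \<bar>LBINT x:{\<xi>..\<eta>}. ?g x\<bar>"
      using ub0_inc[OF that] set_borel_integral_eq_integral(2)[OF si] by simp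
    also have "\<dots> \<le> (LBINT x. \<bar>indicator {\<xi>..\<eta>} x *\<^sub>R ?g x\<bar>)"
      unfolding set_lebesgue_integral_def by (rule integral_abs_bound)
    also have "\<dots> \<le> g_total" unfolding g_total_def
    proof (rule integral_mono)
      show "integrable lborel (\<lambda>\<xi>. \<bar>?g \<xi>\<bar>)" by (rule integrable_abs[OF g0_int])
    show "integrable lborel (\<lambda>x. \<bar>indicator {\<xi>..\<eta>} x *\<^sub>R ?g x\<bar>)"
        using si unfolding set_integrable_def by (rule integrable_abs)
    qed (auto simp: indicator_def)
    finally show ?thesis .
  qed
  show ?thesis using *[of 0 \<xi>] *[of \<xi> 0] by (cases "0 \<le> \<xi>") auto
qed

lemma g_total_nonneg: "0 \<le> g_total"
  unfolding g_total_def by (rule Bochner_Integration.integral_nonneg) simp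

lemma D_lim_bd: "\<bar>D_lim t \<xi>\<bar> \<le> e_total"
proof -
  have "\<bar>LBINT \<eta>. sgn (\<xi> - \<eta>) * e_lim t \<eta>\<bar> \<le> (LBINT \<eta>. \<bar>sgn (\<xi> - \<eta>) * e_lim t \<eta>\<bar>)"
    by (rule integral_abs_bound)
  also have "\<dots> \<le> (LBINT \<eta>. e_lim t \<eta>)"
    by (rule Bochner_Integration.integral_mono_AE')
      (use e_lim_int e_lim_bd in \<open>auto simp: abs_mult sgn_real_def\<close>)
  finally show ?thesis using e_lim_total[of t] e_total_nonneg by (simp add: D_lim_def abs_mult)
qed

text \<open>Off the endpoints the two signs differ by 2 exactly between \<xi> and \<eta>, which
  turns the factor 1/4 into 1/2.\<close>

lemma D_lim_inc:
  assumes "\<xi> \<le> \<eta>" shows "D_lim t \<eta> - D_lim t \<xi> = integral {\<xi>..\<eta>} (\<lambda>x. e_lim t x / 2)"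
proof -
  have i: "integrable lborel (\<lambda>\<eta>. sgn (\<xi> - \<eta>) * e_lim t \<eta>)" for \<xi>
    by (rule Bochner_Integration.integrable_bound[OF e_lim_int[of t]]) (auto simp: abs_mult sgn_real_def)
  have "D_lim t \<eta> - D_lim t \<xi> = 1 / 4 * (LBINT x. sgn (\<eta> - x) * e_lim t x - sgn (\<xi> - x) * e_lim t x)"
    unfolding D_lim_def by (subst Bochner_Integration.integral_diff[OF i i]) (simp add: algebra_simps)
  also have "(LBINT x. sgn (\<eta> - x) * e_lim t x - sgn (\<xi> - x) * e_lim t x)
    = (LBINT x. 4 * (indicator {\<xi>..\<eta>} x *\<^sub>R (e_lim t x / 2)))"
  proof (rule integral_cong_AE)
    have "AE x in lborel. x \<noteq> \<xi>" "AE x in lborel. x \<noteq> \<eta>" by (rule AE_lborel_singleton)+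
    then show "AE x in lborel. sgn (\<eta> - x) * e_lim t x - sgn (\<xi> - x) * e_lim t x
      = 4 * (indicator {\<xi>..\<eta>} x *\<^sub>R (e_lim t x / 2))"
      by eventually_elim (use assms in \<open>auto simp: indicator_def sgn_real_def\<close>)
  qed measurable
  also have "\<dots> = 4 * (LBINT x:{\<xi>..\<eta>}. e_lim t x / 2)" by (simp add: set_lebesgue_integral_def mult.commute)
  also have "(LBINT x:{\<xi>..\<eta>}. e_lim t x / 2) = integral {\<xi>..\<eta>} (\<lambda>x. e_lim t x / 2)"
  proof (rule bounded_Borel_integrable(4)[where C=1])
    show "\<bar>e_lim t x / 2\<bar> \<le> 1" for x using e_lim_bd[of t x] by simp
  qed measurable
  finally show ?thesis by simp
qed

text \<open>The constant collects (1 + |w|)^2 \<le> 2 (1 + w^2) for a, |w| \<le> 1 + w^2 for g, and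
  the total energy and variation of the initial datum for D and the initial velocity.\<close>

lemma limit_flow:
  assumes T: "0 \<le> T"
  shows "lagrangian_flow T (2 * (1 + T)\<^sup>2 + e_total + \<bar>ub0 0\<bar> + g_total) e_total a_lim g_lim e_lim (\<lambda>t \<xi>. e_lim t \<xi>
    / 2) D_lim ub0 y0"
proof -
  let ?C = "2 * (1 + T)\<^sup>2 + e_total + \<bar>ub0 0\<bar> + g_total"
  have T1: "1 \<le> (1 + T)\<^sup>2" using T by (simp add: power2_eq_square algebra_simps)
  have T2: "1 + T \<le> (1 + T)\<^sup>2" using T by (simp add: power2_eq_square algebra_simps)
  have wabs: "\<bar>w0 \<xi>\<bar> \<le> 1 + (w0 \<xi>)\<^sup>2" for \<xi>
    using zero_le_power2[of "\<bar>w0 \<xi>\<bar> - 1"] zero_le_power2[of "w0 \<xi>"] by (simp add: power2_diff)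
  have rampb: "0 \<le> ramp t \<xi>" "ramp t \<xi> \<le> 1 + \<bar>w0 \<xi>\<bar> * T" if "0 \<le> t" "t \<le> T" for t \<xi>
  proof -
    show "0 \<le> ramp t \<xi>" by (simp add: ramp_def)
    have "w0 \<xi> * t \<le> \<bar>w0 \<xi>\<bar> * T" using that by (intro mult_mono) auto
    moreover have "0 \<le> \<bar>w0 \<xi>\<bar> * T" using T by simp
    ultimately show "ramp t \<xi> \<le> 1 + \<bar>w0 \<xi>\<bar> * T" unfolding ramp_def by (auto simp: max_def)
  qed
  have gb: "\<bar>g_lim t \<xi>\<bar> \<le> 1 + T" if "0 \<le> t" "t \<le> T" for t \<xi>
  proof -
    have "\<bar>w0 \<xi>\<bar> * ramp t \<xi> \<le> \<bar>w0 \<xi>\<bar> * (1 + \<bar>w0 \<xi>\<bar> * T)" using rampb[OF that] by (intro mult_left_mono) auto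
    also have "\<dots> = \<bar>w0 \<xi>\<bar> + (w0 \<xi>)\<^sup>2 * T" by (simp add: algebra_simps power2_eq_square abs_mult_self_eq)
    also have "\<dots> \<le> (1 + (w0 \<xi>)\<^sup>2) + (1 + (w0 \<xi>)\<^sup>2) * T" using wabs[of \<xi>] T by (intro add_mono mult_right_mono) auto
    also have "\<dots> = (1 + T) * (1 + (w0 \<xi>)\<^sup>2)" by (simp add: algebra_simps)
    finally show ?thesis using rampb(1)[OF that, of \<xi>] w_pos[of \<xi>]
      by (simp add: g_lim_def abs_mult divide_le_eq)
  qed
  have ab: "\<bar>a_lim t \<xi>\<bar> \<le> 2 * (1 + T)\<^sup>2" if "0 \<le> t" "t \<le> T" for t \<xi>
  proof -
    have "1 + \<bar>w0 \<xi>\<bar> * T \<le> (1 + T) * (1 + \<bar>w0 \<xi>\<bar>)" using T by (simp add: algebra_simps)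
    then have "(ramp t \<xi>)\<^sup>2 \<le> ((1 + T) * (1 + \<bar>w0 \<xi>\<bar>))\<^sup>2" using rampb[OF that, of \<xi>] by (intro power_mono) auto
    also have "\<dots> = (1 + T)\<^sup>2 * (1 + \<bar>w0 \<xi>\<bar>)\<^sup>2" by (simp add: power_mult_distrib)
    also have "\<dots> \<le> (1 + T)\<^sup>2 * (2 * (1 + (w0 \<xi>)\<^sup>2))"
      using zero_le_power2[of "\<bar>w0 \<xi>\<bar> - 1"] by (intro mult_left_mono zero_le_power2) (simp add: power2_sum power2_diff)
    also have "\<dots> = 2 * (1 + T)\<^sup>2 * (1 + (w0 \<xi>)\<^sup>2)" by (simp only: ac_simps)
    finally show ?thesis using w_pos[of \<xi>] by (simp add: a_lim_def divide_le_eq)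
  qed
  have rI: "ramp t \<xi> = 1 + integral {0..t} (\<lambda>s. if alive s \<xi> then w0 \<xi> / 2 else 0)" if "0 \<le> t" for t \<xi>
    using integral_ramp[OF that, of "w0 \<xi> / 2"] unfolding ramp_def alive_def by simp
  have aliveM[measurable]: "Measurable.pred borel (\<lambda>s. alive s \<xi>)" for \<xi> unfolding alive_def by measurable
  \<comment> \<open>\<open>ramp\<close> has density w0 / 2 while the particle is alive and 0
    afterwards; multiplying by the initial u_xi, respectively squaring, yields g_t = e / 2 and a_t =
    g through the moment of death.\<close>
  have rAC: "AC_on 0 T (\<lambda>t. ramp t \<xi>) (\<lambda>s. if alive s \<xi> then w0 \<xi> / 2 else 0)" for \<xi>
    unfolding AC_on_def
  proof (intro conjI ballI)
    show "(\<lambda>s. if alive s \<xi> then w0 \<xi> / 2 else 0) absolutely_integrable_on {0..T}"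
      by (rule bounded_Borel_integrable(2)[where C="\<bar>w0 \<xi>\<bar>"]) auto
    fix t assume t: "t \<in> {0..T}"
    have "ramp 0 \<xi> = 1" by (simp add: ramp_def)
    then show "ramp t \<xi> = ramp 0 \<xi> + integral {0..t} (\<lambda>s. if alive s \<xi> then w0 \<xi> / 2 else 0)"
      using rI[of t \<xi>] t by simp
  qed
  have gAC: "AC_on 0 T (\<lambda>t. g_lim t \<xi>) (\<lambda>s. e_lim s \<xi> / 2)" for \<xi>
    by (rule AC_on_cong[OF AC_on_cmult[OF rAC, of "w0 \<xi> / (1 + (w0 \<xi>)\<^sup>2)"]])
      (auto simp: g_lim_def e_lim_def power2_eq_square)
  have aAC: "AC_on 0 T (\<lambda>t. a_lim t \<xi>) (\<lambda>s. g_lim s \<xi>)" for \<xi>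
    by (rule AC_on_cong[OF AC_on_cmult[OF AC_on_mult[OF rAC rAC], of "1 / (1 + (w0 \<xi>)\<^sup>2)"]])
      (auto simp: a_lim_def g_lim_def power2_eq_square alive_def ramp_def)
  have 0: "g_lim 0 = (\<lambda>\<xi>. w0 \<xi> / (1 + (w0 \<xi>)\<^sup>2))" "a_lim 0 = (\<lambda>\<xi>. 1 / (1 + (w0 \<xi>)\<^sup>2))"
    by (auto simp: g_lim_def a_lim_def ramp_def)
  show ?thesis
  proof
    fix t \<xi> assume t: "0 \<le> t" "t \<le> T"
    show "\<bar>D_lim t \<xi>\<bar> \<le> ?C" using D_lim_bd[of t \<xi>] T1 g_total_nonneg by simp
    show "\<bar>e_lim t \<xi> / 2\<bar> \<le> ?C" using e_lim_bd[of t \<xi>] T1 g_total_nonneg e_total_nonneg by simp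
    show "\<bar>g_lim t \<xi>\<bar> \<le> ?C" using gb[OF t, of \<xi>] T1 T2 g_total_nonneg e_total_nonneg by simp
    show "\<bar>a_lim t \<xi>\<bar> \<le> ?C" using ab[OF t, of \<xi>] g_total_nonneg e_total_nonneg by simp
    show "0 \<le> a_lim t \<xi>" using w_pos[of \<xi>] by (simp add: a_lim_def)
    show "(g_lim t \<xi>)\<^sup>2 \<le> a_lim t \<xi> * e_lim t \<xi>"
    proof (cases "alive t \<xi>")
      case True
      then show ?thesis
        by (simp add: g_lim_def a_lim_def e_lim_def power_mult_distrib power_divide power2_eq_square[of
          "1 + (w0 \<xi>)\<^sup>2"] mult.commute)
    qed (auto simp: g_lim_def a_lim_def e_lim_def ramp_def alive_def)
    show "g_lim t \<xi> = g_lim 0 \<xi> + integral {0..t} (\<lambda>s. e_lim s \<xi> / 2)"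
      using AC_onD(3)[OF gAC, of t] t by simp
    show "a_lim t \<xi> = a_lim 0 \<xi> + integral {0..t} (\<lambda>s. g_lim s \<xi>)"
      using AC_onD(3)[OF aAC, of t] t by simp
  next
    show "\<bar>ub0 \<xi>\<bar> \<le> ?C" for \<xi> using ub0_bd[of \<xi>] T1 e_total_nonneg by simp
    show "(\<lambda>(t, \<xi>). e_lim t \<xi> / 2) \<in> borel_measurable (borel \<Otimes>\<^sub>M borel)"
      using lim_meas(2) by (simp add: split_beta')
  qed (use T e_lim_bd e_lim_int e_lim_total D_lim_inc y0_inc ub0_inc y0_surj lim_meas D_lim_meas 0 in \<open>auto\<close>)
qed

end

section \<open>The regularised flow\<close>

text \<open>The Lagrangian unknowns are normalised to be Borel functions of \<open>(t, \<xi>)\<close> for which the integrated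
  system holds at every \<open>\<xi>\<close>; on the exceptional null set \<open>N\<close> they are replaced by the stationary dead
  state \<open>v = -\<pi>\<close>, \<open>q = 1\<close>.\<close>

locale regularized = lagrangian_datum w0 ub0 y0 for w0 ub0 y0 +
  fixes l :: real and v q :: "real \<Rightarrow> real \<Rightarrow> real" and N :: "real set"
  assumes l_pos: "0 < l"
    and v_meas [measurable]: "jointly_Borel v"
    and q_meas [measurable]: "jointly_Borel q"
    and N_null: "N \<in> null_sets lborel"
    and v_init: "\<And>\<xi>. \<xi> \<notin> N \<Longrightarrow> v 0 \<xi> = 2 * arctan (w0 \<xi>)"
    and v_init_N: "\<And>\<xi>. \<xi> \<in> N \<Longrightarrow> v 0 \<xi> = - pi"
    and q_init: "\<And>\<xi>. q 0 \<xi> = 1"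
    and q_bd: "\<And>T. 0 \<le> T \<Longrightarrow> \<exists>Q. \<forall>t\<in>{0..T}. \<forall>\<xi>. \<bar>q t \<xi>\<bar> \<le> Q"
    and v_uc: "\<And>T. 0 \<le> T \<Longrightarrow> \<exists>\<delta>>0. \<forall>s\<in>{0..T}. \<forall>t\<in>{0..T}. \<bar>s - t\<bar> \<le> \<delta> \<longrightarrow> (\<forall>\<xi>. \<bar>v s \<xi> - v t \<xi>\<bar> \<le> 1 / 10)"
    and P_int: "\<And>t \<xi>. 0 \<le> t \<Longrightarrow> integrable lborel (P_integrand l (v t) (q t) \<xi>)"
    and v_ode: "\<And>T \<xi>. 0 \<le> T \<Longrightarrow> AC_on 0 T (\<lambda>t. v t \<xi>) (\<lambda>s. v_rhs l (v s) (q s) \<xi>)"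
    and q_ode: "\<And>T \<xi>. 0 \<le> T \<Longrightarrow> AC_on 0 T (\<lambda>t. q t \<xi>) (\<lambda>s. q_rhs l (v s) (q s) \<xi>)"
begin

section \<open>Densities of the regularised flow and their measurability\<close>

definition qb :: "real \<Rightarrow> real \<Rightarrow> real" where "qb t \<xi> = qbar (v t) (q t) \<xi>"
definition a :: "real \<Rightarrow> real \<Rightarrow> real" where "a t \<xi> = qb t \<xi> * (cos (v t \<xi> / 2))\<^sup>2"
definition g :: "real \<Rightarrow> real \<Rightarrow> real" where "g t \<xi> = qb t \<xi> * (sin (v t \<xi> / 2) * cos (v t \<xi> / 2))"
definition e :: "real \<Rightarrow> real \<Rightarrow> real" where "e t \<xi> = qb t \<xi> * (sin (v t \<xi> / 2))\<^sup>2"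
text \<open>Energy density without the cut-off at death. Unlike \<open>e\<close> it does not jump,
  so it obeys a differential equation at all times, and it dominates \<open>e\<close> wherever
  \<open>q\<close> is nonnegative.\<close>

definition eu :: "real \<Rightarrow> real \<Rightarrow> real" where "eu t \<xi> = q t \<xi> * (sin (v t \<xi> / 2))\<^sup>2"
text \<open>Position of a particle up to a term depending on time only; the kernel sees just its
  differences.\<close>

definition Z :: "real \<Rightarrow> real \<Rightarrow> real" where "Z t = prim (a t)"
definition k :: "real \<Rightarrow> real \<Rightarrow> real \<Rightarrow> real" where "k t \<xi> \<eta> = exp (- (1 / l) * \<bar>Z t \<eta> - Z t \<xi>\<bar>)"
definition P :: "real \<Rightarrow> real \<Rightarrow> real" where "P t \<xi> = 1 / (4 * l) * (LBINT \<eta>. k t \<xi> \<eta> * e t \<eta>)"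
text \<open>This is -l^2 P_x, with the two half-line integrals joined into one by a sign.\<close>

definition D :: "real \<Rightarrow> real \<Rightarrow> real" where "D t \<xi> = 1 / 4 * (LBINT \<eta>. sgn (\<xi> - \<eta>) * (k t \<xi> \<eta> * e t \<eta>))"
text \<open>The value of D_xi: e / 2 comes from the jump of the signed kernel at its source, -P a
  from its decay.\<close>

definition h :: "real \<Rightarrow> real \<Rightarrow> real" where "h t \<xi> = e t \<xi> / 2 - P t \<xi> * a t \<xi>"

lemma meas [measurable]:
  "jointly_Borel qb"
  "jointly_Borel a"
  "jointly_Borel g"
  "jointly_Borel e"
  "jointly_Borel eu"
  "jointly_Borel Z"
proof -
  have vq: "(\<lambda>p. v (fst p) (snd p)) \<in> borel_measurable (borel \<Otimes>\<^sub>M borel)"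
    "(\<lambda>p. q (fst p) (snd p)) \<in> borel_measurable (borel \<Otimes>\<^sub>M borel)"
    using v_meas q_meas by (simp_all add: split_beta')
  note [measurable] = vq
  show 1: "jointly_Borel qb"
    unfolding qb_def qbar_def split_beta' by measurable
  have [measurable]: "(\<lambda>p. qb (fst p) (snd p)) \<in> borel_measurable (borel \<Otimes>\<^sub>M borel)"
    using 1 by (simp add: split_beta')
  show 2: "jointly_Borel a"
    unfolding a_def split_beta' by measurable
  show "jointly_Borel g"
    unfolding g_def split_beta' by measurable
  show "jointly_Borel e"
    unfolding e_def split_beta' by measurable
  show "jointly_Borel eu"
    unfolding eu_def split_beta' by measurable
  show "jointly_Borel Z"
    unfolding Z_def by (rule prim_measurable[OF 2])
qed

lemma sec_meas [measurable]:
  "v t \<in> borel_measurable borel" "q t \<in> borel_measurable borel"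
  "a t \<in> borel_measurable borel" "g t \<in> borel_measurable borel" "e t \<in> borel_measurable borel"
  "eu t \<in> borel_measurable borel" "Z t \<in> borel_measurable borel"
  "(\<lambda>s. v s \<xi>) \<in> borel_measurable borel" "(\<lambda>s. q s \<xi>) \<in> borel_measurable borel"
  "(\<lambda>s. a s \<xi>) \<in> borel_measurable borel" "(\<lambda>s. g s \<xi>) \<in> borel_measurable borel"
  "(\<lambda>s. e s \<xi>) \<in> borel_measurable borel" "(\<lambda>s. eu s \<xi>) \<in> borel_measurable borel"
  by measurable

lemma k_meas [measurable]:
  "(\<lambda>(p, \<eta>). k (fst p) (snd p) \<eta>) \<in> borel_measurable ((borel \<Otimes>\<^sub>M borel) \<Otimes>\<^sub>M lborel)"
  "(\<lambda>(p, \<eta>). e (fst p) \<eta>) \<in> borel_measurable ((borel \<Otimes>\<^sub>M (borel :: real measure)) \<Otimes>\<^sub>M lborel)"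
proof -
  have Z1: "(\<lambda>p. Z (fst (fst p)) (snd p)) \<in> borel_measurable ((borel \<Otimes>\<^sub>M (borel :: real measure)) \<Otimes>\<^sub>M lborel)"
    using measurable_compose[OF _ meas(6), of "\<lambda>p. (fst (fst p), snd p)"
      "(borel \<Otimes>\<^sub>M (borel :: real measure)) \<Otimes>\<^sub>M lborel"] by simp
  have Z2: "(\<lambda>p. Z (fst (fst p)) (snd (fst p))) \<in> borel_measurable ((borel \<Otimes>\<^sub>M borel) \<Otimes>\<^sub>M (lborel :: real measure))"
    using measurable_compose[OF _ meas(6), of "\<lambda>p. fst p" "(borel \<Otimes>\<^sub>M borel) \<Otimes>\<^sub>M (lborel :: real measure)"]
      by (simp add: split_beta')
  show "(\<lambda>(p, \<eta>). k (fst p) (snd p) \<eta>) \<in> borel_measurable ((borel \<Otimes>\<^sub>M borel) \<Otimes>\<^sub>M lborel)"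
    unfolding k_def split_beta' using Z1 Z2 by measurable
  show "(\<lambda>(p, \<eta>). e (fst p) \<eta>) \<in> borel_measurable ((borel \<Otimes>\<^sub>M (borel :: real measure)) \<Otimes>\<^sub>M lborel)"
    using measurable_compose[OF _ meas(4), of "\<lambda>p. (fst (fst p), snd p)" "(borel \<Otimes>\<^sub>M (borel :: real measure)) \<Otimes>\<^sub>M lborel"]
    by (simp add: split_beta')
qed

lemma P_meas [measurable]: "jointly_Borel P"
proof -
  have "(\<lambda>p. LINT \<eta>|lborel. k (fst p) (snd p) \<eta> * e (fst p) \<eta>) \<in> borel_measurable (borel \<Otimes>\<^sub>M borel)"
    by (rule lborel.borel_measurable_lebesgue_integral)
      (use borel_measurable_times[OF k_meas] in \<open>simp add: split_beta'\<close>)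
  then show ?thesis by (simp add: P_def split_beta')
qed

lemma D_meas [measurable]: "jointly_Borel D"
proof -
  have s: "(\<lambda>(p, \<eta>). sgn (snd p - \<eta>)) \<in> borel_measurable ((borel \<Otimes>\<^sub>M borel) \<Otimes>\<^sub>M (lborel :: real measure))"
    for p :: "real \<times> real" by measurable
  have "(\<lambda>p. LINT \<eta>|lborel. sgn (snd p - \<eta>) * (k (fst p) (snd p) \<eta> * e (fst p) \<eta>)) \<in> borel_measurable (borel \<Otimes>\<^sub>M borel)"
    by (rule lborel.borel_measurable_lebesgue_integral)
      (use borel_measurable_times[OF s borel_measurable_times[OF k_meas]] in \<open>simp add: split_beta'\<close>)
  then show ?thesis by (simp add: D_def split_beta')
qed

lemma h_meas [measurable]: "jointly_Borel h"
  unfolding h_def split_beta' using meas(2,4) P_meas by (simp add: split_beta')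

lemma sec_meas2 [measurable]:
  "P t \<in> borel_measurable borel" "(\<lambda>s. P s \<xi>) \<in> borel_measurable borel" "k t \<xi> \<in> borel_measurable borel"
  "(\<lambda>\<xi>. k t \<xi> \<eta>) \<in> borel_measurable borel"
proof -
  have k: "k t \<xi> = (\<lambda>\<eta>. exp (- (1 / l) * \<bar>Z t \<eta> - Z t \<xi>\<bar>))" by (auto simp: k_def)
  show "k t \<xi> \<in> borel_measurable borel" unfolding k by measurable
  show "(\<lambda>\<xi>. k t \<xi> \<eta>) \<in> borel_measurable borel" unfolding k_def by measurable
qed measurable

lemma v_cont: "0 \<le> T \<Longrightarrow> continuous_on {0..T} (\<lambda>t. v t \<xi>)"
  by (rule AC_on_continuous[OF v_ode])

section \<open>The dead state and the evolution of the densities\<close>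

text \<open>At and below -pi the right-hand side is 0 and v is frozen. At the last time with v \<ge>
  -pi continuity forces v = -pi, and from then on nothing can move it.\<close>

lemma v_ge: assumes t: "0 \<le> t" shows "- pi \<le> v t \<xi>"
proof (rule ccontr)
  assume "\<not> - pi \<le> v t \<xi>"
  then have lt: "v t \<xi> < - pi" by simp
  have v0: "- pi \<le> v 0 \<xi>"
    using v_init[of \<xi>] v_init_N[of \<xi>] arctan_bounded[of "w0 \<xi>"] by (cases "\<xi> \<in> N") auto
  obtain s where s: "0 \<le> s" "s \<le> t" "v s \<xi> = - pi" "\<And>r. s < r \<Longrightarrow> r \<le> t \<Longrightarrow> v r \<xi> < - pi"
  proof -
    define S where "S = {0..t} \<inter> (\<lambda>s. v s \<xi>) -` {- pi..}"
    have "closed S" unfolding S_def by (rule continuous_closed_preimage[OF v_cont[OF t]]) auto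
    then have cS: "compact S" unfolding S_def
      by (metis bounded_Int bounded_closed_interval compact_eq_bounded_closed)
    have "0 \<in> S" using v0 t by (simp add: S_def)
    then obtain s where s: "s \<in> S" "\<And>r. r \<in> S \<Longrightarrow> r \<le> s" using compact_attains_sup[OF cS] by auto
    have st: "0 \<le> s" "s \<le> t" "- pi \<le> v s \<xi>" using s(1) by (auto simp: S_def)
    have after: "v r \<xi> < - pi" if "s < r" "r \<le> t" for r
      using s(2)[of r] that st by (force simp: S_def)
    have "v s \<xi> = - pi"
    proof (rule ccontr)
      assume "v s \<xi> \<noteq> - pi"
      then have gt: "- pi \<le> v s \<xi>" "v s \<xi> \<noteq> - pi" using st by auto
      have "\<exists>r\<ge>s. r \<le> t \<and> v r \<xi> = - pi"
        by (rule IVT2') (use lt gt st continuous_on_subset[OF v_cont[OF t]] in auto)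
      then show False using after gt(2) by (metis less_eq_real_def less_irrefl)
    qed
    with st after show thesis using that by blast
  qed
  have "integral {s..t} (\<lambda>s. v_rhs l (v s) (q s) \<xi>) = integral {s..t} (\<lambda>_. 0)"
  proof (rule integral_cong)
    fix r assume "r \<in> {s..t}"
    then have "v r \<xi> \<le> - pi" using s(3) s(4)[of r] by (cases "r = s") auto
    then show "v_rhs l (v r) (q r) \<xi> = 0" by (simp add: v_rhs_def)
  qed
  then have "v t \<xi> = v s \<xi>" using AC_on_diff[OF v_ode[OF t] s(1,2) order_refl, of \<xi>] by simp
  then show False using lt s(3) by simp
qed

lemma dead_or_alive: "0 \<le> t \<Longrightarrow> v t \<xi> > - pi \<or> v t \<xi> = - pi"
  using v_ge[of t \<xi>] by linarith

text \<open>At v = -pi the factor cos (v / 2) is 0, so the cut-off of \<open>q\<close> is invisible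
  in \<open>a\<close> and \<open>g\<close>. Both stay absolutely continuous through death, whereas
  \<open>e\<close> jumps.\<close>

lemma a_unbarred: "0 \<le> t \<Longrightarrow> a t \<xi> = q t \<xi> * (cos (v t \<xi> / 2))\<^sup>2"
  using dead_or_alive[of t \<xi>] by (auto simp: a_def qb_def qbar_def)

lemma g_unbarred: "0 \<le> t \<Longrightarrow> g t \<xi> = q t \<xi> * (sin (v t \<xi> / 2) * cos (v t \<xi> / 2))"
  using dead_or_alive[of t \<xi>] by (auto simp: g_def qb_def qbar_def)

lemma k_le1: "k t \<xi> \<eta> \<le> 1" "0 \<le> k t \<xi> \<eta>" "k t \<xi> \<eta> = k t \<eta> \<xi>"
  using l_pos by (auto simp: k_def abs_minus_commute)

lemma state_bounded:
  assumes "0 \<le> T"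
  obtains Q where "0 \<le> Q" "\<And>t \<xi>. 0 \<le> t \<Longrightarrow> t \<le> T \<Longrightarrow>
    \<bar>qb t \<xi>\<bar> \<le> Q \<and> \<bar>q t \<xi>\<bar> \<le> Q \<and> \<bar>a t \<xi>\<bar> \<le> Q \<and> \<bar>g t \<xi>\<bar> \<le> Q \<and> \<bar>e t \<xi>\<bar> \<le> Q \<and> \<bar>eu t \<xi>\<bar> \<le> Q"
proof -
  obtain Q where "\<forall>t\<in>{0..T}. \<forall>\<xi>. \<bar>q t \<xi>\<bar> \<le> Q" using q_bd[OF assms] by blast
  then have Q: "\<And>t \<xi>. 0 \<le> t \<Longrightarrow> t \<le> T \<Longrightarrow> \<bar>q t \<xi>\<bar> \<le> Q" by auto
  have Q0: "0 \<le> Q" using Q[of 0 0] assms by simp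
  have qbQ: "\<bar>qb t \<xi>\<bar> \<le> Q" if "0 \<le> t" "t \<le> T" for t \<xi> using Q[OF that, of \<xi>] Q0 by (simp add: qb_def qbar_def)
  have c: "\<bar>(cos x)\<^sup>2\<bar> \<le> 1" "\<bar>(sin x)\<^sup>2\<bar> \<le> 1" "\<bar>sin x * cos x\<bar> \<le> 1" for x :: real
    using abs_cos_le_one[of x] abs_sin_le_one[of x]
    by (auto simp: abs_square_le_1 abs_mult intro!: mult_le_one)
  have m: "\<bar>x * y\<bar> \<le> Q" if "\<bar>x\<bar> \<le> Q" "\<bar>y\<bar> \<le> 1" for x y
    using mult_mono[OF that Q0] by (simp add: abs_mult)
  show thesis
  proof (rule that[OF Q0])
    fix t \<xi> assume t: "0 \<le> t" "t \<le> T"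
    show "\<bar>qb t \<xi>\<bar> \<le> Q \<and> \<bar>q t \<xi>\<bar> \<le> Q \<and> \<bar>a t \<xi>\<bar> \<le> Q \<and> \<bar>g t \<xi>\<bar> \<le> Q \<and> \<bar>e t \<xi>\<bar> \<le> Q \<and> \<bar>eu t \<xi>\<bar> \<le> Q"
      unfolding a_def g_def e_def eu_def by (intro conjI m qbQ[OF t] Q[OF t] c)
  qed
qed

lemma kern_eq: assumes "0 \<le> t" shows "kern l (v t) (q t) \<xi> \<eta> = k t \<xi> \<eta>"
proof -
  obtain Q where Q: "\<And>s \<xi>. 0 \<le> s \<Longrightarrow> s \<le> t \<Longrightarrow> \<bar>a s \<xi>\<bar> \<le> Q" using state_bounded[OF assms] by metis
  have "(LINT s=ereal \<xi>..ereal \<eta>|lebesgue. a t s) = prim (a t) \<eta> - prim (a t) \<xi>"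
  proof (rule interval_LINT_eq_prim)
    show "set_integrable lborel {x..y} (a t)" for x y
      by (rule bounded_Borel_integrable(1)[where C=Q]) (use Q assms in auto)
    have "a t \<in> borel_measurable borel" by measurable
    then show "a t \<in> borel_measurable lebesgue" by (simp add: measurable_completion)
  qed auto
  then show ?thesis by (simp add: kern_def k_def Z_def a_def qb_def)
qed

lemma P_integrand_eq: "0 \<le> t \<Longrightarrow> P_integrand l (v t) (q t) \<xi> = (\<lambda>\<eta>. k t \<xi> \<eta> * e t \<eta>)"
  by (auto simp: P_integrand_def kern_eq e_def qb_def mult.assoc)

lemma ke_int: "0 \<le> t \<Longrightarrow> integrable lborel (\<lambda>\<eta>. k t \<xi> \<eta> * e t \<eta>)"
  using P_int[of t \<xi>] by (simp add: P_integrand_eq)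

lemma Pfun_eq: "0 \<le> t \<Longrightarrow> Pfun l (v t) (q t) \<xi> = P t \<xi>"
  unfolding Pfun_def P_def by (simp add: P_integrand_eq integral_completion)

text \<open>The point \<xi> belongs to both half-lines but is a null set, so the difference of the
  integrals is one integral against a sign.\<close>

lemma Pxfun_eq: assumes t: "0 \<le> t" shows "l\<^sup>2 * Pxfun l (v t) (q t) \<xi> = - D t \<xi>"
proof -
  let ?f = "\<lambda>\<eta>. k t \<xi> \<eta> * e t \<eta>"
  have c: "(LINT \<eta>:S|lebesgue. ?f \<eta>) = (LBINT \<eta>:S. ?f \<eta>)" if "S \<in> sets borel" for S
    unfolding set_lebesgue_integral_def by (rule integral_completion) (use that in measurable)
  have si: "integrable lborel (\<lambda>\<eta>. indicator S \<eta> *\<^sub>R ?f \<eta>)" if "S \<in> sets borel" for S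
    using integrable_mult_indicator[OF _ ke_int[OF t], of S] that by simp
  have "(LBINT \<eta>:{\<xi>..}. ?f \<eta>) - (LBINT \<eta>:{..\<xi>}. ?f \<eta>) = (LBINT \<eta>. indicator {\<xi>..} \<eta> *\<^sub>R ?f \<eta> - indicator {..\<xi>} \<eta> *\<^sub>R ?f \<eta>)"
    unfolding set_lebesgue_integral_def by (rule Bochner_Integration.integral_diff[symmetric]) (rule si; simp)+
  also have "\<dots> = (LBINT \<eta>. - (sgn (\<xi> - \<eta>) * ?f \<eta>))"
    by (rule integral_cong_AE) (auto simp: indicator_def sgn_real_def intro!: AE_mp[OF AE_lborel_singleton[of \<xi>]])
  finally have "(LBINT \<eta>:{\<xi>..}. ?f \<eta>) - (LBINT \<eta>:{..\<xi>}. ?f \<eta>) = - (LBINT \<eta>. sgn (\<xi> - \<eta>) * ?f \<eta>)" by simp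
  then show ?thesis using l_pos t
    by (simp add: Pxfun_def D_def P_integrand_eq c)
qed

lemma rhs_eq: assumes "0 \<le> t"
  shows "v_rhs l (v t) (q t) \<xi> = (if v t \<xi> > - pi then - P t \<xi> * (2 * (cos (v t \<xi> / 2))\<^sup>2) - (sin (v t \<xi> / 2))\<^sup>2 else 0)"
    "q_rhs l (v t) (q t) \<xi> = (if v t \<xi> > - pi then q t \<xi> * (1 / 2 - P t \<xi>) * (2 * sin (v t \<xi> / 2) * cos (v t \<xi> / 2)) else 0)"
proof -
  have 1: "1 + cos (v t \<xi>) = 2 * (cos (v t \<xi> / 2))\<^sup>2" using cos_double_cos[of "v t \<xi> / 2"] by simp
  have 2: "sin (v t \<xi>) = 2 * sin (v t \<xi> / 2) * cos (v t \<xi> / 2)" using sin_double[of "v t \<xi> / 2"] by simp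
  show "v_rhs l (v t) (q t) \<xi> = (if v t \<xi> > - pi then - P t \<xi> * (2 * (cos (v t \<xi> / 2))\<^sup>2) - (sin (v t \<xi> / 2))\<^sup>2 else 0)"
    using 1 by (simp add: v_rhs_def Pfun_eq[OF assms])
  show "q_rhs l (v t) (q t) \<xi> = (if v t \<xi> > - pi then q t \<xi> * (1 / 2 - P t \<xi>) * (2 * sin (v t \<xi> / 2) * cos (v t \<xi> /
    2)) else 0)"
    using 2 by (simp add: q_rhs_def Pfun_eq[OF assms])
qed

text \<open>The algebra behind a_t = g, g_t = e / 2 - P a and eu_t = -2 P g, with S and C the sine
  and cosine of v / 2 and x in the place of q. In the first identity the pressure cancels, which is
  what makes a the density of the flow map y.\<close>

lemma trig_id:
  fixes p S C x :: real
  assumes "S\<^sup>2 + C\<^sup>2 = 1"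
  shows "x * (1 / 2 - p) * (2 * S * C) * C\<^sup>2 + x * (- (C * S) * (- p * (2 * C\<^sup>2) - S\<^sup>2)) = x * (S * C)"
    "x * (1 / 2 - p) * (2 * S * C) * (S * C) + x * ((C\<^sup>2 - S\<^sup>2) / 2 * (- p * (2 * C\<^sup>2) - S\<^sup>2)) = x * S\<^sup>2 / 2 - p * (x * C\<^sup>2)"
    "x * (1 / 2 - p) * (2 * S * C) * S\<^sup>2 + x * (S * C * (- p * (2 * C\<^sup>2) - S\<^sup>2)) = - 2 * p * (x * (S * C))"
proof -
  have C: "C\<^sup>2 = 1 - S\<^sup>2" using assms by simp
  show "x * (1 / 2 - p) * (2 * S * C) * C\<^sup>2 + x * (- (C * S) * (- p * (2 * C\<^sup>2) - S\<^sup>2)) = x * (S * C)"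
    unfolding C by (simp add: algebra_simps power2_eq_square)
  have key: "x * (1 - 2 * p) * (A * (1 - A)) + x * ((1 - A - A) / 2 * (- p * (2 * (1 - A)) - A))
    = x * A / 2 - p * (x * (1 - A))" for A
    by (simp add: field_simps)
  have "x * (1 / 2 - p) * (2 * S * C) * (S * C) = x * (1 - 2 * p) * (S\<^sup>2 * C\<^sup>2)"
    by (simp add: power2_eq_square algebra_simps)
  then show "x * (1 / 2 - p) * (2 * S * C) * (S * C) + x * ((C\<^sup>2 - S\<^sup>2) / 2 * (- p * (2 * C\<^sup>2) - S\<^sup>2))
    = x * S\<^sup>2 / 2 - p * (x * C\<^sup>2)"
    unfolding C by (simp only: key)
  show "x * (1 / 2 - p) * (2 * S * C) * S\<^sup>2 + x * (S * C * (- p * (2 * C\<^sup>2) - S\<^sup>2)) = - 2 * p * (x * (S * C))"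
    unfolding C by (simp add: algebra_simps power2_eq_square)
qed

lemma a_AC: assumes T: "0 \<le> T" shows "AC_on 0 T (\<lambda>t. a t \<xi>) (\<lambda>s. g s \<xi>)"
proof (rule AC_on_cong)
  have "AC_on 0 T (\<lambda>t. (cos (v t \<xi> / 2))\<^sup>2) (\<lambda>s. (- (cos (v s \<xi> / 2) * sin (v s \<xi> / 2))) * v_rhs l (v s) (q s) \<xi>)"
    by (rule AC_on_comp[OF v_ode[OF T], where G="\<lambda>x. (cos (x / 2))\<^sup>2" and G'="\<lambda>x. - (cos (x / 2) * sin (x / 2))"])
      (auto intro!: derivative_eq_intros continuous_intros)
  from AC_on_mult[OF q_ode[OF T] this]
  show "AC_on 0 T (\<lambda>t. q t \<xi> * (cos (v t \<xi> / 2))\<^sup>2)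
     (\<lambda>s. q_rhs l (v s) (q s) \<xi> * (cos (v s \<xi> / 2))\<^sup>2 + q s \<xi> * ((- (cos (v s \<xi> / 2) * sin (v s \<xi> / 2))) * v_rhs l
       (v s) (q s) \<xi>))" .
  show "q_rhs l (v s) (q s) \<xi> * (cos (v s \<xi> / 2))\<^sup>2 + q s \<xi> * ((- (cos (v s \<xi> / 2) * sin (v s \<xi> / 2))) * v_rhs l (v
    s) (q s) \<xi>) = g s \<xi>"
    if "0 \<le> s" for s
    unfolding rhs_eq[OF that] using trig_id(1)[of "sin (v s \<xi> / 2)" "cos (v s \<xi> / 2)" "q s \<xi>" "P s \<xi>"]
    by (simp add: g_def qb_def qbar_def)
qed (simp add: a_unbarred)

lemma g_AC: assumes T: "0 \<le> T" shows "AC_on 0 T (\<lambda>t. g t \<xi>) (\<lambda>s. h s \<xi>)"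
proof (rule AC_on_cong)
  have "AC_on 0 T (\<lambda>t. sin (v t \<xi> / 2) * cos (v t \<xi> / 2)) (\<lambda>s. (((cos (v s \<xi> / 2))\<^sup>2 - (sin (v s \<xi> / 2))\<^sup>2) / 2) *
    v_rhs l (v s) (q s) \<xi>)"
    by (rule AC_on_comp[OF v_ode[OF T], where G="\<lambda>x. sin (x / 2) * cos (x / 2)"
      and G'="\<lambda>x. ((cos (x / 2))\<^sup>2 - (sin (x / 2))\<^sup>2) / 2"])
      (auto intro!: derivative_eq_intros continuous_intros simp: power2_eq_square field_simps)
  from AC_on_mult[OF q_ode[OF T] this]
  show "AC_on 0 T (\<lambda>t. q t \<xi> * (sin (v t \<xi> / 2) * cos (v t \<xi> / 2)))
     (\<lambda>s. q_rhs l (v s) (q s) \<xi> * (sin (v s \<xi> / 2) * cos (v s \<xi> / 2)) + q s \<xi> * ((((cos (v s \<xi> / 2))\<^sup>2 - (sin (v s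
       \<xi> / 2))\<^sup>2) / 2) * v_rhs l (v s) (q s) \<xi>))" .
  show "q_rhs l (v s) (q s) \<xi> * (sin (v s \<xi> / 2) * cos (v s \<xi> / 2)) + q s \<xi> * ((((cos (v s \<xi> / 2))\<^sup>2 - (sin (v s \<xi>
    / 2))\<^sup>2) / 2) * v_rhs l (v s) (q s) \<xi>) = h s \<xi>"
    if "0 \<le> s" for s
    unfolding rhs_eq[OF that] using trig_id(2)[of "sin (v s \<xi> / 2)" "cos (v s \<xi> / 2)" "q s \<xi>" "P s \<xi>"]
    by (simp add: h_def e_def a_def qb_def qbar_def)
qed (simp add: g_unbarred)

text \<open>The uncut energy of a particle changes through the pressure alone; for small P this is
  the near conservation law behind the estimates uniform in l.\<close>

lemma eu_AC: assumes T: "0 \<le> T" shows "AC_on 0 T (\<lambda>t. eu t \<xi>) (\<lambda>s. - 2 * P s \<xi> * g s \<xi>)"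
proof (rule AC_on_cong)
  have "AC_on 0 T (\<lambda>t. (sin (v t \<xi> / 2))\<^sup>2) (\<lambda>s. (sin (v s \<xi> / 2) * cos (v s \<xi> / 2)) * v_rhs l (v s) (q s) \<xi>)"
    by (rule AC_on_comp[OF v_ode[OF T], where G="\<lambda>x. (sin (x / 2))\<^sup>2" and G'="\<lambda>x. sin (x / 2) * cos (x / 2)"])
      (auto intro!: derivative_eq_intros continuous_intros)
  from AC_on_mult[OF q_ode[OF T] this]
  show "AC_on 0 T (\<lambda>t. q t \<xi> * (sin (v t \<xi> / 2))\<^sup>2)
     (\<lambda>s. q_rhs l (v s) (q s) \<xi> * (sin (v s \<xi> / 2))\<^sup>2 + q s \<xi> * ((sin (v s \<xi> / 2) * cos (v s \<xi> / 2)) * v_rhs l (v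
       s) (q s) \<xi>))" .
  show "q_rhs l (v s) (q s) \<xi> * (sin (v s \<xi> / 2))\<^sup>2 + q s \<xi> * ((sin (v s \<xi> / 2) * cos (v s \<xi> / 2)) * v_rhs l (v s)
    (q s) \<xi>) = - 2 * P s \<xi> * g s \<xi>"
    if "0 \<le> s" for s
    unfolding rhs_eq[OF that] using trig_id(3)[of "sin (v s \<xi> / 2)" "cos (v s \<xi> / 2)" "q s \<xi>" "P s \<xi>"]
    by (simp add: g_def qb_def qbar_def)
qed (simp add: eu_def)

end

section \<open>Signs, kernel mass and finite energy under a pressure bound\<close>

lemma nn_integral_Icc:
  fixes f :: "real \<Rightarrow> real"
  assumes f[measurable]: "f \<in> borel_measurable borel" and b: "\<And>x. a \<le> x \<Longrightarrow> x \<le> b \<Longrightarrow> \<bar>f x\<bar> \<le> C"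
    and p: "\<And>x. a \<le> x \<Longrightarrow> x \<le> b \<Longrightarrow> 0 \<le> f x"
  shows "(\<integral>\<^sup>+x. ennreal (f x) * indicator {a..b} x \<partial>lborel) = ennreal (integral {a..b} f)"
proof -
  note i = bounded_Borel_integrable[OF f b]
  have "(\<integral>\<^sup>+x. ennreal (f x) * indicator {a..b} x \<partial>lborel) = (\<integral>\<^sup>+x. ennreal (indicator {a..b} x *\<^sub>R f x) \<partial>lborel)"
    by (intro nn_integral_cong) (auto simp: indicator_def)
  also have "\<dots> = ennreal (LBINT x:{a..b}. f x)"
    unfolding set_lebesgue_integral_def
    by (rule nn_integral_eq_integral) (use i(1) p in \<open>auto simp: set_integrable_def indicator_def\<close>)
  finally show ?thesis using i(4) by simp
qed

text \<open>The weight exp (-2 c t) makes the integral term contribute at most half of the weighted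
  supremum M, whence M \<le> 2 \<alpha>. The argument runs on bounded measurable functions, at the
  price of the two factors 2.\<close>

lemma gronwall:
  fixes f :: "real \<Rightarrow> real"
  assumes f: "f \<in> borel_measurable borel" and b: "\<And>t. 0 \<le> t \<Longrightarrow> t \<le> T \<Longrightarrow> 0 \<le> f t \<and> f t \<le> S"
    and c: "0 < c" and le: "\<And>t. 0 \<le> t \<Longrightarrow> t \<le> T \<Longrightarrow> f t \<le> \<alpha> + c * integral {0..t} f"
    and t: "0 \<le> t" "t \<le> T"
  shows "f t \<le> 2 * \<alpha> * exp (2 * c * t)"
proof -
  define M where "M = (SUP t\<in>{0..T}. f t * exp (- 2 * c * t))"
  have bdd: "bdd_above ((\<lambda>t. f t * exp (- 2 * c * t)) ` {0..T})"
  proof (rule bdd_aboveI2)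
    fix t assume t: "t \<in> {0..T}"
    have "f t * exp (- 2 * c * t) \<le> S * 1" using b[of t] t c by (intro mult_mono) auto
    then show "f t * exp (- 2 * c * t) \<le> S" by simp
  qed
  have up: "f t * exp (- 2 * c * t) \<le> M" if "0 \<le> t" "t \<le> T" for t
    unfolding M_def by (rule cSUP_upper[OF _ bdd]) (use that in auto)
  have up': "f t \<le> M * exp (2 * c * t)" if "0 \<le> t" "t \<le> T" for t
  proof -
    have "f t = f t * exp (- 2 * c * t) * exp (2 * c * t)" by (simp add: mult.assoc flip: exp_add)
    also have "\<dots> \<le> M * exp (2 * c * t)" using up[OF that] by (intro mult_right_mono) auto
    finally show ?thesis .
  qed
  have M0: "0 \<le> M" using up[of 0] b[of 0] t by auto
  have *: "f t * exp (- 2 * c * t) \<le> \<alpha> * exp (- 2 * c * t) + M / 2" if t: "0 \<le> t" "t \<le> T" for t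
  proof -
    have hi: "((\<lambda>s. M * exp (2 * c * s)) has_integral (M * exp (2 * c * t) / (2 * c) - M * exp (2 * c * 0) / (2 *
      c))) {0..t}"
      by (rule fundamental_theorem_of_calculus)
        (use t c in \<open>auto intro!: derivative_eq_intros simp: has_real_derivative_iff_has_vector_derivative[symmetric]\<close>)
    have "integral {0..t} f \<le> integral {0..t} (\<lambda>s. M * exp (2 * c * s))"
    proof (rule integral_le)
      show "f integrable_on {0..t}" by (rule bounded_Borel_integrable(3)[OF f, where C=S]) (use b t in force)
    qed (use hi up' t in auto)
    also have "\<dots> \<le> M * exp (2 * c * t) / (2 * c)"
      using integral_unique[OF hi] M0 c by simp
    finally have "c * integral {0..t} f \<le> c * (M * exp (2 * c * t) / (2 * c))" using c by (intro mult_left_mono) auto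
    then have "f t \<le> \<alpha> + M * exp (2 * c * t) / 2" using le[OF t] c by simp
    then have "f t * exp (- 2 * c * t) \<le> (\<alpha> + M * exp (2 * c * t) / 2) * exp (- 2 * c * t)"
      by (rule mult_right_mono) simp
    also have "\<dots> = \<alpha> * exp (- 2 * c * t) + M / 2 * (exp (2 * c * t) * exp (- (2 * c * t)))" by (simp add: algebra_simps)
    also have "\<dots> = \<alpha> * exp (- 2 * c * t) + M / 2" by (simp only: exp_minus_inverse mult_1_right)
    finally show ?thesis .
  qed
  have \<alpha>0: "0 \<le> \<alpha>" using le[of 0] b[of 0] t by simp
  have "M \<le> \<alpha> + M / 2" unfolding M_def
  proof (rule cSUP_least)
    fix s assume s: "s \<in> {0..T}"
    have "\<alpha> * exp (- 2 * c * s) \<le> \<alpha> * 1" using \<alpha>0 s c by (intro mult_left_mono) auto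
    then show "f s * exp (- 2 * c * s) \<le> \<alpha> + (SUP t\<in>{0..T}. f t * exp (- 2 * c * t)) / 2"
      using *[of s] s unfolding M_def by auto
  qed (use t in auto)
  then have "M \<le> 2 * \<alpha>" by simp
  then have "M * exp (2 * c * t) \<le> 2 * \<alpha> * exp (2 * c * t)" by (rule mult_right_mono) simp
  then show ?thesis using up'[OF t] by linarith
qed

context regularized
begin

lemma g_sq: "(g t \<xi>)\<^sup>2 = a t \<xi> * e t \<xi>"
  by (simp add: g_def a_def e_def power2_eq_square)

text \<open>Positivity of \<open>q\<close> at a single time. It follows from a pressure bound that
  is itself still to be built up in time, so its consequences are stated time by time.\<close>

definition nonneg_at :: "real \<Rightarrow> bool" where "nonneg_at t \<longleftrightarrow> 0 \<le> t \<and> (\<forall>\<xi>. 0 < q t \<xi>)"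

lemma nonneg_atD:
  assumes "nonneg_at t"
  shows "0 \<le> t" "0 < q t \<xi>" "0 \<le> qb t \<xi>" "0 \<le> a t \<xi>" "0 \<le> e t \<xi>" "0 \<le> eu t \<xi>" "e t \<xi> \<le> eu t \<xi>"
    "2 * \<bar>g t \<xi>\<bar> \<le> a t \<xi> + e t \<xi>" "0 \<le> P t \<xi>"
proof -
  show t: "0 \<le> t" and q: "0 < q t \<xi>" for \<xi> using assms by (auto simp: nonneg_at_def)
  show qb: "0 \<le> qb t \<xi>" for \<xi> using q[of \<xi>] by (simp add: qb_def qbar_def)
  show "0 \<le> a t \<xi>" using qb[of \<xi>] by (simp add: a_def)
  show e: "0 \<le> e t \<xi>" for \<xi> using qb[of \<xi>] by (simp add: e_def)
  show "0 \<le> eu t \<xi>" using q[of \<xi>] by (simp add: eu_def)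
  show "e t \<xi> \<le> eu t \<xi>" using q[of \<xi>] by (auto simp: eu_def e_def qb_def qbar_def)
  have sq: "x * C\<^sup>2 + x * S\<^sup>2 - 2 * (x * (S * C)) = x * (S - C)\<^sup>2" for x S C :: real
    by (simp add: power2_diff algebra_simps)
  have "\<bar>g t \<xi>\<bar> = qb t \<xi> * (\<bar>sin (v t \<xi> / 2)\<bar> * \<bar>cos (v t \<xi> / 2)\<bar>)" using qb[of \<xi>] by (simp add: g_def abs_mult)
  then have "a t \<xi> + e t \<xi> - 2 * \<bar>g t \<xi>\<bar> = qb t \<xi> * (\<bar>sin (v t \<xi> / 2)\<bar> - \<bar>cos (v t \<xi> / 2)\<bar>)\<^sup>2"
    using sq[of "qb t \<xi>" "\<bar>cos (v t \<xi> / 2)\<bar>" "\<bar>sin (v t \<xi> / 2)\<bar>"] by (simp only: a_def e_def power2_abs)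
  moreover have "0 \<le> qb t \<xi> * (\<bar>sin (v t \<xi> / 2)\<bar> - \<bar>cos (v t \<xi> / 2)\<bar>)\<^sup>2" using qb[of \<xi>] by simp
  ultimately show "2 * \<bar>g t \<xi>\<bar> \<le> a t \<xi> + e t \<xi>" by linarith
  show "0 \<le> P t \<xi>" unfolding P_def using l_pos e k_le1(1,2)
    by (intro mult_nonneg_nonneg Bochner_Integration.integral_nonneg) auto
qed

lemma P_nn:
  assumes n: "nonneg_at t"
  shows "(\<integral>\<^sup>+\<eta>. ennreal (k t \<xi> \<eta> * e t \<eta>) \<partial>lborel) = ennreal (4 * l * P t \<xi>)"
proof -
  have "(\<integral>\<^sup>+\<eta>. ennreal (k t \<xi> \<eta> * e t \<eta>) \<partial>lborel) = ennreal (LBINT \<eta>. k t \<xi> \<eta> * e t \<eta>)"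
    by (rule nn_integral_eq_integral) (use ke_int[of t] nonneg_atD[OF n] k_le1(1,2) in auto)
  then show ?thesis using l_pos by (simp add: P_def)
qed

lemma kernel_total:
  assumes n: "nonneg_at t"
  shows "(\<integral>\<^sup>+\<xi>. ennreal (k t \<xi> \<eta> * a t \<xi>) \<partial>lborel) \<le> ennreal (2 * pi * l)"
proof -
  obtain Q where "\<And>s \<xi>. 0 \<le> s \<Longrightarrow> s \<le> t \<Longrightarrow> \<bar>a s \<xi>\<bar> \<le> Q" using state_bounded[OF nonneg_atD(1)[OF n]] by metis
  then have "\<bar>a t \<xi>\<bar> \<le> Q" for \<xi> using nonneg_atD(1)[OF n] by simp
  from kernel_integral_le[OF sec_meas(3) this nonneg_atD(4)[OF n] l_pos, of "Z t \<eta>"]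
  show ?thesis by (simp add: k_def Z_def abs_minus_commute)
qed

text \<open>Tonelli moves the weight through the kernel onto the energy. Extended nonnegative
  integrals are used because finiteness is not known at this stage.\<close>

lemma P_weighted:
  assumes n: "nonneg_at t" and w[measurable]: "w \<in> borel_measurable borel" and w0: "\<And>\<xi>. 0 \<le> w \<xi>"
  shows "(\<integral>\<^sup>+\<xi>. ennreal (P t \<xi> * w \<xi>) \<partial>lborel)
    = ennreal (1 / (4 * l)) * (\<integral>\<^sup>+\<eta>. ennreal (e t \<eta>) * (\<integral>\<^sup>+\<xi>. ennreal (k t \<xi> \<eta> * w \<xi>) \<partial>lborel) \<partial>lborel)"
proof -
  have [measurable]: "(\<lambda>(\<xi>, \<eta>). k t \<xi> \<eta>) \<in> borel_measurable (lborel \<Otimes>\<^sub>M lborel)"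
    unfolding k_def by measurable
  have "ennreal (P t \<xi> * w \<xi>) = ennreal (1 / (4 * l)) * (\<integral>\<^sup>+\<eta>. ennreal (w \<xi> * (k t \<xi> \<eta> * e t \<eta>)) \<partial>lborel)" for \<xi>
  proof -
    have "(\<integral>\<^sup>+\<eta>. ennreal (w \<xi> * (k t \<xi> \<eta> * e t \<eta>)) \<partial>lborel) = ennreal (w \<xi>) * ennreal (4 * l * P t \<xi>)"
      unfolding P_nn[OF n, symmetric] using w0 nonneg_atD[OF n] k_le1(1,2)
      by (subst nn_integral_cmult[symmetric]) (auto simp: ennreal_mult')
    also have "ennreal (1 / (4 * l)) * \<dots> = ennreal (1 / (4 * l) * (w \<xi> * (4 * l * P t \<xi>)))"
    proof -
      have 1: "0 \<le> 4 * l * P t \<xi>" "0 \<le> 1 / (4 * l)" using l_pos nonneg_atD(9)[OF n, of \<xi>] by auto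
      show ?thesis
        by (simp only: ennreal_mult[OF w0 1(1)] ennreal_mult[OF 1(2) mult_nonneg_nonneg[OF w0 1(1)]])
    qed
    also have "1 / (4 * l) * (w \<xi> * (4 * l * P t \<xi>)) = P t \<xi> * w \<xi>" using l_pos by simp
    finally show ?thesis by simp
  qed
  then have "(\<integral>\<^sup>+\<xi>. ennreal (P t \<xi> * w \<xi>) \<partial>lborel)
     = ennreal (1 / (4 * l)) * (\<integral>\<^sup>+\<xi>. (\<integral>\<^sup>+\<eta>. ennreal (w \<xi> * (k t \<xi> \<eta> * e t \<eta>)) \<partial>lborel) \<partial>lborel)"
    by (simp add: nn_integral_cmult)
  also have "(\<integral>\<^sup>+\<xi>. (\<integral>\<^sup>+\<eta>. ennreal (w \<xi> * (k t \<xi> \<eta> * e t \<eta>)) \<partial>lborel) \<partial>lborel)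
     = (\<integral>\<^sup>+\<eta>. (\<integral>\<^sup>+\<xi>. ennreal (w \<xi> * (k t \<xi> \<eta> * e t \<eta>)) \<partial>lborel) \<partial>lborel)"
    by (rule lborel_pair.Fubini'[symmetric]) measurable
  also have "\<dots> = (\<integral>\<^sup>+\<eta>. ennreal (e t \<eta>) * (\<integral>\<^sup>+\<xi>. ennreal (k t \<xi> \<eta> * w \<xi>) \<partial>lborel) \<partial>lborel)"
  proof (rule nn_integral_cong)
    fix \<eta>
    have "ennreal (w \<xi> * (k t \<xi> \<eta> * e t \<eta>)) = ennreal (e t \<eta>) * ennreal (k t \<xi> \<eta> * w \<xi>)" for \<xi>
      using nonneg_atD(5)[OF n, of \<eta>] w0 k_le1(1,2) by (simp add: ac_simps flip: ennreal_mult)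
    then show "(\<integral>\<^sup>+\<xi>. ennreal (w \<xi> * (k t \<xi> \<eta> * e t \<eta>)) \<partial>lborel) = ennreal (e t \<eta>) * (\<integral>\<^sup>+\<xi>. ennreal (k t \<xi> \<eta> * w \<xi>) \<partial>lborel)"
      by (simp add: nn_integral_cmult)
  qed
  finally show ?thesis .
qed

text \<open>Integrating P against y_xi integrates the kernel over positions; its mass 2 pi l cancels
  the l in the prefactor of P, so the bound is free of l.\<close>

lemma Pa_total:
  assumes n: "nonneg_at t"
  shows "(\<integral>\<^sup>+\<xi>. ennreal (P t \<xi> * a t \<xi>) \<partial>lborel) \<le> ennreal (pi / 2) * (\<integral>\<^sup>+\<eta>. ennreal (e t \<eta>) \<partial>lborel)"
proof -
  have "(\<integral>\<^sup>+\<xi>. ennreal (P t \<xi> * a t \<xi>) \<partial>lborel)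
    \<le> ennreal (1 / (4 * l)) * (\<integral>\<^sup>+\<eta>. ennreal (e t \<eta>) * ennreal (2 * pi * l) \<partial>lborel)"
    using nonneg_atD(4)[OF n] by (subst P_weighted[OF n]) (auto intro!: mult_left_mono nn_integral_mono kernel_total[OF n])
  also have "\<dots> = (ennreal (1 / (4 * l)) * ennreal (2 * pi * l)) * (\<integral>\<^sup>+\<eta>. ennreal (e t \<eta>) \<partial>lborel)"
    by (simp add: nn_integral_multc ac_simps)
  also have "ennreal (1 / (4 * l)) * ennreal (2 * pi * l) = ennreal (pi / 2)"
    using l_pos by (simp flip: ennreal_mult)
  finally show ?thesis .
qed

lemma Z_mono: assumes n: "nonneg_at t" and "\<xi> \<le> \<eta>" shows "Z t \<xi> \<le> Z t \<eta>"
proof -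
  obtain Q where "\<And>s \<xi>. 0 \<le> s \<Longrightarrow> s \<le> t \<Longrightarrow> \<bar>a s \<xi>\<bar> \<le> Q" using state_bounded[OF nonneg_atD(1)[OF n]] by metis
  then have Q: "\<bar>a t \<xi>\<bar> \<le> Q" for \<xi> using nonneg_atD(1)[OF n] by simp
  have "0 \<le> integral {\<xi>..\<eta>} (a t)"
    by (rule integral_nonneg) (use bounded_Borel_integrable(3)[OF sec_meas(3) Q] nonneg_atD[OF n] in auto)
  then show ?thesis using prim_diff[OF sec_meas(3) Q assms(2)] by (simp add: Z_def)
qed

lemma k_split: assumes n: "nonneg_at t" and "\<xi> \<le> \<zeta>" "\<zeta> \<le> \<eta>" shows "k t \<xi> \<eta> = k t \<xi> \<zeta> * k t \<zeta> \<eta>"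
  using Z_mono[OF n assms(2)] Z_mono[OF n assms(3)]
  by (simp add: k_def add_divide_distrib diff_divide_distrib flip: exp_add)

text \<open>Window version, usable while the total energy may still be infinite. For a source
  outside the window the kernel factors through the nearer endpoint, so all exterior energy is
  hidden in the boundary values of P at R and -R.\<close>

lemma Pa_local:
  assumes n: "nonneg_at t" and R: "0 \<le> R"
  shows "(\<integral>\<^sup>+\<xi>. ennreal (P t \<xi> * a t \<xi>) * indicator {- R..R} \<xi> \<partial>lborel)
    \<le> ennreal (pi / 2) * (\<integral>\<^sup>+\<eta>. ennreal (e t \<eta>) * indicator {- R..R} \<eta> \<partial>lborel) + ennreal (2 * pi * l * (P t R + P t (- R)))"
proof -
  let ?w = "\<lambda>\<xi>. a t \<xi> * indicator {- R..R} \<xi>"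
  have w: "?w \<in> borel_measurable borel" "\<And>\<xi>. 0 \<le> ?w \<xi>" using nonneg_atD(4)[OF n] by auto
  have inner: "(\<integral>\<^sup>+\<xi>. ennreal (k t \<xi> \<eta> * ?w \<xi>) \<partial>lborel)
     \<le> ennreal (2 * pi * l) * (indicator {- R..R} \<eta> + ennreal (k t R \<eta>) + ennreal (k t (- R) \<eta>))" for \<eta>
  proof -
    \<comment> \<open>\<open>\<zeta>\<close> is the endpoint separating the source from the window:
      its factor is constant in \<xi>, and the remaining kernel still has mass at most 2 pi
      l.\<close>
    have far: "(\<integral>\<^sup>+\<xi>. ennreal (k t \<xi> \<eta> * ?w \<xi>) \<partial>lborel) \<le> ennreal (2 * pi * l) * ennreal (k t \<zeta> \<eta>)"
      if "\<And>\<xi>. \<xi> \<in> {- R..R} \<Longrightarrow> k t \<xi> \<eta> = k t \<xi> \<zeta> * k t \<zeta> \<eta>" for \<zeta>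
    proof -
      have "(\<integral>\<^sup>+\<xi>. ennreal (k t \<xi> \<eta> * ?w \<xi>) \<partial>lborel) \<le> (\<integral>\<^sup>+\<xi>. ennreal (k t \<xi> \<zeta> * a t \<xi>) * ennreal (k t \<zeta> \<eta>) \<partial>lborel)"
        using that k_le1(1,2) nonneg_atD(4)[OF n]
        by (intro nn_integral_mono) (auto simp: indicator_def ac_simps simp flip: ennreal_mult intro!: ennreal_leI)
      also have "\<dots> = (\<integral>\<^sup>+\<xi>. ennreal (k t \<xi> \<zeta> * a t \<xi>) \<partial>lborel) * ennreal (k t \<zeta> \<eta>)"
        by (rule nn_integral_multc) measurable
      also have "\<dots> \<le> ennreal (2 * pi * l) * ennreal (k t \<zeta> \<eta>)" by (intro mult_right_mono kernel_total[OF n]) auto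
      finally show ?thesis .
    qed
    consider "\<eta> \<in> {- R..R}" | "\<eta> > R" | "\<eta> < - R" by force
    then show ?thesis
    proof cases
      case 1
      have "(\<integral>\<^sup>+\<xi>. ennreal (k t \<xi> \<eta> * ?w \<xi>) \<partial>lborel) \<le> (\<integral>\<^sup>+\<xi>. ennreal (k t \<xi> \<eta> * a t \<xi>) \<partial>lborel)"
        using k_le1(1,2) nonneg_atD(4)[OF n] by (intro nn_integral_mono ennreal_leI) (auto simp: indicator_def)
      also have "\<dots> \<le> ennreal (2 * pi * l) * 1" using kernel_total[OF n] by simp
      also have "\<dots> \<le> ennreal (2 * pi * l) * (indicator {- R..R} \<eta> + ennreal (k t R \<eta>) + ennreal (k t (- R) \<eta>))"
        using 1 by (intro mult_left_mono) (auto simp: add.assoc)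
      finally show ?thesis .
    next
      case 2
      have "(\<integral>\<^sup>+\<xi>. ennreal (k t \<xi> \<eta> * ?w \<xi>) \<partial>lborel) \<le> ennreal (2 * pi * l) * ennreal (k t R \<eta>)"
        by (rule far) (use k_split[OF n] 2 in auto)
      also have "\<dots> \<le> ennreal (2 * pi * l) * (indicator {- R..R} \<eta> + ennreal (k t R \<eta>) + ennreal (k t (- R) \<eta>))"
        using 2 by (intro mult_left_mono) (auto simp: indicator_def)
      finally show ?thesis .
    next
      case 3
      have "(\<integral>\<^sup>+\<xi>. ennreal (k t \<xi> \<eta> * ?w \<xi>) \<partial>lborel) \<le> ennreal (2 * pi * l) * ennreal (k t (- R) \<eta>)"
      proof (rule far)
        fix \<xi> assume "\<xi> \<in> {- R..R}"
        then have "k t \<eta> \<xi> = k t \<eta> (- R) * k t (- R) \<xi>" using 3 by (intro k_split[OF n]) auto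
        then show "k t \<xi> \<eta> = k t \<xi> (- R) * k t (- R) \<eta>"
          using k_le1(3)[of t \<xi> \<eta>] k_le1(3)[of t \<xi> "- R"] k_le1(3)[of t \<eta> "- R"] by simp
      qed
      also have "\<dots> \<le> ennreal (2 * pi * l) * (indicator {- R..R} \<eta> + ennreal (k t R \<eta>) + ennreal (k t (- R) \<eta>))"
        using 3 by (intro mult_left_mono) (auto simp: indicator_def)
      finally show ?thesis .
    qed
  qed
  have "(\<integral>\<^sup>+\<xi>. ennreal (P t \<xi> * a t \<xi>) * indicator {- R..R} \<xi> \<partial>lborel) = (\<integral>\<^sup>+\<xi>. ennreal (P t \<xi> * ?w \<xi>) \<partial>lborel)"
    by (intro nn_integral_cong) (auto simp: indicator_def)
  also have "\<dots> \<le> ennreal (1 / (4 * l)) * (\<integral>\<^sup>+\<eta>. ennreal (e t \<eta>) * (ennreal (2 * pi * l) * (indicator {- R..R} \<eta> +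
    ennreal (k t R \<eta>) + ennreal (k t (- R) \<eta>))) \<partial>lborel)"
    unfolding P_weighted[OF n w] by (intro mult_left_mono nn_integral_mono inner) auto
  also have "\<dots> = ennreal (1 / (4 * l)) * (\<integral>\<^sup>+\<eta>. ennreal (2 * pi * l) * (ennreal (e t \<eta>) * indicator {- R..R} \<eta> +
    ennreal (k t R \<eta> * e t \<eta>) + ennreal (k t (- R) \<eta> * e t \<eta>)) \<partial>lborel)"
  proof -
    have "ennreal (e t \<eta>) * (ennreal (2 * pi * l) * (indicator {- R..R} \<eta> + ennreal (k t R \<eta>) + ennreal (k t (- R) \<eta>)))
      = ennreal (2 * pi * l) * (ennreal (e t \<eta>) * indicator {- R..R} \<eta> + ennreal (k t R \<eta> * e t \<eta>) + ennreal (k t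
        (- R) \<eta> * e t \<eta>))" for \<eta>
      unfolding ennreal_mult[OF k_le1(2) nonneg_atD(5)[OF n]] distrib_left by (simp only: ac_simps)
    then show ?thesis by simp
  qed
  also have "\<dots> = (ennreal (1 / (4 * l)) * ennreal (2 * pi * l)) * ((\<integral>\<^sup>+\<eta>. ennreal (e t \<eta>) * indicator {- R..R} \<eta>
    \<partial>lborel) + ennreal (4 * l * P t R) + ennreal (4 * l * P t (- R)))"
    unfolding P_nn[OF n, symmetric] by (subst nn_integral_cmult, measurable) (simp add: nn_integral_add mult.assoc)
  also have "ennreal (1 / (4 * l)) * ennreal (2 * pi * l) = ennreal (pi / 2)"
    using l_pos by (simp flip: ennreal_mult)
  also have "ennreal (pi / 2) * ((\<integral>\<^sup>+\<eta>. ennreal (e t \<eta>) * indicator {- R..R} \<eta> \<partial>lborel) + ennreal (4 * l * P t R) +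
    ennreal (4 * l * P t (- R)))
     = ennreal (pi / 2) * (\<integral>\<^sup>+\<eta>. ennreal (e t \<eta>) * indicator {- R..R} \<eta> \<partial>lborel) + ennreal (pi / 2) * (ennreal (4 *
       l * P t R) + ennreal (4 * l * P t (- R)))"
    by (simp add: distrib_left add.assoc)
  also have "ennreal (pi / 2) * (ennreal (4 * l * P t R) + ennreal (4 * l * P t (- R)))
    = ennreal (2 * pi * l * (P t R + P t (- R)))"
    using l_pos nonneg_atD(9)[OF n, of R] nonneg_atD(9)[OF n, of "- R"]
    by (simp add: algebra_simps flip: ennreal_plus ennreal_mult)
  finally show ?thesis .
qed

lemma initial_values:
  assumes "\<xi> \<notin> N"
  shows "a 0 \<xi> = 1 / (1 + (w0 \<xi>)\<^sup>2)" "g 0 \<xi> = w0 \<xi> / (1 + (w0 \<xi>)\<^sup>2)" "eu 0 \<xi> = (w0 \<xi>)\<^sup>2 / (1 + (w0 \<xi>)\<^sup>2)"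
    "e 0 \<xi> = (w0 \<xi>)\<^sup>2 / (1 + (w0 \<xi>)\<^sup>2)" "v 0 \<xi> > - pi"
proof -
  have c: "cos (v 0 \<xi> / 2) = 1 / sqrt (1 + (w0 \<xi>)\<^sup>2)" and s: "sin (v 0 \<xi> / 2) = w0 \<xi> / sqrt (1 + (w0 \<xi>)\<^sup>2)"
    using v_init[OF assms] by (simp_all add: cos_arctan sin_arctan)
  show v: "v 0 \<xi> > - pi" using v_init[OF assms] arctan_bounded[of "w0 \<xi>"] by simp
  have qb: "qb 0 \<xi> = 1" using v q_init by (simp add: qb_def qbar_def)
  have sq: "(sqrt (1 + (w0 \<xi>)\<^sup>2))\<^sup>2 = 1 + (w0 \<xi>)\<^sup>2" using w_pos[of \<xi>] by simp
  show "a 0 \<xi> = 1 / (1 + (w0 \<xi>)\<^sup>2)" unfolding a_def qb c power_divide sq by simp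
  show "g 0 \<xi> = w0 \<xi> / (1 + (w0 \<xi>)\<^sup>2)" unfolding g_def qb c s using sq by (simp add: power2_eq_square)
  show "eu 0 \<xi> = (w0 \<xi>)\<^sup>2 / (1 + (w0 \<xi>)\<^sup>2)" unfolding eu_def q_init s power_divide sq by simp
  show "e 0 \<xi> = (w0 \<xi>)\<^sup>2 / (1 + (w0 \<xi>)\<^sup>2)" unfolding e_def qb s power_divide sq by simp
qed

lemma AE_N: "AE \<xi> in lborel. \<xi> \<notin> N" using N_null by (rule AE_not_in)

lemma eu0_total: "(\<integral>\<^sup>+\<xi>. ennreal (eu 0 \<xi>) \<partial>lborel) = ennreal e_total"
proof -
  have "(\<integral>\<^sup>+\<xi>. ennreal (eu 0 \<xi>) \<partial>lborel) = (\<integral>\<^sup>+\<xi>. ennreal ((w0 \<xi>)\<^sup>2 / (1 + (w0 \<xi>)\<^sup>2)) \<partial>lborel)"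
    by (rule nn_integral_cong_AE) (use AE_N in \<open>eventually_elim, simp add: initial_values\<close>)
  also have "\<dots> = ennreal e_total" unfolding e_total_def
    by (rule nn_integral_eq_integral[OF e0_int]) simp
  finally show ?thesis .
qed

lemma g0_total: "(\<integral>\<^sup>+\<xi>. ennreal \<bar>g 0 \<xi>\<bar> \<partial>lborel) = ennreal g_total"
proof -
  have "(\<integral>\<^sup>+\<xi>. ennreal \<bar>g 0 \<xi>\<bar> \<partial>lborel) = (\<integral>\<^sup>+\<xi>. ennreal \<bar>w0 \<xi> / (1 + (w0 \<xi>)\<^sup>2)\<bar> \<partial>lborel)"
    by (rule nn_integral_cong_AE) (use AE_N in \<open>eventually_elim, simp add: initial_values\<close>)
  also have "\<dots> = ennreal g_total" unfolding g_total_def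
    by (rule nn_integral_eq_integral[OF integrable_abs[OF g0_int]]) simp
  finally show ?thesis .
qed

definition P_bound :: "real \<Rightarrow> real \<Rightarrow> bool" where
  "P_bound T B \<longleftrightarrow> 0 \<le> B \<and> (\<forall>s\<in>{0..T}. \<forall>\<xi>. \<bar>P s \<xi>\<bar> \<le> B)"

text \<open>Integrating factor: q is the exponential of the integral of (1 / 2 - P) sin v, cut off
  at death. A pressure bound thereby yields positivity.\<close>

lemma q_exp_bounds:
  assumes PB: "P_bound T B" and t: "0 \<le> t" "t \<le> T"
  shows "exp (- (1 / 2 + B) * t) \<le> q t \<xi>" "q t \<xi> \<le> exp ((1 / 2 + B) * t)" "nonneg_at t"
proof -
  have *: "exp (- (1 / 2 + B) * t) \<le> q t \<xi> \<and> q t \<xi> \<le> exp ((1 / 2 + B) * t)" for \<xi>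
  proof -
    define b where "b s = (if v s \<xi> > - pi then (1 / 2 - P s \<xi>) * (2 * sin (v s \<xi> / 2) * cos (v s \<xi> / 2)) else 0)" for s
    have bm: "b \<in> borel_measurable borel" unfolding b_def by measurable
    have bb: "\<bar>b s\<bar> \<le> 1 / 2 + B" if "0 \<le> s" "s \<le> t" for s
    proof -
      have "\<bar>P s \<xi>\<bar> \<le> B" using PB that t by (auto simp: P_bound_def)
      then have "\<bar>1 / 2 - P s \<xi>\<bar> \<le> 1 / 2 + B" by linarith
      moreover have "\<bar>2 * sin (v s \<xi> / 2) * cos (v s \<xi> / 2)\<bar> \<le> 1"
      proof -
        have "sin (v s \<xi>) = 2 * sin (v s \<xi> / 2) * cos (v s \<xi> / 2)" using sin_double[of "v s \<xi> / 2"] by simp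
        then show ?thesis using abs_sin_le_one[of "v s \<xi>"] by (simp only:)
      qed
      ultimately have "\<bar>1 / 2 - P s \<xi>\<bar> * \<bar>2 * sin (v s \<xi> / 2) * cos (v s \<xi> / 2)\<bar> \<le> (1 / 2 + B) * 1"
        using PB by (intro mult_mono) (auto simp: P_bound_def)
      then show ?thesis using PB by (auto simp: b_def abs_mult P_bound_def)
    qed
    note bi = bounded_Borel_integrable[OF bm bb]
    have AC: "AC_on 0 t (\<lambda>t. - integral {0..t} b) (\<lambda>s. - b s)"
      using AC_on_cmult[of 0 t "\<lambda>t. integral {0..t} b" b "-1"] bi(2)[of 0 t] by (simp add: AC_on_def)
    have AC2: "AC_on 0 t (\<lambda>t. exp (- integral {0..t} b)) (\<lambda>s. exp (- integral {0..s} b) * - b s)"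
      by (rule AC_on_comp[OF AC, where G=exp and G'=exp]) (auto intro!: derivative_eq_intros continuous_intros)
    have "AC_on 0 t (\<lambda>t. q t \<xi> * exp (- integral {0..t} b)) (\<lambda>s. 0)"
      by (rule AC_on_cong[OF AC_on_mult[OF q_ode[OF t(1)] AC2]]) (auto simp: rhs_eq b_def)
    from AC_onD(3)[OF this, of t] t have "q t \<xi> * exp (- integral {0..t} b) = 1" by (simp add: q_init)
    then have q: "q t \<xi> = exp (integral {0..t} b)" by (simp add: exp_minus field_simps)
    have "norm (integral {0..t} b) \<le> integral {0..t} (\<lambda>_. 1 / 2 + B)"
      by (rule Henstock_Kurzweil_Integration.integral_norm_bound_integral) (use bi(3)[of 0 t] bb in auto)
    then have "\<bar>integral {0..t} b\<bar> \<le> (1 / 2 + B) * t" using t by (simp add: mult.commute)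
    then have "- ((1 / 2 + B) * t) \<le> integral {0..t} b" "integral {0..t} b \<le> (1 / 2 + B) * t" by linarith+
    then show ?thesis unfolding q mult_minus_left exp_le_cancel_iff by blast
  qed
  then show "exp (- (1 / 2 + B) * t) \<le> q t \<xi>" "q t \<xi> \<le> exp ((1 / 2 + B) * t)" by blast+
  show "nonneg_at t" using * t unfolding nonneg_at_def by (meson exp_gt_zero less_le_trans)
qed

lemma P_bound_mono: "P_bound T B \<Longrightarrow> T' \<le> T \<Longrightarrow> P_bound T' B"
  by (auto simp: P_bound_def)

lemma Icc_time_meas:
  fixes f :: "real \<Rightarrow> real \<Rightarrow> real"
  assumes "jointly_Borel f"
  shows "(\<lambda>t. LBINT \<xi>:{c..d}. f t \<xi>) \<in> borel_measurable (borel :: real measure)"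
  using measurable_compose[OF _ LBINT_interval_measurable(1)[OF assms, of c], of "\<lambda>t. (t, d)" borel] by simp

text \<open>On [-R, R] all integrals are finite, and -2 P g \<le> P (a + e) together with
  \<open>Pa_local\<close> closes a Gronwall inequality whose constants do not involve R. The bound
  depends on l and B; its role is to make the energy finite.\<close>

lemma energy_finite:
  assumes PB: "P_bound T B" and T: "0 \<le> T"
  obtains K where "0 \<le> K" "\<And>t. 0 \<le> t \<Longrightarrow> t \<le> T \<Longrightarrow> (\<integral>\<^sup>+\<xi>. ennreal (eu t \<xi>) \<partial>lborel) \<le> ennreal K"
proof -
  have B0: "0 \<le> B" and PB': "\<And>s \<xi>. 0 \<le> s \<Longrightarrow> s \<le> T \<Longrightarrow> \<bar>P s \<xi>\<bar> \<le> B" using PB by (auto simp: P_bound_def)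
  have n: "nonneg_at t" if "0 \<le> t" "t \<le> T" for t using q_exp_bounds[OF PB that] by blast
  obtain Q where Qs: "\<And>t \<xi>. 0 \<le> t \<Longrightarrow> t \<le> T \<Longrightarrow>
    \<bar>qb t \<xi>\<bar> \<le> Q \<and> \<bar>q t \<xi>\<bar> \<le> Q \<and> \<bar>a t \<xi>\<bar> \<le> Q \<and> \<bar>g t \<xi>\<bar> \<le> Q \<and> \<bar>e t \<xi>\<bar> \<le> Q \<and> \<bar>eu t \<xi>\<bar> \<le> Q"
    by (rule state_bounded[OF T]) (rule that)
  have Q: "\<bar>a t \<xi>\<bar> \<le> Q" "\<bar>g t \<xi>\<bar> \<le> Q" "\<bar>e t \<xi>\<bar> \<le> Q" "\<bar>eu t \<xi>\<bar> \<le> Q" if "0 \<le> t" "t \<le> T" for t \<xi>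
    using Qs[OF that, of \<xi>] by auto
  \<comment> \<open>B comes from P e \<le> B e and 2 from pi / 2 \<le> 2 in the local estimate; the
    second term of \<open>\<alpha>\<close> is the boundary contribution 4 pi l B accumulated up to
    time T.\<close>
  define c where "c = B + 2"
  define \<alpha> where "\<alpha> = e_total + 4 * pi * l * B * T"
  define K where "K = 2 * \<alpha> * exp (2 * c * T)"
  have \<alpha>0: "0 \<le> \<alpha>" using e_total_nonneg B0 T l_pos by (simp add: \<alpha>_def)
  have K0: "0 \<le> K" using \<alpha>0 by (simp add: K_def)
  have main: "integral {- R..R} (eu t) \<le> K" if R: "0 \<le> R" and t: "0 \<le> t" "t \<le> T" for R t
  proof -
    define f where "f t = (LBINT \<xi>:{- R..R}. eu t \<xi>)" for t
    have fm: "f \<in> borel_measurable borel" unfolding f_def by (rule Icc_time_meas[OF meas(5)])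
    have f: "f t = integral {- R..R} (eu t)" if "0 \<le> t" "t \<le> T" for t
      unfolding f_def by (rule bounded_Borel_integrable(4)[where C=Q]) (use Q(4) that in auto)
    have eui: "eu t integrable_on {- R..R}" "e t integrable_on {- R..R}" if "0 \<le> t" "t \<le> T" for t
      by (rule bounded_Borel_integrable(3)[OF sec_meas(6)], rule Q(4)[OF that])
        (rule bounded_Borel_integrable(3)[OF sec_meas(5)], rule Q(3)[OF that])
    have fb: "0 \<le> f t \<and> f t \<le> Q * (2 * R)" if "0 \<le> t" "t \<le> T" for t
    proof
      show "0 \<le> f t" unfolding f[OF that]
        by (rule integral_nonneg) (use eui that nonneg_atD(6)[OF n[OF that]] in auto)
      have "integral {- R..R} (eu t) \<le> integral {- R..R} (\<lambda>_. Q)"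
        by (rule integral_le) (use eui that Q(4) in \<open>auto intro: abs_le_D1\<close>)
      then show "f t \<le> Q * (2 * R)" unfolding f[OF that] using R by (simp add: mult.commute)
    qed
    have eu0: "f 0 \<le> e_total"
    proof -
      have "ennreal (f 0) = (\<integral>\<^sup>+x. ennreal (eu 0 x) * indicator {- R..R} x \<partial>lborel)"
        unfolding f[OF order_refl T]
        by (rule nn_integral_Icc[symmetric, where C=Q]) (use Q(4) T nonneg_atD(6)[OF n] in auto)
      also have "\<dots> \<le> (\<integral>\<^sup>+x. ennreal (eu 0 x) \<partial>lborel)" by (intro nn_integral_mono) (auto simp: indicator_def)
      finally show ?thesis unfolding eu0_total using e_total_nonneg by (simp add: ennreal_le_iff)
    qed
    have PaB: "\<bar>B * e s \<xi> + P s \<xi> * a s \<xi>\<bar> \<le> 2 * (B * Q)" if "0 \<le> s" "s \<le> T" for s \<xi>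
    proof -
      have "\<bar>B * e s \<xi>\<bar> \<le> B * Q" using Q(3)[OF that, of \<xi>] B0 by (simp add: abs_mult mult_left_mono)
      moreover have "\<bar>P s \<xi> * a s \<xi>\<bar> \<le> B * Q" unfolding abs_mult
        by (rule mult_mono) (use Q(1)[OF that] PB'[OF that] B0 in auto)
      ultimately show ?thesis by linarith
    qed
    have jm: "(\<lambda>(s, \<xi>). B * e s \<xi> + P s \<xi> * a s \<xi>) \<in> borel_measurable (borel \<Otimes>\<^sub>M borel)"
      using meas(2,4) P_meas by (simp add: split_beta')
    have sm: "(\<lambda>\<xi>. B * e s \<xi> + P s \<xi> * a s \<xi>) \<in> borel_measurable borel"
      "(\<lambda>s. B * e s \<xi> + P s \<xi> * a s \<xi>) \<in> borel_measurable borel" for s \<xi>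
      by measurable
    have pt: "eu t \<xi> \<le> eu 0 \<xi> + integral {0..t} (\<lambda>s. B * e s \<xi> + P s \<xi> * a s \<xi>)" if t: "0 \<le> t" "t \<le> T" for t \<xi>
    proof -
      have "integral {0..t} (\<lambda>s. - 2 * P s \<xi> * g s \<xi>) \<le> integral {0..t} (\<lambda>s. B * e s \<xi> + P s \<xi> * a s \<xi>)"
      proof (rule integral_le)
        show "(\<lambda>s. - 2 * P s \<xi> * g s \<xi>) integrable_on {0..t}" by (rule AC_onD(2)[OF eu_AC[OF t(1)]])
        show "(\<lambda>s. B * e s \<xi> + P s \<xi> * a s \<xi>) integrable_on {0..t}"
          by (rule bounded_Borel_integrable(3)[OF sm(2), where C="2 * (B * Q)"]) (use PaB t in auto)
        fix s assume s: "s \<in> {0..t}"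
        then have ns: "nonneg_at s" using n t by auto
        have "- 2 * P s \<xi> * g s \<xi> = P s \<xi> * (2 * - g s \<xi>)" by simp
        also have "\<dots> \<le> P s \<xi> * (2 * \<bar>g s \<xi>\<bar>)"
          by (rule mult_left_mono[OF _ nonneg_atD(9)[OF ns]]) linarith
        also have "\<dots> \<le> P s \<xi> * (a s \<xi> + e s \<xi>)" using nonneg_atD(8,9)[OF ns] by (intro mult_left_mono)
        also have "\<dots> \<le> B * e s \<xi> + P s \<xi> * a s \<xi>"
          using mult_right_mono[of "P s \<xi>" B "e s \<xi>"] PB'[of s \<xi>] nonneg_atD(5)[OF ns, of \<xi>] s t
            by (auto simp: algebra_simps)
        finally show "- 2 * P s \<xi> * g s \<xi> \<le> B * e s \<xi> + P s \<xi> * a s \<xi>" .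
      qed
      then show ?thesis using AC_onD(3)[OF eu_AC[OF t(1)], of t] t by auto
    qed
    have le: "f t \<le> \<alpha> + c * integral {0..t} f" if t: "0 \<le> t" "t \<le> T" for t
    proof -
      have Ii: "(\<lambda>\<xi>. integral {0..t} (\<lambda>s. B * e s \<xi> + P s \<xi> * a s \<xi>)) integrable_on {- R..R}"
      proof -
        have eq: "integral {0..t} (\<lambda>s. B * e s \<xi> + P s \<xi> * a s \<xi>) = (LBINT s:{0..t}. B * e s \<xi> + P s \<xi> * a s \<xi>)" for \<xi>
          by (rule bounded_Borel_integrable(4)[OF sm(2), where C="2 * (B * Q)", symmetric]) (use PaB t in auto)
        have bd: "\<bar>integral {0..t} (\<lambda>s. B * e s \<xi> + P s \<xi> * a s \<xi>)\<bar> \<le> 2 * (B * Q) * t" for \<xi>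
        proof -
          have "norm (integral {0..t} (\<lambda>s. B * e s \<xi> + P s \<xi> * a s \<xi>)) \<le> integral {0..t} (\<lambda>_. 2 * (B * Q))"
            by (rule Henstock_Kurzweil_Integration.integral_norm_bound_integral)
              (use PaB t bounded_Borel_integrable(3)[OF sm(2), where C="2 * (B * Q)"] in auto)
          moreover have "integral {0..t} (\<lambda>_. 2 * (B * Q)) = 2 * (B * Q) * t" using t by (simp add: ac_simps)
          ultimately show ?thesis by (simp only: real_norm_def)
        qed
        have "(\<lambda>(\<xi>, s). B * e s \<xi> + P s \<xi> * a s \<xi>) \<in> borel_measurable (borel \<Otimes>\<^sub>M borel)"
          using measurable_compose[OF _ jm, of "\<lambda>(\<xi>, s). (s, \<xi>)" "borel \<Otimes>\<^sub>M borel"] by (simp add: split_beta')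
        from Icc_time_meas[OF this, of 0 t]
        show ?thesis unfolding eq[symmetric] by (rule bounded_Borel_integrable(3)[OF _ bd])
      qed
      have "f t \<le> integral {- R..R} (\<lambda>\<xi>. eu 0 \<xi> + integral {0..t} (\<lambda>s. B * e s \<xi> + P s \<xi> * a s \<xi>))"
        unfolding f[OF t] by (rule integral_le) (use eui T t pt Ii in \<open>auto intro!: integrable_add\<close>)
      also have "\<dots> = f 0 + integral {- R..R} (\<lambda>\<xi>. integral {0..t} (\<lambda>s. B * e s \<xi> + P s \<xi> * a s \<xi>))"
        using f[OF order_refl T] eui(1)[OF order_refl T] Ii by (simp add: Henstock_Kurzweil_Integration.integral_add)
      also have "integral {- R..R} (\<lambda>\<xi>. integral {0..t} (\<lambda>s. B * e s \<xi> + P s \<xi> * a s \<xi>))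
        = integral {0..t} (\<lambda>s. integral {- R..R} (\<lambda>\<xi>. B * e s \<xi> + P s \<xi> * a s \<xi>))"
        by (rule interval_swap[OF jm, where C="2 * (B * Q)", symmetric]) (use PaB t in auto)
      also have "\<dots> \<le> integral {0..t} (\<lambda>s. c * f s + 4 * pi * l * B)"
      proof (rule integral_le)
        have eq: "integral {- R..R} (\<lambda>\<xi>. B * e s \<xi> + P s \<xi> * a s \<xi>)
          = (LBINT \<xi>:{- R..R}. B * e s \<xi> + P s \<xi> * a s \<xi>)" if "s \<in> {0..t}" for s
          by (rule bounded_Borel_integrable(4)[OF sm(1), where C="2 * (B * Q)", symmetric]) (use PaB t that in auto)
        have bd: "\<bar>LBINT \<xi>:{- R..R}. B * e s \<xi> + P s \<xi> * a s \<xi>\<bar> \<le> 2 * (B * Q) * (2 * R)" if "0 \<le> s" "s \<le> t" for s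
        proof -
          have "norm (integral {- R..R} (\<lambda>\<xi>. B * e s \<xi> + P s \<xi> * a s \<xi>)) \<le> integral {- R..R} (\<lambda>_. 2 * (B * Q))"
            by (rule Henstock_Kurzweil_Integration.integral_norm_bound_integral)
              (use PaB t that bounded_Borel_integrable(3)[OF sm(1), where C="2 * (B * Q)"] in auto)
          moreover have "integral {- R..R} (\<lambda>_. 2 * (B * Q)) = 2 * (B * Q) * (2 * R)" using R by (simp add: ac_simps)
          moreover have "s \<in> {0..t}" using that by simp
          ultimately show ?thesis unfolding eq[OF \<open>s \<in> {0..t}\<close>, symmetric] by (simp only: real_norm_def)
        qed
        have "(\<lambda>s. LBINT \<xi>:{- R..R}. B * e s \<xi> + P s \<xi> * a s \<xi>) integrable_on {0..t}"
          by (rule bounded_Borel_integrable(3)[OF Icc_time_meas[OF jm] bd])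
        then show "(\<lambda>s. integral {- R..R} (\<lambda>\<xi>. B * e s \<xi> + P s \<xi> * a s \<xi>)) integrable_on {0..t}"
          by (rule integrable_eq) (use eq in auto)
        show "(\<lambda>s. c * f s + 4 * pi * l * B) integrable_on {0..t}"
          by (intro integrable_add integrable_on_mult_right bounded_Borel_integrable(3)[OF fm, where C="Q * (2 * R)"])
            (use fb t in \<open>auto simp: abs_of_nonneg\<close>)
        fix s assume s: "s \<in> {0..t}"
        then have s0: "0 \<le> s" "s \<le> T" using t by auto
        note ns = n[OF s0]
        have Pai: "(\<lambda>\<xi>. P s \<xi> * a s \<xi>) integrable_on {- R..R}" and Pab: "\<bar>P s \<xi> * a s \<xi>\<bar> \<le> B * Q" for \<xi>
        proof -
          show b: "\<bar>P s \<xi> * a s \<xi>\<bar> \<le> B * Q" for \<xi> unfolding abs_mult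
            by (rule mult_mono) (use Q(1)[OF s0] PB'[OF s0] B0 in auto)
          show "(\<lambda>\<xi>. P s \<xi> * a s \<xi>) integrable_on {- R..R}"
            by (rule bounded_Borel_integrable(3)[where C="B * Q"]) (use b in auto)
        qed
        have ele: "integral {- R..R} (e s) \<le> f s" unfolding f[OF s0]
          by (rule integral_le) (use eui s0 nonneg_atD(7)[OF ns] in auto)
        have e0: "0 \<le> integral {- R..R} (e s)" by (rule integral_nonneg) (use eui s0 nonneg_atD(5)[OF ns] in auto)
        have "ennreal (integral {- R..R} (\<lambda>\<xi>. P s \<xi> * a s \<xi>))
          = (\<integral>\<^sup>+\<xi>. ennreal (P s \<xi> * a s \<xi>) * indicator {- R..R} \<xi> \<partial>lborel)"
          by (rule nn_integral_Icc[symmetric, where C="B * Q"]) (use Pab nonneg_atD(4,9)[OF ns] in auto)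
        also have "\<dots> \<le> ennreal (pi / 2) * (\<integral>\<^sup>+\<eta>. ennreal (e s \<eta>) * indicator {- R..R} \<eta> \<partial>lborel) + ennreal (2 * pi
          * l * (P s R + P s (- R)))"
          by (rule Pa_local[OF ns R])
        also have "(\<integral>\<^sup>+\<eta>. ennreal (e s \<eta>) * indicator {- R..R} \<eta> \<partial>lborel) = ennreal (integral {- R..R} (e s))"
          by (rule nn_integral_Icc[where C=Q]) (use Q(3)[OF s0] nonneg_atD(5)[OF ns] in auto)
        also have "ennreal (pi / 2) * ennreal (integral {- R..R} (e s)) + ennreal (2 * pi * l * (P s R + P s (- R)))
          = ennreal (pi / 2 * integral {- R..R} (e s) + 2 * pi * l * (P s R + P s (- R)))"
        proof -
          have p: "0 \<le> pi / 2" by simp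
          have 1: "0 \<le> pi / 2 * integral {- R..R} (e s)" "0 \<le> 2 * pi * l * (P s R + P s (- R))"
            using e0 l_pos nonneg_atD(9)[OF ns] by auto
          show ?thesis unfolding ennreal_plus[OF 1] ennreal_mult[OF p e0] ..
        qed
        finally have "integral {- R..R} (\<lambda>\<xi>. P s \<xi> * a s \<xi>)
          \<le> pi / 2 * integral {- R..R} (e s) + 2 * pi * l * (P s R + P s (- R))"
          using e0 l_pos nonneg_atD(9)[OF ns] by (subst (asm) ennreal_le_iff) auto
        moreover have "pi / 2 * integral {- R..R} (e s) \<le> 2 * f s"
          by (rule mult_mono) (use ele e0 pi_less_4 in auto)
        moreover have "2 * pi * l * (P s R + P s (- R)) \<le> 2 * pi * l * (B + B)"
          using PB'[OF s0, of R] PB'[OF s0, of "- R"] l_pos by (intro mult_left_mono add_mono) auto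
        moreover have "B * integral {- R..R} (e s) \<le> B * f s" using ele B0 by (rule mult_left_mono)
        moreover have "integral {- R..R} (\<lambda>\<xi>. B * e s \<xi> + P s \<xi> * a s \<xi>)
          = B * integral {- R..R} (e s) + integral {- R..R} (\<lambda>\<xi>. P s \<xi> * a s \<xi>)"
          using eui(2)[OF s0] Pai by (simp add: Henstock_Kurzweil_Integration.integral_add integrable_on_mult_right)
        ultimately show "integral {- R..R} (\<lambda>\<xi>. B * e s \<xi> + P s \<xi> * a s \<xi>) \<le> c * f s + 4 * pi * l * B"
          unfolding c_def by (simp add: algebra_simps)
      qed
      also have "\<dots> = c * integral {0..t} f + 4 * pi * l * B * t"
      proof -
        have fi: "f integrable_on {0..t}"
          by (rule bounded_Borel_integrable(3)[OF fm, where C="Q * (2 * R)"]) (use fb t in \<open>auto simp: abs_of_nonneg\<close>)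
        have "integral {0..t} (\<lambda>s. c * f s + 4 * pi * l * B)
          = integral {0..t} (\<lambda>s. c * f s) + integral {0..t} (\<lambda>_. 4 * pi * l * B)"
          by (rule Henstock_Kurzweil_Integration.integral_add) (use fi in \<open>auto intro: integrable_on_mult_right\<close>)
        then show ?thesis using t by simp
      qed
      also have "4 * pi * l * B * t \<le> 4 * pi * l * B * T" using t l_pos B0 by (intro mult_left_mono) auto
      finally show ?thesis using eu0 unfolding \<alpha>_def by simp
    qed
    have "f t \<le> 2 * \<alpha> * exp (2 * c * t)"
      by (rule gronwall[OF fm fb _ le t]) (use B0 in \<open>auto simp: c_def\<close>)
    also have "\<dots> \<le> K" unfolding K_def using t \<alpha>0 B0 by (intro mult_left_mono) (auto simp: c_def)
    finally show ?thesis unfolding f[OF t] .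
  qed
  have "(\<integral>\<^sup>+\<xi>. ennreal (eu t \<xi>) \<partial>lborel) \<le> ennreal K" if t: "0 \<le> t" "t \<le> T" for t
  proof (rule nn_integral_le_intervals)
    fix m :: nat
    have "(\<integral>\<^sup>+x. ennreal (eu t x) * indicator {- real m..real m} x \<partial>lborel) = ennreal (integral {- real m..real m} (eu t))"
      by (rule nn_integral_Icc[where C=Q]) (use Q(4)[OF t] nonneg_atD(6)[OF n[OF t]] in auto)
    then show "(\<integral>\<^sup>+x. ennreal (eu t x) * indicator {- real m..real m} x \<partial>lborel) \<le> ennreal K"
      using main[OF _ t, of m] by (simp add: ennreal_leI)
  qed measurable
  with K0 that show thesis by blast
qed

end

section \<open>Bounding the pressure by continuation in time\<close>

context regularized
begin

text \<open>Off A the energy density is at most (Q / m) a, so the kernel mass bounds its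
  contribution; on A the measure of A does. The sign of \<open>a\<close> on A is unknown at this
  stage, so the kernel is compared with that of \<open>\<alpha>\<close>, the part of a off A, which
  is nonnegative; the exponents differ by at most Q K / l.\<close>

lemma P_bound_of_lower:
  assumes t: "0 \<le> t" and Q: "\<And>\<xi>. \<bar>a t \<xi>\<bar> \<le> Q" "\<And>\<xi>. \<bar>e t \<xi>\<bar> \<le> Q" and m: "0 < m"
    and A[measurable]: "A \<in> sets borel" and fin: "emeasure lborel A \<le> ennreal K" and K: "0 \<le> K"
    and low: "\<And>\<xi>. \<xi> \<notin> A \<Longrightarrow> m \<le> a t \<xi>"
  shows "\<bar>P t \<xi>\<bar> \<le> 1 / (4 * l) * (Q * K + Q / m * exp (Q * K / l) * (2 * pi * l))"
proof -
  have Q0: "0 \<le> Q" using Q(1)[of 0] by linarith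
  define \<alpha> where "\<alpha> x = indicator (- A) x * a t x" for x
  have \<alpha>m[measurable]: "\<alpha> \<in> borel_measurable borel" unfolding \<alpha>_def by measurable
  have \<alpha>b: "\<bar>\<alpha> x\<bar> \<le> Q" for x using Q(1)[of x] Q0 by (auto simp: \<alpha>_def indicator_def)
  have \<alpha>0: "0 \<le> \<alpha> x" for x using low[of x] m by (auto simp: \<alpha>_def indicator_def)
  have fm: "emeasure lborel A < \<infinity>" using fin by (simp add: order.strict_trans1)
  have Zdiff: "\<bar>prim \<alpha> \<eta> - prim \<alpha> \<xi>\<bar> \<le> \<bar>Z t \<eta> - Z t \<xi>\<bar> + Q * K" for \<xi> \<eta>
  proof -
    have *: "\<bar>prim \<alpha> \<eta> - prim \<alpha> \<xi>\<bar> \<le> \<bar>Z t \<eta> - Z t \<xi>\<bar> + Q * K" if "\<xi> \<le> \<eta>" for \<xi> \<eta>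
    proof -
      have sm: "(\<lambda>x. a t x - \<alpha> x) \<in> borel_measurable borel" by measurable
      have sb: "\<bar>a t x - \<alpha> x\<bar> \<le> Q" for x using Q(1)[of x] Q0 by (auto simp: \<alpha>_def indicator_def)
      have "(Z t \<eta> - Z t \<xi>) - (prim \<alpha> \<eta> - prim \<alpha> \<xi>) = integral {\<xi>..\<eta>} (a t) - integral {\<xi>..\<eta>} \<alpha>"
        unfolding Z_def prim_diff[OF sec_meas(3) Q(1) that] prim_diff[OF \<alpha>m \<alpha>b that] ..
      also have "\<dots> = integral {\<xi>..\<eta>} (\<lambda>x. a t x - \<alpha> x)"
        by (rule integral_diff[symmetric]) (rule bounded_Borel_integrable(3)[OF sec_meas(3) Q(1)]
          bounded_Borel_integrable(3)[OF \<alpha>m \<alpha>b])+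
      also have "\<dots> = (LBINT x:{\<xi>..\<eta>}. a t x - \<alpha> x)" by (rule bounded_Borel_integrable(4)[OF sm sb, symmetric])
      finally have eq: "(Z t \<eta> - Z t \<xi>) - (prim \<alpha> \<eta> - prim \<alpha> \<xi>) = (LBINT x:{\<xi>..\<eta>}. a t x - \<alpha> x)" .
      have "\<bar>LBINT x:{\<xi>..\<eta>}. a t x - \<alpha> x\<bar> \<le> (LBINT x. \<bar>indicator {\<xi>..\<eta>} x *\<^sub>R (a t x - \<alpha> x)\<bar>)"
        unfolding set_lebesgue_integral_def by (rule integral_abs_bound)
      also have "\<dots> \<le> (LBINT x. indicator A x *\<^sub>R Q)"
      proof (rule integral_mono)
        show "integrable lborel (\<lambda>x. \<bar>indicator {\<xi>..\<eta>} x *\<^sub>R (a t x - \<alpha> x)\<bar>)"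
          using bounded_Borel_integrable(1)[OF sm sb, of \<xi> \<eta>] unfolding set_integrable_def by (rule integrable_abs)
        show "integrable lborel (\<lambda>x. indicat_real A x *\<^sub>R Q)" using fm by simp
        show "\<bar>indicator {\<xi>..\<eta>} x *\<^sub>R (a t x - \<alpha> x)\<bar> \<le> indicat_real A x *\<^sub>R Q" for x
          using Q(1)[of x] Q0 by (auto simp: \<alpha>_def indicator_def)
      qed
      also have "\<dots> = measure lborel A * Q" using fm by simp
      also have "\<dots> \<le> K * Q"
        using fin K Q0 by (intro mult_right_mono) (simp_all add: measure_def enn2real_leI)
      finally show ?thesis unfolding eq[symmetric] by (simp add: mult.commute)
    qed
    show ?thesis using *[of \<xi> \<eta>] *[of \<eta> \<xi>] by (cases "\<xi> \<le> \<eta>") (auto simp: abs_minus_commute)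
  qed
  have kb: "k t \<xi> \<eta> \<le> exp (Q * K / l) * exp (- (1 / l) * \<bar>prim \<alpha> \<eta> - prim \<alpha> \<xi>\<bar>)" for \<eta>
  proof -
    have "(1 / l) * \<bar>prim \<alpha> \<eta> - prim \<alpha> \<xi>\<bar> \<le> (1 / l) * (\<bar>Z t \<eta> - Z t \<xi>\<bar> + Q * K)"
      using Zdiff l_pos by (intro mult_left_mono) auto
    then show ?thesis unfolding k_def exp_add[symmetric] by (simp add: distrib_left)
  qed
  let ?I = "\<lambda>\<eta>. indicator A \<eta> * ennreal Q + ennreal (Q / m * exp (Q * K / l)) * ennreal (exp (- (1 / l) * \<bar>prim \<alpha> \<eta>
    - prim \<alpha> \<xi>\<bar>) * \<alpha> \<eta>)"
  have Z\<alpha>: "prim \<alpha> \<in> borel_measurable borel"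
  proof (rule borel_measurable_mono, rule monoI)
    fix x y :: real assume "x \<le> y"
    have "0 \<le> integral {x..y} \<alpha>"
      by (rule integral_nonneg[OF bounded_Borel_integrable(3)[OF \<alpha>m \<alpha>b]]) (rule \<alpha>0)
    then show "prim \<alpha> x \<le> prim \<alpha> y" using prim_diff[OF \<alpha>m \<alpha>b \<open>x \<le> y\<close>] by linarith
  qed
  note [measurable] = Z\<alpha>
  have "(\<integral>\<^sup>+\<eta>. ennreal \<bar>k t \<xi> \<eta> * e t \<eta>\<bar> \<partial>lborel) \<le> (\<integral>\<^sup>+\<eta>. ?I \<eta> \<partial>lborel)"
  proof (rule nn_integral_mono)
    fix \<eta>
    show "ennreal \<bar>k t \<xi> \<eta> * e t \<eta>\<bar> \<le> ?I \<eta>"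
    proof (cases "\<eta> \<in> A")
      case True
      have "\<bar>k t \<xi> \<eta> * e t \<eta>\<bar> \<le> 1 * Q" unfolding abs_mult
        using k_le1(1,2)[of t \<xi> \<eta>] Q(2)[of \<eta>] by (intro mult_mono) auto
      then have "ennreal \<bar>k t \<xi> \<eta> * e t \<eta>\<bar> \<le> ennreal Q" by (simp add: ennreal_leI)
      then show ?thesis using True by (simp add: add_increasing2)
    next
      case False
      have "\<bar>e t \<eta>\<bar> \<le> Q * 1" using Q(2)[of \<eta>] by simp
      also have "\<dots> \<le> Q * (\<alpha> \<eta> / m)" using low[OF False] False m Q0 by (intro mult_left_mono) (auto simp: \<alpha>_def)
      finally have "\<bar>k t \<xi> \<eta> * e t \<eta>\<bar> \<le> (exp (Q * K / l) * exp (- (1 / l) * \<bar>prim \<alpha> \<eta> - prim \<alpha> \<xi>\<bar>)) * (Q * (\<alpha> \<eta> / m))"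
        unfolding abs_mult using kb[of \<eta>] k_le1(2)[of t \<xi> \<eta>] by (intro mult_mono) auto
      also have "\<dots> = (Q / m * exp (Q * K / l)) * (exp (- (1 / l) * \<bar>prim \<alpha> \<eta> - prim \<alpha> \<xi>\<bar>) * \<alpha> \<eta>)" by simp
      finally show ?thesis using False Q0 m \<alpha>0[of \<eta>] by (simp add: ennreal_leI flip: ennreal_mult)
    qed
  qed
  also have "\<dots> = ennreal Q * emeasure lborel A + ennreal (Q / m * exp (Q * K / l)) * (\<integral>\<^sup>+\<eta>. ennreal (exp (- (1 / l)
    * \<bar>prim \<alpha> \<eta> - prim \<alpha> \<xi>\<bar>) * \<alpha> \<eta>) \<partial>lborel)"
    by (subst nn_integral_add) (auto simp: nn_integral_cmult nn_integral_multc mult.commute)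
  also have "\<dots> \<le> ennreal Q * ennreal K + ennreal (Q / m * exp (Q * K / l)) * ennreal (2 * pi * l)"
    by (intro add_mono mult_left_mono fin kernel_integral_le[OF \<alpha>m \<alpha>b \<alpha>0 l_pos]) auto
  also have "\<dots> = ennreal (Q * K + Q / m * exp (Q * K / l) * (2 * pi * l))"
  proof -
    have 0: "0 \<le> Q / m * exp (Q * K / l)" "0 \<le> 2 * pi * l" using Q0 m l_pos by auto
    have 1: "0 \<le> Q * K" "0 \<le> Q / m * exp (Q * K / l) * (2 * pi * l)"
      by (rule mult_nonneg_nonneg[OF Q0 K], rule mult_nonneg_nonneg[OF 0])
    show ?thesis unfolding ennreal_plus[OF 1] ennreal_mult[OF Q0 K] ennreal_mult[OF 0] ..
  qed
  finally have fin2: "(\<integral>\<^sup>+\<eta>. ennreal \<bar>k t \<xi> \<eta> * e t \<eta>\<bar> \<partial>lborel) \<le> ennreal (Q * K + Q / m * exp (Q * K / l) * (2 * pi * l))" .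
  have "\<bar>LBINT \<eta>. k t \<xi> \<eta> * e t \<eta>\<bar> \<le> (LBINT \<eta>. \<bar>k t \<xi> \<eta> * e t \<eta>\<bar>)" by (rule integral_abs_bound)
  also have "\<dots> \<le> Q * K + Q / m * exp (Q * K / l) * (2 * pi * l)"
  proof -
    have S0: "0 \<le> Q * K + Q / m * exp (Q * K / l) * (2 * pi * l)"
      using Q0 K m l_pos by (intro add_nonneg_nonneg mult_nonneg_nonneg) auto
    have "(\<integral>\<^sup>+\<eta>. ennreal \<bar>k t \<xi> \<eta> * e t \<eta>\<bar> \<partial>lborel) = ennreal (LBINT \<eta>. \<bar>k t \<xi> \<eta> * e t \<eta>\<bar>)"
      by (rule nn_integral_eq_integral[OF integrable_abs[OF ke_int[OF t]]]) simp
    then show ?thesis using fin2 ennreal_le_iff[OF S0] by metis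
  qed
  finally show ?thesis unfolding P_def abs_mult using l_pos by (simp add: divide_right_mono)
qed

text \<open>Finite energy at t0 leaves only a set A of finite measure where |v| > 1/10. Off A, v
  moves by at most 1/10 during the step, so a stays bounded below and
  \<open>P_bound_of_lower\<close> bounds P. The step length is the same for every t0.\<close>

lemma P_bound_step:
  assumes PB: "P_bound t0 B" and t0: "0 \<le> t0" "t0 \<le> T" and T: "0 \<le> T"
    and \<delta>: "0 < \<delta>" "\<delta> \<le> 1 / 3"
    and uc: "\<And>s t \<xi>. 0 \<le> s \<Longrightarrow> s \<le> T \<Longrightarrow> 0 \<le> t \<Longrightarrow> t \<le> T \<Longrightarrow> \<bar>s - t\<bar> \<le> \<delta> \<Longrightarrow> \<bar>v s \<xi> - v t \<xi>\<bar> \<le> 1 / 10"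
  shows "\<exists>B'. P_bound (min T (t0 + \<delta>)) B'"
proof -
  obtain Q where Q0: "0 \<le> Q" and Qs: "\<And>t \<xi>. 0 \<le> t \<Longrightarrow> t \<le> T \<Longrightarrow>
    \<bar>qb t \<xi>\<bar> \<le> Q \<and> \<bar>q t \<xi>\<bar> \<le> Q \<and> \<bar>a t \<xi>\<bar> \<le> Q \<and> \<bar>g t \<xi>\<bar> \<le> Q \<and> \<bar>e t \<xi>\<bar> \<le> Q \<and> \<bar>eu t \<xi>\<bar> \<le> Q"
    using state_bounded[OF T] by blast
  obtain K where K: "0 \<le> K" "(\<integral>\<^sup>+\<xi>. ennreal (eu t0 \<xi>) \<partial>lborel) \<le> ennreal K"
    using energy_finite[OF PB t0(1)] t0 by (metis order_refl)
  define m0 where "m0 = exp (- (1 / 2 + B) * t0)"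
  have m0: "0 < m0" "\<And>\<xi>. m0 \<le> q t0 \<xi>" using q_exp_bounds(1)[OF PB t0(1) order_refl] by (auto simp: m0_def)
  define A where "A = {\<xi>. \<bar>v t0 \<xi>\<bar> > 1 / 10}"
  have Am[measurable]: "A \<in> sets borel" unfolding A_def by measurable
  define s0 where "s0 = (sin (1 / 20 :: real))\<^sup>2"
  have s0: "0 < s0" unfolding s0_def using sin_gt_zero[of "1/20"] pi_gt3 by simp
  \<comment> \<open>Keeps |v / 2| in the range where the sine is monotone: v decreases from its
    initial value, as P is nonnegative up to t0.\<close>
  have vle: "v t0 \<xi> \<le> pi" for \<xi>
  proof -
    have "v t0 \<xi> - v 0 \<xi> = integral {0..t0} (\<lambda>s. v_rhs l (v s) (q s) \<xi>)"
      using AC_on_diff[OF v_ode[OF t0(1)] order_refl t0(1) order_refl] .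
    also have "\<dots> \<le> integral {0..t0} (\<lambda>_. 0)"
    proof (rule integral_le)
      fix s assume "s \<in> {0..t0}"
      then have s: "0 \<le> s" "s \<le> t0" by auto
      have "0 \<le> P s \<xi>" using nonneg_atD(9)[OF q_exp_bounds(3)[OF PB s]] .
      then have "0 \<le> P s \<xi> * (2 * (cos (v s \<xi> / 2))\<^sup>2)" by (intro mult_nonneg_nonneg) auto
      then have "- P s \<xi> * (2 * (cos (v s \<xi> / 2))\<^sup>2) - (sin (v s \<xi> / 2))\<^sup>2 \<le> 0"
        using zero_le_power2[of "sin (v s \<xi> / 2)"] by linarith
      then show "v_rhs l (v s) (q s) \<xi> \<le> 0" unfolding rhs_eq[OF s(1)] by simp
    qed (use AC_onD(2)[OF v_ode[OF t0(1)]] in auto)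
    finally have "v t0 \<xi> \<le> v 0 \<xi>" by simp
    moreover have "v 0 \<xi> \<le> pi" using v_init[of \<xi>] v_init_N[of \<xi>] arctan_bounded[of "w0 \<xi>"] pi_gt_zero by (cases "\<xi> \<in> N") auto
    ultimately show ?thesis by simp
  qed
  have Alow: "m0 * s0 \<le> eu t0 \<xi>" if "\<xi> \<in> A" for \<xi>
  proof -
    have v: "1 / 20 \<le> \<bar>v t0 \<xi> / 2\<bar>" "\<bar>v t0 \<xi> / 2\<bar> \<le> pi / 2" using that vle[of \<xi>] v_ge[OF t0(1), of \<xi>] by (auto simp: A_def)
    have "sin (1 / 20) \<le> sin \<bar>v t0 \<xi> / 2\<bar>" using v pi_gt3 by (subst sin_mono_le_eq) auto
    moreover have "0 \<le> sin (1 / 20 :: real)" using sin_gt_zero[of "1/20"] pi_gt3 by simp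
    ultimately have "s0 \<le> (sin \<bar>v t0 \<xi> / 2\<bar>)\<^sup>2" unfolding s0_def by (intro power_mono)
    also have "\<dots> = (sin (v t0 \<xi> / 2))\<^sup>2" by (simp add: abs_if)
    finally show ?thesis unfolding eu_def using m0 s0 by (intro mult_mono) (auto intro: order_trans[OF less_imp_le])
  qed
  \<comment> \<open>Chebyshev's inequality: on A the energy density is at least m0 s0.\<close>
  define K' where "K' = K / (m0 * s0)"
  have K': "0 \<le> K'" using K m0 s0 by (simp add: K'_def)
  have fin: "emeasure lborel A \<le> ennreal K'"
  proof -
    have "ennreal (m0 * s0) * emeasure lborel A = (\<integral>\<^sup>+\<xi>. ennreal (m0 * s0) * indicator A \<xi> \<partial>lborel)"
      by (subst nn_integral_cmult_indicator) auto
    also have "\<dots> \<le> (\<integral>\<^sup>+\<xi>. ennreal (eu t0 \<xi>) \<partial>lborel)"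
      by (intro nn_integral_mono) (use Alow in \<open>auto simp: indicator_def intro!: ennreal_leI\<close>)
    also have "\<dots> \<le> ennreal K" by (rule K(2))
    finally have "ennreal (1 / (m0 * s0)) * (ennreal (m0 * s0) * emeasure lborel A) \<le> ennreal (1 / (m0 * s0)) * ennreal K"
      by (rule mult_left_mono) simp
    moreover have "ennreal (1 / (m0 * s0)) * ennreal (m0 * s0) = 1" using m0 s0 by (simp flip: ennreal_mult)
    moreover have "ennreal (1 / (m0 * s0)) * ennreal K = ennreal K'" using K m0 s0 by (simp add: K'_def flip: ennreal_mult)
    ultimately show ?thesis by (simp flip: mult.assoc)
  qed
  define c0 where "c0 = (cos (1 / 20 :: real))\<^sup>2"
  have c0: "0 < c0" unfolding c0_def using cos_gt_zero[of "1/20"] pi_gt3 by simp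
  define t1 where "t1 = min T (t0 + \<delta>)"
  have t1: "t0 \<le> t1" "t1 \<le> T" "t1 - t0 \<le> \<delta>" using t0 \<delta> by (auto simp: t1_def)
  have low: "m0 * c0 / 2 \<le> a t \<xi>" if t: "t0 \<le> t" "t \<le> t1" and \<xi>: "\<xi> \<notin> A" for t \<xi>
  proof -
    have vs: "\<bar>v s \<xi>\<bar> \<le> 1 / 5" if "t0 \<le> s" "s \<le> t1" for s
    proof -
      have "\<bar>v s \<xi> - v t0 \<xi>\<bar> \<le> 1 / 10" by (rule uc) (use that t0 t1 in auto)
      moreover have "\<bar>v t0 \<xi>\<bar> \<le> 1 / 10" using \<xi> by (simp add: A_def not_less)
      ultimately show ?thesis by linarith
    qed
    \<comment> \<open>For |v| \<le> 1/5 the tangent of v / 2 is at most 1 in absolute value, so a,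
      whose density in time is g, changes at most at the rate |a|.\<close>
    have ga: "\<bar>g s \<xi>\<bar> \<le> \<bar>a s \<xi>\<bar>" if "t0 \<le> s" "s \<le> t1" for s
    proof -
      define x where "x = v s \<xi> / 2"
      have x: "\<bar>x\<bar> \<le> 1 / 10" using vs[OF that] by (simp add: x_def)
      have "\<bar>sin x\<bar> \<le> 1 / 10" using abs_sin_x_le_abs_x[of x] x by linarith
      then have "(sin x)\<^sup>2 \<le> (1 / 10)\<^sup>2" by (simp add: abs_le_square_iff[symmetric])
      then have "(sin x)\<^sup>2 \<le> (cos x)\<^sup>2" using sin_cos_squared_add[of x] by (simp add: power2_eq_square)
      then have "\<bar>sin x\<bar> \<le> \<bar>cos x\<bar>" by (simp add: abs_le_square_iff)
      then have "\<bar>qb s \<xi>\<bar> * (\<bar>sin x\<bar> * \<bar>cos x\<bar>) \<le> \<bar>qb s \<xi>\<bar> * (\<bar>cos x\<bar> * \<bar>cos x\<bar>)"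
        by (intro mult_left_mono mult_right_mono) auto
      then show ?thesis by (simp add: g_def a_def x_def abs_mult power2_eq_square)
    qed
    have a0: "m0 * c0 \<le> a t0 \<xi>"
    proof -
      have v: "\<bar>v t0 \<xi> / 2\<bar> \<le> 1 / 20" using \<xi> by (auto simp: A_def)
      have "cos (1 / 20) \<le> cos \<bar>v t0 \<xi> / 2\<bar>" using v pi_gt3 by (subst cos_mono_le_eq) auto
      moreover have "0 \<le> cos (1 / 20 :: real)" using cos_gt_zero[of "1/20"] pi_gt3 by simp
      ultimately have "c0 \<le> (cos (v t0 \<xi> / 2))\<^sup>2" unfolding c0_def cos_abs_real by (intro power_mono)
      then show ?thesis unfolding a_unbarred[OF t0(1)] using m0 c0
        by (intro mult_mono) (auto intro: order_trans[OF less_imp_le])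
    qed
    have AC: "AC_on t0 t1 (\<lambda>t. a t \<xi>) (\<lambda>s. g s \<xi>)"
      by (rule AC_on_subset[OF a_AC[of t1]]) (use t0 t1 in auto)
    have "continuous_on {t0..t1} (\<lambda>t. \<bar>a t \<xi>\<bar>)" by (intro continuous_intros AC_on_continuous[OF AC])
    then obtain z where z: "z \<in> {t0..t1}" "\<And>s. s \<in> {t0..t1} \<Longrightarrow> \<bar>a s \<xi>\<bar> \<le> \<bar>a z \<xi>\<bar>"
      using continuous_attains_sup[of "{t0..t1}" "\<lambda>t. \<bar>a t \<xi>\<bar>"] t1 by auto
    \<comment> \<open>Within a time of 1/3 the change is at most a third of the maximum of |a|; this
      maximum is then at most 3/2 of the value at t0, and at least half of that value
      survives.\<close>
    have diff: "\<bar>a s \<xi> - a t0 \<xi>\<bar> \<le> \<bar>a z \<xi>\<bar> / 3" if s: "t0 \<le> s" "s \<le> t1" for s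
    proof -
      have "norm (integral {t0..s} (\<lambda>s. g s \<xi>)) \<le> integral {t0..s} (\<lambda>_. \<bar>a z \<xi>\<bar>)"
      proof (rule Henstock_Kurzweil_Integration.integral_norm_bound_integral)
        show "(\<lambda>s. g s \<xi>) integrable_on {t0..s}"
          by (rule AC_onD(2)[OF AC_on_subset[OF AC]]) (use s in auto)
        show "norm (g x \<xi>) \<le> \<bar>a z \<xi>\<bar>" if "x \<in> {t0..s}" for x
          using ga[of x] z(2)[of x] that s by auto
      qed auto
      also have "\<dots> = (s - t0) * \<bar>a z \<xi>\<bar>" using s by simp
      also have "\<dots> \<le> (1 / 3) * \<bar>a z \<xi>\<bar>" using s t1 \<delta> by (intro mult_right_mono) auto
      finally show ?thesis using AC_on_diff[OF AC order_refl s] by simp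
    qed
    have "\<bar>a z \<xi> - a t0 \<xi>\<bar> \<le> \<bar>a z \<xi>\<bar> / 3" by (rule diff) (use z(1) in auto)
    then have "\<bar>a z \<xi>\<bar> / 3 \<le> \<bar>a t0 \<xi>\<bar> / 2" by linarith
    moreover have "0 < a t0 \<xi>" using a0 m0 c0 by (smt (verit) mult_pos_pos)
    ultimately have "a t0 \<xi> / 2 \<le> a t \<xi>" using diff[OF t] by linarith
    then show ?thesis using a0 by simp
  qed
  define B' where "B' = 1 / (4 * l) * (Q * K' + Q / (m0 * c0 / 2) * exp (Q * K' / l) * (2 * pi * l))"
  have B'0: "0 \<le> B'" unfolding B'_def using l_pos Q0 K' m0 c0 by auto
  have new: "\<bar>P t \<xi>\<bar> \<le> B'" if t: "t0 \<le> t" "t \<le> t1" for t \<xi>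
    unfolding B'_def
    by (rule P_bound_of_lower[OF _ _ _ _ Am fin K' low[OF t]]) (use t t0 t1 Qs m0 c0 in auto)
  have "P_bound t1 (max B B')"
    unfolding P_bound_def
  proof (intro conjI ballI allI)
    fix s \<xi> assume s: "s \<in> {0..t1}"
    show "\<bar>P s \<xi>\<bar> \<le> max B B'"
    proof (cases "s \<le> t0")
      case True
      then have "\<bar>P s \<xi>\<bar> \<le> B" using PB s by (auto simp: P_bound_def)
      then show ?thesis by simp
    next
      case False
      then show ?thesis using new[of s \<xi>] s by (simp add: le_max_iff_disj)
    qed
  qed (use B'0 in auto)
  then show ?thesis unfolding t1_def by blast
qed

text \<open>Uniform continuity of v gives one step length for all of [0, T], so finitely many
  continuation steps reach T.\<close>

theorem P_bounded:
  assumes T: "0 \<le> T"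
  shows "\<exists>B. P_bound T B"
proof -
  obtain \<delta>0 where \<delta>0: "0 < \<delta>0" "\<forall>s\<in>{0..T}. \<forall>t\<in>{0..T}. \<bar>s - t\<bar> \<le> \<delta>0 \<longrightarrow> (\<forall>\<xi>. \<bar>v s \<xi> - v t \<xi>\<bar> \<le> 1 / 10)"
    using v_uc[OF T] by blast
  define \<delta> where "\<delta> = min \<delta>0 (1 / 3)"
  have \<delta>: "0 < \<delta>" "\<delta> \<le> 1 / 3" using \<delta>0 by (auto simp: \<delta>_def)
  have uc: "\<bar>v s \<xi> - v t \<xi>\<bar> \<le> 1 / 10" if "0 \<le> s" "s \<le> T" "0 \<le> t" "t \<le> T" "\<bar>s - t\<bar> \<le> \<delta>" for s t \<xi>
    using \<delta>0(2) that by (auto simp: \<delta>_def)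
  have n0: "nonneg_at 0" using q_init by (simp add: nonneg_at_def)
  \<comment> \<open>At time 0 every q is 1, and k \<le> 1 bounds P by the total initial
    energy.\<close>
  have base: "P_bound 0 (e_total / (4 * l))"
    unfolding P_bound_def
  proof (intro conjI ballI allI)
    show "0 \<le> e_total / (4 * l)" using e_total_nonneg l_pos by simp
    fix s \<xi> assume "s \<in> {0..0::real}"
    then have s: "s = 0" by simp
    have "ennreal (4 * l * P 0 \<xi>) \<le> (\<integral>\<^sup>+\<eta>. ennreal (eu 0 \<eta>) \<partial>lborel)"
      unfolding P_nn[OF n0, symmetric]
    proof (intro nn_integral_mono ennreal_leI)
      fix \<eta>
      have "k 0 \<xi> \<eta> * e 0 \<eta> \<le> 1 * e 0 \<eta>" using k_le1(1) nonneg_atD(5)[OF n0] by (intro mult_right_mono)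
      then show "k 0 \<xi> \<eta> * e 0 \<eta> \<le> eu 0 \<eta>" using nonneg_atD(7)[OF n0, of \<eta>] by simp
    qed
    then have "4 * l * P 0 \<xi> \<le> e_total" unfolding eu0_total using e_total_nonneg by (simp add: ennreal_le_iff)
    then show "\<bar>P s \<xi>\<bar> \<le> e_total / (4 * l)"
      using l_pos nonneg_atD(9)[OF n0, of \<xi>] unfolding s by (simp add: field_simps)
  qed
  have "\<exists>B. P_bound (min T (real n * \<delta>)) B" for n
  proof (induction n)
    case 0
    then show ?case using base T by auto
  next
    case (Suc n)
    then obtain B where B: "P_bound (min T (real n * \<delta>)) B" by blast
    have "\<exists>B'. P_bound (min T (min T (real n * \<delta>) + \<delta>)) B'"
      by (rule P_bound_step[OF B _ _ T \<delta> uc]) (use T \<delta> in auto)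
    then obtain B' where B': "P_bound (min T (min T (real n * \<delta>) + \<delta>)) B'" by blast
    have "min T (real (Suc n) * \<delta>) \<le> min T (min T (real n * \<delta>) + \<delta>)"
      using \<delta> by (auto simp: min_def algebra_simps)
    then show ?case using P_bound_mono[OF B'] by blast
  qed
  moreover obtain n :: nat where "T / \<delta> < n" using reals_Archimedean2 by blast
  then have "T \<le> real n * \<delta>" using \<delta> by (simp add: field_simps)
  ultimately show ?thesis by (metis min.absorb1)
qed

lemma nonneg: "0 \<le> t \<Longrightarrow> nonneg_at t"
  using P_bounded[of t] q_exp_bounds(3)[of t _ t] by auto

end

section \<open>Energy estimates uniform in the parameter\<close>

lemma ennreal_add_le: "ennreal (x + y) \<le> ennreal x + ennreal y"
proof -
  have m: "ennreal (max 0 x) = ennreal x" for x by (cases "0 \<le> x") (auto simp: max_def ennreal_neg)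
  have "ennreal (x + y) \<le> ennreal (max 0 x + max 0 y)" by (rule ennreal_leI) auto
  also have "\<dots> = ennreal (max 0 x) + ennreal (max 0 y)" by (rule ennreal_plus) auto
  finally show ?thesis unfolding m .
qed

text \<open>Tonelli turns an integral inequality along each trajectory into one for integrals over
  the line, finite or not.\<close>

lemma nn_integral_time_bound:
  fixes H :: "real \<Rightarrow> real \<Rightarrow> real"
  assumes H: "jointly_Borel H"
    and b: "\<And>s x. 0 \<le> s \<Longrightarrow> s \<le> t \<Longrightarrow> 0 \<le> H s x \<and> H s x \<le> C"
    and F0[measurable]: "F0 \<in> borel_measurable borel"
    and F: "\<And>x. F x \<le> F0 x + integral {0..t} (\<lambda>s. H s x)"
  shows "(\<integral>\<^sup>+x. ennreal (F x) \<partial>lborel) \<le> (\<integral>\<^sup>+x. ennreal (F0 x) \<partial>lborel) + (\<integral>\<^sup>+s. (\<integral>\<^sup>+x. ennreal (H s x) \<partial>lborel) *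
    indicator {0..t} s \<partial>lborel)"
proof -
  have Hm: "(\<lambda>p. H (fst p) (snd p)) \<in> borel_measurable (lborel \<Otimes>\<^sub>M lborel)" using H by (simp add: split_beta')
  have Hx[measurable]: "(\<lambda>s. H s x) \<in> borel_measurable borel" for x using H by measurable
  have Hs[measurable]: "(\<lambda>x. H s x) \<in> borel_measurable borel" for s using H by measurable
  have I: "ennreal (integral {0..t} (\<lambda>s. H s x)) = (\<integral>\<^sup>+s. ennreal (H s x) * indicator {0..t} s \<partial>lborel)" for x
    by (rule nn_integral_Icc[symmetric, where C=C]) (use b in auto)
  have m1: "(\<lambda>x. \<integral>\<^sup>+s. ennreal (H s x) * indicator {0..t} s \<partial>lborel) \<in> borel_measurable lborel"
  proof -
    have "(\<lambda>(x, s). ennreal (H s x) * indicator {0..t} s) \<in> borel_measurable (lborel \<Otimes>\<^sub>M lborel)"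
      using measurable_compose[OF _ Hm, of "\<lambda>(x, s). (s, x)" "lborel \<Otimes>\<^sub>M lborel"] by (simp add: split_beta') 
    then show ?thesis by (rule lborel.borel_measurable_nn_integral)
  qed
  have "(\<integral>\<^sup>+x. ennreal (F x) \<partial>lborel) \<le> (\<integral>\<^sup>+x. ennreal (F0 x) + (\<integral>\<^sup>+s. ennreal (H s x) * indicator {0..t} s
    \<partial>lborel) \<partial>lborel)"
  proof (rule nn_integral_mono)
    fix x
    have "ennreal (F x) \<le> ennreal (F0 x + integral {0..t} (\<lambda>s. H s x))" by (rule ennreal_leI[OF F])
    also have "\<dots> \<le> ennreal (F0 x) + ennreal (integral {0..t} (\<lambda>s. H s x))"
      by (rule ennreal_add_le)
    finally show "ennreal (F x) \<le> ennreal (F0 x) + (\<integral>\<^sup>+s. ennreal (H s x) * indicator {0..t} s \<partial>lborel)" unfolding I .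
  qed
  also have "\<dots> = (\<integral>\<^sup>+x. ennreal (F0 x) \<partial>lborel) + (\<integral>\<^sup>+x. (\<integral>\<^sup>+s. ennreal (H s x) * indicator {0..t} s \<partial>lborel) \<partial>lborel)"
    by (rule nn_integral_add) (use m1 in auto)
  also have "(\<integral>\<^sup>+x. (\<integral>\<^sup>+s. ennreal (H s x) * indicator {0..t} s \<partial>lborel) \<partial>lborel)
    = (\<integral>\<^sup>+s. (\<integral>\<^sup>+x. ennreal (H s x) * indicator {0..t} s \<partial>lborel) \<partial>lborel)"
    by (rule lborel_pair.Fubini') (use Hm in \<open>simp add: split_beta'\<close>)
  also have "\<dots> = (\<integral>\<^sup>+s. (\<integral>\<^sup>+x. ennreal (H s x) \<partial>lborel) * indicator {0..t} s \<partial>lborel)"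
    by (intro nn_integral_cong nn_integral_multc) measurable
  finally show ?thesis .
qed

text \<open>Continuity argument on the right-hand side F, since f itself is only measurable. F is
  continuous, nondecreasing and starts at A; if it reached A + 1 at a time s, the integral of f up
  to s would be at most T (A + 1), and smallness would force F s < A + 1.\<close>

lemma bootstrap:
  fixes f :: "real \<Rightarrow> real"
  assumes f: "f \<in> borel_measurable borel" and b: "\<And>t. 0 \<le> t \<Longrightarrow> t \<le> T \<Longrightarrow> 0 \<le> f t \<and> f t \<le> K"
    and pos: "0 \<le> G" "0 \<le> A" "0 < l" and T: "0 \<le> T"
    and le: "\<And>t. 0 \<le> t \<Longrightarrow> t \<le> T \<Longrightarrow> f t \<le> A + (G * integral {0..t} f + 3 / 2 * (integral {0..t} f)\<^sup>2) / (2 * l)"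
    and small: "T * (A + 1) * (G + 3 * T * (A + 1)) < 2 * l"
    and t: "0 \<le> t" "t \<le> T"
  shows "f t \<le> A + 1" "G * integral {0..t} f + 3 / 2 * (integral {0..t} f)\<^sup>2 \<le> T * (A + 1) * (G + 3 * T * (A + 1))"
proof -
  define I where "I t = integral {0..t} f" for t
  define F where "F t = A + (G * I t + 3 / 2 * (I t)\<^sup>2) / (2 * l)" for t
  have fi: "f integrable_on {0..t}" if "t \<le> T" for t
    by (rule bounded_Borel_integrable(3)[OF f, where C=K]) (use b that in \<open>auto simp: abs_of_nonneg\<close>)
  have I0: "0 \<le> I t" if "t \<le> T" for t unfolding I_def by (rule integral_nonneg[OF fi[OF that]]) (use b that in auto)
  have Imono: "I s \<le> I t" if "0 \<le> s" "s \<le> t" "t \<le> T" for s t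
    unfolding I_def by (rule integral_subset_le) (use fi that b in auto)
  have Fmono: "F s \<le> F t" if "0 \<le> s" "s \<le> t" "t \<le> T" for s t
    unfolding F_def using Imono[OF that] I0[of s] that pos
    by (intro add_left_mono divide_right_mono add_mono mult_left_mono power_mono) auto
  have Fc: "continuous_on {0..T} F" unfolding F_def I_def
    by (intro continuous_intros indefinite_integral_continuous_1 fi) (use pos in auto)
  have Ib: "I s \<le> T * (A + 1)" if "0 \<le> s" "s \<le> T" and F: "F s \<le> A + 1" for s
  proof -
    have "I s \<le> integral {0..s} (\<lambda>_. A + 1)"
      unfolding I_def
    proof (rule integral_le[OF fi])
      fix r assume r: "r \<in> {0..s}"
      have "f r \<le> F r" using le[of r] r that by (auto simp: F_def I_def)
      also have "\<dots> \<le> F s" using r that by (intro Fmono) auto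
      finally show "f r \<le> A + 1" using F by simp
    qed (use that in auto)
    also have "\<dots> = s * (A + 1)" using that by simp
    also have "\<dots> \<le> T * (A + 1)" using that pos by (intro mult_right_mono) auto
    finally show ?thesis .
  qed
  have quad: "G * I s + 3 / 2 * (I s)\<^sup>2 \<le> T * (A + 1) * (G + 3 * T * (A + 1))" if "0 \<le> s" "s \<le> T" "F s \<le> A + 1" for s
  proof -
    have "G * I s \<le> G * (T * (A + 1))" using Ib[OF that] pos by (intro mult_left_mono)
    moreover have "(I s)\<^sup>2 \<le> (T * (A + 1))\<^sup>2" using Ib[OF that] I0[OF that(2)] by (intro power_mono)
    moreover have "0 \<le> (T * (A + 1))\<^sup>2" by simp
    ultimately show ?thesis by (simp add: power2_eq_square algebra_simps)
  qed
  have FT: "F T \<le> A + 1"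
  proof (rule ccontr)
    assume "\<not> F T \<le> A + 1"
    moreover have "F 0 \<le> A + 1" by (simp add: F_def I_def)
    ultimately obtain s where s: "0 \<le> s" "s \<le> T" "F s = A + 1"
      using IVT'[of F 0 "A + 1" T] T Fc by auto
    have "F s \<le> A + (T * (A + 1) * (G + 3 * T * (A + 1))) / (2 * l)"
      unfolding F_def using quad[OF s(1,2)] s(3) pos by (intro add_left_mono divide_right_mono) auto
    also have "\<dots> < A + 1" using small pos by (simp add: divide_less_eq)
    finally show False using s(3) by simp
  qed
  have Ft: "F t \<le> A + 1" using Fmono[OF t order_refl] FT by simp
  show "f t \<le> A + 1" using le[OF t] Ft by (simp add: F_def I_def)
  show "G * integral {0..t} f + 3 / 2 * (integral {0..t} f)\<^sup>2 \<le> T * (A + 1) * (G + 3 * T * (A + 1))"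
    using quad[OF t Ft] by (simp add: I_def)
qed

context regularized
begin

lemma eu_int: assumes t: "0 \<le> t" shows "integrable lborel (eu t)"
proof -
  obtain B where B: "P_bound t B" using P_bounded[OF t] by blast
  obtain K where "(\<integral>\<^sup>+\<xi>. ennreal (eu t \<xi>) \<partial>lborel) \<le> ennreal K" using energy_finite[OF B t] t by (metis order_refl)
  then have "(\<integral>\<^sup>+\<xi>. ennreal (eu t \<xi>) \<partial>lborel) < \<infinity>" by (simp add: order.strict_trans1)
  then show ?thesis using nonneg_atD(6)[OF nonneg[OF t]] by (intro integrableI_nonneg) auto
qed

lemma e_int: assumes t: "0 \<le> t" shows "integrable lborel (e t)"
  by (rule Bochner_Integration.integrable_bound[OF eu_int[OF t]])
    (use nonneg_atD(5,6,7)[OF nonneg[OF t]] in \<open>auto simp: abs_of_nonneg\<close>)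

definition En :: "real \<Rightarrow> real" where "En t = (LBINT \<xi>. e t \<xi>)"

lemma En_meas [measurable]: "En \<in> borel_measurable borel"
  unfolding En_def by (rule lborel.borel_measurable_lebesgue_integral) (use meas(4) in simp)

lemma En_nn: assumes t: "0 \<le> t" shows "(\<integral>\<^sup>+\<xi>. ennreal (e t \<xi>) \<partial>lborel) = ennreal (En t)" "0 \<le> En t"
proof -
  show "(\<integral>\<^sup>+\<xi>. ennreal (e t \<xi>) \<partial>lborel) = ennreal (En t)" unfolding En_def
    by (rule nn_integral_eq_integral[OF e_int[OF t]]) (use nonneg_atD(5)[OF nonneg[OF t]] in auto)
  show "0 \<le> En t" unfolding En_def
    by (rule Bochner_Integration.integral_nonneg) (use nonneg_atD(5)[OF nonneg[OF t]] in auto)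
qed

lemma En_bounded:
  assumes T: "0 \<le> T"
  obtains K where "0 \<le> K" "\<And>t. 0 \<le> t \<Longrightarrow> t \<le> T \<Longrightarrow> 0 \<le> En t \<and> En t \<le> K"
proof -
  obtain B where B: "P_bound T B" using P_bounded[OF T] by blast
  obtain K where K: "0 \<le> K" "\<And>s. 0 \<le> s \<Longrightarrow> s \<le> T \<Longrightarrow> (\<integral>\<^sup>+\<xi>. ennreal (eu s \<xi>) \<partial>lborel) \<le> ennreal K"
    using energy_finite[OF B T] by metis
  have "0 \<le> En s \<and> En s \<le> K" if "0 \<le> s" "s \<le> T" for s
  proof -
    have "ennreal (En s) \<le> (\<integral>\<^sup>+\<xi>. ennreal (eu s \<xi>) \<partial>lborel)"
      unfolding En_nn(1)[OF that(1), symmetric]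
      by (intro nn_integral_mono ennreal_leI nonneg_atD(7)[OF nonneg[OF that(1)]])
    also have "\<dots> \<le> ennreal K" by (rule K(2)[OF that])
    finally show ?thesis using En_nn(2)[OF that(1)] K(1) by (simp add: ennreal_le_iff)
  qed
  with K(1) show ?thesis by (rule that)
qed

lemma P_le_En: assumes t: "0 \<le> t" shows "P t \<xi> \<le> En t / (4 * l)"
proof -
  have "(LBINT \<eta>. k t \<xi> \<eta> * e t \<eta>) \<le> (LBINT \<eta>. e t \<eta>)"
  proof (rule integral_mono[OF ke_int[OF t] e_int[OF t]])
    fix \<eta> show "k t \<xi> \<eta> * e t \<eta> \<le> e t \<eta>"
      using mult_right_mono[OF k_le1(1)[of t \<xi> \<eta>] nonneg_atD(5)[OF nonneg[OF t], of \<eta>]] by simp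
  qed
  then show ?thesis unfolding P_def En_def using l_pos by (simp add: divide_right_mono)
qed

text \<open>From g_t = e / 2 - P a and the l-free bound on the integral of P a: the rate is (1 + pi)
  / 2 times the energy, rounded up to 3. In Eulerian terms this controls the variation of the
  velocity.\<close>

lemma g_growth:
  assumes t: "0 \<le> t"
  shows "(\<integral>\<^sup>+\<xi>. ennreal \<bar>g t \<xi>\<bar> \<partial>lborel) \<le> ennreal (g_total + 3 * integral {0..t} En)"
proof -
  obtain B where B: "P_bound t B" using P_bounded[OF t] by blast
  obtain Q where Qs: "\<And>s \<xi>. 0 \<le> s \<Longrightarrow> s \<le> t \<Longrightarrow>
    \<bar>qb s \<xi>\<bar> \<le> Q \<and> \<bar>q s \<xi>\<bar> \<le> Q \<and> \<bar>a s \<xi>\<bar> \<le> Q \<and> \<bar>g s \<xi>\<bar> \<le> Q \<and> \<bar>e s \<xi>\<bar> \<le> Q \<and> \<bar>eu s \<xi>\<bar> \<le> Q"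
    by (rule state_bounded[OF t]) (rule that)
  obtain K where K: "0 \<le> K" and "\<And>s. 0 \<le> s \<Longrightarrow> s \<le> t \<Longrightarrow> 0 \<le> En s \<and> En s \<le> K"
    using En_bounded[OF t] by metis
  then have EnK: "\<bar>En s\<bar> \<le> K" if "0 \<le> s" "s \<le> t" for s using that by (simp add: abs_of_nonneg)
  have hm: "(\<lambda>(s, \<xi>). e s \<xi> / 2 + P s \<xi> * a s \<xi>) \<in> borel_measurable (borel \<Otimes>\<^sub>M borel)"
    using meas(2,4) P_meas by (simp add: split_beta')
  have "(\<integral>\<^sup>+\<xi>. ennreal \<bar>g t \<xi>\<bar> \<partial>lborel) \<le> (\<integral>\<^sup>+\<xi>. ennreal \<bar>g 0 \<xi>\<bar> \<partial>lborel) + (\<integral>\<^sup>+s. (\<integral>\<^sup>+\<xi>. ennreal (e s \<xi> / 2 + P s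
    \<xi> * a s \<xi>) \<partial>lborel) * indicator {0..t} s \<partial>lborel)"
  proof (rule nn_integral_time_bound[OF hm, where C="Q / 2 + B * Q"])
    fix s \<xi> assume s: "0 \<le> s" "s \<le> t"
    have "P s \<xi> * a s \<xi> \<le> B * Q"
      by (rule mult_mono) (use Qs[OF s, of \<xi>] B s nonneg_atD(4,9)[OF nonneg[OF s(1)], of \<xi>] in \<open>auto simp:
        P_bound_def abs_le_iff\<close>)
    then show "0 \<le> e s \<xi> / 2 + P s \<xi> * a s \<xi> \<and> e s \<xi> / 2 + P s \<xi> * a s \<xi> \<le> Q / 2 + B * Q"
      using nonneg_atD(4,5,9)[OF nonneg[OF s(1)], of \<xi>] Qs[OF s, of \<xi>] by (auto simp: abs_le_iff)
  next
    fix \<xi>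
    have "norm (integral {0..t} (\<lambda>s. h s \<xi>)) \<le> integral {0..t} (\<lambda>s. e s \<xi> / 2 + P s \<xi> * a s \<xi>)"
    proof (rule Henstock_Kurzweil_Integration.integral_norm_bound_integral)
      show "(\<lambda>s. h s \<xi>) integrable_on {0..t}" by (rule AC_onD(2)[OF g_AC[OF t]])
      have "\<bar>e s \<xi> / 2 + P s \<xi> * a s \<xi>\<bar> \<le> Q / 2 + B * Q" if s: "0 \<le> s" "s \<le> t" for s
      proof -
        have "\<bar>P s \<xi> * a s \<xi>\<bar> \<le> B * Q" unfolding abs_mult
          by (rule mult_mono) (use Qs[OF s, of \<xi>] B s in \<open>auto simp: P_bound_def\<close>)
        then show ?thesis using Qs[OF s, of \<xi>] by (auto simp: abs_le_iff)
      qed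
      then show "(\<lambda>s. e s \<xi> / 2 + P s \<xi> * a s \<xi>) integrable_on {0..t}"
        by (intro bounded_Borel_integrable(3)[where C="Q / 2 + B * Q"]) auto
      fix s assume "s \<in> {0..t}"
      then have s: "0 \<le> s" by auto
      have "0 \<le> P s \<xi> * a s \<xi>" using nonneg_atD(4,9)[OF nonneg[OF s], of \<xi>] by simp
      then show "norm (h s \<xi>) \<le> e s \<xi> / 2 + P s \<xi> * a s \<xi>"
        using nonneg_atD(5)[OF nonneg[OF s], of \<xi>] by (simp add: h_def abs_le_iff)
    qed
    then show "\<bar>g t \<xi>\<bar> \<le> \<bar>g 0 \<xi>\<bar> + integral {0..t} (\<lambda>s. e s \<xi> / 2 + P s \<xi> * a s \<xi>)"
      using AC_onD(3)[OF g_AC[OF t], of t \<xi>] t by (auto simp: abs_le_iff)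
  qed measurable
  also have "(\<integral>\<^sup>+s. (\<integral>\<^sup>+\<xi>. ennreal (e s \<xi> / 2 + P s \<xi> * a s \<xi>) \<partial>lborel) * indicator {0..t} s \<partial>lborel)
    \<le> (\<integral>\<^sup>+s. ennreal (3 * En s) * indicator {0..t} s \<partial>lborel)"
  proof (rule nn_integral_mono)
    fix s
    show "(\<integral>\<^sup>+\<xi>. ennreal (e s \<xi> / 2 + P s \<xi> * a s \<xi>) \<partial>lborel) * indicator {0..t} s \<le> ennreal (3 * En s) * indicator {0..t} s"
    proof (cases "s \<in> {0..t}")
      case True
      then have s: "0 \<le> s" by auto
      note ns = nonneg[OF s]
      have "(\<integral>\<^sup>+\<xi>. ennreal (e s \<xi> / 2 + P s \<xi> * a s \<xi>) \<partial>lborel)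
        = (\<integral>\<^sup>+\<xi>. ennreal (1 / 2) * ennreal (e s \<xi>) + ennreal (P s \<xi> * a s \<xi>) \<partial>lborel)"
      proof (rule nn_integral_cong)
        fix \<xi>
        have 1: "0 \<le> 1 / 2 * e s \<xi>" "0 \<le> P s \<xi> * a s \<xi>" using nonneg_atD(4,5,9)[OF ns, of \<xi>] by auto
        have 2: "(0::real) \<le> 1 / 2" by simp
        show "ennreal (e s \<xi> / 2 + P s \<xi> * a s \<xi>) = ennreal (1 / 2) * ennreal (e s \<xi>) + ennreal (P s \<xi> * a s \<xi>)"
          using ennreal_plus[OF 1] ennreal_mult[OF 2 nonneg_atD(5)[OF ns, of \<xi>]] by simp
      qed
      also have "\<dots> = ennreal (1 / 2) * ennreal (En s) + (\<integral>\<^sup>+\<xi>. ennreal (P s \<xi> * a s \<xi>) \<partial>lborel)"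
        by (subst nn_integral_add) (auto simp: nn_integral_cmult En_nn[OF s])
      also have "\<dots> \<le> ennreal (1 / 2) * ennreal (En s) + ennreal (pi / 2) * ennreal (En s)"
        using Pa_total[OF ns] En_nn(1)[OF s] by (intro add_left_mono) simp
      also have "\<dots> = ennreal ((1 / 2 + pi / 2) * En s)"
      proof -
        have p: "(0::real) \<le> 1 / 2" "0 \<le> pi / 2" "0 \<le> 1 / 2 * En s" "0 \<le> pi / 2 * En s" using En_nn(2)[OF s] by auto
        show ?thesis unfolding distrib_right ennreal_plus[OF p(3,4)] ennreal_mult[OF p(1) En_nn(2)[OF s]]
          ennreal_mult[OF p(2) En_nn(2)[OF s]] ..
      qed
      also have "\<dots> \<le> ennreal (3 * En s)"
        using En_nn(2)[OF s] pi_less_4 by (intro ennreal_leI mult_right_mono) auto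
      finally show ?thesis using True by simp
    qed simp
  qed
  also have "(\<integral>\<^sup>+s. ennreal (3 * En s) * indicator {0..t} s \<partial>lborel) = ennreal (integral {0..t} (\<lambda>s. 3 * En s))"
    by (rule nn_integral_Icc[where C="3 * K"]) (use EnK En_nn in auto)
  also have "integral {0..t} (\<lambda>s. 3 * En s) = 3 * integral {0..t} En" by simp
  also have "(\<integral>\<^sup>+\<xi>. ennreal \<bar>g 0 \<xi>\<bar> \<partial>lborel) + ennreal (3 * integral {0..t} En) = ennreal (g_total + 3 * integral {0..t} En)"
  proof -
    have "0 \<le> integral {0..t} En"
      by (rule integral_nonneg) (use bounded_Borel_integrable(3)[OF En_meas, of 0 t K] EnK En_nn in auto)
    then show ?thesis unfolding g0_total using g_total_nonneg by (simp add: ennreal_plus)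
  qed
  finally show ?thesis by (simp add: add_left_mono)
qed

text \<open>T is short relative to l, so that by the bootstrap the energy cannot grow by 1 before T;
  for fixed T this holds for all large l. The condition 1 \<le> l allows bounds of order 1/l to be
  replaced by constants.\<close>

definition small :: "real \<Rightarrow> bool" where
  "small T \<longleftrightarrow> 0 \<le> T \<and> 1 \<le> l \<and> T * (e_total + 1) * (g_total + 3 * T * (e_total + 1)) < 2 * l"

text \<open>The rate -2 P g with P \<le> energy / (4 l), combined with the growth bound for the
  integral of |g|. \<open>ennreal\<close> truncates negative values, so the first claim measures the
  excess over the initial density, the part that no fixed function dominates as l varies.\<close>

lemma energy_growth:
  assumes t: "0 \<le> t"
  shows "(\<integral>\<^sup>+\<xi>. ennreal (eu t \<xi> - eu 0 \<xi>) \<partial>lborel)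
    \<le> ennreal ((g_total * integral {0..t} En + 3 / 2 * (integral {0..t} En)\<^sup>2) / (2 * l))"
    "En t \<le> e_total + (g_total * integral {0..t} En + 3 / 2 * (integral {0..t} En)\<^sup>2) / (2 * l)"
proof -
  obtain B where B: "P_bound t B" using P_bounded[OF t] by blast
  obtain Q where Qs: "\<And>s \<xi>. 0 \<le> s \<Longrightarrow> s \<le> t \<Longrightarrow>
    \<bar>qb s \<xi>\<bar> \<le> Q \<and> \<bar>q s \<xi>\<bar> \<le> Q \<and> \<bar>a s \<xi>\<bar> \<le> Q \<and> \<bar>g s \<xi>\<bar> \<le> Q \<and> \<bar>e s \<xi>\<bar> \<le> Q \<and> \<bar>eu s \<xi>\<bar> \<le> Q"
    by (rule state_bounded[OF t]) (rule that)
  obtain K where K: "0 \<le> K" and "\<And>s. 0 \<le> s \<Longrightarrow> s \<le> t \<Longrightarrow> 0 \<le> En s \<and> En s \<le> K"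
    using En_bounded[OF t] by metis
  then have EnK: "\<bar>En s\<bar> \<le> K" if "0 \<le> s" "s \<le> t" for s using that by (simp add: abs_of_nonneg)
  define I where "I s = (LBINT r:{0..s}. En r)" for s
  have Im[measurable]: "I \<in> borel_measurable borel"
  proof -
    have "(\<lambda>(t::real, s). En s) \<in> borel_measurable (borel \<Otimes>\<^sub>M borel)" by measurable
    from LBINT_interval_measurable(1)[OF this, of 0]
    have "(\<lambda>(t::real, x). LBINT s:{0..x}. En s) \<in> borel_measurable (borel \<Otimes>\<^sub>M borel)" .
    from measurable_compose[OF _ this, of "\<lambda>s. (0, s)" borel] show ?thesis by (simp add: I_def[abs_def])
  qed
  have I: "I s = integral {0..s} En" if "0 \<le> s" "s \<le> t" for s
    unfolding I_def by (rule bounded_Borel_integrable(4)[OF En_meas, where C=K]) (use EnK that in auto)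
  have Eni: "En integrable_on {0..s}" if "s \<le> t" for s
    by (rule bounded_Borel_integrable(3)[OF En_meas, where C=K]) (use EnK that in auto)
  have I0: "0 \<le> I s" if "0 \<le> s" "s \<le> t" for s
    unfolding I[OF that] by (rule integral_nonneg[OF Eni]) (use that En_nn in auto)
  have IK: "I s \<le> K * t" if "0 \<le> s" "s \<le> t" for s
  proof -
    have "I s \<le> integral {0..s} (\<lambda>_. K)" unfolding I[OF that]
      by (rule integral_le[OF Eni]) (use that EnK in \<open>auto simp: abs_le_iff\<close>)
    also have "\<dots> = K * s" using that by simp
    also have "\<dots> \<le> K * t" using that K by (intro mult_left_mono)
    finally show ?thesis .
  qed
  have hm: "(\<lambda>(s, \<xi>). 2 * (P s \<xi> * \<bar>g s \<xi>\<bar>)) \<in> borel_measurable (borel \<Otimes>\<^sub>M borel)"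
    using meas(3) P_meas by (simp add: split_beta')
  have Pg: "0 \<le> 2 * (P s \<xi> * \<bar>g s \<xi>\<bar>) \<and> 2 * (P s \<xi> * \<bar>g s \<xi>\<bar>) \<le> 2 * (B * Q)" if s: "0 \<le> s" "s \<le> t" for s \<xi>
  proof -
    have "P s \<xi> * \<bar>g s \<xi>\<bar> \<le> B * Q"
      by (rule mult_mono) (use Qs[OF s, of \<xi>] B s in \<open>auto simp: P_bound_def abs_le_iff\<close>)
    then show ?thesis using nonneg_atD(9)[OF nonneg[OF s(1)], of \<xi>] by auto
  qed
  have pt: "eu t \<xi> - eu 0 \<xi> \<le> integral {0..t} (\<lambda>s. 2 * (P s \<xi> * \<bar>g s \<xi>\<bar>))" for \<xi>
  proof -
    have "integral {0..t} (\<lambda>s. - 2 * P s \<xi> * g s \<xi>) \<le> integral {0..t} (\<lambda>s. 2 * (P s \<xi> * \<bar>g s \<xi>\<bar>))"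
    proof (rule integral_le)
      show "(\<lambda>s. - 2 * P s \<xi> * g s \<xi>) integrable_on {0..t}" by (rule AC_onD(2)[OF eu_AC[OF t]])
      show "(\<lambda>s. 2 * (P s \<xi> * \<bar>g s \<xi>\<bar>)) integrable_on {0..t}"
        by (rule bounded_Borel_integrable(3)[where C="2 * (B * Q)"]) (use Pg in \<open>auto simp: abs_of_nonneg\<close>)
      fix s assume "s \<in> {0..t}"
      then have "0 \<le> P s \<xi>" using nonneg_atD(9)[OF nonneg[of s]] by auto
      then have "P s \<xi> * - g s \<xi> \<le> P s \<xi> * \<bar>g s \<xi>\<bar>" by (intro mult_left_mono) auto
      moreover have "- 2 * P s \<xi> * g s \<xi> = 2 * (P s \<xi> * - g s \<xi>)" by simp
      ultimately show "- 2 * P s \<xi> * g s \<xi> \<le> 2 * (P s \<xi> * \<bar>g s \<xi>\<bar>)" by linarith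
    qed
    then show ?thesis using AC_onD(3)[OF eu_AC[OF t], of t \<xi>] t by auto
  qed
  have inner: "(\<integral>\<^sup>+s. (\<integral>\<^sup>+\<xi>. ennreal (2 * (P s \<xi> * \<bar>g s \<xi>\<bar>)) \<partial>lborel) * indicator {0..t} s \<partial>lborel)
     \<le> ennreal ((g_total * integral {0..t} En + 3 / 2 * (integral {0..t} En)\<^sup>2) / (2 * l))"
  proof -
    have "(\<integral>\<^sup>+s. (\<integral>\<^sup>+\<xi>. ennreal (2 * (P s \<xi> * \<bar>g s \<xi>\<bar>)) \<partial>lborel) * indicator {0..t} s \<partial>lborel)
      \<le> (\<integral>\<^sup>+s. ennreal (En s / (2 * l) * (g_total + 3 * I s)) * indicator {0..t} s \<partial>lborel)"
    proof (rule nn_integral_mono)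
      fix s
      show "(\<integral>\<^sup>+\<xi>. ennreal (2 * (P s \<xi> * \<bar>g s \<xi>\<bar>)) \<partial>lborel) * indicator {0..t} s
        \<le> ennreal (En s / (2 * l) * (g_total + 3 * I s)) * indicator {0..t} s"
      proof (cases "s \<in> {0..t}")
        case True
        then have s: "0 \<le> s" "s \<le> t" by auto
        have c0: "0 \<le> En s / (2 * l)" using En_nn(2)[OF s(1)] l_pos by simp
        have "(\<integral>\<^sup>+\<xi>. ennreal (2 * (P s \<xi> * \<bar>g s \<xi>\<bar>)) \<partial>lborel) \<le> (\<integral>\<^sup>+\<xi>. ennreal (En s / (2 * l)) * ennreal \<bar>g s \<xi>\<bar> \<partial>lborel)"
        proof (rule nn_integral_mono)
          fix \<xi>
          have "2 * P s \<xi> \<le> En s / (2 * l)" using P_le_En[OF s(1), of \<xi>] l_pos by (simp add: field_simps)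
          then have "2 * P s \<xi> * \<bar>g s \<xi>\<bar> \<le> En s / (2 * l) * \<bar>g s \<xi>\<bar>" by (rule mult_right_mono) simp
          then show "ennreal (2 * (P s \<xi> * \<bar>g s \<xi>\<bar>)) \<le> ennreal (En s / (2 * l)) * ennreal \<bar>g s \<xi>\<bar>"
            unfolding ennreal_mult[OF c0 abs_ge_zero, symmetric] by (intro ennreal_leI) (simp add: mult.assoc)
        qed
        also have "\<dots> = ennreal (En s / (2 * l)) * (\<integral>\<^sup>+\<xi>. ennreal \<bar>g s \<xi>\<bar> \<partial>lborel)" by (rule nn_integral_cmult) measurable
        also have "\<dots> \<le> ennreal (En s / (2 * l)) * ennreal (g_total + 3 * I s)"
          unfolding I[OF s] by (intro mult_left_mono g_growth s) auto
        also have "\<dots> = ennreal (En s / (2 * l) * (g_total + 3 * I s))"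
          using c0 I0[OF s] g_total_nonneg by (intro ennreal_mult[symmetric]) auto
        finally show ?thesis using True by simp
      qed simp
    qed
    also have "\<dots> = ennreal (integral {0..t} (\<lambda>s. En s / (2 * l) * (g_total + 3 * I s)))"
    proof (rule nn_integral_Icc)
      fix s assume s: "0 \<le> s" "s \<le> t"
      have c0: "0 \<le> En s / (2 * l)" using En_nn(2)[OF s(1)] l_pos by simp
      show "0 \<le> En s / (2 * l) * (g_total + 3 * I s)" using c0 I0[OF s] g_total_nonneg by (intro mult_nonneg_nonneg) auto
      then show "\<bar>En s / (2 * l) * (g_total + 3 * I s)\<bar> \<le> K / (2 * l) * (g_total + 3 * (K * t))"
        unfolding abs_of_nonneg[OF \<open>0 \<le> En s / (2 * l) * (g_total + 3 * I s)\<close>]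
        using c0 I0[OF s] IK[OF s] g_total_nonneg EnK[OF s] l_pos K
        by (intro mult_mono divide_right_mono add_mono mult_left_mono) auto
    qed measurable
    also have "integral {0..t} (\<lambda>s. En s / (2 * l) * (g_total + 3 * I s))
      = (g_total * integral {0..t} En + 3 / 2 * (integral {0..t} En)\<^sup>2) / (2 * l)"
    proof -
      have AC: "AC_on 0 t I En" unfolding AC_on_def
      proof (intro conjI ballI)
        show "En absolutely_integrable_on {0..t}"
          by (rule bounded_Borel_integrable(2)[OF En_meas, where C=K]) (use EnK in auto)
        show "I s = I 0 + integral {0..s} En" if "s \<in> {0..t}" for s using I[of s] I[of 0] that by auto
      qed
      \<comment> \<open>With En as the density of I, the integrand is an exact derivative; 3 En I
        integrates to 3/2 I^2.\<close>
      have "AC_on 0 t (\<lambda>s. 1 / (2 * l) * (g_total * I s + 3 / 2 * (I s * I s))) (\<lambda>s. 1 / (2 * l) * (g_total * En s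
        + 3 / 2 * (En s * I s + I s * En s)))"
        by (intro AC_on_cmult AC_on_add AC_on_mult AC)
      then have "AC_on 0 t (\<lambda>s. 1 / (2 * l) * (g_total * I s + 3 / 2 * (I s * I s))) (\<lambda>s. En s / (2 * l) * (g_total
        + 3 * I s))"
        by (rule AC_on_cong) (simp_all add: algebra_simps add_divide_distrib)
      from AC_onD(3)[OF this t order_refl]
      have "1 / (2 * l) * (g_total * I t + 3 / 2 * (I t * I t))
        = 1 / (2 * l) * (g_total * I 0 + 3 / 2 * (I 0 * I 0)) + integral {0..t} (\<lambda>s. En s / (2 * l) * (g_total + 3 * I s))" .
      moreover have "1 / (2 * l) * (g_total * I 0 + 3 / 2 * (I 0 * I 0)) = 0" using I[OF order_refl t] by simp
      ultimately have "integral {0..t} (\<lambda>s. En s / (2 * l) * (g_total + 3 * I s))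
        = 1 / (2 * l) * (g_total * I t + 3 / 2 * (I t * I t))"
        by linarith
      then show ?thesis unfolding I[OF t order_refl] by (simp add: power2_eq_square)
    qed
    finally show ?thesis .
  qed
  show 1: "(\<integral>\<^sup>+\<xi>. ennreal (eu t \<xi> - eu 0 \<xi>) \<partial>lborel)
    \<le> ennreal ((g_total * integral {0..t} En + 3 / 2 * (integral {0..t} En)\<^sup>2) / (2 * l))"
    using nn_integral_time_bound[OF hm Pg, of t "\<lambda>_. 0" "\<lambda>\<xi>. eu t \<xi> - eu 0 \<xi>"] pt inner by (auto intro: order_trans)
  let ?R = "(g_total * integral {0..t} En + 3 / 2 * (integral {0..t} En)\<^sup>2) / (2 * l)"
  have R0: "0 \<le> ?R" using I0[OF t order_refl] I[OF t order_refl] g_total_nonneg l_pos by simp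
  have "ennreal (En t) \<le> (\<integral>\<^sup>+\<xi>. ennreal (eu 0 \<xi>) + ennreal (eu t \<xi> - eu 0 \<xi>) \<partial>lborel)"
    unfolding En_nn(1)[OF t, symmetric]
  proof (rule nn_integral_mono)
    fix \<xi>
    have "ennreal (e t \<xi>) \<le> ennreal (eu 0 \<xi> + (eu t \<xi> - eu 0 \<xi>))"
      using nonneg_atD(7)[OF nonneg[OF t], of \<xi>] by (intro ennreal_leI) simp
    also have "\<dots> \<le> ennreal (eu 0 \<xi>) + ennreal (eu t \<xi> - eu 0 \<xi>)"
      by (rule ennreal_add_le)
    finally show "ennreal (e t \<xi>) \<le> ennreal (eu 0 \<xi>) + ennreal (eu t \<xi> - eu 0 \<xi>)" .
  qed
  also have "\<dots> = ennreal e_total + (\<integral>\<^sup>+\<xi>. ennreal (eu t \<xi> - eu 0 \<xi>) \<partial>lborel)"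
    by (subst nn_integral_add) (auto simp: eu0_total)
  also have "\<dots> \<le> ennreal e_total + ennreal ?R" using 1 by (intro add_left_mono)
  also have "\<dots> = ennreal (e_total + ?R)" using e_total_nonneg R0 by (simp add: ennreal_plus)
  finally show "En t \<le> e_total + ?R" using e_total_nonneg R0 by (subst (asm) ennreal_le_iff) auto
qed

lemma energy_small:
  assumes s: "small T" and t: "0 \<le> t" "t \<le> T"
  shows "En t \<le> e_total + 1"
    "(\<integral>\<^sup>+\<xi>. ennreal (eu t \<xi> - eu 0 \<xi>) \<partial>lborel) \<le> ennreal (T * (e_total + 1) * (g_total + 3 * T * (e_total + 1)) / (2 * l))"
    "P t \<xi> \<le> (e_total + 1) / (4 * l)"
proof -
  have T: "0 \<le> T" using s by (simp add: small_def)
  obtain K where EnK: "\<And>s. 0 \<le> s \<Longrightarrow> s \<le> T \<Longrightarrow> 0 \<le> En s \<and> En s \<le> K"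
    using En_bounded[OF T] by metis
  note bs = bootstrap[OF En_meas EnK g_total_nonneg e_total_nonneg l_pos T energy_growth(2) _ t]
  show 1: "En t \<le> e_total + 1" using bs(1) s by (simp add: small_def)
  have "(g_total * integral {0..t} En + 3 / 2 * (integral {0..t} En)\<^sup>2) / (2 * l)
    \<le> T * (e_total + 1) * (g_total + 3 * T * (e_total + 1)) / (2 * l)"
    using bs(2) s l_pos by (intro divide_right_mono) (auto simp: small_def)
  then show "(\<integral>\<^sup>+\<xi>. ennreal (eu t \<xi> - eu 0 \<xi>) \<partial>lborel)
    \<le> ennreal (T * (e_total + 1) * (g_total + 3 * T * (e_total + 1)) / (2 * l))"
    using energy_growth(1)[OF t(1)] ennreal_leI order_trans by blast
  have "En t / (4 * l) \<le> (e_total + 1) / (4 * l)" using 1 l_pos by (intro divide_right_mono) auto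
  then show "P t \<xi> \<le> (e_total + 1) / (4 * l)" using P_le_En[OF t(1), of \<xi>] by linarith
qed

section \<open>The regularised unknowns as a Lagrangian flow\<close>

lemma D_bd: assumes t: "0 \<le> t" shows "\<bar>D t \<xi>\<bar> \<le> En t"
proof -
  have "\<bar>LBINT \<eta>. sgn (\<xi> - \<eta>) * (k t \<xi> \<eta> * e t \<eta>)\<bar> \<le> (LBINT \<eta>. \<bar>sgn (\<xi> - \<eta>) * (k t \<xi> \<eta> * e t \<eta>)\<bar>)"
    by (rule integral_abs_bound)
  also have "\<dots> \<le> (LBINT \<eta>. e t \<eta>)"
  proof (rule Bochner_Integration.integral_mono_AE')
    have "\<bar>sgn (\<xi> - \<eta>) * (k t \<xi> \<eta> * e t \<eta>)\<bar> \<le> e t \<eta>" for \<eta>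
    proof -
      have "\<bar>sgn (\<xi> - \<eta>)\<bar> * (k t \<xi> \<eta> * e t \<eta>) \<le> 1 * (1 * e t \<eta>)"
        using k_le1(1,2)[of t \<xi> \<eta>] nonneg_atD(5)[OF nonneg[OF t], of \<eta>]
        by (intro mult_mono) (auto simp: sgn_real_def)
      then show ?thesis using k_le1(2)[of t \<xi> \<eta>] nonneg_atD(5)[OF nonneg[OF t], of \<eta>] by (simp add: abs_mult)
    qed
    then show "AE \<eta> in lborel. \<bar>sgn (\<xi> - \<eta>) * (k t \<xi> \<eta> * e t \<eta>)\<bar> \<le> e t \<eta>" by simp
  qed (use e_int[OF t] nonneg_atD(5)[OF nonneg[OF t]] in auto)
  finally show ?thesis using En_nn(2)[OF t] by (simp add: D_def En_def)
qed

text \<open>On either side of \<zeta> the kernel is an exponential of Z, and a is the density of Z,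
  so k a is l times an exact derivative, with opposite signs on the two sides.\<close>

lemma k_integral:
  assumes t: "0 \<le> t" and xy: "x \<le> y"
  shows "y \<le> \<zeta> \<Longrightarrow> integral {x..y} (\<lambda>s. k t s \<zeta> * a t s) = l * (k t y \<zeta> - k t x \<zeta>)"
    "\<zeta> \<le> x \<Longrightarrow> integral {x..y} (\<lambda>s. k t s \<zeta> * a t s) = l * (k t x \<zeta> - k t y \<zeta>)"
proof -
  obtain Q where "\<And>s \<xi>. 0 \<le> s \<Longrightarrow> s \<le> t \<Longrightarrow> \<bar>a s \<xi>\<bar> \<le> Q" using state_bounded[OF t] by metis
  then have Q: "\<bar>a t \<xi>\<bar> \<le> Q" for \<xi> using t by simp
  have AC: "AC_on x y (Z t) (a t)" unfolding Z_def by (rule AC_on_prim[OF sec_meas(3) Q])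
  note n = nonneg[OF t]
  show "integral {x..y} (\<lambda>s. k t s \<zeta> * a t s) = l * (k t y \<zeta> - k t x \<zeta>)" if "y \<le> \<zeta>"
  proof -
    have k: "k t s \<zeta> = exp ((Z t s - Z t \<zeta>) / l)" if "s \<le> y" for s
      using Z_mono[OF n, of s \<zeta>] that \<open>y \<le> \<zeta>\<close> by (simp add: k_def diff_divide_distrib)
    have "AC_on x y (\<lambda>s. l * exp ((Z t s - Z t \<zeta>) / l)) (\<lambda>s. exp ((Z t s - Z t \<zeta>) / l) * a t s)"
      by (rule AC_on_comp[OF AC, where G="\<lambda>z. l * exp ((z - Z t \<zeta>) / l)" and G'="\<lambda>z. exp ((z - Z t \<zeta>) / l)"])
        (use l_pos in \<open>auto intro!: derivative_eq_intros continuous_intros\<close>)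
    from AC_on_diff[OF this order_refl xy order_refl]
    have "integral {x..y} (\<lambda>s. exp ((Z t s - Z t \<zeta>) / l) * a t s) = l * (k t y \<zeta> - k t x \<zeta>)"
      using k[of x] k[of y] xy by (simp add: right_diff_distrib)
    moreover have "integral {x..y} (\<lambda>s. k t s \<zeta> * a t s) = integral {x..y} (\<lambda>s. exp ((Z t s - Z t \<zeta>) / l) * a t s)"
      by (rule integral_cong) (use k in auto)
    ultimately show ?thesis by simp
  qed
  show "integral {x..y} (\<lambda>s. k t s \<zeta> * a t s) = l * (k t x \<zeta> - k t y \<zeta>)" if "\<zeta> \<le> x"
  proof -
    have k: "k t s \<zeta> = exp ((Z t \<zeta> - Z t s) / l)" if "x \<le> s" for s
      using Z_mono[OF n, of \<zeta> s] that \<open>\<zeta> \<le> x\<close> by (simp add: k_def diff_divide_distrib)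
    have "AC_on x y (\<lambda>s. - l * exp ((Z t \<zeta> - Z t s) / l)) (\<lambda>s. exp ((Z t \<zeta> - Z t s) / l) * a t s)"
      by (rule AC_on_comp[OF AC, where G="\<lambda>z. - l * exp ((Z t \<zeta> - z) / l)" and G'="\<lambda>z. exp ((Z t \<zeta> - z) / l)"])
        (use l_pos in \<open>auto intro!: derivative_eq_intros continuous_intros\<close>)
    from AC_on_diff[OF this order_refl xy order_refl]
    have "integral {x..y} (\<lambda>s. exp ((Z t \<zeta> - Z t s) / l) * a t s) = l * (k t x \<zeta> - k t y \<zeta>)"
      using k[of x] k[of y] xy by (simp add: right_diff_distrib)
    moreover have "integral {x..y} (\<lambda>s. k t s \<zeta> * a t s) = integral {x..y} (\<lambda>s. exp ((Z t \<zeta> - Z t s) / l) * a t s)"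
      by (rule integral_cong) (use k in auto)
    ultimately show ?thesis by simp
  qed
qed

text \<open>Integrated form of D_xi = e / 2 - P a. For each source \<zeta> the integral of k a over
  [\<xi>, \<eta>] is computed exactly, the jump at the source producing the e / 2 term. Integrating
  in \<zeta> against e and exchanging the order gives the integral of P a.\<close>

lemma D_inc:
  assumes t: "0 \<le> t" and le: "\<xi> \<le> \<eta>"
  shows "D t \<eta> - D t \<xi> = integral {\<xi>..\<eta>} (h t)"
proof -
  note n = nonneg[OF t]
  obtain B where "P_bound t B" using P_bounded[OF t] by blast
  then have B0: "0 \<le> B" and B: "\<bar>P t x\<bar> \<le> B" for x using t by (auto simp: P_bound_def)
  obtain Q where "\<And>s \<xi>. 0 \<le> s \<Longrightarrow> s \<le> t \<Longrightarrow>
    \<bar>qb s \<xi>\<bar> \<le> Q \<and> \<bar>q s \<xi>\<bar> \<le> Q \<and> \<bar>a s \<xi>\<bar> \<le> Q \<and> \<bar>g s \<xi>\<bar> \<le> Q \<and> \<bar>e s \<xi>\<bar> \<le> Q \<and> \<bar>eu s \<xi>\<bar> \<le> Q"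
    by (rule state_bounded[OF t]) (rule that)
  then have Qa: "\<bar>a t x\<bar> \<le> Q" and Qe: "\<bar>e t x\<bar> \<le> Q" for x using t by auto
  define F where "F x \<zeta> = sgn (x - \<zeta>) * k t x \<zeta>" for x \<zeta>
  define J where "J \<zeta> = integral {\<xi>..\<eta>} (\<lambda>x. k t x \<zeta> * a t x)" for \<zeta>
  \<comment> \<open>Closed form of \<open>J\<close> off the two endpoints: the 2 on [\<xi>, \<eta>]
    is the jump of the signed kernel across its source.\<close>
  define Jm where "Jm \<zeta> = l * (2 * indicator {\<xi>..\<eta>} \<zeta> - (F \<eta> \<zeta> - F \<xi> \<zeta>))" for \<zeta>
  have [measurable]: "F x \<in> borel_measurable borel" for x unfolding F_def by measurable
  have kab: "\<bar>k t x \<zeta> * a t x\<bar> \<le> Q" for x \<zeta>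
    using mult_mono[of "k t x \<zeta>" 1 "\<bar>a t x\<bar>" Q] k_le1(1,2)[of t x \<zeta>] Qa[of x] by (simp add: abs_mult)
  have kai: "(\<lambda>x. k t x \<zeta> * a t x) integrable_on {x..y}" for \<zeta> x y
    by (rule bounded_Borel_integrable(3)[where C=Q]) (use kab in auto)
  have J0: "0 \<le> J \<zeta>" for \<zeta> unfolding J_def
    by (rule integral_nonneg[OF kai]) (use k_le1(2) nonneg_atD(4)[OF n] in auto)
  have JJ: "J \<zeta> = Jm \<zeta>" if ne: "\<zeta> \<noteq> \<xi>" "\<zeta> \<noteq> \<eta>" for \<zeta>
  proof -
    consider "\<zeta> < \<xi>" | "\<eta> < \<zeta>" | "\<xi> < \<zeta>" "\<zeta> < \<eta>" using ne by linarith
    then show ?thesis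
    proof cases
      case 1 then show ?thesis using k_integral(2)[OF t le, of \<zeta>] le by (simp add: J_def Jm_def F_def)
    next
      case 2 then show ?thesis using k_integral(1)[OF t le, of \<zeta>] le by (simp add: J_def Jm_def F_def)
    next
      case 3
      have kz: "k t \<zeta> \<zeta> = 1" by (simp add: k_def)
      have "J \<zeta> = integral {\<xi>..\<zeta>} (\<lambda>x. k t x \<zeta> * a t x) + integral {\<zeta>..\<eta>} (\<lambda>x. k t x \<zeta> * a t x)"
        unfolding J_def by (rule Henstock_Kurzweil_Integration.integral_combine[symmetric]) (use 3 kai in auto)
      also have "\<dots> = l * (1 - k t \<xi> \<zeta>) + l * (1 - k t \<eta> \<zeta>)"
        using k_integral(1)[OF t, of \<xi> \<zeta> \<zeta>] k_integral(2)[OF t, of \<zeta> \<eta> \<zeta>] 3 kz by simp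
      also have "\<dots> = Jm \<zeta>" using 3 by (simp add: Jm_def F_def algebra_simps)
      finally show ?thesis .
    qed
  qed
  have AEJ: "AE \<zeta> in lborel. J \<zeta> = Jm \<zeta>"
  proof -
    have "AE x in lborel. x \<noteq> \<xi>" "AE x in lborel. x \<noteq> \<eta>" by (rule AE_lborel_singleton)+
    then show ?thesis by eventually_elim (rule JJ)
  qed
  have Fi: "integrable lborel (\<lambda>\<zeta>. F x \<zeta> * e t \<zeta>)" for x
    by (rule Bochner_Integration.integrable_bound[OF ke_int[OF t, of x]]) (auto simp: F_def abs_mult sgn_real_def)
  have ei: "integrable lborel (\<lambda>\<zeta>. indicator {\<xi>..\<eta>} \<zeta> * e t \<zeta>)"
    using integrable_mult_indicator[OF _ e_int[OF t], of "{\<xi>..\<eta>}"] by simp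
  have Jme: "Jm \<zeta> * e t \<zeta> = l * (2 * (indicator {\<xi>..\<eta>} \<zeta> * e t \<zeta>) - (F \<eta> \<zeta> * e t \<zeta> - F \<xi> \<zeta> * e t \<zeta>))" for \<zeta>
    by (simp add: Jm_def algebra_simps)
  have Ji: "integrable lborel (\<lambda>\<zeta>. Jm \<zeta> * e t \<zeta>)"
    unfolding Jme by (intro integrable_mult_right Bochner_Integration.integrable_diff Fi ei)
  have DF: "D t x = 1 / 4 * (LBINT \<zeta>. F x \<zeta> * e t \<zeta>)" for x by (simp add: D_def F_def mult.assoc)
  have eI: "(LBINT \<zeta>. indicator {\<xi>..\<eta>} \<zeta> * e t \<zeta>) = integral {\<xi>..\<eta>} (e t)"
    using bounded_Borel_integrable(4)[OF sec_meas(5) Qe, of \<xi> \<eta>] by (simp add: set_lebesgue_integral_def)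
  have "(LBINT \<zeta>. Jm \<zeta> * e t \<zeta>) = l * (2 * integral {\<xi>..\<eta>} (e t) - 4 * (D t \<eta> - D t \<xi>))"
    unfolding Jme DF eI[symmetric] using Fi ei by simp
  moreover have "(LBINT \<zeta>. Jm \<zeta> * e t \<zeta>) = 4 * l * integral {\<xi>..\<eta>} (\<lambda>x. P t x * a t x)"
  proof -
    have nn: "AE \<zeta> in lborel. 0 \<le> Jm \<zeta> * e t \<zeta>"
      using AEJ by eventually_elim (use J0 nonneg_atD(5)[OF n] in \<open>metis mult_nonneg_nonneg\<close>)
    let ?w = "\<lambda>x. indicator {\<xi>..\<eta>} x * a t x"
    have w: "?w \<in> borel_measurable borel" "\<And>x. 0 \<le> ?w x" using nonneg_atD(4)[OF n] by auto
    have Pab: "\<bar>P t x * a t x\<bar> \<le> B * Q" for x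
      unfolding abs_mult by (rule mult_mono[OF B Qa B0]) simp
    have I0: "0 \<le> integral {\<xi>..\<eta>} (\<lambda>x. P t x * a t x)"
      by (rule integral_nonneg[OF bounded_Borel_integrable(3)[where C="B * Q"]])
        (use Pab nonneg_atD(4,9)[OF n] in auto)
    have "ennreal (LBINT \<zeta>. Jm \<zeta> * e t \<zeta>) = (\<integral>\<^sup>+\<zeta>. ennreal (Jm \<zeta> * e t \<zeta>) \<partial>lborel)"
      by (rule nn_integral_eq_integral[OF Ji nn, symmetric])
    also have "\<dots> = (\<integral>\<^sup>+\<zeta>. ennreal (e t \<zeta>) * (\<integral>\<^sup>+x. ennreal (k t x \<zeta> * ?w x) \<partial>lborel) \<partial>lborel)"
    proof (rule nn_integral_cong_AE)
      show "AE \<zeta> in lborel. ennreal (Jm \<zeta> * e t \<zeta>) = ennreal (e t \<zeta>) * (\<integral>\<^sup>+x. ennreal (k t x \<zeta> * ?w x) \<partial>lborel)"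
        using AEJ
      proof eventually_elim
        case (elim \<zeta>)
        have "(\<integral>\<^sup>+x. ennreal (k t x \<zeta> * ?w x) \<partial>lborel) = (\<integral>\<^sup>+x. ennreal (k t x \<zeta> * a t x) * indicator {\<xi>..\<eta>} x \<partial>lborel)"
          by (intro nn_integral_cong) (auto simp: indicator_def)
        also have "\<dots> = ennreal (J \<zeta>)" unfolding J_def
          by (rule nn_integral_Icc[where C=Q]) (use kab k_le1(2) nonneg_atD(4)[OF n] in auto)
        finally show ?case using elim ennreal_mult[OF nonneg_atD(5)[OF n, of \<zeta>] J0[of \<zeta>]] by (simp add: mult.commute)
      qed
    qed
    also have "\<dots> = ennreal (4 * l) * (ennreal (1 / (4 * l)) * \<dots>)"
      using l_pos by (simp add: mult.assoc[symmetric] flip: ennreal_mult)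
    also have "\<dots> = ennreal (4 * l) * (\<integral>\<^sup>+x. ennreal (P t x * ?w x) \<partial>lborel)"
      unfolding P_weighted[OF n w] ..
    also have "(\<integral>\<^sup>+x. ennreal (P t x * ?w x) \<partial>lborel) = (\<integral>\<^sup>+x. ennreal (P t x * a t x) * indicator {\<xi>..\<eta>} x \<partial>lborel)"
      by (intro nn_integral_cong) (auto simp: indicator_def)
    also have "\<dots> = ennreal (integral {\<xi>..\<eta>} (\<lambda>x. P t x * a t x))"
      by (rule nn_integral_Icc[where C="B * Q"]) (use Pab nonneg_atD(4,9)[OF n] in auto)
    also have "ennreal (4 * l) * ennreal (integral {\<xi>..\<eta>} (\<lambda>x. P t x * a t x))
      = ennreal (4 * l * integral {\<xi>..\<eta>} (\<lambda>x. P t x * a t x))"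
      by (rule ennreal_mult[symmetric]) (use l_pos I0 in auto)
    finally show ?thesis
      using l_pos I0 integral_nonneg_AE[OF nn] by (subst (asm) ennreal_inj) auto
  qed
  ultimately have "l * (2 * integral {\<xi>..\<eta>} (e t) - 4 * (D t \<eta> - D t \<xi>)) = 4 * l * integral {\<xi>..\<eta>} (\<lambda>x. P t x * a t x)"
    by (rule trans[OF sym])
  then have "l * (2 * integral {\<xi>..\<eta>} (e t) - 4 * (D t \<eta> - D t \<xi>)) = l * (4 * integral {\<xi>..\<eta>} (\<lambda>x. P t x * a t x))"
    by (simp only: ac_simps)
  then have "2 * integral {\<xi>..\<eta>} (e t) - 4 * (D t \<eta> - D t \<xi>) = 4 * integral {\<xi>..\<eta>} (\<lambda>x. P t x * a t x)"
    using l_pos by simp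
  moreover have "integral {\<xi>..\<eta>} (h t) = integral {\<xi>..\<eta>} (e t) / 2 - integral {\<xi>..\<eta>} (\<lambda>x. P t x * a t x)"
  proof -
    have 1: "(\<lambda>x. e t x / 2) integrable_on {\<xi>..\<eta>}"
      using bounded_Borel_integrable(3)[OF sec_meas(5) Qe, of \<xi> \<eta>] by (intro integrable_on_divide)
    have Pab: "\<bar>P t x * a t x\<bar> \<le> B * Q" for x unfolding abs_mult by (rule mult_mono[OF B Qa B0]) simp
    have 2: "(\<lambda>x. P t x * a t x) integrable_on {\<xi>..\<eta>}"
      by (rule bounded_Borel_integrable(3)[where C="B * Q"]) (use Pab in auto)
    have "h t = (\<lambda>x. e t x / 2 - P t x * a t x)" by (auto simp: h_def)
    then show ?thesis using Henstock_Kurzweil_Integration.integral_diff[OF 1 2] by simp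
  qed
  ultimately show ?thesis by simp
qed

text \<open>The constant is explicit so that B and E alone decide about uniformity in l: exp ((1 / 2
  + B) T) bounds q, hence a, g and e, and the factor 2 + B covers h = e / 2 - P a.\<close>

lemma flow:
  assumes PB: "P_bound T B" and T: "0 \<le> T" and E: "\<And>t. 0 \<le> t \<Longrightarrow> t \<le> T \<Longrightarrow> En t \<le> E"
  shows "lagrangian_flow T ((2 + B) * exp ((1 / 2 + B) * T) + E + \<bar>ub0 0\<bar> + g_total) E a g e h D ub0 y0"
proof -
  let ?Q = "exp ((1 / 2 + B) * T)"
  let ?C = "(2 + B) * ?Q + E + \<bar>ub0 0\<bar> + g_total"
  have B0: "0 \<le> B" and B: "\<And>s \<xi>. 0 \<le> s \<Longrightarrow> s \<le> T \<Longrightarrow> \<bar>P s \<xi>\<bar> \<le> B" using PB by (auto simp: P_bound_def)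
  have E0: "0 \<le> E" using E[OF order_refl T] En_nn(2)[of 0] by simp
  have Q0: "0 \<le> ?Q" by simp
  have qQ: "\<bar>qb t \<xi>\<bar> \<le> ?Q" if t: "0 \<le> t" "t \<le> T" for t \<xi>
  proof -
    have "q t \<xi> \<le> exp ((1 / 2 + B) * t)" by (rule q_exp_bounds(2)[OF PB t])
    also have "\<dots> \<le> ?Q" using t B0 by (simp add: mult_left_mono)
    finally show ?thesis using nonneg_atD(2)[OF nonneg[OF t(1)], of \<xi>] by (simp add: qb_def qbar_def)
  qed
  have trig: "\<bar>(cos x)\<^sup>2\<bar> \<le> 1" "\<bar>(sin x)\<^sup>2\<bar> \<le> 1" "\<bar>sin x * cos x\<bar> \<le> 1" for x :: real
    using abs_cos_le_one[of x] abs_sin_le_one[of x]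
    by (auto simp: abs_square_le_1 abs_mult intro!: mult_le_one)
  have m: "\<bar>x * y\<bar> \<le> ?Q" if "\<bar>x\<bar> \<le> ?Q" "\<bar>y\<bar> \<le> 1" for x y
    using mult_mono[OF that Q0] by (simp add: abs_mult)
  have bd: "\<bar>a t \<xi>\<bar> \<le> ?Q" "\<bar>g t \<xi>\<bar> \<le> ?Q" "\<bar>e t \<xi>\<bar> \<le> ?Q" if "0 \<le> t" "t \<le> T" for t \<xi>
    unfolding a_def g_def e_def by (intro m qQ[OF that] trig)+
  have QC: "?Q \<le> ?C"
  proof -
    have "1 * ?Q \<le> (2 + B) * ?Q" using B0 by (intro mult_right_mono) auto
    then show ?thesis using E0 g_total_nonneg unfolding mult_1 by linarith
  qed
  have QB: "0 \<le> (2 + B) * ?Q" using B0 by (intro mult_nonneg_nonneg) auto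
  \<comment> \<open>The initial densities are identified off the null set N, and the increments of
    y0 and ub0 see them only through integrals.\<close>
  have spike: "integral {\<xi>..\<eta>} f = integral {\<xi>..\<eta>} f'" if "\<And>x. x \<notin> N \<Longrightarrow> f x = f' x" for f f' :: "real \<Rightarrow> real" and \<xi> \<eta>
  proof -
    have "N \<in> null_sets lebesgue" using N_null by (rule null_sets_completionI)
    then have "negligible N" by (simp add: negligible_iff_null_sets)
    then show ?thesis by (rule integral_spike) (use that in auto)
  qed
  show ?thesis
  proof
    fix t \<xi> assume t: "0 \<le> t" "t \<le> T"
    show "\<bar>D t \<xi>\<bar> \<le> ?C" using D_bd[OF t(1), of \<xi>] E[OF t] QB g_total_nonneg by linarith
    show "\<bar>h t \<xi>\<bar> \<le> ?C"
    proof -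
      have "\<bar>P t \<xi> * a t \<xi>\<bar> \<le> B * ?Q" unfolding abs_mult
        by (rule mult_mono[OF B[OF t] bd(1)[OF t] B0]) simp
      moreover have "\<bar>e t \<xi> / 2\<bar> \<le> ?Q" using bd(3)[OF t, of \<xi>] by simp
      ultimately have "\<bar>h t \<xi>\<bar> \<le> B * ?Q + ?Q" unfolding h_def by linarith
      also have "\<dots> \<le> (2 + B) * ?Q" by (simp add: distrib_right)
      finally show ?thesis using E0 g_total_nonneg by linarith
    qed
    show "\<bar>g t \<xi>\<bar> \<le> ?C" "\<bar>a t \<xi>\<bar> \<le> ?C" using bd[OF t, of \<xi>] QC by linarith+
    show "g t \<xi> = g 0 \<xi> + integral {0..t} (\<lambda>s. h s \<xi>)" by (rule AC_onD(3)[OF g_AC[OF t(1)] t(1) order_refl])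
    show "a t \<xi> = a 0 \<xi> + integral {0..t} (\<lambda>s. g s \<xi>)" by (rule AC_onD(3)[OF a_AC[OF t(1)] t(1) order_refl])
    show "(g t \<xi>)\<^sup>2 \<le> a t \<xi> * e t \<xi>" by (simp add: g_sq)
  next
    show "\<bar>ub0 \<xi>\<bar> \<le> ?C" for \<xi> using ub0_bd[of \<xi>] QB E0 by linarith
    show "y0 \<eta> - y0 \<xi> = integral {\<xi>..\<eta>} (a 0)" if "\<xi> \<le> \<eta>" for \<xi> \<eta>
      unfolding y0_inc[OF that] by (rule spike) (simp add: initial_values)
    show "ub0 \<eta> - ub0 \<xi> = integral {\<xi>..\<eta>} (g 0)" if "\<xi> \<le> \<eta>" for \<xi> \<eta>
      unfolding ub0_inc[OF that] by (rule spike) (simp add: initial_values)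
  qed (use T nonneg_atD nonneg e_int E D_inc y0_surj meas D_meas h_meas in \<open>auto simp: En_def\<close>)
qed

end

section \<open>Death times with and without pressure\<close>

context regularized
begin

text \<open>Both terms of the right-hand side are nonpositive once the pressure is known to be
  nonnegative.\<close>

lemma v_antimono: assumes "0 \<le> s" "s \<le> t" shows "v t \<xi> \<le> v s \<xi>"
proof -
  have t: "0 \<le> t" using assms by simp
  have "v t \<xi> - v s \<xi> = integral {s..t} (\<lambda>s. v_rhs l (v s) (q s) \<xi>)"
    using AC_on_diff[OF v_ode[OF t] assms order_refl] .
  also have "\<dots> \<le> integral {s..t} (\<lambda>_. 0)"
  proof (rule integral_le)
    show "(\<lambda>s. v_rhs l (v s) (q s) \<xi>) integrable_on {s..t}"
      by (rule AC_onD(2)[OF AC_on_subset[OF v_ode[OF t] assms order_refl]])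
    fix r assume "r \<in> {s..t}"
    then have r: "0 \<le> r" using assms by auto
    have "0 \<le> P r \<xi> * (2 * (cos (v r \<xi> / 2))\<^sup>2)" using nonneg_atD(9)[OF nonneg[OF r], of \<xi>]
      by (intro mult_nonneg_nonneg) auto
    then have "- P r \<xi> * (2 * (cos (v r \<xi> / 2))\<^sup>2) - (sin (v r \<xi> / 2))\<^sup>2 \<le> 0"
      using zero_le_power2[of "sin (v r \<xi> / 2)"] by linarith
    then show "v_rhs l (v r) (q r) \<xi> \<le> 0" unfolding rhs_eq[OF r] by simp
  qed auto
  finally show ?thesis by simp
qed

text \<open>For \<open>w0 \<xi> < 0\<close> the function \<open>cot (v / 2) = 1 / u\<^sub>x\<close> solves a Riccati equation that is regular through the
  blow-up \<open>v = -\<pi>\<close>; this locates the blow-up time.\<close>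

lemma cot_equation:
  assumes \<xi>: "\<xi> \<notin> N" and w: "w0 \<xi> < 0" and t: "0 \<le> t"
  shows "(\<lambda>s. if v s \<xi> > - pi then 1 / 2 + P s \<xi> * (cos (v s \<xi> / 2) / sin (v s \<xi> / 2))\<^sup>2 else 0) integrable_on {0..t}"
    "cos (v t \<xi> / 2) / sin (v t \<xi> / 2) = 1 / w0 \<xi> + integral {0..t} (\<lambda>s. if v s \<xi> > - pi then 1 / 2 + P s \<xi> * (cos
      (v s \<xi> / 2) / sin (v s \<xi> / 2))\<^sup>2 else 0)"
    "1 / w0 \<xi> \<le> cos (v t \<xi> / 2) / sin (v t \<xi> / 2)" "cos (v t \<xi> / 2) / sin (v t \<xi> / 2) \<le> 0"
    "v t \<xi> > - pi \<Longrightarrow> cos (v t \<xi> / 2) / sin (v t \<xi> / 2) < 0"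
proof -
  have v0: "v 0 \<xi> = 2 * arctan (w0 \<xi>)" by (rule v_init[OF \<xi>])
  have v0n: "v 0 \<xi> < 0" using w unfolding v0 by simp
  have rng: "- (pi / 2) \<le> v s \<xi> / 2" "v s \<xi> / 2 < 0" if "0 \<le> s" for s
    using v_ge[OF that, of \<xi>] v_antimono[OF order_refl that, of \<xi>] v0n by auto
  have sn: "sin (v s \<xi> / 2) < 0" if "0 \<le> s" for s
  proof -
    have "0 < sin (- (v s \<xi> / 2))" by (rule sin_gt_zero) (use rng[OF that] pi_gt_zero in linarith)+
    then show ?thesis unfolding sin_minus by simp
  qed
  have cs: "0 \<le> cos (v s \<xi> / 2)" if "0 \<le> s" for s
    by (rule cos_ge_zero) (use rng[OF that] pi_gt_zero in linarith)+
  define J where "J s = (if v s \<xi> > - pi then 1 / 2 + P s \<xi> * (cos (v s \<xi> / 2) / sin (v s \<xi> / 2))\<^sup>2 else 0)" for s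
  \<comment> \<open>Only sin (v / 2) stands in the denominator, and it stays negative for -pi \<le>
    v < 0, so nothing degenerates at death.\<close>
  have "AC_on 0 t (\<lambda>s. cos (v s \<xi> / 2) / sin (v s \<xi> / 2)) (\<lambda>s. (- (1 / 2) / (sin (v s \<xi> / 2))\<^sup>2) * v_rhs l (v s) (q s) \<xi>)"
  proof (rule AC_on_comp[OF v_ode[OF t], where G="\<lambda>x. cos (x / 2) / sin (x / 2)" and G'="\<lambda>x. - (1 / 2) / (sin (x / 2))\<^sup>2"])
    fix x assume "x \<in> (\<lambda>t. v t \<xi>) ` {0..t}"
    then have s: "sin (x / 2) \<noteq> 0" using sn by force
    have "((\<lambda>x. cos (x / 2) / sin (x / 2)) has_real_derivative
       ((- sin (x / 2) * (1 / 2)) * sin (x / 2) - cos (x / 2) * (cos (x / 2) * (1 / 2))) / (sin (x / 2) * sin (x /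
         2))) (at x)"
      using s by (auto intro!: derivative_eq_intros)
    moreover have "(- sin (x / 2) * (1 / 2)) * sin (x / 2) - cos (x / 2) * (cos (x / 2) * (1 / 2)) = - (1 / 2)"
      using sin_cos_squared_add[of "x / 2"] by (simp add: power2_eq_square)
    ultimately show "((\<lambda>x. cos (x / 2) / sin (x / 2)) has_real_derivative - (1 / 2) / (sin (x / 2))\<^sup>2) (at x)"
      by (simp add: power2_eq_square)
  next
    show "continuous_on ((\<lambda>t. v t \<xi>) ` {0..t}) (\<lambda>x. - (1 / 2) / (sin (x / 2))\<^sup>2)"
      using sn by (intro continuous_intros) force+
  qed
  then have AC: "AC_on 0 t (\<lambda>s. cos (v s \<xi> / 2) / sin (v s \<xi> / 2)) J"
  proof (rule AC_on_cong)
    fix s assume s: "0 \<le> s" "s \<le> t"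
    have "sin (v s \<xi> / 2) \<noteq> 0" using sn[OF s(1)] by simp
    then show "(- (1 / 2) / (sin (v s \<xi> / 2))\<^sup>2) * v_rhs l (v s) (q s) \<xi> = J s"
      unfolding rhs_eq[OF s(1)] J_def by (simp add: power_divide field_simps)
  qed simp
  have J0: "0 \<le> J s" if "0 \<le> s" for s unfolding J_def using nonneg_atD(9)[OF nonneg[OF that], of \<xi>] by auto
  show i: "(\<lambda>s. if v s \<xi> > - pi then 1 / 2 + P s \<xi> * (cos (v s \<xi> / 2) / sin (v s \<xi> / 2))\<^sup>2 else 0) integrable_on {0..t}"
    using AC_onD(2)[OF AC] by (simp add: J_def[abs_def])
  have c0: "cos (v 0 \<xi> / 2) / sin (v 0 \<xi> / 2) = 1 / w0 \<xi>"
    unfolding v0 using w w_pos[of \<xi>] by (simp add: cos_arctan sin_arctan)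
  have eq: "cos (v t \<xi> / 2) / sin (v t \<xi> / 2) = 1 / w0 \<xi> + integral {0..t} J"
    using AC_onD(3)[OF AC t order_refl] unfolding c0 .
  then show "cos (v t \<xi> / 2) / sin (v t \<xi> / 2)
    = 1 / w0 \<xi> + integral {0..t} (\<lambda>s. if v s \<xi> > - pi then 1 / 2 + P s \<xi> * (cos (v s \<xi> / 2) / sin (v s \<xi> / 2))\<^sup>2 else 0)"
    by (simp add: J_def[abs_def])
  have "0 \<le> integral {0..t} J" by (rule integral_nonneg[OF AC_onD(2)[OF AC]]) (use J0 in auto)
  then show "1 / w0 \<xi> \<le> cos (v t \<xi> / 2) / sin (v t \<xi> / 2)" using eq by linarith
  show "cos (v t \<xi> / 2) / sin (v t \<xi> / 2) \<le> 0" using cs[OF t] sn[OF t] by (simp add: divide_nonneg_neg)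
  show "cos (v t \<xi> / 2) / sin (v t \<xi> / 2) < 0" if "v t \<xi> > - pi"
  proof -
    have "0 < cos (v t \<xi> / 2)" by (rule cos_gt_zero_pi) (use that rng[OF t] pi_gt_zero in linarith)+
    then show ?thesis using sn[OF t] by (simp add: divide_pos_neg)
  qed
qed

text \<open>Pressure only hastens death: for w0 < 0 the cotangent of v / 2 starts at 1 / w0 and
  grows at least at the rate 1/2 while the particle lives, so it reaches 0 no later than at the
  limit death time -2 / w0.\<close>

lemma dead_if_limit_dead:
  assumes \<xi>: "\<xi> \<notin> N" and t: "0 \<le> t" and d: "\<not> alive t \<xi>"
  shows "v t \<xi> = - pi"
proof (rule ccontr)
  assume "v t \<xi> \<noteq> - pi"
  then have vt: "v t \<xi> > - pi" using v_ge[OF t, of \<xi>] by simp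
  have w: "w0 \<xi> < 0"
  proof (rule ccontr)
    assume "\<not> w0 \<xi> < 0"
    then have "0 \<le> w0 \<xi> / 2 * t" using t by simp
    then show False using d unfolding alive_def by linarith
  qed
  note c = cot_equation[OF \<xi> w t]
  have "integral {0..t} (\<lambda>_. 1 / 2) \<le> integral {0..t} (\<lambda>s. if v s \<xi> > - pi then 1 / 2 + P s \<xi> * (cos (v s \<xi> / 2) /
    sin (v s \<xi> / 2))\<^sup>2 else 0)"
  proof (rule integral_le[OF _ c(1)])
    fix s assume "s \<in> {0..t}"
    then have s: "0 \<le> s" "s \<le> t" by auto
    have "v s \<xi> > - pi" using v_antimono[OF s, of \<xi>] vt by simp
    then show "1 / 2 \<le> (if v s \<xi> > - pi then 1 / 2 + P s \<xi> * (cos (v s \<xi> / 2) / sin (v s \<xi> / 2))\<^sup>2 else 0)"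
      using nonneg_atD(9)[OF nonneg[OF s(1)], of \<xi>] by simp
  qed auto
  then have "1 / w0 \<xi> + t / 2 < 0" using c(2) c(5)[OF vt] t by simp
  then have "0 < w0 \<xi> * (1 / w0 \<xi> + t / 2)" using w by (rule mult_neg_neg[OF _, rotated])
  then have "alive t \<xi>" using w by (simp add: alive_def distrib_left)
  then show False using d by simp
qed

text \<open>Under \<open>small\<close> these bound the pressure and q on [0, T]:
  \<open>\<epsilon>\<close> is of order 1/l, while in the exponent of \<open>QT\<close> the pressure
  is replaced by e_total + 1 to remove l.\<close>

definition \<epsilon> :: real where "\<epsilon> = (e_total + 1) / (4 * l)"
definition QT :: "real \<Rightarrow> real" where "QT T = exp ((1 / 2 + (e_total + 1)) * T)"

lemma small_bounds:
  assumes s: "small T"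
  shows "P_bound T (e_total + 1)" "\<And>t \<xi>. 0 \<le> t \<Longrightarrow> t \<le> T \<Longrightarrow> P t \<xi> \<le> \<epsilon>" "0 \<le> \<epsilon>"
    "\<And>t \<xi>. 0 \<le> t \<Longrightarrow> t \<le> T \<Longrightarrow> 0 \<le> qb t \<xi> \<and> qb t \<xi> \<le> QT T" "\<And>t \<xi>. 0 \<le> t \<Longrightarrow> t \<le> T \<Longrightarrow> \<bar>a t \<xi>\<bar> \<le> QT T"
    "\<And>t \<xi>. 0 \<le> t \<Longrightarrow> t \<le> T \<Longrightarrow> \<bar>g t \<xi>\<bar> \<le> QT T"
proof -
  have l1: "1 \<le> l" using s by (simp add: small_def)
  show Pe: "P t \<xi> \<le> \<epsilon>" if "0 \<le> t" "t \<le> T" for t \<xi> unfolding \<epsilon>_def by (rule energy_small(3)[OF s that])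
  show e0: "0 \<le> \<epsilon>" using e_total_nonneg l_pos by (simp add: \<epsilon>_def)
  have "(e_total + 1) * 1 \<le> (e_total + 1) * (4 * l)" using l1 e_total_nonneg by (intro mult_left_mono) auto
  then have eE: "\<epsilon> \<le> e_total + 1" using l1 by (simp add: \<epsilon>_def divide_le_eq)
  show PB: "P_bound T (e_total + 1)"
    unfolding P_bound_def
  proof (intro conjI ballI allI)
    fix t \<xi> assume "t \<in> {0..T}"
    then show "\<bar>P t \<xi>\<bar> \<le> e_total + 1" using Pe[of t \<xi>] eE nonneg_atD(9)[OF nonneg[of t], of \<xi>] by auto
  qed (use e_total_nonneg in auto)
  show Q: "0 \<le> qb t \<xi> \<and> qb t \<xi> \<le> QT T" if t: "0 \<le> t" "t \<le> T" for t \<xi>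
  proof -
    have "q t \<xi> \<le> exp ((1 / 2 + (e_total + 1)) * t)" by (rule q_exp_bounds(2)[OF PB t])
    also have "\<dots> \<le> QT T" unfolding QT_def using t e_total_nonneg by (simp add: mult_left_mono)
    finally show ?thesis using nonneg_atD(3)[OF nonneg[OF t(1)], of \<xi>] by (auto simp: qb_def qbar_def QT_def)
  qed
  have trig: "\<bar>(cos x)\<^sup>2\<bar> \<le> 1" "\<bar>sin x * cos x\<bar> \<le> 1" for x :: real
    using abs_cos_le_one[of x] abs_sin_le_one[of x]
    by (auto simp: abs_square_le_1 abs_mult intro!: mult_le_one)
  have m: "\<bar>x * y\<bar> \<le> QT T" if "0 \<le> x \<and> x \<le> QT T" "\<bar>y\<bar> \<le> 1" for x y
    using mult_mono[of x "QT T" "\<bar>y\<bar>" 1] that by (simp add: abs_mult)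
  show "\<bar>a t \<xi>\<bar> \<le> QT T" "\<bar>g t \<xi>\<bar> \<le> QT T" if "0 \<le> t" "t \<le> T" for t \<xi>
    unfolding a_def g_def by (intro m Q[OF that] trig)+
qed

text \<open>The opposite comparison, for a fixed particle. With w0 < 0 the cotangent stays in
  [1 / w0, 0], so its rate is at most 1/2 + \<epsilon> / w0^2 and \<open>c2\<close> keeps it
  negative. With w0 \<ge> 0 one has g \<ge> - \<epsilon> QT T, and \<open>c1\<close> keeps a
  positive, whereas a vanishes at death.\<close>

lemma alive_if_small:
  assumes s: "small T" and \<xi>: "\<xi> \<notin> N" and t: "0 \<le> t" "t \<le> T"
    and c1: "\<epsilon> * QT T * T * T < 1 / (1 + (w0 \<xi>)\<^sup>2)"
    and c2: "w0 \<xi> < 0 \<Longrightarrow> (1 / 2 + \<epsilon> / (w0 \<xi>)\<^sup>2) * t < - 1 / w0 \<xi>"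
  shows "v t \<xi> > - pi"
proof (rule ccontr)
  assume "\<not> v t \<xi> > - pi"
  then have vt: "v t \<xi> = - pi" using v_ge[OF t(1), of \<xi>] by simp
  note b = small_bounds[OF s]
  show False
  proof (cases "w0 \<xi> < 0")
    case True
    note c = cot_equation[OF \<xi> True]
    have "integral {0..t} (\<lambda>s. if v s \<xi> > - pi then 1 / 2 + P s \<xi> * (cos (v s \<xi> / 2) / sin (v s \<xi> / 2))\<^sup>2 else 0)
      \<le> integral {0..t} (\<lambda>_. 1 / 2 + \<epsilon> / (w0 \<xi>)\<^sup>2)"
    proof (rule integral_le[OF c(1)[OF t(1)]])
      fix s assume "s \<in> {0..t}"
      then have s: "0 \<le> s" "s \<le> T" using t by auto
      have "(cos (v s \<xi> / 2) / sin (v s \<xi> / 2))\<^sup>2 \<le> (1 / w0 \<xi>)\<^sup>2"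
        unfolding abs_le_square_iff[symmetric] using c(3,4)[OF s(1)] True by simp
      then have "P s \<xi> * (cos (v s \<xi> / 2) / sin (v s \<xi> / 2))\<^sup>2 \<le> \<epsilon> * (1 / w0 \<xi>)\<^sup>2"
        using b(2)[OF s, of \<xi>] b(3) by (intro mult_mono) auto
      moreover have "0 \<le> \<epsilon> / (w0 \<xi>)\<^sup>2" using b(3) by simp
      ultimately show "(if v s \<xi> > - pi then 1 / 2 + P s \<xi> * (cos (v s \<xi> / 2) / sin (v s \<xi> / 2))\<^sup>2 else 0)
        \<le> 1 / 2 + \<epsilon> / (w0 \<xi>)\<^sup>2"
        by (simp add: power_divide)
    qed auto
    also have "\<dots> = (1 / 2 + \<epsilon> / (w0 \<xi>)\<^sup>2) * t" using t by (simp add: mult.commute)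
    finally have "cos (v t \<xi> / 2) / sin (v t \<xi> / 2) < 0" using c(2)[OF t(1)] c2[OF True] by simp
    then show False unfolding vt by simp
  next
    case False
    have Pa: "\<bar>P s \<xi> * a s \<xi>\<bar> \<le> \<epsilon> * QT T" if s: "0 \<le> s" "s \<le> T" for s
      unfolding abs_mult using b(2)[OF s, of \<xi>] b(3) b(5)[OF s, of \<xi>] nonneg_atD(9)[OF nonneg[OF s(1)], of \<xi>]
      by (intro mult_mono) auto
    have g_low: "- (\<epsilon> * QT T * T) \<le> g r \<xi>" if r: "0 \<le> r" "r \<le> T" for r
    proof -
      have "integral {0..r} (\<lambda>_. - (\<epsilon> * QT T)) \<le> integral {0..r} (\<lambda>s. h s \<xi>)"
      proof (rule integral_le)
        show "(\<lambda>s. h s \<xi>) integrable_on {0..r}" by (rule AC_onD(2)[OF g_AC[OF r(1)]])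
        fix s assume "s \<in> {0..r}"
        then have s: "0 \<le> s" "s \<le> T" using r by auto
        show "- (\<epsilon> * QT T) \<le> h s \<xi>"
          using Pa[OF s] nonneg_atD(5)[OF nonneg[OF s(1)], of \<xi>] unfolding h_def by linarith
      qed auto
      moreover have "integral {0..r} (\<lambda>_. - (\<epsilon> * QT T)) = - (\<epsilon> * QT T * r)" using r by (simp add: mult.commute)
      moreover have "\<epsilon> * QT T * r \<le> \<epsilon> * QT T * T" using r b(3) by (intro mult_left_mono) (auto simp: QT_def)
      moreover have "0 \<le> g 0 \<xi>" using False w_pos[of \<xi>] initial_values(2)[OF \<xi>] by simp
      ultimately show ?thesis using AC_onD(3)[OF g_AC[OF r(1)] r(1) order_refl, of \<xi>] by linarith
    qed
    have "integral {0..t} (\<lambda>_. - (\<epsilon> * QT T * T)) \<le> integral {0..t} (\<lambda>s. g s \<xi>)"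
      by (rule integral_le) (use AC_onD(2)[OF a_AC[OF t(1)], of \<xi>] g_low t in auto)
    moreover have "integral {0..t} (\<lambda>_. - (\<epsilon> * QT T * T)) = - (\<epsilon> * QT T * T * t)" using t by (simp add: mult.commute)
    moreover have "\<epsilon> * QT T * T * t \<le> \<epsilon> * QT T * T * T" using t b(3) by (intro mult_left_mono) (auto simp: QT_def)
    ultimately have "0 < a t \<xi>"
      using AC_onD(3)[OF a_AC[OF t(1)] t(1) order_refl, of \<xi>] initial_values(1)[OF \<xi>] c1 by linarith
    then show False using vt by (simp add: a_def qb_def qbar_def)
  qed
qed

text \<open>Either the particle is dead in both flows and both densities are 0, or it is alive in
  both and the uncut energy has moved by at most the integral of 2 P |g|. The two smallness
  conditions exclude a particle that is alive only in the limit.\<close>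

lemma e_close:
  assumes s: "small T" and \<xi>: "\<xi> \<notin> N" and t: "0 \<le> t" "t \<le> T"
    and c1: "\<epsilon> * QT T * T * T < 1 / (1 + (w0 \<xi>)\<^sup>2)"
    and c2: "w0 \<xi> < 0 \<Longrightarrow> alive t \<xi> \<Longrightarrow> (1 / 2 + \<epsilon> / (w0 \<xi>)\<^sup>2) * t < - 1 / w0 \<xi>"
  shows "\<bar>e t \<xi> - e_lim t \<xi>\<bar> \<le> 2 * \<epsilon> * QT T * T"
proof (cases "alive t \<xi>")
  case False
  have "v t \<xi> = - pi" by (rule dead_if_limit_dead[OF \<xi> t(1) False])
  then show ?thesis using False small_bounds(3)[OF s] t by (simp add: e_lim_def e_def qb_def qbar_def QT_def)
next
  case True
  note b = small_bounds[OF s]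
  have vt: "v t \<xi> > - pi" by (rule alive_if_small[OF s \<xi> t c1]) (rule c2[OF _ True])
  have "norm (integral {0..t} (\<lambda>s. - 2 * P s \<xi> * g s \<xi>)) \<le> integral {0..t} (\<lambda>_. 2 * \<epsilon> * QT T)"
  proof (rule Henstock_Kurzweil_Integration.integral_norm_bound_integral)
    show "(\<lambda>s. - 2 * P s \<xi> * g s \<xi>) integrable_on {0..t}" by (rule AC_onD(2)[OF eu_AC[OF t(1)]])
    fix s assume "s \<in> {0..t}"
    then have s: "0 \<le> s" "s \<le> T" using t by auto
    have "\<bar>P s \<xi>\<bar> * \<bar>g s \<xi>\<bar> \<le> \<epsilon> * QT T"
      using b(2)[OF s, of \<xi>] b(3) b(6)[OF s, of \<xi>] nonneg_atD(9)[OF nonneg[OF s(1)], of \<xi>] by (intro mult_mono) auto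
    then show "norm (- 2 * P s \<xi> * g s \<xi>) \<le> 2 * \<epsilon> * QT T" by (simp add: abs_mult)
  qed auto
  also have "\<dots> = 2 * \<epsilon> * QT T * t" using t by simp
  also have "\<dots> \<le> 2 * \<epsilon> * QT T * T" using t b(3) by (intro mult_left_mono) (auto simp: QT_def)
  finally have "\<bar>eu t \<xi> - eu 0 \<xi>\<bar> \<le> 2 * \<epsilon> * QT T * T"
    using AC_onD(3)[OF eu_AC[OF t(1)] t(1) order_refl, of \<xi>] by simp
  moreover have "e t \<xi> = eu t \<xi>" using vt by (simp add: e_def eu_def qb_def qbar_def)
  moreover have "e_lim t \<xi> = eu 0 \<xi>" using True initial_values(3)[OF \<xi>] by (simp add: e_lim_def)
  ultimately show ?thesis by simp
qed

text \<open>The positions of two fixed particles differ by at most QT times the distance of their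
  labels, which is negligible against l.\<close>

lemma k_near_1:
  assumes s: "small T" and t: "0 \<le> t" "t \<le> T"
  shows "exp (- (1 / l) * (QT T * \<bar>\<eta> - \<xi>\<bar>)) \<le> k t \<xi> \<eta>"
proof -
  have Q: "\<bar>a t x\<bar> \<le> QT T" for x using small_bounds(5)[OF s t] .
  have *: "\<bar>Z t y - Z t x\<bar> \<le> QT T * (y - x)" if "x \<le> y" for x y
  proof -
    have "norm (integral {x..y} (a t)) \<le> integral {x..y} (\<lambda>_. QT T)"
      by (rule Henstock_Kurzweil_Integration.integral_norm_bound_integral)
        (use bounded_Borel_integrable(3)[OF sec_meas(3) Q] Q in auto)
    then show ?thesis using that prim_diff[OF sec_meas(3) Q that] by (simp add: Z_def mult.commute)
  qed
  have "\<bar>Z t \<eta> - Z t \<xi>\<bar> \<le> QT T * \<bar>\<eta> - \<xi>\<bar>"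
    using *[of \<xi> \<eta>] *[of \<eta> \<xi>] by (cases "\<xi> \<le> \<eta>") (auto simp: abs_minus_commute)
  then have "(1 / l) * \<bar>Z t \<eta> - Z t \<xi>\<bar> \<le> (1 / l) * (QT T * \<bar>\<eta> - \<xi>\<bar>)" using l_pos by (intro mult_left_mono) auto
  then show ?thesis unfolding k_def by simp
qed

text \<open>The positive excess of \<open>e\<close> over its initial value is small in \<open>L\<^sup>1\<close>; what remains is dominated by the
  initial energy density, which allows dominated convergence as \<open>l\<close> tends to infinity.\<close>

lemma D_close:
  assumes s: "small T" and t: "0 \<le> t" "t \<le> T"
  shows "4 * \<bar>D t \<xi> - D_lim t \<xi>\<bar> \<le>
     (LBINT \<eta>. \<bar>k t \<xi> \<eta> * min (e t \<eta>) ((w0 \<eta>)\<^sup>2 / (1 + (w0 \<eta>)\<^sup>2)) - e_lim t \<eta>\<bar>)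
     + T * (e_total + 1) * (g_total + 3 * T * (e_total + 1)) / (2 * l)"
proof -
  let ?init = "\<lambda>\<eta>. (w0 \<eta>)\<^sup>2 / (1 + (w0 \<eta>)\<^sup>2)"
  let ?\<kappa> = "T * (e_total + 1) * (g_total + 3 * T * (e_total + 1)) / (2 * l)"
  note n = nonneg[OF t(1)]
  have e00: "0 \<le> ?init \<eta>" for \<eta> by simp
  have \<kappa>0: "0 \<le> ?\<kappa>" using t e_total_nonneg g_total_nonneg l_pos
    by (intro divide_nonneg_pos mult_nonneg_nonneg add_nonneg_nonneg) auto
  have mi: "integrable lborel (\<lambda>\<eta>. k t \<xi> \<eta> * min (e t \<eta>) (?init \<eta>))"
    by (rule Bochner_Integration.integrable_bound[OF e0_int])
      (use k_le1(1,2) nonneg_atD(5)[OF n] e00 in \<open>auto simp: abs_mult abs_of_nonneg intro!: mult_le_one[THEN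
        order_trans] mult_left_le_one_le[THEN order_trans]\<close>)
  have pt: "AE \<eta> in lborel. \<bar>sgn (\<xi> - \<eta>) * (k t \<xi> \<eta> * e t \<eta>) - sgn (\<xi> - \<eta>) * e_lim t \<eta>\<bar>
     \<le> \<bar>k t \<xi> \<eta> * min (e t \<eta>) (?init \<eta>) - e_lim t \<eta>\<bar> + max 0 (eu t \<eta> - eu 0 \<eta>)"
    using AE_N
  proof eventually_elim
    case (elim \<eta>)
    have "\<bar>sgn (\<xi> - \<eta>) * (k t \<xi> \<eta> * e t \<eta>) - sgn (\<xi> - \<eta>) * e_lim t \<eta>\<bar> = \<bar>sgn (\<xi> - \<eta>)\<bar> * \<bar>k t \<xi> \<eta> * e t \<eta> - e_lim t \<eta>\<bar>"
      unfolding abs_mult[symmetric] by (simp add: right_diff_distrib)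
    also have "\<dots> \<le> 1 * \<bar>k t \<xi> \<eta> * e t \<eta> - e_lim t \<eta>\<bar>" by (intro mult_right_mono) (auto simp: sgn_real_def)
    also have "\<dots> \<le> \<bar>k t \<xi> \<eta> * min (e t \<eta>) (?init \<eta>) - e_lim t \<eta>\<bar> + k t \<xi> \<eta> * (e t \<eta> - min (e t \<eta>) (?init \<eta>))"
    proof -
      have "0 \<le> k t \<xi> \<eta> * (e t \<eta> - min (e t \<eta>) (?init \<eta>))" using k_le1(2) by (intro mult_nonneg_nonneg) auto
      moreover have "k t \<xi> \<eta> * e t \<eta> = k t \<xi> \<eta> * min (e t \<eta>) (?init \<eta>) + k t \<xi> \<eta> * (e t \<eta> - min (e t \<eta>) (?init \<eta>))"
        by (simp add: algebra_simps)
      ultimately show ?thesis unfolding mult_1 by linarith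
    qed
    also have "k t \<xi> \<eta> * (e t \<eta> - min (e t \<eta>) (?init \<eta>)) \<le> 1 * max 0 (eu t \<eta> - eu 0 \<eta>)"
      using k_le1(1,2)[of t \<xi> \<eta>] nonneg_atD(7)[OF n, of \<eta>] initial_values(3)[OF elim] by (intro mult_mono) auto
    finally show ?case by simp
  qed
  have maxi: "integrable lborel (\<lambda>\<eta>. max 0 (eu t \<eta> - eu 0 \<eta>))"
    by (intro Bochner_Integration.integrable_max Bochner_Integration.integrable_diff eu_int t) auto
  have ki: "integrable lborel (\<lambda>\<eta>. sgn (\<xi> - \<eta>) * (k t \<xi> \<eta> * e t \<eta>))"
    by (rule Bochner_Integration.integrable_bound[OF ke_int[OF t(1), of \<xi>]]) (auto simp: abs_mult sgn_real_def)
  have li: "integrable lborel (\<lambda>\<eta>. sgn (\<xi> - \<eta>) * e_lim t \<eta>)"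
    by (rule Bochner_Integration.integrable_bound[OF e_lim_int[of t]]) (auto simp: abs_mult sgn_real_def)
  have quarter: "4 * \<bar>1 / 4 * x - 1 / 4 * y\<bar> = \<bar>x - y\<bar>" for x y :: real
  proof -
    have "1 / 4 * x - 1 / 4 * y = (x - y) / 4" by (simp add: diff_divide_distrib)
    then have "\<bar>1 / 4 * x - 1 / 4 * y\<bar> = \<bar>x - y\<bar> / 4" by (simp only: abs_divide abs_numeral)
    then show ?thesis by (subst \<open>\<bar>1 / 4 * x - 1 / 4 * y\<bar> = \<bar>x - y\<bar> / 4\<close>) simp
  qed
  have "4 * \<bar>D t \<xi> - D_lim t \<xi>\<bar> = \<bar>LBINT \<eta>. sgn (\<xi> - \<eta>) * (k t \<xi> \<eta> * e t \<eta>) - sgn (\<xi> - \<eta>) * e_lim t \<eta>\<bar>"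
    unfolding D_def D_lim_def Bochner_Integration.integral_diff[OF ki li] by (rule quarter)
  also have "\<dots> \<le> (LBINT \<eta>. \<bar>sgn (\<xi> - \<eta>) * (k t \<xi> \<eta> * e t \<eta>) - sgn (\<xi> - \<eta>) * e_lim t \<eta>\<bar>)" by (rule integral_abs_bound)
  also have "\<dots> \<le> (LBINT \<eta>. \<bar>k t \<xi> \<eta> * min (e t \<eta>) (?init \<eta>) - e_lim t \<eta>\<bar> + max 0 (eu t \<eta> - eu 0 \<eta>))"
    by (rule integral_mono_AE[OF _ _ pt])
      (intro integrable_abs Bochner_Integration.integrable_diff Bochner_Integration.integrable_add ki li mi maxi e_lim_int)+
  also have "\<dots> = (LBINT \<eta>. \<bar>k t \<xi> \<eta> * min (e t \<eta>) (?init \<eta>) - e_lim t \<eta>\<bar>) + (LBINT \<eta>. max 0 (eu t \<eta> - eu 0 \<eta>))"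
    by (intro Bochner_Integration.integral_add integrable_abs Bochner_Integration.integrable_diff mi maxi e_lim_int)
  also have "(LBINT \<eta>. max 0 (eu t \<eta> - eu 0 \<eta>)) \<le> ?\<kappa>"
  proof -
    have "ennreal (LBINT \<eta>. max 0 (eu t \<eta> - eu 0 \<eta>)) = (\<integral>\<^sup>+\<eta>. ennreal (max 0 (eu t \<eta> - eu 0 \<eta>)) \<partial>lborel)"
      by (rule nn_integral_eq_integral[OF maxi, symmetric]) simp
    also have "\<dots> = (\<integral>\<^sup>+\<eta>. ennreal (eu t \<eta> - eu 0 \<eta>) \<partial>lborel)"
      by (intro nn_integral_cong) (auto simp: max_def ennreal_neg)
    also have "\<dots> \<le> ennreal ?\<kappa>" by (rule energy_small(2)[OF s t])
    finally show ?thesis using \<kappa>0 ennreal_le_iff by blast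
  qed
  finally show ?thesis by simp
qed

end

section \<open>Pointwise limits of the Lagrangian unknowns\<close>

locale regularized_sequence = lagrangian_datum w0 ub0 y0 for w0 ub0 y0 +
  fixes L :: "nat \<Rightarrow> real" and v q :: "nat \<Rightarrow> real \<Rightarrow> real \<Rightarrow> real" and N :: "nat \<Rightarrow> real set"
  assumes reg: "\<And>n. regularized w0 ub0 y0 (L n) (v n) (q n) (N n)"
    and L_lim: "filterlim L at_top sequentially"
begin

abbreviation "Dn n \<equiv> regularized.D (L n) (v n) (q n)"
abbreviation "un n \<equiv> flow_u ub0 (Dn n)"
abbreviation "yn n \<equiv> flow_y y0 ub0 (Dn n)"

lemma eventually_small:
  assumes "0 \<le> T" shows "\<forall>\<^sub>F n in sequentially. regularized.small w0 (L n) T"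
proof -
  have "\<forall>\<^sub>F n in sequentially. max 1 (T * (e_total + 1) * (g_total + 3 * T * (e_total + 1))) < L n"
    using L_lim unfolding filterlim_at_top_dense by blast
  then show ?thesis
  proof eventually_elim
    case (elim n)
    interpret R: regularized w0 ub0 y0 "L n" "v n" "q n" "N n" by (rule reg)
    show ?case using elim assms unfolding R.small_def by auto
  qed
qed

lemma inverse_L: "(\<lambda>n. c / L n) \<longlonglongrightarrow> 0"
  by (rule tendsto_divide_0[OF tendsto_const]) (rule filterlim_at_top_imp_at_infinity[OF L_lim])

text \<open>Dominated convergence with the initial energy density as majorant. Almost every particle
  avoids all the exceptional sets N n at once, and for such a particle the smallness conditions of
  \<open>e_close\<close> hold from some n on.\<close>

lemma D_tendsto:
  assumes t: "0 \<le> t"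
  shows "(\<lambda>n. Dn n t \<xi>) \<longlonglongrightarrow> D_lim t \<xi>"
proof -
  let ?init = "\<lambda>\<eta>. (w0 \<eta>)\<^sup>2 / (1 + (w0 \<eta>)\<^sup>2)"
  let ?k = "\<lambda>n. regularized.k (L n) (v n) (q n) t \<xi>"
  let ?e = "\<lambda>n. regularized.e (v n) (q n) t"
  define QQ where "QQ = exp ((1 / 2 + (e_total + 1)) * t)"
  have sm: "\<forall>\<^sub>F n in sequentially. regularized.small w0 (L n) t" by (rule eventually_small[OF t])
  have int0: "(\<lambda>n. LBINT \<eta>. \<bar>?k n \<eta> * min (?e n \<eta>) (?init \<eta>) - e_lim t \<eta>\<bar>)
    \<longlonglongrightarrow> integral\<^sup>L (lborel :: real measure) (\<lambda>_. 0 :: real)"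
  proof (rule integral_dominated_convergence[where w="?init"])
    show "integrable lborel ?init" by (rule e0_int)
    \<comment> \<open>Thanks to the minimum both terms lie between 0 and the initial density, and so
      does the modulus of their difference.\<close>
    show "AE \<eta> in lborel. norm \<bar>?k n \<eta> * min (?e n \<eta>) (?init \<eta>) - e_lim t \<eta>\<bar> \<le> ?init \<eta>" for n
    proof (rule AE_I2)
      fix \<eta>
      interpret R: regularized w0 ub0 y0 "L n" "v n" "q n" "N n" by (rule reg)
      have e: "0 \<le> R.e t \<eta>" using R.nonneg_atD(5)[OF R.nonneg[OF t]] .
      have "0 \<le> R.k t \<xi> \<eta> * min (R.e t \<eta>) (?init \<eta>)" using R.k_le1(2) e by (intro mult_nonneg_nonneg) auto
      moreover have "R.k t \<xi> \<eta> * min (R.e t \<eta>) (?init \<eta>) \<le> 1 * ?init \<eta>"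
        using R.k_le1(1,2) e by (intro mult_mono) auto
      ultimately show "norm \<bar>R.k t \<xi> \<eta> * min (R.e t \<eta>) (?init \<eta>) - e_lim t \<eta>\<bar> \<le> ?init \<eta>"
        using e_lim_bd(1,2)[of t \<eta>] unfolding real_norm_def abs_abs by linarith
    qed
    show "(\<lambda>\<eta>. \<bar>?k n \<eta> * min (?e n \<eta>) (?init \<eta>) - e_lim t \<eta>\<bar>) \<in> borel_measurable lborel" for n
    proof -
      interpret R: regularized w0 ub0 y0 "L n" "v n" "q n" "N n" by (rule reg)
      show ?thesis by measurable
    qed
    have "AE \<eta> in lborel. \<forall>n. \<eta> \<notin> N n"
      unfolding AE_all_countable using regularized.AE_N[OF reg] by blast
    then show "AE \<eta> in lborel. (\<lambda>n. \<bar>?k n \<eta> * min (?e n \<eta>) (?init \<eta>) - e_lim t \<eta>\<bar>) \<longlonglongrightarrow> 0"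
    proof eventually_elim
      case (elim \<eta>)
      have k1: "(\<lambda>n. ?k n \<eta>) \<longlonglongrightarrow> 1"
      proof (rule tendsto_sandwich)
        show "\<forall>\<^sub>F n in sequentially. exp (- ((QQ * \<bar>\<eta> - \<xi>\<bar>) / L n)) \<le> ?k n \<eta>"
          using sm
        proof eventually_elim
          case (elim n)
          interpret R: regularized w0 ub0 y0 "L n" "v n" "q n" "N n" by (rule reg)
          show ?case using R.k_near_1[OF elim t order_refl, of \<eta> \<xi>] by (simp add: R.QT_def QQ_def)
        qed
        show "\<forall>\<^sub>F n in sequentially. ?k n \<eta> \<le> 1"
          using regularized.k_le1(1)[OF reg] by simp
        have "(\<lambda>n. exp (- ((QQ * \<bar>\<eta> - \<xi>\<bar>) / L n))) \<longlonglongrightarrow> exp (- 0)"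
          by (intro tendsto_exp tendsto_minus inverse_L)
        then show "(\<lambda>n. exp (- ((QQ * \<bar>\<eta> - \<xi>\<bar>) / L n))) \<longlonglongrightarrow> 1" by simp
      qed simp
      have eps: "(\<lambda>n. (e_total + 1) / (4 * L n)) \<longlonglongrightarrow> 0"
        using inverse_L[of "(e_total + 1) / 4"] by simp
      have c1: "\<forall>\<^sub>F n in sequentially. (e_total + 1) / (4 * L n) * QQ * t * t < 1 / (1 + (w0 \<eta>)\<^sup>2)"
      proof (rule order_tendstoD(2))
        show "(\<lambda>n. (e_total + 1) / (4 * L n) * QQ * t * t) \<longlonglongrightarrow> 0"
          using tendsto_mult_left_zero[OF tendsto_mult_left_zero[OF tendsto_mult_left_zero[OF eps, of QQ], of t], of t] .
        show "0 < 1 / (1 + (w0 \<eta>)\<^sup>2)" using w_pos[of \<eta>] by simp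
      qed
      \<comment> \<open>\<open>alive\<close> is a strict inequality, so the perturbed condition
        holds for large n. At the death time itself the limit counts as dead, and nothing has to be
        shown.\<close>
      have c2: "\<forall>\<^sub>F n in sequentially. w0 \<eta> < 0 \<longrightarrow> alive t \<eta> \<longrightarrow> (1 / 2 + (e_total + 1) / (4 * L n) / (w0 \<eta>)\<^sup>2) * t
        < - 1 / w0 \<eta>"
      proof (cases "w0 \<eta> < 0 \<and> alive t \<eta>")
        case True
        have "(\<lambda>n. (1 / 2 + (e_total + 1) / (4 * L n) / (w0 \<eta>)\<^sup>2) * t) \<longlonglongrightarrow> (1 / 2 + 0 / (w0 \<eta>)\<^sup>2) * t"
          using True by (intro tendsto_intros eps) auto
        moreover have "(1 / 2 + 0 / (w0 \<eta>)\<^sup>2) * t < - 1 / w0 \<eta>"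
        proof -
          have "- 1 < t / 2 * w0 \<eta>" using True by (simp add: alive_def algebra_simps)
          then have "t / 2 < - 1 / w0 \<eta>" using True by (subst neg_less_divide_eq) auto
          then show ?thesis by simp
        qed
        ultimately have "\<forall>\<^sub>F n in sequentially. (1 / 2 + (e_total + 1) / (4 * L n) / (w0 \<eta>)\<^sup>2) * t < - 1 / w0 \<eta>"
          by (rule order_tendstoD(2))
        then show ?thesis by eventually_elim simp
      qed auto
      have e1: "(\<lambda>n. ?e n \<eta>) \<longlonglongrightarrow> e_lim t \<eta>"
      proof (rule LIM_zero_cancel, rule Lim_null_comparison)
        show "\<forall>\<^sub>F n in sequentially. norm (?e n \<eta> - e_lim t \<eta>) \<le> 2 * ((e_total + 1) / (4 * L n)) * QQ * t"
          using sm c1 c2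
        proof eventually_elim
          case (elim n)
          interpret R: regularized w0 ub0 y0 "L n" "v n" "q n" "N n" by (rule reg)
          have "\<eta> \<notin> N n" using \<open>\<forall>n. \<eta> \<notin> N n\<close> by blast
          from R.e_close[OF elim(1) this t order_refl] elim(2,3)
          show ?case by (simp add: R.\<epsilon>_def R.QT_def QQ_def)
        qed
        have "(\<lambda>n. 2 * ((e_total + 1) / (4 * L n)) * QQ * t) \<longlonglongrightarrow> 2 * 0 * QQ * t"
          by (intro tendsto_intros eps)
        then show "(\<lambda>n. 2 * ((e_total + 1) / (4 * L n)) * QQ * t) \<longlonglongrightarrow> 0" by simp
      qed
      have "(\<lambda>n. \<bar>?k n \<eta> * min (?e n \<eta>) (?init \<eta>) - e_lim t \<eta>\<bar>) \<longlonglongrightarrow> \<bar>1 * min (e_lim t \<eta>) (?init \<eta>) - e_lim t \<eta>\<bar>"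
        by (intro tendsto_intros k1 e1)
      then show ?case using e_lim_bd(2)[of t \<eta>] by (simp add: min_absorb1)
    qed
  qed simp
  define \<kappa> where "\<kappa> = t * (e_total + 1) * (g_total + 3 * t * (e_total + 1)) / 2"
  have lim: "(\<lambda>n. ((LBINT \<eta>. \<bar>?k n \<eta> * min (?e n \<eta>) (?init \<eta>) - e_lim t \<eta>\<bar>) + \<kappa> / L n) / 4) \<longlonglongrightarrow> (0 + 0) / 4"
    using int0 by (intro tendsto_intros inverse_L) auto
  show ?thesis
  proof (rule LIM_zero_cancel, rule Lim_null_comparison)
    show "\<forall>\<^sub>F n in sequentially. norm (Dn n t \<xi> - D_lim t \<xi>)
      \<le> ((LBINT \<eta>. \<bar>?k n \<eta> * min (?e n \<eta>) (?init \<eta>) - e_lim t \<eta>\<bar>) + \<kappa> / L n) / 4"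
      using sm
    proof eventually_elim
      case (elim n)
      interpret R: regularized w0 ub0 y0 "L n" "v n" "q n" "N n" by (rule reg)
      show ?case using R.D_close[OF elim t order_refl, of \<xi>] by (simp add: \<kappa>_def)
    qed
    show "(\<lambda>n. ((LBINT \<eta>. \<bar>?k n \<eta> * min (?e n \<eta>) (?init \<eta>) - e_lim t \<eta>\<bar>) + \<kappa> / L n) / 4) \<longlonglongrightarrow> 0"
      using lim by simp
  qed
qed

text \<open>The constant of \<open>flow\<close> at B = E = e_total + 1, free of n.\<close>

definition flow_const :: "real \<Rightarrow> real" where
  "flow_const T = (2 + (e_total + 1)) * exp ((1 / 2 + (e_total + 1)) * T) + (e_total + 1) + \<bar>ub0 0\<bar> + g_total"

lemma eventually_flow:
  assumes T: "0 \<le> T"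
  shows "\<forall>\<^sub>F n in sequentially. lagrangian_flow T (flow_const T) (e_total + 1)
    (regularized.a (v n) (q n)) (regularized.g (v n) (q n)) (regularized.e (v n) (q n)) (regularized.h (L n) (v n)
      (q n)) (Dn n) ub0 y0"
  using eventually_small[OF T]
proof eventually_elim
  case (elim n)
  interpret R: regularized w0 ub0 y0 "L n" "v n" "q n" "N n" by (rule reg)
  show ?case unfolding flow_const_def
    by (rule R.flow[OF R.small_bounds(1)[OF elim] T R.energy_small(1)[OF elim]])
qed

text \<open>The bounds are available for large n only, so dominated convergence is applied to a
  shifted sequence.\<close>

lemma integral_tendsto:
  fixes f :: "nat \<Rightarrow> real \<Rightarrow> real"
  assumes "\<forall>\<^sub>F n in sequentially. f n integrable_on {0..t} \<and> (\<forall>s\<in>{0..t}. \<bar>f n s\<bar> \<le> C)"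
    and lim: "\<And>s. 0 \<le> s \<Longrightarrow> s \<le> t \<Longrightarrow> (\<lambda>n. f n s) \<longlonglongrightarrow> g s"
  shows "(\<lambda>n. integral {0..t} (f n)) \<longlonglongrightarrow> integral {0..t} g"
proof -
  obtain n0 where n0: "\<And>n. n \<ge> n0 \<Longrightarrow> f n integrable_on {0..t} \<and> (\<forall>s\<in>{0..t}. \<bar>f n s\<bar> \<le> C)"
    using assms(1) unfolding eventually_sequentially by blast
  have "(\<lambda>n. integral {0..t} (f (n + n0))) \<longlonglongrightarrow> integral {0..t} g"
  proof (rule dominated_convergence(2)[where h="\<lambda>_. C"])
    show "(\<lambda>n. f (n + n0) s) \<longlonglongrightarrow> g s" if "s \<in> {0..t}" for s
      using LIMSEQ_ignore_initial_segment[OF lim, of s n0] that by auto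
  qed (use n0 in auto)
  then show ?thesis by (rule LIMSEQ_offset)
qed

lemma u_tendsto:
  assumes t: "0 \<le> t"
  shows "(\<lambda>n. un n t \<xi>) \<longlonglongrightarrow> flow_u ub0 D_lim t \<xi>"
proof -
  have "(\<lambda>n. integral {0..t} (\<lambda>s. Dn n s \<xi>)) \<longlonglongrightarrow> integral {0..t} (\<lambda>s. D_lim s \<xi>)"
  proof (rule integral_tendsto[where C="flow_const t"])
    show "\<forall>\<^sub>F n in sequentially. (\<lambda>s. Dn n s \<xi>) integrable_on {0..t} \<and> (\<forall>s\<in>{0..t}. \<bar>Dn n s \<xi>\<bar> \<le> flow_const t)"
      using eventually_flow[OF t]
      by eventually_elim (auto intro: lagrangian_flow.time_integrable lagrangian_flow.D_bd)
  qed (use D_tendsto in auto)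
  then show ?thesis unfolding flow_u_def by (intro tendsto_intros)
qed

lemma y_tendsto:
  assumes t: "0 \<le> t"
  shows "(\<lambda>n. yn n t \<xi>) \<longlonglongrightarrow> flow_y y0 ub0 D_lim t \<xi>"
proof -
  have "(\<lambda>n. integral {0..t} (\<lambda>s. un n s \<xi>)) \<longlonglongrightarrow> integral {0..t} (\<lambda>s. flow_u ub0 D_lim s \<xi>)"
  proof (rule integral_tendsto[where C="flow_const t + flow_const t * t"])
    show "\<forall>\<^sub>F n in sequentially. (\<lambda>s. un n s \<xi>) integrable_on {0..t} \<and> (\<forall>s\<in>{0..t}. \<bar>un n s \<xi>\<bar>
      \<le> flow_const t + flow_const t * t)"
      using eventually_flow[OF t]
      by eventually_elim (auto intro: lagrangian_flow.u_time_integrable lagrangian_flow.u_bd)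
  qed (use u_tendsto in auto)
  then show ?thesis unfolding flow_y_def by (intro tendsto_intros)
qed

end

section \<open>Convergence in Eulerian coordinates\<close>

text \<open>Pointwise convergence on a finite net of centres plus equicontinuity, with three errors
  of a third each. Equicontinuity is asked of large n only, since the common modulus requires l to
  be large.\<close>

lemma uniform_limit_equicontinuous:
  fixes f :: "nat \<Rightarrow> 'a::metric_space \<Rightarrow> real"
  assumes K: "compact K" and lim: "\<And>x. x \<in> K \<Longrightarrow> (\<lambda>n. f n x) \<longlonglongrightarrow> g x"
    and f: "\<And>\<epsilon>. \<epsilon> > 0 \<Longrightarrow> \<exists>\<delta>>0. \<forall>\<^sub>F n in sequentially. \<forall>x\<in>K. \<forall>y\<in>K. dist x y < \<delta> \<longrightarrow> \<bar>f n x - f n y\<bar> < \<epsilon>"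
    and g: "\<And>\<epsilon>. \<epsilon> > 0 \<Longrightarrow> \<exists>\<delta>>0. \<forall>x\<in>K. \<forall>y\<in>K. dist x y < \<delta> \<longrightarrow> \<bar>g x - g y\<bar> < \<epsilon>"
  shows "uniform_limit K f g sequentially"
proof (rule uniform_limitI)
  fix \<epsilon> :: real assume "\<epsilon> > 0"
  then have e3: "\<epsilon> / 3 > 0" by simp
  obtain \<delta>1 where \<delta>1: "\<delta>1 > 0" "\<forall>\<^sub>F n in sequentially. \<forall>x\<in>K. \<forall>y\<in>K. dist x y < \<delta>1 \<longrightarrow> \<bar>f n x - f n y\<bar> < \<epsilon> / 3"
    using f[OF e3] by blast
  obtain \<delta>2 where \<delta>2: "\<delta>2 > 0" "\<forall>x\<in>K. \<forall>y\<in>K. dist x y < \<delta>2 \<longrightarrow> \<bar>g x - g y\<bar> < \<epsilon> / 3"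
    using g[OF e3] by blast
  define \<delta> where "\<delta> = min \<delta>1 \<delta>2"
  have "\<delta> > 0" using \<delta>1 \<delta>2 by (simp add: \<delta>_def)
  then have "K \<subseteq> (\<Union>z\<in>K. ball z \<delta>)" by force
  then obtain F where F: "F \<subseteq> K" "finite F" "K \<subseteq> (\<Union>z\<in>F. ball z \<delta>)"
    using compactE_image[OF K, of K "\<lambda>z. ball z \<delta>"] by auto
  have "\<forall>\<^sub>F n in sequentially. \<forall>z\<in>F. \<bar>f n z - g z\<bar> < \<epsilon> / 3"
  proof (rule eventually_ball_finite[OF F(2)], rule ballI)
    fix z assume "z \<in> F"
    then have "(\<lambda>n. f n z) \<longlonglongrightarrow> g z" using F lim by auto
    from tendstoD[OF this e3] show "\<forall>\<^sub>F n in sequentially. \<bar>f n z - g z\<bar> < \<epsilon> / 3" by (simp add: dist_real_def)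
  qed
  with \<delta>1(2) show "\<forall>\<^sub>F n in sequentially. \<forall>x\<in>K. dist (f n x) (g x) < \<epsilon>"
  proof eventually_elim
    case (elim n)
    show ?case
    proof
      fix x assume x: "x \<in> K"
      then obtain z where z: "z \<in> F" "dist x z < \<delta>" using F(3) by (auto simp: dist_commute)
      have zK: "z \<in> K" using z F by auto
      have "\<bar>f n x - f n z\<bar> < \<epsilon> / 3" using elim(1) x zK z(2) by (auto simp: \<delta>_def)
      moreover have "\<bar>f n z - g z\<bar> < \<epsilon> / 3" using elim(2) z by blast
      moreover have "\<bar>g x - g z\<bar> < \<epsilon> / 3" using \<delta>2(2) x zK z(2) by (auto simp: \<delta>_def)
      ultimately show "dist (f n x) (g x) < \<epsilon>" unfolding dist_real_def by linarith
    qed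
  qed
qed

definition has_modulus :: "real \<Rightarrow> real \<Rightarrow> real \<Rightarrow> real \<Rightarrow> (real \<Rightarrow> real \<Rightarrow> real) \<Rightarrow> bool" where
  "has_modulus T C E K W \<longleftrightarrow> (\<forall>t\<in>{0..T}. \<forall>s\<in>{0..T}. \<forall>x x'.
     \<bar>W t x - W s x'\<bar> \<le> C * \<bar>t - s\<bar> + sqrt (E * (\<bar>x - x'\<bar> + K * \<bar>t - s\<bar>)))"

text \<open>One \<delta> serves all functions with these constants and all time horizons, which is
  the equicontinuity required. The summands 1 keep the quotients meaningful when C or E is
  0.\<close>

lemma modulus_uniform:
  assumes "0 \<le> C" "0 \<le> E" "0 \<le> K" "\<epsilon> > 0"
  obtains \<delta> where "\<delta> > 0" "\<And>W T t s x x'. has_modulus T C E K W \<Longrightarrow> t \<in> {0..T} \<Longrightarrow> s \<in> {0..T} \<Longrightarrow>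
    dist (t, x) (s, x') < \<delta> \<Longrightarrow> \<bar>W t x - W s x'\<bar> < \<epsilon>"
proof -
  define \<delta> where "\<delta> = min (\<epsilon> / (2 * (C + 1))) ((\<epsilon> / 2)\<^sup>2 / ((E + 1) * (1 + K)))"
  have d0: "\<delta> > 0" using assms by (auto simp: \<delta>_def intro!: divide_pos_pos mult_pos_pos add_nonneg_pos add_pos_nonneg)
  have "\<bar>W t x - W s x'\<bar> < \<epsilon>"
    if W: "has_modulus T C E K W" and t: "t \<in> {0..T}" and s: "s \<in> {0..T}" and d: "dist (t, x) (s, x') < \<delta>" for W T t s x x'
  proof -
    have ts: "\<bar>t - s\<bar> < \<delta>" using dist_fst_le[of "(t, x)" "(s, x')"] d by (simp add: dist_real_def)
    have xx: "\<bar>x - x'\<bar> < \<delta>" using dist_snd_le[of "(t, x)" "(s, x')"] d by (simp add: dist_real_def)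
    have "C * \<bar>t - s\<bar> \<le> C * (\<epsilon> / (2 * (C + 1)))" using ts assms by (intro mult_left_mono) (auto simp: \<delta>_def)
    also have "\<dots> < (C + 1) * (\<epsilon> / (2 * (C + 1)))" using assms by (intro mult_strict_right_mono) auto
    also have "\<dots> = \<epsilon> / 2" using assms by (simp add: field_simps)
    finally have 1: "C * \<bar>t - s\<bar> < \<epsilon> / 2" .
    have "\<bar>x - x'\<bar> + K * \<bar>t - s\<bar> \<le> \<delta> + K * \<delta>" using ts xx assms by (intro add_mono mult_left_mono) auto
    then have "E * (\<bar>x - x'\<bar> + K * \<bar>t - s\<bar>) \<le> (E + 1) * (\<delta> + K * \<delta>)" using assms by (intro mult_mono) auto
    also have "\<dots> = ((E + 1) * (1 + K)) * \<delta>" by (simp add: algebra_simps)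
    also have "\<dots> \<le> ((E + 1) * (1 + K)) * ((\<epsilon> / 2)\<^sup>2 / ((E + 1) * (1 + K)))"
      using assms by (intro mult_left_mono) (auto simp: \<delta>_def)
    also have "\<dots> = (\<epsilon> / 2)\<^sup>2"
    proof -
      have "(E + 1) * (1 + K) \<noteq> 0" using assms by auto
      then show ?thesis by simp
    qed
    finally have "sqrt (E * (\<bar>x - x'\<bar> + K * \<bar>t - s\<bar>)) \<le> \<epsilon> / 2"
      using assms by (intro real_le_lsqrt) auto
    moreover have "\<bar>W t x - W s x'\<bar> \<le> C * \<bar>t - s\<bar> + sqrt (E * (\<bar>x - x'\<bar> + K * \<bar>t - s\<bar>))"
      using W t s by (auto simp: has_modulus_def)
    ultimately show ?thesis using 1 by linarith
  qed
  with d0 that show thesis by blast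
qed

lemma has_modulus_continuous:
  assumes W: "has_modulus T C E K W" and "0 \<le> C" "0 \<le> E" "0 \<le> K"
  shows "continuous_on ({0..T} \<times> UNIV) (\<lambda>(t, x). W t x)"
  unfolding continuous_on_iff
proof (intro ballI allI impI)
  fix z :: "real \<times> real" and e :: real assume z: "z \<in> {0..T} \<times> UNIV" and "0 < e"
  obtain \<delta> where \<delta>: "\<delta> > 0" "\<And>W T t s x x'. has_modulus T C E K W \<Longrightarrow> t \<in> {0..T} \<Longrightarrow> s \<in> {0..T} \<Longrightarrow>
    dist (t, x) (s, x') < \<delta> \<Longrightarrow> \<bar>W t x - W s x'\<bar> < e" using modulus_uniform[OF assms(2-4) \<open>0 < e\<close>] by blast
  show "\<exists>d>0. \<forall>x'\<in>{0..T} \<times> UNIV. dist x' z < d \<longrightarrow> dist (case x' of (t, x) \<Rightarrow> W t x) (case z of (t, x) \<Rightarrow> W t x) < e"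
    using \<delta>(1) \<delta>(2)[OF W] z by (intro exI[of _ \<delta>]) (auto simp: dist_real_def)
qed

text \<open>\<open>I\<close> may be open, closed or half-open; its measurability comes from
  convexity and boundedness.\<close>

lemma interval_L1_le:
  fixes \<phi> :: "real \<Rightarrow> real"
  assumes I: "is_interval I" "I \<subseteq> {- X..X}" and X: "0 \<le> X" and \<phi>: "continuous_on UNIV \<phi>"
    and c: "\<And>x. x \<in> {- X..X} \<Longrightarrow> \<bar>\<phi> x\<bar> \<le> c"
  shows "set_integrable lebesgue I \<phi>" "(LINT x:I|lebesgue. \<bar>\<phi> x\<bar>) \<le> c * (2 * X)" "0 \<le> (LINT x:I|lebesgue. \<bar>\<phi> x\<bar>)"
proof -
  have m: "\<phi> \<in> borel_measurable borel" using \<phi> by (rule borel_measurable_continuous_onI)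
  have "bounded I" using I(2) bounded_closed_interval bounded_subset by blast
  then have Im: "I \<in> sets lebesgue"
    using measurable_convex[OF is_interval_convex[OF I(1)]] by (auto simp: fmeasurable_def)
  have "\<phi> absolutely_integrable_on {- X..X}" by (rule bounded_Borel_integrable(2)[OF m, where C=c]) (use c in auto)
  then show i: "set_integrable lebesgue I \<phi>" by (rule set_integrable_subset[OF _ Im I(2)])
  have ci: "set_integrable lebesgue {- X..X} (\<lambda>_. c)"
    by (rule absolutely_integrable_continuous_real) simp
  have "(LINT x:I|lebesgue. \<bar>\<phi> x\<bar>) \<le> (LINT x:{- X..X}|lebesgue. c)"
    unfolding set_lebesgue_integral_def
  proof (rule integral_mono)
    show "integrable lebesgue (\<lambda>x. indicat_real I x *\<^sub>R \<bar>\<phi> x\<bar>)"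
      using set_integrable_abs[OF i] unfolding set_integrable_def .
    show "integrable lebesgue (\<lambda>x. indicat_real {- X..X} x *\<^sub>R c)" using ci unfolding set_integrable_def .
    show "indicat_real I x *\<^sub>R \<bar>\<phi> x\<bar> \<le> indicat_real {- X..X} x *\<^sub>R c" for x
      using I(2) c[of x] by (auto simp: indicator_def intro: order_trans[OF abs_ge_zero])
  qed
  also have "\<dots> = c * (2 * X)" using set_lebesgue_integral_eq_integral(2)[OF ci] X by simp
  finally show "(LINT x:I|lebesgue. \<bar>\<phi> x\<bar>) \<le> c * (2 * X)" .
  show "0 \<le> (LINT x:I|lebesgue. \<bar>\<phi> x\<bar>)"
    unfolding set_lebesgue_integral_def by (rule Bochner_Integration.integral_nonneg) auto
qed

lemma has_modulus_section:
  assumes W: "has_modulus T C E K W" and "0 \<le> C" "0 \<le> E" "0 \<le> K" and t: "t \<in> {0..T}"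
  shows "continuous_on UNIV (W t)"
proof -
  have "continuous_on UNIV (\<lambda>x. case (t, x) of (t, x) \<Rightarrow> W t x)"
    by (rule continuous_on_compose2[OF has_modulus_continuous[OF assms(1-4)]]) (use t in \<open>auto intro!: continuous_intros\<close>)
  then show ?thesis by simp
qed

lemma has_modulus_C_L1:
  assumes W: "has_modulus T C E K W" and nn: "0 \<le> C" "0 \<le> E" "0 \<le> K"
    and I: "is_interval I" "I \<subseteq> {- X..X}" and X: "0 \<le> X"
  shows "C_L1 T I W"
  unfolding C_L1_def
proof (intro conjI ballI)
  fix t assume t: "t \<in> {0..T}"
  note ct = has_modulus_section[OF W nn t]
  have "bounded (W t ` {- X..X})"
    by (intro compact_imp_bounded compact_continuous_image continuous_on_subset[OF ct]) auto
  then obtain c where "\<forall>y\<in>W t ` {- X..X}. norm y \<le> c" unfolding bounded_iff by blast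
  then show "set_integrable lebesgue I (W t)" by (intro interval_L1_le(1)[OF I X ct, of c]) auto
next
  fix t0 assume t0: "t0 \<in> {0..T}"
  show "((\<lambda>t. LINT x:I|lebesgue. \<bar>W t x - W t0 x\<bar>) \<longlongrightarrow> 0) (at t0 within {0..T})"
  proof (rule tendstoI)
    fix \<epsilon> :: real assume \<epsilon>: "0 < \<epsilon>"
    then have \<epsilon>': "0 < \<epsilon> / (2 * X + 1)" using X by simp
    obtain \<delta> where \<delta>: "\<delta> > 0" "\<And>W T t s x x'. has_modulus T C E K W \<Longrightarrow> t \<in> {0..T} \<Longrightarrow> s \<in> {0..T} \<Longrightarrow>
      dist (t, x) (s, x') < \<delta> \<Longrightarrow> \<bar>W t x - W s x'\<bar> < \<epsilon> / (2 * X + 1)" using modulus_uniform[OF nn \<epsilon>'] by blast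
    have "\<forall>\<^sub>F t in at t0 within {0..T}. t \<in> {0..T} \<and> dist t t0 < \<delta>"
      unfolding eventually_at using \<delta>(1) by auto
    then show "\<forall>\<^sub>F t in at t0 within {0..T}. dist (LINT x:I|lebesgue. \<bar>W t x - W t0 x\<bar>) 0 < \<epsilon>"
    proof eventually_elim
      case (elim t)
      have cd: "continuous_on UNIV (\<lambda>x. W t x - W t0 x)"
        using has_modulus_section[OF W nn] elim t0 by (intro continuous_intros) auto
      have "\<bar>W t x - W t0 x\<bar> \<le> \<epsilon> / (2 * X + 1)" for x
        by (rule less_imp_le, rule \<delta>(2)[OF W]) (use elim t0 in \<open>auto simp: dist_Pair_Pair\<close>)
      note i = interval_L1_le[OF I X cd this]
      have "\<epsilon> / (2 * X + 1) * (2 * X) < \<epsilon> / (2 * X + 1) * (2 * X + 1)"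
        using \<epsilon>' by (intro mult_strict_left_mono) auto
      also have "\<dots> = \<epsilon>" using X by simp
      finally show ?case using i(2,3) by (simp add: dist_real_def)
    qed
  qed
qed

lemma (in lagrangian_flow) solution_modulus:
  assumes W: "\<And>t \<xi>. 0 \<le> t \<Longrightarrow> t \<le> T \<Longrightarrow> W t (y t \<xi>) = u t \<xi>"
  shows "has_modulus T C E (C + C * T) W"
  unfolding has_modulus_def using Eulerian_modulus[of W, OF W] by auto

section \<open>The Eulerian limit function\<close>

context lagrangian_datum
begin

abbreviation "u_lim \<equiv> flow_u ub0 D_lim"
abbreviation "y_lim \<equiv> flow_y y0 ub0 D_lim"

definition lim_const :: "real \<Rightarrow> real" where
  "lim_const T = 2 * (1 + T)\<^sup>2 + e_total + \<bar>ub0 0\<bar> + g_total"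

text \<open>The choice of a particle at x is harmless, because the Hoelder estimate forces particles
  at one position to share their velocity.\<close>

definition sol :: "real \<Rightarrow> real \<Rightarrow> real" where
  "sol t x = u_lim t (SOME \<xi>. y_lim t \<xi> = x)"

lemma limit_flow':
  assumes T: "0 \<le> T"
  shows "lagrangian_flow T (lim_const T) e_total a_lim g_lim e_lim (\<lambda>t \<xi>. e_lim t \<xi> / 2) D_lim ub0 y0"
  unfolding lim_const_def by (rule limit_flow[OF T])

lemma sol_eq: assumes t: "0 \<le> t" shows "sol t (y_lim t \<xi>) = u_lim t \<xi>"
proof -
  interpret F: lagrangian_flow t "lim_const t" e_total a_lim g_lim e_lim "\<lambda>t \<xi>. e_lim t \<xi> / 2" D_lim ub0 y0
    by (rule limit_flow'[OF t])
  define \<eta> where "\<eta> = (SOME \<eta>. y_lim t \<eta> = y_lim t \<xi>)"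
  have "y_lim t \<eta> = y_lim t \<xi>" unfolding \<eta>_def by (rule someI[of _ \<xi>]) simp
  then have "(u_lim t \<eta> - u_lim t \<xi>)\<^sup>2 \<le> 0" using F.u_hoelder[OF t order_refl, of \<eta> \<xi>] by simp
  then show ?thesis by (simp add: sol_def \<eta>_def)
qed

lemma sol_modulus: assumes T: "0 \<le> T"
  shows "has_modulus T (lim_const T) e_total (lim_const T + lim_const T * T) sol"
  by (rule lagrangian_flow.solution_modulus[OF limit_flow'[OF T]]) (rule sol_eq)

lemma lim_const_nonneg: "0 \<le> lim_const T"
  using e_total_nonneg g_total_nonneg by (simp add: lim_const_def)

lemma y_lim_surj: "0 \<le> t \<Longrightarrow> \<exists>\<xi>. x = y_lim t \<xi>"
  using lagrangian_flow.y_surj[OF limit_flow', of t t] by (meson order_refl surjD)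

end

text \<open>The constants may depend on l. Convergence in C([0,T], L1) asks every member of the
  sequence to lie in that space, also those with small l.\<close>

lemma (in regularized) flow_exists:
  assumes T: "0 \<le> T"
  obtains C E where "lagrangian_flow T C E a g e h D ub0 y0"
proof -
  obtain B where B: "P_bound T B" using P_bounded[OF T] by blast
  obtain K where "\<And>s. 0 \<le> s \<Longrightarrow> s \<le> T \<Longrightarrow> En s \<le> K" using En_bounded[OF T] by metis
  from flow[OF B T this] show ?thesis by (rule that)
qed

context regularized_sequence
begin

lemma flow_const_nonneg: "0 \<le> flow_const T"
  using e_total_nonneg g_total_nonneg by (simp add: flow_const_def)

text \<open>Pointwise limits and a common modulus give uniform convergence on rectangles in time and
  space, hence convergence in L1 of the bounded interval uniformly in time.\<close>

theorem convergence:
  assumes W: "\<And>n t \<xi>. 0 \<le> t \<Longrightarrow> W n t (yn n t \<xi>) = un n t \<xi>"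
    and T: "0 \<le> T" and I: "is_interval I" "bounded I"
  shows "C_L1_tendsto T I W sol"
proof -
  obtain X0 where X0: "\<forall>x\<in>I. norm x \<le> X0" using I(2) unfolding bounded_iff by blast
  define X where "X = max 0 X0"
  have X: "0 \<le> X" and IX: "I \<subseteq> {- X..X}" using X0 by (auto simp: X_def abs_le_iff le_max_iff_disj)
  have modn: "\<exists>C E K. 0 \<le> C \<and> 0 \<le> E \<and> 0 \<le> K \<and> has_modulus T C E K (W n)" for n
  proof -
    interpret R: regularized w0 ub0 y0 "L n" "v n" "q n" "N n" by (rule reg)
    obtain C K where F: "lagrangian_flow T C K R.a R.g R.e R.h (Dn n) ub0 y0" using R.flow_exists[OF T] by blast
    have "has_modulus T C K (C + C * T) (W n)"
      by (rule lagrangian_flow.solution_modulus[OF F]) (rule W)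
    moreover have "0 \<le> C" by (rule lagrangian_flow.C0[OF F])
    ultimately show ?thesis using lagrangian_flow.E0[OF F] T by (meson add_nonneg_nonneg mult_nonneg_nonneg)
  qed
  have CL: "C_L1 T I (W n)" for n using modn[of n] has_modulus_C_L1[OF _ _ _ _ I(1) IX X] by blast
  have nn: "0 \<le> lim_const T" "0 \<le> e_total" "0 \<le> lim_const T + lim_const T * T"
    using lim_const_nonneg[of T] e_total_nonneg T by auto
  have CLs: "C_L1 T I sol" by (rule has_modulus_C_L1[OF sol_modulus[OF T] nn I(1) IX X])
  have nn': "0 \<le> flow_const T" "0 \<le> e_total + 1" "0 \<le> flow_const T + flow_const T * T"
    using flow_const_nonneg[of T] e_total_nonneg T by auto
  have evm: "\<forall>\<^sub>F n in sequentially. has_modulus T (flow_const T) (e_total + 1) (flow_const T + flow_const T * T) (W n)"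
    using eventually_flow[OF T] by eventually_elim (rule lagrangian_flow.solution_modulus, assumption, rule W)
  \<comment> \<open>Take a limit particle at x. The approximating particle with the same label sits
    at a point tending to x, and the modulus in space transfers its velocity to x.\<close>
  have ptw: "(\<lambda>n. W n t x) \<longlonglongrightarrow> sol t x" if t: "0 \<le> t" "t \<le> T" for t x
  proof -
    obtain \<xi> where \<xi>: "x = y_lim t \<xi>" using y_lim_surj[OF t(1)] by blast
    have sq: "(\<lambda>n. sqrt ((e_total + 1) * \<bar>x - yn n t \<xi>\<bar>)) \<longlonglongrightarrow> sqrt ((e_total + 1) * \<bar>x - x\<bar>)"
      using y_tendsto[OF t(1), of \<xi>] unfolding \<xi> by (intro tendsto_intros)
    have "(\<lambda>n. W n t x - un n t \<xi>) \<longlonglongrightarrow> 0"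
    proof (rule Lim_null_comparison)
      show "\<forall>\<^sub>F n in sequentially. norm (W n t x - un n t \<xi>) \<le> sqrt ((e_total + 1) * \<bar>x - yn n t \<xi>\<bar>)"
        using evm
      proof eventually_elim
        case (elim n)
        have "t \<in> {0..T}" using t by simp
        then have "\<bar>W n t x - W n t (yn n t \<xi>)\<bar>
          \<le> flow_const T * \<bar>t - t\<bar> + sqrt ((e_total + 1) * (\<bar>x - yn n t \<xi>\<bar> + (flow_const T + flow_const T * T) * \<bar>t - t\<bar>))"
          using elim unfolding has_modulus_def by blast
        then show ?case using W[OF t(1), of n \<xi>] by simp
      qed
      show "(\<lambda>n. sqrt ((e_total + 1) * \<bar>x - yn n t \<xi>\<bar>)) \<longlonglongrightarrow> 0" using sq by simp
    qed
    from tendsto_add[OF this u_tendsto[OF t(1), of \<xi>]] show ?thesis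
      using sol_eq[OF t(1), of \<xi>] \<xi> by simp
  qed
  have ul: "uniform_limit ({0..T} \<times> {- X..X}) (\<lambda>n (t, x). W n t x) (\<lambda>(t, x). sol t x) sequentially"
  proof (rule uniform_limit_equicontinuous)
    show "compact ({0..T} \<times> {- X..X})" by (intro compact_Times) auto
    show "(\<lambda>n. case z of (t, x) \<Rightarrow> W n t x) \<longlonglongrightarrow> (case z of (t, x) \<Rightarrow> sol t x)" if "z \<in> {0..T} \<times> {- X..X}" for z
      using ptw that by auto
    fix \<epsilon> :: real assume \<epsilon>: "\<epsilon> > 0"
    obtain \<delta> where \<delta>: "\<delta> > 0" "\<And>W T' t s x x'. has_modulus T' (flow_const T) (e_total + 1) (flow_const T +
      flow_const T * T) W \<Longrightarrow> t \<in> {0..T'} \<Longrightarrow> s \<in> {0..T'} \<Longrightarrow>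
      dist (t, x) (s, x') < \<delta> \<Longrightarrow> \<bar>W t x - W s x'\<bar> < \<epsilon>" using modulus_uniform[OF nn' \<epsilon>] by blast
    have "\<forall>\<^sub>F n in sequentially. \<forall>z\<in>{0..T} \<times> {- X..X}. \<forall>z'\<in>{0..T} \<times> {- X..X}. dist z z' < \<delta>
      \<longrightarrow> \<bar>(case z of (t, x) \<Rightarrow> W n t x) - (case z' of (t, x) \<Rightarrow> W n t x)\<bar> < \<epsilon>"
      using evm by eventually_elim (auto intro: \<delta>(2))
    then show "\<exists>\<delta>>0. \<forall>\<^sub>F n in sequentially. \<forall>z\<in>{0..T} \<times> {- X..X}. \<forall>z'\<in>{0..T} \<times> {- X..X}. dist z z' < \<delta>
      \<longrightarrow> \<bar>(case z of (t, x) \<Rightarrow> W n t x) - (case z' of (t, x) \<Rightarrow> W n t x)\<bar> < \<epsilon>"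
      using \<delta>(1) by blast
    obtain \<delta>' where \<delta>': "\<delta>' > 0" "\<And>W T' t s x x'. has_modulus T' (lim_const T) e_total (lim_const T + lim_const T *
      T) W \<Longrightarrow> t \<in> {0..T'} \<Longrightarrow> s \<in> {0..T'} \<Longrightarrow>
      dist (t, x) (s, x') < \<delta>' \<Longrightarrow> \<bar>W t x - W s x'\<bar> < \<epsilon>" using modulus_uniform[OF nn \<epsilon>] by blast
    have "\<forall>z\<in>{0..T} \<times> {- X..X}. \<forall>z'\<in>{0..T} \<times> {- X..X}. dist z z' < \<delta>'
      \<longrightarrow> \<bar>(case z of (t, x) \<Rightarrow> sol t x) - (case z' of (t, x) \<Rightarrow> sol t x)\<bar> < \<epsilon>"
      using \<delta>'(2)[OF sol_modulus[OF T]] by auto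
    then show "\<exists>\<delta>>0. \<forall>z\<in>{0..T} \<times> {- X..X}. \<forall>z'\<in>{0..T} \<times> {- X..X}. dist z z' < \<delta>
      \<longrightarrow> \<bar>(case z of (t, x) \<Rightarrow> sol t x) - (case z' of (t, x) \<Rightarrow> sol t x)\<bar> < \<epsilon>"
      using \<delta>'(1) by blast
  qed
  have "uniform_limit {0..T} (\<lambda>n t. LINT x:I|lebesgue. \<bar>W n t x - sol t x\<bar>) (\<lambda>t. 0) sequentially"
  proof (rule uniform_limitI)
    fix \<epsilon> :: real assume \<epsilon>: "0 < \<epsilon>"
    then have \<epsilon>': "0 < \<epsilon> / (2 * X + 1)" using X by simp
    have "\<forall>\<^sub>F n in sequentially. \<forall>z\<in>{0..T} \<times> {- X..X}. dist (case z of (t, x) \<Rightarrow> W n t x) (case z of (t, x) \<Rightarrow> sol t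
      x) < \<epsilon> / (2 * X + 1)"
      using uniform_limitD[OF ul \<epsilon>'] by simp
    then show "\<forall>\<^sub>F n in sequentially. \<forall>t\<in>{0..T}. dist (LINT x:I|lebesgue. \<bar>W n t x - sol t x\<bar>) 0 < \<epsilon>"
    proof eventually_elim
      case (elim n)
      show ?case
      proof
        fix t assume t: "t \<in> {0..T}"
        obtain C E K where m: "0 \<le> C" "0 \<le> E" "0 \<le> K" "has_modulus T C E K (W n)" using modn[of n] by blast
        have cd: "continuous_on UNIV (\<lambda>x. W n t x - sol t x)"
          by (intro continuous_intros has_modulus_section[OF m(4) m(1-3) t] has_modulus_section[OF sol_modulus[OF T] nn t])
        have "\<bar>W n t x - sol t x\<bar> \<le> \<epsilon> / (2 * X + 1)" if "x \<in> {- X..X}" for x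
          using elim[rule_format, of "(t, x)"] that t by (simp add: dist_real_def)
        note i = interval_L1_le[OF I(1) IX X cd this]
        have "\<epsilon> / (2 * X + 1) * (2 * X) < \<epsilon> / (2 * X + 1) * (2 * X + 1)"
          using \<epsilon>' by (intro mult_strict_left_mono) auto
        also have "\<dots> = \<epsilon>" using X by simp
        finally show "dist (LINT x:I|lebesgue. \<bar>W n t x - sol t x\<bar>) 0 < \<epsilon>" using i(2,3) by (simp add: dist_real_def)
      qed
    qed
  qed
  with CL CLs show ?thesis by (simp add: C_L1_tendsto_def)
qed

end

section \<open>Smooth functions of two variables\<close>

text \<open>In \<open>Ck\<close> the derivative is existentially quantified anew at each order;
  uniqueness of derivatives identifies all of them with \<open>frechet_derivative\<close>, through
  which \<open>d_t\<close> and \<open>d_x\<close> are defined.\<close>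

lemma Ck_frechet:
  fixes \<phi> :: "real \<times> real \<Rightarrow> real"
  assumes "\<And>n. Ck n \<phi>"
  shows "(\<phi> has_derivative frechet_derivative \<phi> (at z)) (at z)" "Ck n (\<lambda>z. frechet_derivative \<phi> (at z) h)"
proof -
  have "Ck (Suc n) \<phi>" for n using assms .
  then have ex: "\<exists>f'. (\<forall>x. (\<phi> has_derivative f' x) (at x)) \<and> (\<forall>h. Ck n (\<lambda>x. f' x h))" for n by simp
  obtain f' where f': "\<And>x. (\<phi> has_derivative f' x) (at x)" "\<And>h. Ck n (\<lambda>x. f' x h)" using ex[of n] by blast
  have fr: "frechet_derivative \<phi> (at x) = f' x" for x by (rule frechet_derivative_at[OF f'(1), symmetric])
  show "(\<phi> has_derivative frechet_derivative \<phi> (at z)) (at z)" unfolding fr by (rule f'(1))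
  show "Ck n (\<lambda>z. frechet_derivative \<phi> (at z) h)" unfolding fr by (rule f'(2))
qed

lemma Ck_partial:
  fixes \<phi> :: "real \<times> real \<Rightarrow> real"
  assumes "\<And>n. Ck n \<phi>"
  shows "(\<phi> has_derivative (\<lambda>h. fst h * d_t \<phi> z + snd h * d_x \<phi> z)) (at z)" "Ck n (d_t \<phi>)" "Ck n (d_x \<phi>)"
proof -
  note f = Ck_frechet[OF assms]
  have lin: "linear (frechet_derivative \<phi> (at z))" by (rule has_derivative_linear[OF f(1)])
  have fd: "frechet_derivative \<phi> (at z) h = fst h * d_t \<phi> z + snd h * d_x \<phi> z" for h
  proof -
    have "h = fst h *\<^sub>R (1, 0) + snd h *\<^sub>R (0, 1)" by (simp add: prod_eq_iff)
    then have "frechet_derivative \<phi> (at z) h = frechet_derivative \<phi> (at z) (fst h *\<^sub>R (1, 0) + snd h *\<^sub>R (0, 1))" by simp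
    also have "\<dots> = fst h * d_t \<phi> z + snd h * d_x \<phi> z"
      unfolding linear_add[OF lin] linear_scale[OF lin] by (simp add: d_t_def d_x_def)
    finally show ?thesis .
  qed
  show "(\<phi> has_derivative (\<lambda>h. fst h * d_t \<phi> z + snd h * d_x \<phi> z)) (at z)"
    by (rule has_derivative_eq_rhs[OF f(1)]) (rule ext, rule fd)
  show "Ck n (d_t \<phi>)" unfolding d_t_def[abs_def] by (rule f(2))
  show "Ck n (d_x \<phi>)" unfolding d_x_def[abs_def] by (rule f(2))
qed

lemma Ck_continuous: "(\<And>n. Ck n \<phi>) \<Longrightarrow> continuous_on UNIV \<phi>"
  using Ck.simps(1) by blast

lemma curve_derivative:
  fixes \<phi> :: "real \<times> real \<Rightarrow> real"
  assumes "\<And>n. Ck n \<phi>" and "(Y has_real_derivative U) (at s within S)"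
  shows "((\<lambda>s. \<phi> (s, Y s)) has_real_derivative d_t \<phi> (s, Y s) + U * d_x \<phi> (s, Y s)) (at s within S)"
proof -
  have "((\<lambda>s. (s, Y s)) has_derivative (\<lambda>h. (h, h * U))) (at s within S)"
  proof (intro has_derivative_Pair has_derivative_ident)
    show "(Y has_derivative (\<lambda>h. h * U)) (at s within S)"
      using assms(2) unfolding has_field_derivative_def by (rule has_derivative_eq_rhs) (auto simp: mult.commute)
  qed
  from has_derivative_in_compose[OF this has_derivative_at_withinI[OF Ck_partial(1)[OF assms(1)]]]
  have "((\<lambda>s. \<phi> (s, Y s)) has_derivative (\<lambda>h. h * d_t \<phi> (s, Y s) + h * U * d_x \<phi> (s, Y s))) (at s within S)" by simp
  then show ?thesis unfolding has_field_derivative_def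
    by (rule has_derivative_eq_rhs) (auto simp: algebra_simps)
qed

lemma partial_t: "(\<And>n. Ck n \<phi>) \<Longrightarrow> ((\<lambda>s. \<phi> (s, x)) has_real_derivative d_t \<phi> (s, x)) (at s)"
  using curve_derivative[of \<phi> "\<lambda>_. x" 0 s UNIV] by auto

lemma partial_x:
  assumes "\<And>n. Ck n \<phi>" shows "((\<lambda>x. \<phi> (t, x)) has_real_derivative d_x \<phi> (t, x)) (at x)"
proof -
  have "((\<lambda>x. (t, x)) has_derivative (\<lambda>h. (0, h))) (at x)"
    by (intro has_derivative_Pair has_derivative_ident has_derivative_const)
  from has_derivative_compose[OF this Ck_partial(1)[OF assms]]
  have "((\<lambda>x. \<phi> (t, x)) has_derivative (\<lambda>h. h * d_x \<phi> (t, x))) (at x)" by simp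
  then show ?thesis unfolding has_field_derivative_def by (rule has_derivative_eq_rhs) (auto simp: mult.commute)
qed

text \<open>The second difference over a square of side h, evaluated by two mean value theorems in
  either order, is h^2 times each mixed partial at nearby points; continuity finishes. The limit
  equation has d_t outermost, while integration by parts in x needs d_x outermost.\<close>

lemma mixed_partials:
  fixes \<phi> :: "real \<times> real \<Rightarrow> real"
  assumes \<phi>: "\<And>n. Ck n \<phi>"
  shows "d_t (d_x \<phi>) z = d_x (d_t \<phi>) z"
proof -
  obtain t x where z: "z = (t, x)" by (cases z)
  have \<phi>t: "\<And>n. Ck n (d_t \<phi>)" and \<phi>x: "\<And>n. Ck n (d_x \<phi>)" using Ck_partial(2,3)[OF \<phi>] by auto
  have ex: "\<exists>\<theta>1 \<theta>2. dist \<theta>1 z \<le> 2 * h \<and> dist \<theta>2 z \<le> 2 * h \<and> d_t (d_x \<phi>) \<theta>1 = d_x (d_t \<phi>) \<theta>2" if h: "h > 0" for h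
  proof -
    have th: "t < t + h" and xh: "x < x + h" using h by auto
    have close: "dist (s, r) z \<le> 2 * h" if "t < s" "s < t + h" "x < r" "r < x + h" for s r
    proof -
      have "dist (s, r) z \<le> \<bar>s - t\<bar> + \<bar>r - x\<bar>"
        unfolding z dist_Pair_Pair dist_real_def by (rule sqrt_sum_squares_le_sum_abs[THEN order_trans]) simp
      then show ?thesis using that by linarith
    qed
    have pt: "((\<lambda>s. \<phi> (s, x + h) - \<phi> (s, x)) has_real_derivative d_t \<phi> (s, x + h) - d_t \<phi> (s, x)) (at s)" for s
      by (intro DERIV_diff partial_t[OF \<phi>])
    have px: "((\<lambda>r. \<phi> (t + h, r) - \<phi> (t, r)) has_real_derivative d_x \<phi> (t + h, r) - d_x \<phi> (t, r)) (at r)" for r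
      by (intro DERIV_diff partial_x[OF \<phi>])
    obtain s where s: "t < s" "s < t + h"
      "(\<phi> (t + h, x + h) - \<phi> (t + h, x)) - (\<phi> (t, x + h) - \<phi> (t, x)) = (t + h - t) * (d_t \<phi> (s, x + h) - d_t \<phi> (s, x))"
      using MVT2[OF th, of "\<lambda>s. \<phi> (s, x + h) - \<phi> (s, x)" "\<lambda>s. d_t \<phi> (s, x + h) - d_t \<phi> (s, x)", OF pt] by blast
    obtain r where r: "x < r" "r < x + h" "d_t \<phi> (s, x + h) - d_t \<phi> (s, x) = (x + h - x) * d_x (d_t \<phi>) (s, r)"
      using MVT2[OF xh, of "\<lambda>r. d_t \<phi> (s, r)" "\<lambda>r. d_x (d_t \<phi>) (s, r)"] partial_x[OF \<phi>t] by auto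
    obtain r' where r': "x < r'" "r' < x + h"
      "(\<phi> (t + h, x + h) - \<phi> (t, x + h)) - (\<phi> (t + h, x) - \<phi> (t, x)) = (x + h - x) * (d_x \<phi> (t + h, r') - d_x \<phi> (t, r'))"
      using MVT2[OF xh, of "\<lambda>r. \<phi> (t + h, r) - \<phi> (t, r)" "\<lambda>r. d_x \<phi> (t + h, r) - d_x \<phi> (t, r)", OF px] by blast
    obtain s' where s': "t < s'" "s' < t + h" "d_x \<phi> (t + h, r') - d_x \<phi> (t, r') = (t + h - t) * d_t (d_x \<phi>) (s', r')"
      using MVT2[OF th, of "\<lambda>s. d_x \<phi> (s, r')" "\<lambda>s. d_t (d_x \<phi>) (s, r')"] partial_t[OF \<phi>x] by auto
    have "h * (h * d_x (d_t \<phi>) (s, r)) = h * (h * d_t (d_x \<phi>) (s', r'))"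
      using s(3) r(3) r'(3) s'(3) by (simp add: algebra_simps)
    then have "d_t (d_x \<phi>) (s', r') = d_x (d_t \<phi>) (s, r)" using h by simp
    then show ?thesis using close[of s r] close[of s' r'] s r s' r' by blast
  qed
  then have "\<forall>n. \<exists>\<theta>1 \<theta>2. dist \<theta>1 z \<le> 2 * (1 / real (Suc n)) \<and> dist \<theta>2 z \<le> 2 * (1 / real (Suc n)) \<and> d_t (d_x \<phi>) \<theta>1
    = d_x (d_t \<phi>) \<theta>2"
    by (intro allI ex) simp
  then obtain \<theta>1 \<theta>2 where \<theta>: "\<And>n. dist (\<theta>1 n) z \<le> 2 * (1 / real (Suc n))" "\<And>n. dist (\<theta>2 n) z \<le> 2 * (1 / real (Suc n))"
    "\<And>n. d_t (d_x \<phi>) (\<theta>1 n) = d_x (d_t \<phi>) (\<theta>2 n)" by metis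
  have n0: "(\<lambda>n. 2 * (1 / real (Suc n))) \<longlonglongrightarrow> 0"
    using tendsto_mult_right_zero[OF LIMSEQ_Suc[OF lim_const_over_n[of 1]], of 2] by simp
  have l: "\<theta> \<longlonglongrightarrow> z" if "\<And>n. dist (\<theta> n) z \<le> 2 * (1 / real (Suc n))" for \<theta>
    unfolding tendsto_dist_iff[of \<theta>]
    by (rule tendsto_sandwich[OF _ _ tendsto_const n0]) (use that in auto)
  have "(\<lambda>n. d_t (d_x \<phi>) (\<theta>1 n)) \<longlonglongrightarrow> d_t (d_x \<phi>) z"
    by (rule continuous_on_tendsto_compose[OF Ck_continuous[OF Ck_partial(2)[OF \<phi>x]] l[OF \<theta>(1)]]) auto
  moreover have "(\<lambda>n. d_x (d_t \<phi>) (\<theta>2 n)) \<longlonglongrightarrow> d_x (d_t \<phi>) z"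
    by (rule continuous_on_tendsto_compose[OF Ck_continuous[OF Ck_partial(3)[OF \<phi>t]] l[OF \<theta>(2)]]) auto
  ultimately show ?thesis unfolding \<theta>(3) using LIMSEQ_unique by blast
qed

lemma partials_vanish:
  fixes \<psi> :: "real \<times> real \<Rightarrow> real"
  assumes "closed S" "\<And>z. z \<notin> S \<Longrightarrow> \<psi> z = 0" "z \<notin> S"
  shows "d_t \<psi> z = 0" "d_x \<psi> z = 0"
proof -
  have "(\<psi> has_derivative (\<lambda>_. 0)) (at z)"
    by (rule has_derivative_transform_within_open[of "\<lambda>_. 0" "\<lambda>_. 0" z UNIV "- S"])
      (use assms in \<open>auto simp: open_Compl\<close>)
  then have "frechet_derivative \<psi> (at z) = (\<lambda>_. 0)" by (rule frechet_derivative_at[symmetric])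
  then show "d_t \<psi> z = 0" "d_x \<psi> z = 0" by (simp_all add: d_t_def d_x_def)
qed

section \<open>Properties of the limit\<close>

lemma continuous_on_test:
  fixes h :: "real \<Rightarrow> real"
  assumes "continuous_on UNIV h" "\<And>x. x \<notin> {a..b} \<Longrightarrow> h x = 0"
  shows "integrable lborel h" "(LBINT x. h x) = integral {a..b} h"
proof -
  have eq: "indicator {a..b} x *\<^sub>R h x = h x" for x using assms(2)[of x] by (auto simp: indicator_def)
  have si: "set_integrable lborel {a..b} h"
    by (rule borel_integrable_atLeastAtMost') (rule continuous_on_subset[OF assms(1)], simp)
  then show "integrable lborel h" unfolding set_integrable_def eq .
  show "(LBINT x. h x) = integral {a..b} h"
    using set_borel_integral_eq_integral(2)[OF si] unfolding set_lebesgue_integral_def eq .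
qed

section \<open>Integration in Lagrangian coordinates\<close>

context lagrangian_flow
begin

text \<open>The map y may be constant on intervals, so instead of inverting it a primitive of \<psi>
  is composed with y and the chain rule applied.\<close>

lemma change_of_variables:
  assumes t: "0 \<le> t" "t \<le> T" and \<psi>: "continuous_on UNIV \<psi>" and le: "\<xi> \<le> \<eta>"
  shows "integral {\<xi>..\<eta>} (\<lambda>x. \<psi> (y t x) * a t x) = integral {y t \<xi>..y t \<eta>} \<psi>"
proof -
  define c where "c = y t \<xi> - 1"
  define d where "d = y t \<eta> + 1"
  have hc: "continuous_on A \<psi>" for A by (rule continuous_on_subset[OF \<psi>]) simp
  have r: "y t \<xi> \<le> y t x" "y t x \<le> y t \<eta>" if "x \<in> {\<xi>..\<eta>}" for x using y_mono[OF t] that by auto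
  have AC: "AC_on \<xi> \<eta> (\<lambda>x. integral {c..y t x} \<psi>) (\<lambda>x. \<psi> (y t x) * a t x)"
  proof (rule AC_on_comp[OF y_AC[OF t], where G="\<lambda>z. integral {c..z} \<psi>" and G'=\<psi>])
    fix z assume "z \<in> y t ` {\<xi>..\<eta>}"
    then have z: "c < z" "z < d" using r by (force simp: c_def d_def)+
    have "((\<lambda>z. integral {c..z} \<psi>) has_real_derivative \<psi> z) (at z within {c..d})"
      by (rule integral_has_real_derivative[OF hc]) (use z in auto)
    moreover have "at z within {c..d} = at z" by (rule at_within_interior) (use z in auto)
    ultimately show "((\<lambda>z. integral {c..z} \<psi>) has_real_derivative \<psi> z) (at z)" by simp
  qed (rule hc)
  have "integral {\<xi>..\<eta>} (\<lambda>x. \<psi> (y t x) * a t x) = integral {c..y t \<eta>} \<psi> - integral {c..y t \<xi>} \<psi>"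
    using AC_on_diff[OF AC order_refl le order_refl] by simp
  also have "\<dots> = integral {y t \<xi>..y t \<eta>} \<psi>"
    using Henstock_Kurzweil_Integration.integral_combine[of c "y t \<xi>"
      "y t \<eta>" \<psi>] y_mono[OF t le] integrable_continuous_interval[OF hc]
    by (simp add: c_def)
  finally show ?thesis .
qed

text \<open>Pull back to the particles, where W becomes u, integrate by parts in the label and use
  u_xi = g. The Eulerian function W is merely continuous.\<close>

lemma by_parts:
  assumes t: "0 \<le> t" "t \<le> T" and le: "\<xi> \<le> \<eta>"
    and W: "\<And>\<xi>. W (y t \<xi>) = u t \<xi>" "continuous_on UNIV W"
    and F: "\<And>z. (F has_real_derivative F' z) (at z)" "continuous_on UNIV F'"
    and f: "\<And>z. (f has_real_derivative f' z) (at z)" "continuous_on UNIV f'" "f (y t \<xi>) = 0" "f (y t \<eta>) = 0"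
  shows "integral {y t \<xi>..y t \<eta>} (\<lambda>x. F (W x) * f' x) = - integral {\<xi>..\<eta>} (\<lambda>x. F' (u t x) * g t x * f (y t x))"
proof -
  have Fc: "continuous_on UNIV F" by (intro continuous_at_imp_continuous_on ballI DERIV_isCont[OF F(1)])
  have AC1: "AC_on \<xi> \<eta> (\<lambda>x. F (u t x)) (\<lambda>x. F' (u t x) * g t x)"
    by (rule AC_on_comp[OF u_AC[OF t] F(1)]) (rule continuous_on_subset[OF F(2)], simp)
  have AC2: "AC_on \<xi> \<eta> (\<lambda>x. f (y t x)) (\<lambda>x. f' (y t x) * a t x)"
    by (rule AC_on_comp[OF y_AC[OF t] f(1)]) (rule continuous_on_subset[OF f(2)], simp)
  note AC = AC_on_mult[OF AC1 AC2]
  have i1: "(\<lambda>x. F' (u t x) * g t x * f (y t x)) integrable_on {\<xi>..\<eta>}"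
  proof -
    have c: "continuous_on {\<xi>..\<eta>} (\<lambda>x. F' (u t x))" "continuous_on {\<xi>..\<eta>} (\<lambda>x. f (y t x))"
      using continuous_on_compose2[OF F(2) AC_on_continuous[OF u_AC[OF t]]] AC_on_continuous[OF AC2] by auto
    have "(\<lambda>x. (F' (u t x) * f (y t x)) * g t x) absolutely_integrable_on {\<xi>..\<eta>}"
    proof (rule absolutely_integrable_bounded_measurable_product_real)
      have cc: "continuous_on {\<xi>..\<eta>} (\<lambda>x. F' (u t x) * f (y t x))" by (intro continuous_on_mult c)
      then show "(\<lambda>x. F' (u t x) * f (y t x)) \<in> borel_measurable (lebesgue_on {\<xi>..\<eta>})"
        by (rule continuous_imp_measurable_on_sets_lebesgue) simp
      show "bounded ((\<lambda>x. F' (u t x) * f (y t x)) ` {\<xi>..\<eta>})"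
        by (intro compact_imp_bounded compact_continuous_image cc) simp
    qed (use AC_onD(1)[OF u_AC[OF t]] in auto)
    then show ?thesis by (simp add: absolutely_integrable_on_def ac_simps)
  qed
  have "integral {\<xi>..\<eta>} (\<lambda>x. F' (u t x) * g t x * f (y t x) + F (u t x) * (f' (y t x) * a t x)) = 0"
    using AC_on_diff[OF AC order_refl le order_refl] f(3,4) by simp
  moreover have "integral {\<xi>..\<eta>} (\<lambda>x. F' (u t x) * g t x * f (y t x) + F (u t x) * (f' (y t x) * a t x))
     = integral {\<xi>..\<eta>} (\<lambda>x. F' (u t x) * g t x * f (y t x)) + integral {\<xi>..\<eta>} (\<lambda>x. F (u t x) * (f' (y t x) * a t x))"
  proof (rule Henstock_Kurzweil_Integration.integral_add[OF i1])
    have "(\<lambda>x. (F' (u t x) * g t x * f (y t x) + F (u t x) * (f' (y t x) * a t x)) - F' (u t x) * g t x * f (y t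
      x)) integrable_on {\<xi>..\<eta>}"
      using AC_onD(2)[OF AC] i1 by (rule integrable_diff)
    then show "(\<lambda>x. F (u t x) * (f' (y t x) * a t x)) integrable_on {\<xi>..\<eta>}" by simp
  qed
  moreover have "integral {\<xi>..\<eta>} (\<lambda>x. F (u t x) * (f' (y t x) * a t x)) = integral {y t \<xi>..y t \<eta>} (\<lambda>x. F (W x) * f' x)"
  proof -
    have "continuous_on UNIV (\<lambda>x. F (W x) * f' x)"
      using continuous_on_compose2[OF Fc W(2)] f(2) by (intro continuous_on_mult) auto
    from change_of_variables[OF t this le] show ?thesis by (simp add: W(1) ac_simps)
  qed
  ultimately show ?thesis by linarith
qed

end

section \<open>Measurability, variation, energy measure and one-sided bound of the limit\<close>

context lagrangian_datum
begin

lemma y0_meas [measurable]: "y0 \<in> borel_measurable borel"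
  and ub0_meas [measurable]: "ub0 \<in> borel_measurable borel"
proof -
  interpret F: lagrangian_flow 0 "lim_const 0" e_total a_lim g_lim e_lim "\<lambda>t \<xi>. e_lim t \<xi> / 2" D_lim ub0 y0
    by (rule limit_flow') simp
  have y: "y_lim 0 = y0" and u: "u_lim 0 = ub0" by (auto simp: flow_y_def flow_u_def)
  have "mono y0" using F.y_mono[of 0] y by (auto intro: monoI)
  then show "y0 \<in> borel_measurable borel" by (rule borel_measurable_mono)
  have "continuous_on UNIV ub0"
  proof (rule continuous_at_imp_continuous_on, rule ballI)
    fix x :: real
    have "continuous_on {x - 1..x + 1} (u_lim 0)" by (rule AC_on_continuous[OF F.u_AC]) auto
    then show "isCont ub0 x" unfolding u by (rule continuous_on_interior) auto
  qed
  then show "ub0 \<in> borel_measurable borel" by (rule borel_measurable_continuous_onI)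
qed

lemma u_lim_meas [measurable]: "jointly_Borel u_lim"
proof -
  have "(\<lambda>(\<xi>, s). D_lim s \<xi>) \<in> borel_measurable (borel \<Otimes>\<^sub>M borel)"
    using measurable_compose[OF _ D_lim_meas, of "\<lambda>(\<xi>, s). (s, \<xi>)" "borel \<Otimes>\<^sub>M borel"] by (simp add: split_beta')
  from LBINT_interval_measurable(1)[OF this, of 0]
  have m: "(\<lambda>(\<xi>, t). LBINT s:{0..t}. D_lim s \<xi>) \<in> borel_measurable (borel \<Otimes>\<^sub>M borel)" .
  have "(\<lambda>s. D_lim s \<xi>) \<in> borel_measurable borel" for \<xi> using D_lim_meas by measurable
  then have "integral {0..t} (\<lambda>s. D_lim s \<xi>) = (LBINT s:{0..t}. D_lim s \<xi>)" for t \<xi>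
    by (rule bounded_Borel_integrable(4)[symmetric, where C=e_total]) (rule D_lim_bd)
  then have eq: "u_lim t \<xi> = ub0 \<xi> + (LBINT s:{0..t}. D_lim s \<xi>)" for t \<xi> by (simp add: flow_u_def)
  show ?thesis unfolding eq
    using measurable_compose[OF _ m, of "\<lambda>(t, \<xi>). (\<xi>, t)" "borel \<Otimes>\<^sub>M borel"] by (simp add: split_beta')
qed

lemma u_lim_growth: "\<bar>u_lim t \<xi>\<bar> \<le> \<bar>ub0 \<xi>\<bar> + e_total * \<bar>t\<bar>"
proof (cases "0 \<le> t")
  case True
  have m: "(\<lambda>s. D_lim s \<xi>) \<in> borel_measurable borel" using D_lim_meas by measurable
  have "norm (integral {0..t} (\<lambda>s. D_lim s \<xi>)) \<le> integral {0..t} (\<lambda>_. e_total)"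
    by (rule Henstock_Kurzweil_Integration.integral_norm_bound_integral)
      (use bounded_Borel_integrable(3)[OF m, where C=e_total] D_lim_bd in auto)
  then show ?thesis using True unfolding flow_u_def by (simp add: mult.commute)
next
  case False
  then show ?thesis using e_total_nonneg by (auto simp: flow_u_def mult_nonneg_nonpos)
qed

lemma y_lim_meas [measurable]: "jointly_Borel y_lim"
proof -
  have "(\<lambda>(\<xi>, s). u_lim s \<xi>) \<in> borel_measurable (borel \<Otimes>\<^sub>M borel)"
    using measurable_compose[OF _ u_lim_meas, of "\<lambda>(\<xi>, s). (s, \<xi>)" "borel \<Otimes>\<^sub>M borel"] by (simp add: split_beta')
  from LBINT_interval_measurable(1)[OF this, of 0]
  have m: "(\<lambda>(\<xi>, t). LBINT s:{0..t}. u_lim s \<xi>) \<in> borel_measurable (borel \<Otimes>\<^sub>M borel)" .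
  have um: "(\<lambda>s. u_lim s \<xi>) \<in> borel_measurable borel" for \<xi> using u_lim_meas by measurable
  have "integral {0..t} (\<lambda>s. u_lim s \<xi>) = (LBINT s:{0..t}. u_lim s \<xi>)" for t \<xi>
  proof (rule bounded_Borel_integrable(4)[OF um, symmetric, where C="\<bar>ub0 \<xi>\<bar> + e_total * \<bar>t\<bar>"])
    fix s assume s: "0 \<le> s" "s \<le> t"
    have "e_total * \<bar>s\<bar> \<le> e_total * \<bar>t\<bar>" using s e_total_nonneg by (intro mult_left_mono) auto
    then show "\<bar>u_lim s \<xi>\<bar> \<le> \<bar>ub0 \<xi>\<bar> + e_total * \<bar>t\<bar>" using u_lim_growth[of s \<xi>] by linarith
  qed
  then have eq: "y_lim t \<xi> = y0 \<xi> + (LBINT s:{0..t}. u_lim s \<xi>)" for t \<xi> by (simp add: flow_y_def)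
  show ?thesis unfolding eq
    using measurable_compose[OF _ m, of "\<lambda>(t, \<xi>). (\<xi>, t)" "borel \<Otimes>\<^sub>M borel"] by (simp add: split_beta')
qed

lemma y_lim_sec [measurable]: "y_lim t \<in> borel_measurable borel" "(\<lambda>t. y_lim t \<xi>) \<in> borel_measurable borel"
  using y_lim_meas by measurable

text \<open>From ramp \<le> 1 + |w0| t: u_xi is bounded by its initial modulus plus t times the
  initial energy density.\<close>

lemma g_lim_L1: assumes t: "0 \<le> t"
  shows "integrable lborel (g_lim t)" "(LBINT \<xi>. \<bar>g_lim t \<xi>\<bar>) \<le> g_total + e_total * t"
proof -
  let ?b = "\<lambda>\<xi>. \<bar>w0 \<xi> / (1 + (w0 \<xi>)\<^sup>2)\<bar> + t * ((w0 \<xi>)\<^sup>2 / (1 + (w0 \<xi>)\<^sup>2))"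
  have bi: "integrable lborel ?b"
    by (intro Bochner_Integration.integrable_add integrable_abs g0_int integrable_mult_right e0_int)
  have gm: "g_lim t \<in> borel_measurable borel" using lim_meas(3) by measurable
  have b: "\<bar>g_lim t \<xi>\<bar> \<le> ?b \<xi>" for \<xi>
  proof -
    have "\<bar>ramp t \<xi>\<bar> \<le> 1 + \<bar>w0 \<xi>\<bar> * t"
    proof -
      have "w0 \<xi> * t \<le> \<bar>w0 \<xi>\<bar> * t" using t by (intro mult_right_mono) auto
      moreover have "0 \<le> \<bar>w0 \<xi>\<bar> * t" using t by simp
      ultimately show ?thesis unfolding ramp_def by (auto simp: max_def)
    qed
    then have "\<bar>g_lim t \<xi>\<bar> \<le> \<bar>w0 \<xi> / (1 + (w0 \<xi>)\<^sup>2)\<bar> * (1 + \<bar>w0 \<xi>\<bar> * t)"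
      unfolding g_lim_def abs_mult[of "_ / _"] by (intro mult_left_mono) auto
    also have "\<dots> = ?b \<xi>" using w_pos[of \<xi>] by (simp add: abs_divide distrib_left power2_eq_square abs_mult_self_eq)
    finally show ?thesis .
  qed
  show i: "integrable lborel (g_lim t)"
    by (rule Bochner_Integration.integrable_bound[OF bi]) (use gm b in \<open>auto intro: order_trans[OF _ abs_ge_self]\<close>)
  have "(LBINT \<xi>. \<bar>g_lim t \<xi>\<bar>) \<le> (LBINT \<xi>. ?b \<xi>)" by (rule integral_mono[OF integrable_abs[OF i] bi b])
  also have "\<dots> = g_total + t * e_total" unfolding g_total_def e_total_def
    by (subst Bochner_Integration.integral_add[OF integrable_abs[OF g0_int] integrable_mult_right[OF e0_int]])
      (simp only: Bochner_Integration.integral_mult_right_zero)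
  finally show "(LBINT \<xi>. \<bar>g_lim t \<xi>\<bar>) \<le> g_total + e_total * t" by (simp add: mult.commute)
qed

text \<open>A selection of particles that is monotone in x carries partitions to partitions, so the
  variation in space is at most the integral of |u_xi| over the labels.\<close>

lemma sol_variation:
  assumes t: "0 \<le> t"
  shows "total_variation (sol t) \<le> ennreal (g_total + e_total * t)"
  unfolding total_variation_def
proof (rule SUP_least, clarify)
  fix n :: nat and x :: "nat \<Rightarrow> real" assume x: "mono x"
  interpret F: lagrangian_flow t "lim_const t" e_total a_lim g_lim e_lim "\<lambda>t \<xi>. e_lim t \<xi> / 2" D_lim ub0 y0
    by (rule limit_flow'[OF t])
  define \<Xi> where "\<Xi> x = (SOME \<xi>. y_lim t \<xi> = x)" for x
  have \<Xi>: "y_lim t (\<Xi> x) = x" for x unfolding \<Xi>_def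
    by (rule someI_ex) (use y_lim_surj[OF t, of x] in metis)
  \<comment> \<open>Any selection is monotone: y is nondecreasing, so labels in reversed order
    cannot belong to strictly increasing positions.\<close>
  have \<Xi>mono: "\<Xi> x \<le> \<Xi> x'" if "x \<le> x'" for x x'
  proof (cases "x = x'")
    case False
    then show ?thesis using that F.y_mono[OF t order_refl, of "\<Xi> x'" "\<Xi> x"] \<Xi> by (metis linorder_le_cases order_antisym)
  qed simp
  have gm: "(\<lambda>\<xi>. \<bar>g_lim t \<xi>\<bar>) \<in> borel_measurable borel" using F.sec_meas(2) by measurable
  have gb: "\<bar>\<bar>g_lim t \<xi>\<bar>\<bar> \<le> lim_const t" for \<xi> using F.g_bd[OF t order_refl] by simp
  define V where "V = prim (\<lambda>\<xi>. \<bar>g_lim t \<xi>\<bar>)"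
  have V: "\<bar>u_lim t \<eta> - u_lim t \<xi>\<bar> \<le> V \<eta> - V \<xi>" if "\<xi> \<le> \<eta>" for \<xi> \<eta>
  proof -
    have "norm (integral {\<xi>..\<eta>} (g_lim t)) \<le> integral {\<xi>..\<eta>} (\<lambda>\<xi>. \<bar>g_lim t \<xi>\<bar>)"
      by (rule Henstock_Kurzweil_Integration.integral_norm_bound_integral)
        (use F.space_integrable(2)[OF t order_refl] bounded_Borel_integrable(3)[OF gm gb] in auto)
    then show ?thesis unfolding V_def prim_diff[OF gm gb that] F.u_inc[OF t order_refl that] by simp
  qed
  have "(\<Sum>i<n. ennreal \<bar>sol t (x (Suc i)) - sol t (x i)\<bar>) = ennreal (\<Sum>i<n. \<bar>sol t (x (Suc i)) - sol t (x i)\<bar>)"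
    by (rule sum_ennreal) simp
  also have "\<dots> \<le> ennreal (\<Sum>i<n. V (\<Xi> (x (Suc i))) - V (\<Xi> (x i)))"
  proof (intro ennreal_leI sum_mono)
    fix i
    have "\<bar>u_lim t (\<Xi> (x (Suc i))) - u_lim t (\<Xi> (x i))\<bar> \<le> V (\<Xi> (x (Suc i))) - V (\<Xi> (x i))"
      by (rule V, rule \<Xi>mono) (use x in \<open>simp add: monoD\<close>)
    then show "\<bar>sol t (x (Suc i)) - sol t (x i)\<bar> \<le> V (\<Xi> (x (Suc i))) - V (\<Xi> (x i))"
      by (simp add: sol_eq[OF t, symmetric] \<Xi>)
  qed
  also have "(\<Sum>i<n. V (\<Xi> (x (Suc i))) - V (\<Xi> (x i))) = V (\<Xi> (x n)) - V (\<Xi> (x 0))"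
    by (rule sum_lessThan_telescope)
  also have "\<dots> = (LBINT \<xi>:{\<Xi> (x 0)..\<Xi> (x n)}. \<bar>g_lim t \<xi>\<bar>)"
    unfolding V_def using prim_diff[OF gm gb \<Xi>mono] bounded_Borel_integrable(4)[OF gm gb] x by (simp add: monoD)
  also have "\<dots> \<le> (LBINT \<xi>. \<bar>g_lim t \<xi>\<bar>)"
    unfolding set_lebesgue_integral_def
    by (rule integral_mono) (use bounded_Borel_integrable(1)[OF gm gb] integrable_abs[OF g_lim_L1(1)[OF t]] in
      \<open>auto simp: set_integrable_def indicator_def\<close>)
  also have "\<dots> \<le> g_total + e_total * t" by (rule g_lim_L1(2)[OF t])
  finally show "(\<Sum>i<n. ennreal \<bar>sol t (x (Suc i)) - sol t (x i)\<bar>) \<le> ennreal (g_total + e_total * t)"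
    by (simp add: ennreal_leI)
qed

lemma sol_continuous: "continuous_on ({0..T} \<times> UNIV) (\<lambda>(t, x). sol t x)"
proof (cases "0 \<le> T")
  case True
  show ?thesis by (rule has_modulus_continuous[OF sol_modulus[OF True]]) (use lim_const_nonneg e_total_nonneg True in auto)
qed simp

lemma sol_section: "0 \<le> t \<Longrightarrow> continuous_on UNIV (sol t)"
  by (rule has_modulus_section[OF sol_modulus[of t]]) (use lim_const_nonneg e_total_nonneg in auto)

lemma sol_Linf_BV: assumes T: "0 < T" shows "Linf_BV T sol"
  unfolding Linf_BV_def
proof (intro conjI exI)
  have "(\<lambda>z. indicator ({0..T} \<times> UNIV) z *\<^sub>R (case z of (t, x) \<Rightarrow> sol t x)) \<in> borel_measurable borel"
    by (rule borel_measurable_continuous_on_indicator[OF _ sol_continuous]) (auto intro: borel_closed closed_Times)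
  then show "set_borel_measurable lebesgue ({0..T} \<times> UNIV) (\<lambda>(t, x). sol t x)"
    unfolding set_borel_measurable_def by (simp add: measurable_completion)
  let ?C = "(lim_const T + lim_const T * T) + (g_total + e_total * T)"
  show "AE t in lebesgue. t \<in> {0..T} \<longrightarrow> (\<forall>x. \<bar>sol t x\<bar> \<le> ?C) \<and> total_variation (sol t) \<le> ennreal ?C"
  proof (rule AE_I2, intro impI conjI allI)
    fix t assume "t \<in> {0..T}"
    then have t: "0 \<le> t" "t \<le> T" by auto
    interpret F: lagrangian_flow T "lim_const T" e_total a_lim g_lim e_lim "\<lambda>t \<xi>. e_lim t \<xi> / 2" D_lim ub0 y0
      by (rule limit_flow') (use T in simp)
    have gT: "g_total + e_total * t \<le> g_total + e_total * T" "0 \<le> g_total + e_total * T" "0 \<le> lim_const T + lim_const T * T"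
      using t T e_total_nonneg g_total_nonneg lim_const_nonneg[of T] by (auto intro: mult_left_mono)
    show "\<bar>sol t x\<bar> \<le> ?C" for x
    proof -
      obtain \<xi> where "x = y_lim t \<xi>" using y_lim_surj[OF t(1)] by blast
      then show ?thesis using F.u_bd[OF t, of \<xi>] gT sol_eq[OF t(1), of \<xi>] by simp
    qed
    show "total_variation (sol t) \<le> ennreal ?C"
      by (rule order_trans[OF sol_variation[OF t(1)] ennreal_leI]) (use gT in linarith)
  qed
qed

definition nu :: "real \<Rightarrow> real measure" where
  "nu t = distr (density lborel (\<lambda>\<xi>. ennreal (e_lim t \<xi> / 2))) borel (y_lim t)"

lemma nu_emeasure:
  assumes "A \<in> sets borel"
  shows "emeasure (nu t) A = (\<integral>\<^sup>+\<xi>. ennreal (e_lim t \<xi> / 2) * indicator A (y_lim t \<xi>) \<partial>lborel)"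
proof -
  have "emeasure (nu t) A = emeasure (density lborel (\<lambda>\<xi>. ennreal (e_lim t \<xi> / 2))) (y_lim t -` A)"
    unfolding nu_def using assms by (subst emeasure_distr) auto
  also have "\<dots> = (\<integral>\<^sup>+\<xi>. ennreal (e_lim t \<xi> / 2) * indicator (y_lim t -` A) \<xi> \<partial>lborel)"
    using measurable_sets_borel[OF y_lim_sec(1) assms] by (subst emeasure_density) auto
  finally show ?thesis by (simp add: indicator_def)
qed

lemma nu_total: "emeasure (nu t) UNIV \<le> ennreal (e_total / 2)"
proof -
  have i: "integrable lborel (\<lambda>\<xi>. e_lim t \<xi> / 2)" using e_lim_int by simp
  have "emeasure (nu t) UNIV = (\<integral>\<^sup>+\<xi>. ennreal (e_lim t \<xi> / 2) \<partial>lborel)" by (simp add: nu_emeasure)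
  also have "\<dots> = ennreal (LBINT \<xi>. e_lim t \<xi> / 2)" by (rule nn_integral_eq_integral[OF i]) (use e_lim_bd in auto)
  also have "\<dots> \<le> ennreal (e_total / 2)" using e_lim_total[of t] by (intro ennreal_leI) simp
  finally show ?thesis .
qed

lemma nu_Linf: "Linf_M1_nonneg nu"
  unfolding Linf_M1_nonneg_def
proof (intro conjI allI impI ballI)
  fix t :: real
  have "emeasure (nu t) (space (nu t)) \<noteq> \<infinity>"
    using nu_total[of t] by (auto simp: nu_def top_unique)
  then show "finite_measure (nu t)" by (rule finite_measureI)
  show "sets (nu t) = sets borel" by (simp add: nu_def)
next
  fix A :: "real set" assume A[measurable]: "A \<in> sets borel"
  have m: "(\<lambda>p. ennreal (e_lim (fst p) (snd p) / 2) * indicator A (y_lim (fst p) (snd p)))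
    \<in> borel_measurable (borel \<Otimes>\<^sub>M lborel)"
  proof -
    have [measurable]: "(\<lambda>p. e_lim (fst p) (snd p)) \<in> borel_measurable (borel \<Otimes>\<^sub>M lborel)"
      "(\<lambda>p. y_lim (fst p) (snd p)) \<in> borel_measurable (borel \<Otimes>\<^sub>M lborel)"
      using lim_meas(2) y_lim_meas by (simp_all add: split_beta')
    show ?thesis by measurable
  qed
  have "(\<lambda>t. emeasure (nu t) A) \<in> borel_measurable borel"
    unfolding nu_emeasure[OF A] by (rule lborel.borel_measurable_nn_integral) (use m in \<open>simp add: split_beta'\<close>)
  then have "(\<lambda>t. measure (nu t) A) \<in> borel_measurable borel" unfolding measure_def by measurable
  then have "(\<lambda>t. indicator {0..} t *\<^sub>R measure (nu t) A) \<in> borel_measurable borel" by measurable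
  then show "set_borel_measurable lebesgue {0..} (\<lambda>t. measure (nu t) A)"
    unfolding set_borel_measurable_def by (simp add: measurable_completion)
next
  have "measure (nu t) UNIV \<le> e_total / 2" for t
    unfolding measure_def using nu_total[of t] e_total_nonneg by (intro enn2real_leI) auto
  then show "\<exists>C. AE t in lebesgue. t \<ge> 0 \<longrightarrow> measure (nu t) UNIV \<le> C"
    by (intro exI[of _ "e_total / 2"] AE_I2 impI)
qed

text \<open>In particle coordinates the claim is g \<le> c a. For a live particle this reads w0 / (1
  + w0 t / 2) \<le> 2 M / (M t + 2), whose left side increases with w0; for a dead one both sides
  are 0.\<close>

lemma oleinik:
  assumes M: "AE \<xi> in lborel. w0 \<xi> \<le> M" and t: "0 \<le> t"
  shows "distr_deriv_le (sol t) (2 * M / (M * t + 2))"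
  unfolding distr_deriv_le_def
proof (intro allI impI, elim conjE)
  fix \<phi> :: "real \<Rightarrow> real" assume tf: "test_fun UNIV \<phi>" and pos: "\<forall>x. 0 \<le> \<phi> x"
  interpret F: lagrangian_flow t "lim_const t" e_total a_lim g_lim e_lim "\<lambda>t \<xi>. e_lim t \<xi> / 2" D_lim ub0 y0
    by (rule limit_flow'[OF t])
  define c where "c = 2 * M / (M * t + 2)"
  have "Ck (Suc 1) \<phi>" using tf unfolding test_fun_def by blast
  then obtain \<phi>' where \<phi>': "\<And>x. (\<phi> has_real_derivative \<phi>' x) (at x)" "Ck 1 \<phi>'" by (rule Ck_SucE) blast
  have c\<phi>': "continuous_on UNIV \<phi>'" using Ck_Suc_imp[of 0 \<phi>'] \<phi>'(2) by simp
  have c\<phi>: "continuous_on UNIV \<phi>" by (intro continuous_at_imp_continuous_on ballI DERIV_isCont[OF \<phi>'(1)])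
  define S where "S = closure {x. \<phi> x \<noteq> 0}"
  have S: "compact S" "closed S" using tf by (auto simp: test_fun_def S_def)
  have z: "\<phi> x = 0" if "x \<notin> S" for x using that closure_subset[of "{x. \<phi> x \<noteq> 0}"] by (auto simp: S_def)
  have z': "\<phi>' x = 0" if "x \<notin> S" for x
  proof -
    have "((\<lambda>_. 0) has_real_derivative 0) (at x)" by simp
    then have "(\<phi> has_real_derivative 0) (at x)"
      by (rule has_field_derivative_transform_within_open[where S="- S"]) (use that S z in \<open>auto simp: open_Compl\<close>)
    then show ?thesis using DERIV_unique[OF \<phi>'(1)] by blast
  qed
  obtain X where X: "\<forall>x\<in>S. norm x \<le> X" using compact_imp_bounded[OF S(1)] unfolding bounded_iff by blast
  obtain \<xi> where \<xi>: "- (\<bar>X\<bar> + 1) = y_lim t \<xi>" using y_lim_surj[OF t] by blast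
  obtain \<eta> where \<eta>: "\<bar>X\<bar> + 1 = y_lim t \<eta>" using y_lim_surj[OF t] by blast
  have le: "\<xi> \<le> \<eta>"
  proof (rule ccontr)
    assume "\<not> \<xi> \<le> \<eta>"
    then have "y_lim t \<eta> \<le> y_lim t \<xi>" by (intro F.y_mono[OF t order_refl]) simp
    then show False using \<xi> \<eta> by linarith
  qed
  have out: "\<phi> x = 0" "\<phi>' x = 0" if "x \<notin> {- \<bar>X\<bar>..\<bar>X\<bar>}" for x
  proof -
    have "x \<notin> S" using X that by (auto simp: abs_le_iff)
    then show "\<phi> x = 0" "\<phi>' x = 0" using z z' by auto
  qed
  have sc: "continuous_on UNIV (sol t)" by (rule sol_section[OF t])
  have "integral {y_lim t \<xi>..y_lim t \<eta>} (\<lambda>x. sol t x * \<phi>' x) = - integral {\<xi>..\<eta>} (\<lambda>x. 1 * g_lim t x * \<phi> (y_lim t x))"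
    by (rule F.by_parts[OF t order_refl le sol_eq[OF t] sc, where F="\<lambda>z. z" and F'="\<lambda>_. 1"])
      (use \<phi>'(1) c\<phi>' \<xi> \<eta> out in auto)
  moreover have "integral {\<xi>..\<eta>} (\<lambda>x. g_lim t x * \<phi> (y_lim t x)) \<le> integral {\<xi>..\<eta>} (\<lambda>x. c * \<phi> (y_lim t x) * a_lim t x)"
  proof -
    \<comment> \<open>The bound on w0 holds almost everywhere; on the exceptional null set the
      integrand is replaced by its majorant, so that the comparison becomes pointwise.\<close>
    let ?h = "\<lambda>x. if w0 x \<le> M then g_lim t x * \<phi> (y_lim t x) else c * \<phi> (y_lim t x) * a_lim t x"
    have "{x. \<not> w0 x \<le> M} \<in> null_sets lborel" using M by (subst (asm) AE_iff_null) auto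
    then have neg: "negligible {x. \<not> w0 x \<le> M}"
      unfolding negligible_iff_null_sets by (rule null_sets_completionI)
    have "bounded (range \<phi>)"
    proof -
      have "bounded (\<phi> ` {- \<bar>X\<bar>..\<bar>X\<bar>})" by (intro compact_imp_bounded compact_continuous_image
        continuous_on_subset[OF c\<phi>]) auto
      moreover have "\<phi> x \<in> insert 0 (\<phi> ` {- \<bar>X\<bar>..\<bar>X\<bar>})" for x
        using out(1)[of x] by (cases "x \<in> {- \<bar>X\<bar>..\<bar>X\<bar>}") auto
      then have "range \<phi> \<subseteq> insert 0 (\<phi> ` {- \<bar>X\<bar>..\<bar>X\<bar>})" by blast
      ultimately show ?thesis by (meson bounded_insert bounded_subset)
    qed
    then obtain K where K: "\<And>x. \<bar>\<phi> x\<bar> \<le> K" unfolding bounded_iff by auto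
    have K0: "0 \<le> K" using K[of 0] by linarith
    have phm: "\<phi> \<in> borel_measurable borel" by (rule borel_measurable_continuous_onI[OF c\<phi>])
    note [measurable] = phm F.sec_meas(1,2)
    have i1: "(\<lambda>x. g_lim t x * \<phi> (y_lim t x)) integrable_on {\<xi>..\<eta>}"
    proof (rule bounded_Borel_integrable(3)[where C="lim_const t * K"])
      show "\<bar>g_lim t x * \<phi> (y_lim t x)\<bar> \<le> lim_const t * K" for x unfolding abs_mult
        by (rule mult_mono[OF F.g_bd[OF t order_refl] K lim_const_nonneg]) simp
    qed measurable
    have i2: "(\<lambda>x. c * \<phi> (y_lim t x) * a_lim t x) integrable_on {\<xi>..\<eta>}"
    proof (rule bounded_Borel_integrable(3)[where C="\<bar>c\<bar> * K * lim_const t"])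
      show "\<bar>c * \<phi> (y_lim t x) * a_lim t x\<bar> \<le> \<bar>c\<bar> * K * lim_const t" for x unfolding abs_mult
        using K0 by (intro mult_mono K F.a_bd[OF t order_refl]) auto
    qed measurable
    have ih: "?h integrable_on {\<xi>..\<eta>}"
      by (rule integrable_spike[OF i1 neg]) auto
    have "integral {\<xi>..\<eta>} (\<lambda>x. g_lim t x * \<phi> (y_lim t x)) = integral {\<xi>..\<eta>} ?h"
      by (rule integral_spike[OF neg]) auto
    also have "\<dots> \<le> integral {\<xi>..\<eta>} (\<lambda>x. c * \<phi> (y_lim t x) * a_lim t x)"
    proof (rule integral_le[OF ih i2])
      fix x
      have "g_lim t x \<le> c * a_lim t x" if w: "w0 x \<le> M"
      proof (cases "alive t x")
        case True
        then have p1: "0 < 2 + w0 x * t" by (simp add: alive_def)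
        have "w0 x * t \<le> M * t" using w t by (rule mult_right_mono)
        \<comment> \<open>The sign of the denominator is supplied by the live particle: 0 < 2 + w0 t
          \<le> 2 + M t.\<close>
        then have p2: "0 < M * t + 2" using p1 by linarith
        have r: "ramp t x = (2 + w0 x * t) / 2" using True by (simp add: ramp_def alive_def field_simps)
        have "w0 x * (M * t + 2) \<le> M * (2 + w0 x * t)" using w by (simp add: algebra_simps)
        then have "w0 x \<le> M * (2 + w0 x * t) / (M * t + 2)" using p2 by (simp add: pos_le_divide_eq)
        also have "\<dots> = c * ramp t x"
        proof -
          have "A * B / C = 2 * A / C * (B / 2)" for A B C :: real by (cases "C = 0") (auto simp: field_simps)
          then show ?thesis unfolding c_def r .
        qed
        finally have "w0 x * ramp t x \<le> c * ramp t x * ramp t x" by (rule mult_right_mono) (simp add: ramp_def)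
        then have "w0 x * ramp t x / (1 + (w0 x)\<^sup>2) \<le> c * ramp t x * ramp t x / (1 + (w0 x)\<^sup>2)"
          using w_pos[of x] by (intro divide_right_mono) auto
        then show ?thesis by (simp add: g_lim_def a_lim_def power2_eq_square[of "ramp t x"] mult.assoc)
      qed (simp add: g_lim_def a_lim_def ramp_def alive_def)
      then have "g_lim t x * \<phi> (y_lim t x) \<le> c * a_lim t x * \<phi> (y_lim t x)" if "w0 x \<le> M"
        using that pos by (intro mult_right_mono) auto
      then show "?h x \<le> c * \<phi> (y_lim t x) * a_lim t x" by (auto simp: ac_simps)
    qed
    finally show ?thesis .
  qed
  moreover have "integral {\<xi>..\<eta>} (\<lambda>x. c * \<phi> (y_lim t x) * a_lim t x) = integral {y_lim t \<xi>..y_lim t \<eta>} (\<lambda>x. c * \<phi> x)"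
    by (rule F.change_of_variables[OF t order_refl _ le]) (intro continuous_intros c\<phi>)
  ultimately have fin: "- integral {y_lim t \<xi>..y_lim t \<eta>} (\<lambda>x. sol t x * \<phi>' x)
    \<le> integral {y_lim t \<xi>..y_lim t \<eta>} (\<lambda>x. c * \<phi> x)"
    by simp
  have d: "deriv \<phi> = \<phi>'" using DERIV_imp_deriv[OF \<phi>'(1)] by auto
  have c1: "continuous_on UNIV (\<lambda>x. sol t x * \<phi>' x)" and c2: "continuous_on UNIV (\<lambda>x. c * \<phi> x)"
    by (intro continuous_intros sc c\<phi>' c\<phi>)+
  have o: "x \<notin> {- \<bar>X\<bar>..\<bar>X\<bar>}" if "x \<notin> {y_lim t \<xi>..y_lim t \<eta>}" for x using that \<xi> \<eta> by auto
  have "(LINT x|lebesgue. sol t x * deriv \<phi> x) = (LBINT x. sol t x * \<phi>' x)"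
    unfolding d by (rule integral_completion) (use borel_measurable_continuous_onI[OF c1] in simp)
  also have "\<dots> = integral {y_lim t \<xi>..y_lim t \<eta>} (\<lambda>x. sol t x * \<phi>' x)"
    by (rule continuous_on_test(2)[OF c1]) (use out o in auto)
  finally have l: "(LINT x|lebesgue. sol t x * deriv \<phi> x) = integral {y_lim t \<xi>..y_lim t \<eta>} (\<lambda>x. sol t x * \<phi>' x)" .
  have "(LINT x|lebesgue. c * \<phi> x) = (LBINT x. c * \<phi> x)"
    by (rule integral_completion) (use borel_measurable_continuous_onI[OF c2] in simp)
  also have "\<dots> = integral {y_lim t \<xi>..y_lim t \<eta>} (\<lambda>x. c * \<phi> x)"
    by (rule continuous_on_test(2)[OF c2]) (use out o in auto)
  finally have r: "(LINT x|lebesgue. c * \<phi> x) = integral {y_lim t \<xi>..y_lim t \<eta>} (\<lambda>x. c * \<phi> x)" .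
  show "- (LINT x|lebesgue. sol t x * deriv \<phi> x) \<le> (LINT x|lebesgue. 2 * M / (M * t + 2) * \<phi> x)"
    unfolding l c_def[symmetric] r by (rule fin)
qed

end

section \<open>The limit equation\<close>

lemma compact_support_bounded:
  fixes h :: "'a::topological_space \<Rightarrow> real"
  assumes "continuous_on UNIV h" "compact S" "\<And>z. z \<notin> S \<Longrightarrow> h z = 0"
  obtains K where "0 \<le> K" "\<And>z. \<bar>h z\<bar> \<le> K"
proof -
  have "bounded (h ` S)"
    by (intro compact_imp_bounded compact_continuous_image assms(2) continuous_on_subset[OF assms(1)]) simp
  then obtain K where K: "\<forall>y\<in>h ` S. norm y \<le> K" unfolding bounded_iff by blast
  have "\<bar>h z\<bar> \<le> max 0 K" for z using K assms(3)[of z] by (cases "z \<in> S") (auto simp: le_max_iff_disj)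
  then show ?thesis using that[of "max 0 K"] by simp
qed

context lagrangian_datum
begin

text \<open>Along one trajectory the test function has derivative d_t \<phi> + u d_x \<phi> and g
  has density e / 2; the product rule is integrated over [0, T], with vanishing boundary
  terms.\<close>

lemma weak_transport:
  assumes T: "0 \<le> T" and \<phi>: "\<And>n. Ck n \<phi>" and z: "\<phi> (0, y_lim 0 \<xi>) = 0" "\<phi> (T, y_lim T \<xi>) = 0"
  shows "integral {0..T} (\<lambda>t. g_lim t \<xi> * (d_t \<phi> (t, y_lim t \<xi>) + u_lim t \<xi> * d_x \<phi> (t, y_lim t \<xi>)))
    = - integral {0..T} (\<lambda>t. e_lim t \<xi> / 2 * \<phi> (t, y_lim t \<xi>))"
proof -
  interpret F: lagrangian_flow T "lim_const T" e_total a_lim g_lim e_lim "\<lambda>t \<xi>. e_lim t \<xi> / 2" D_lim ub0 y0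
    by (rule limit_flow'[OF T])
  have ACg: "AC_on 0 T (\<lambda>t. g_lim t \<xi>) (\<lambda>t. e_lim t \<xi> / 2)"
    unfolding AC_on_def
  proof (intro conjI ballI)
    show "(\<lambda>t. e_lim t \<xi> / 2) absolutely_integrable_on {0..T}"
      by (rule bounded_Borel_integrable(2)[OF F.sec_meas(7)]) (rule F.h_bd)
  next
    fix t assume "t \<in> {0..T}"
    then show "g_lim t \<xi> = g_lim 0 \<xi> + integral {0..t} (\<lambda>t. e_lim t \<xi> / 2)" by (intro F.g_eq) auto
  qed
  have dy: "((\<lambda>t. y_lim t \<xi>) has_real_derivative u_lim t \<xi>) (at t within {0..T})" if "t \<in> {0..T}" for t
  proof -
    have "((\<lambda>t. y0 \<xi> + integral {0..t} (\<lambda>s. u_lim s \<xi>)) has_real_derivative 0 + u_lim t \<xi>) (at t within {0..T})"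
      by (intro DERIV_add DERIV_const integral_has_real_derivative[OF F.u_cont that])
    then show ?thesis by (simp add: flow_y_def[abs_def])
  qed
  have yc: "continuous_on {0..T} (\<lambda>t. y_lim t \<xi>)" by (rule DERIV_continuous_on[OF dy])
  have cc: "continuous_on {0..T} (\<lambda>t. h (t, y_lim t \<xi>))" if "continuous_on UNIV h" for h :: "real \<times> real \<Rightarrow> real"
    by (rule continuous_on_compose2[OF that]) (auto intro!: continuous_intros yc)
  note c = cc[OF Ck_continuous[OF \<phi>]] cc[OF Ck_continuous[OF Ck_partial(2)[OF \<phi>]]] cc[OF Ck_continuous[OF
    Ck_partial(3)[OF \<phi>]]]
  have cd: "continuous_on {0..T} (\<lambda>t. d_t \<phi> (t, y_lim t \<xi>) + u_lim t \<xi> * d_x \<phi> (t, y_lim t \<xi>))"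
    by (intro continuous_intros c F.u_cont)
  have AC\<phi>: "AC_on 0 T (\<lambda>t. \<phi> (t, y_lim t \<xi>)) (\<lambda>t. d_t \<phi> (t, y_lim t \<xi>) + u_lim t \<xi> * d_x \<phi> (t, y_lim t \<xi>))"
    by (rule AC_on_C1[OF curve_derivative[OF \<phi> dy] cd]) auto
  have prod: "(\<lambda>t. p t * f t) integrable_on {0..T}" if p: "continuous_on {0..T} p" and f: "f absolutely_integrable_on {0..T}"
    for p f :: "real \<Rightarrow> real"
  proof -
    have "(\<lambda>t. p t * f t) absolutely_integrable_on {0..T}"
    proof (rule absolutely_integrable_bounded_measurable_product_real)
      show "p \<in> borel_measurable (lebesgue_on {0..T})"
        by (rule continuous_imp_measurable_on_sets_lebesgue[OF p]) simp
      show "bounded (p ` {0..T})" by (intro compact_imp_bounded compact_continuous_image p) simp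
    qed (use f in auto)
    then show ?thesis by (simp add: absolutely_integrable_on_def)
  qed
  have "integral {0..T} (\<lambda>t. e_lim t \<xi> / 2 * \<phi> (t, y_lim t \<xi>) + g_lim t \<xi> * (d_t \<phi> (t, y_lim t \<xi>) + u_lim t \<xi> * d_x
    \<phi> (t, y_lim t \<xi>))) = 0"
    using AC_on_diff[OF AC_on_mult[OF ACg AC\<phi>] order_refl T order_refl] z by simp
  moreover have "(\<lambda>t. e_lim t \<xi> / 2 * \<phi> (t, y_lim t \<xi>)) integrable_on {0..T}"
    using prod[OF c(1) AC_onD(1)[OF ACg]] by (simp add: mult.commute)
  moreover have "(\<lambda>t. g_lim t \<xi> * (d_t \<phi> (t, y_lim t \<xi>) + u_lim t \<xi> * d_x \<phi> (t, y_lim t \<xi>))) integrable_on {0..T}"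
    by (rule prod[OF AC_on_continuous[OF ACg] absolutely_integrable_continuous_real[OF cd]])
  ultimately show ?thesis by (simp add: Henstock_Kurzweil_Integration.integral_add)
qed

text \<open>Integration by parts in x and passage to particles turn the left side into minus the
  integral of u_xi against the derivative of \<phi> along trajectories. After exchanging the
  integrals each trajectory contributes e / 2 tested with \<phi>, and transport by y produces
  \<open>nu\<close>.\<close>

theorem limit_equation_sol: "limit_equation sol nu"
  unfolding limit_equation_def
proof (intro allI impI)
  fix \<phi> :: "real \<times> real \<Rightarrow> real" assume tf: "test_fun ({0<..} \<times> UNIV) \<phi>"
  then have \<phi>: "\<And>n. Ck n \<phi>" by (simp add: test_fun_def)
  define S where "S = closure {z. \<phi> z \<noteq> 0}"
  have S: "compact S" "closed S" "S \<subseteq> {0<..} \<times> UNIV" using tf by (auto simp: test_fun_def S_def)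
  have \<phi>t: "\<And>n. Ck n (d_t \<phi>)" and \<phi>x: "\<And>n. Ck n (d_x \<phi>)" using Ck_partial(2,3)[OF \<phi>] by auto
  have \<phi>xt: "\<And>n. Ck n (d_t (d_x \<phi>))" and \<phi>xx: "\<And>n. Ck n (d_x (d_x \<phi>))" using Ck_partial(2,3)[OF \<phi>x] by auto
  have z0: "\<phi> z = 0" if "z \<notin> S" for z using that closure_subset[of "{z. \<phi> z \<noteq> 0}"] by (auto simp: S_def)
  have z1: "d_t \<phi> z = 0" "d_x \<phi> z = 0" if "z \<notin> S" for z using partials_vanish[OF S(2) z0 that] by auto
  have z2: "d_t (d_x \<phi>) z = 0" "d_x (d_x \<phi>) z = 0" if "z \<notin> S" for z using partials_vanish[OF S(2) z1(2) that] by auto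
  obtain K0 where K0: "0 \<le> K0" "\<And>z. \<bar>\<phi> z\<bar> \<le> K0"
    using compact_support_bounded[OF Ck_continuous[OF \<phi>] S(1) z0] by blast
  obtain K1 where K1: "0 \<le> K1" "\<And>z. \<bar>d_t \<phi> z\<bar> \<le> K1"
    using compact_support_bounded[OF Ck_continuous[OF \<phi>t] S(1) z1(1)] by blast
  obtain K2 where K2: "0 \<le> K2" "\<And>z. \<bar>d_x \<phi> z\<bar> \<le> K2"
    using compact_support_bounded[OF Ck_continuous[OF \<phi>x] S(1) z1(2)] by blast
  obtain R0 where R0: "\<forall>z\<in>S. norm z \<le> R0" using compact_imp_bounded[OF S(1)] unfolding bounded_iff by blast
  define R where "R = \<bar>R0\<bar>"
  have R: "0 < fst z" "fst z \<le> R" "\<bar>snd z\<bar> \<le> R" if "z \<in> S" for z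
    using S(3) that R0[rule_format, OF that] norm_fst_le[of "fst z" "snd z"] norm_snd_le[of "snd z" "fst z"]
    unfolding R_def by auto
  have R_nn: "0 \<le> R" by (simp add: R_def)
  \<comment> \<open>One more than the extent of the support, so \<phi> vanishes at the final time;
    at time 0 it vanishes because the support lies in t > 0.\<close>
  define T where "T = R + 1"
  have T: "0 \<le> T" "R < T" using R_nn by (auto simp: T_def)
  interpret F: lagrangian_flow T "lim_const T" e_total a_lim g_lim e_lim "\<lambda>t \<xi>. e_lim t \<xi> / 2" D_lim ub0 y0
    by (rule limit_flow'[OF T(1)])
  define c where "c = lim_const T"
  have c0: "0 \<le> c" by (simp add: c_def lim_const_nonneg)
  \<comment> \<open>Maximal displacement of a particle up to T. Particles with labels outside
    [\<xi>1, \<xi>2] stay beyond the support throughout, so label integrals range over a compact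
    interval.\<close>
  define K where "K = (c + c * T) * T"
  obtain \<xi>1 where \<xi>1: "- (R + K + 1) = y0 \<xi>1" using y0_surj unfolding surj_def by blast
  obtain \<xi>2 where \<xi>2: "R + K + 1 = y0 \<xi>2" using y0_surj unfolding surj_def by blast
  have K_nn: "0 \<le> K" unfolding K_def using c0 T by simp
  have y0m: "y0 \<xi> \<le> y0 \<eta>" if "\<xi> \<le> \<eta>" for \<xi> \<eta> using F.y_mono[of 0, OF _ T(1) that] by (simp add: flow_y_def)
  have le: "\<xi>1 \<le> \<xi>2"
  proof (rule ccontr)
    assume "\<not> \<xi>1 \<le> \<xi>2"
    then have "y0 \<xi>2 \<le> y0 \<xi>1" by (intro y0m) simp
    then show False using \<xi>1 \<xi>2 R_nn K_nn by linarith
  qed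
  have far: "\<bar>y_lim t \<xi> - y0 \<xi>\<bar> \<le> K" if "0 \<le> t" "t \<le> T" for t \<xi>
    using F.y_far[OF that] by (simp add: K_def c_def)
  have low: "y_lim t \<xi> \<le> - (R + 1)" if "0 \<le> t" "t \<le> T" "\<xi> \<le> \<xi>1" for t \<xi>
    using far[OF that(1,2), of \<xi>] y0m[OF that(3)] \<xi>1 by linarith
  have high: "R + 1 \<le> y_lim t \<xi>" if "0 \<le> t" "t \<le> T" "\<xi>2 \<le> \<xi>" for t \<xi>
    using far[OF that(1,2), of \<xi>] y0m[OF that(3)] \<xi>2 by linarith
  have notS: "(t, x) \<notin> S" if "t \<le> 0 \<or> R < t \<or> x < - R \<or> R < x" for t x
    using R[of "(t, x)"] that by auto
  define G where "G = (\<lambda>z. sol (fst z) (snd z) * d_t (d_x \<phi>) z + 1 / 2 * (sol (fst z) (snd z))\<^sup>2 * d_x (d_x \<phi>) z)"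
  define B where "B t \<xi> = g_lim t \<xi> * (d_t \<phi> (t, y_lim t \<xi>) + u_lim t \<xi> * d_x \<phi> (t, y_lim t \<xi>))" for t \<xi>
  define C where "C t \<xi> = e_lim t \<xi> / 2 * \<phi> (t, y_lim t \<xi>)" for t \<xi>
  have mc: "(\<lambda>(t, \<xi>). h (t, y_lim t \<xi>)) \<in> borel_measurable (borel \<Otimes>\<^sub>M borel)" if "continuous_on UNIV h"
    for h :: "real \<times> real \<Rightarrow> real"
  proof -
    have "h \<in> borel_measurable (borel \<Otimes>\<^sub>M borel)" using borel_measurable_continuous_onI[OF that] by (simp add: borel_prod)
    then show ?thesis by measurable
  qed
  note [measurable] = mc[OF Ck_continuous[OF \<phi>]] mc[OF Ck_continuous[OF \<phi>t]] mc[OF Ck_continuous[OF \<phi>x]]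
  have Bm: "jointly_Borel B" unfolding B_def by measurable
  have Cm: "jointly_Borel C" unfolding C_def by measurable
  have Bb: "\<bar>B t \<xi>\<bar> \<le> c * (K1 + (c + c * T) * K2)" if "0 \<le> t" "t \<le> T" for t \<xi>
  proof -
    have "\<bar>d_t \<phi> (t, y_lim t \<xi>) + u_lim t \<xi> * d_x \<phi> (t, y_lim t \<xi>)\<bar>
      \<le> \<bar>d_t \<phi> (t, y_lim t \<xi>)\<bar> + \<bar>u_lim t \<xi>\<bar> * \<bar>d_x \<phi> (t, y_lim t \<xi>)\<bar>"
      using abs_triangle_ineq by (simp flip: abs_mult)
    also have "\<dots> \<le> K1 + (c + c * T) * K2"
      by (intro add_mono mult_mono K1 K2) (use F.u_bd[OF that] c0 T in \<open>auto simp: c_def\<close>)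
    finally show ?thesis unfolding B_def abs_mult
      by (intro mult_mono) (use F.g_bd[OF that] c0 in \<open>auto simp: c_def\<close>)
  qed
  have Cb: "\<bar>C t \<xi>\<bar> \<le> c * K0" if "0 \<le> t" "t \<le> T" for t \<xi>
    unfolding C_def abs_mult by (intro mult_mono K0) (use F.h_bd[OF that] c0 in \<open>auto simp: c_def\<close>)
  \<comment> \<open>After exchanging the mixed partials both terms carry an x-derivative of d_t
    \<phi> or d_x \<phi>, so integration by parts applies with F z = z and with F z = z^2 /
    2.\<close>
  have inner: "(LBINT x. indicator ({0..T} \<times> {- R..R}) (t, x) *\<^sub>R G (t, x)) = - integral {\<xi>1..\<xi>2} (B t)"
    if t: "0 \<le> t" "t \<le> T" for t
  proof -
    have "indicator ({0..T} \<times> {- R..R}) (t, x) *\<^sub>R G (t, x) = G (t, x)" for x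
      using z2[OF notS[of t x]] t by (cases "- R \<le> x \<and> x \<le> R") (auto simp: indicator_def G_def not_le)
    then have "(LBINT x. indicator ({0..T} \<times> {- R..R}) (t, x) *\<^sub>R G (t, x)) = (LBINT x. G (t, x))" by (simp only:)
    also have "\<dots> = integral {y_lim t \<xi>1..y_lim t \<xi>2} (\<lambda>x. G (t, x))"
    proof (rule continuous_on_test(2))
      have sl: "continuous_on UNIV (\<lambda>x. h (t, x))" if "continuous_on UNIV h" for h :: "real \<times> real \<Rightarrow> real"
        by (rule continuous_on_compose2[OF that]) (auto intro!: continuous_intros)
      show "continuous_on UNIV (\<lambda>x. G (t, x))" unfolding G_def fst_conv snd_conv
        by (intro continuous_intros sol_section[OF t(1)] sl[OF Ck_continuous[OF \<phi>xt]] sl[OF Ck_continuous[OF \<phi>xx]])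
      fix x assume "x \<notin> {y_lim t \<xi>1..y_lim t \<xi>2}"
      then have "(t, x) \<notin> S" using low[OF t order_refl] high[OF t order_refl] by (intro notS) auto
      then show "G (t, x) = 0" by (simp add: G_def z2)
    qed
    also have "\<dots> = integral {y_lim t \<xi>1..y_lim t \<xi>2} (\<lambda>x. sol t x * d_x (d_t \<phi>) (t, x))
      + integral {y_lim t \<xi>1..y_lim t \<xi>2} (\<lambda>x. (sol t x)\<^sup>2 / 2 * d_x (d_x \<phi>) (t, x))"
    proof -
      have sl: "continuous_on UNIV (\<lambda>x. h (t, x))" if "continuous_on UNIV h" for h :: "real \<times> real \<Rightarrow> real"
        by (rule continuous_on_compose2[OF that]) (auto intro!: continuous_intros)
      have "G (t, x) = sol t x * d_x (d_t \<phi>) (t, x) + (sol t x)\<^sup>2 / 2 * d_x (d_x \<phi>) (t, x)" for x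
        by (simp add: G_def mixed_partials[OF \<phi>])
      moreover have "continuous_on UNIV (\<lambda>x. sol t x * d_x (d_t \<phi>) (t, x))"
        "continuous_on UNIV (\<lambda>x. (sol t x)\<^sup>2 / 2 * d_x (d_x \<phi>) (t, x))"
        by (intro continuous_intros sol_section[OF t(1)] sl[OF Ck_continuous[OF Ck_partial(3)[OF \<phi>t]]] sl[OF
          Ck_continuous[OF \<phi>xx]]; simp)+
      then have "(\<lambda>x. sol t x * d_x (d_t \<phi>) (t, x)) integrable_on {y_lim t \<xi>1..y_lim t \<xi>2}"
        "(\<lambda>x. (sol t x)\<^sup>2 / 2 * d_x (d_x \<phi>) (t, x)) integrable_on {y_lim t \<xi>1..y_lim t \<xi>2}"
        by - (rule integrable_continuous_interval, erule continuous_on_subset, simp)+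
      ultimately show ?thesis by (simp add: Henstock_Kurzweil_Integration.integral_add)
    qed
    also have "\<dots> = - integral {\<xi>1..\<xi>2} (\<lambda>x. 1 * g_lim t x * d_t \<phi> (t, y_lim t x))
      - integral {\<xi>1..\<xi>2} (\<lambda>x. u_lim t x * g_lim t x * d_x \<phi> (t, y_lim t x))"
    proof -
      have sl: "continuous_on UNIV (\<lambda>x. h (t, x))" if "continuous_on UNIV h" for h :: "real \<times> real \<Rightarrow> real"
        by (rule continuous_on_compose2[OF that]) (auto intro!: continuous_intros)
      have e: "(t, y_lim t \<xi>1) \<notin> S" "(t, y_lim t \<xi>2) \<notin> S"
        using low[OF t order_refl] high[OF t order_refl] by (auto intro!: notS)
      have "integral {y_lim t \<xi>1..y_lim t \<xi>2} (\<lambda>x. sol t x * d_x (d_t \<phi>) (t, x))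
        = - integral {\<xi>1..\<xi>2} (\<lambda>x. 1 * g_lim t x * d_t \<phi> (t, y_lim t x))"
        by (rule F.by_parts[OF t le sol_eq[OF t(1)] sol_section[OF t(1)], where F="\<lambda>z. z" and F'="\<lambda>_. 1"
          and f="\<lambda>x. d_t \<phi> (t, x)"])
          (auto simp: z1[OF e(1)] z1[OF e(2)] intro: partial_x[OF \<phi>t] sl[OF Ck_continuous[OF Ck_partial(3)[OF \<phi>t]]])
      moreover have "integral {y_lim t \<xi>1..y_lim t \<xi>2} (\<lambda>x. (sol t x)\<^sup>2 / 2 * d_x (d_x \<phi>) (t, x))
        = - integral {\<xi>1..\<xi>2} (\<lambda>x. u_lim t x * g_lim t x * d_x \<phi> (t, y_lim t x))"
        by (rule F.by_parts[OF t le sol_eq[OF t(1)] sol_section[OF t(1)], where F="\<lambda>z. z\<^sup>2 / 2" and F'="\<lambda>z. z"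
          and f="\<lambda>x. d_x \<phi> (t, x)"])
          (auto simp: z1[OF e(1)] z1[OF e(2)] intro!: partial_x[OF \<phi>x] sl[OF Ck_continuous[OF \<phi>xx]] derivative_eq_intros)
      ultimately show ?thesis by simp
    qed
    also have "\<dots> = - integral {\<xi>1..\<xi>2} (B t)"
    proof -
      have pm: "(\<lambda>x. h (t, y_lim t x)) \<in> borel_measurable borel" if "continuous_on UNIV h" for h :: "real \<times> real \<Rightarrow> real"
        using mc[OF that] by measurable
      have [measurable]: "(\<lambda>x. d_t \<phi> (t, y_lim t x)) \<in> borel_measurable borel"
        "(\<lambda>x. d_x \<phi> (t, y_lim t x)) \<in> borel_measurable borel"
        "u_lim t \<in> borel_measurable borel" "g_lim t \<in> borel_measurable borel"
        using pm[OF Ck_continuous[OF \<phi>t]] pm[OF Ck_continuous[OF \<phi>x]] u_lim_meas F.sec_meas(2) by measurable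
      have "(\<lambda>x. 1 * g_lim t x * d_t \<phi> (t, y_lim t x)) integrable_on {\<xi>1..\<xi>2}"
      proof (rule bounded_Borel_integrable(3)[where C="c * K1"])
        show "\<bar>1 * g_lim t x * d_t \<phi> (t, y_lim t x)\<bar> \<le> c * K1" for x
          unfolding abs_mult by (intro mult_mono K1) (use F.g_bd[OF t] c0 in \<open>auto simp: c_def\<close>)
      qed measurable
      moreover have "(\<lambda>x. u_lim t x * g_lim t x * d_x \<phi> (t, y_lim t x)) integrable_on {\<xi>1..\<xi>2}"
      proof (rule bounded_Borel_integrable(3)[where C="(c + c * T) * c * K2"])
        show "\<bar>u_lim t x * g_lim t x * d_x \<phi> (t, y_lim t x)\<bar> \<le> (c + c * T) * c * K2" for x
          unfolding abs_mult by (intro mult_mono K2) (use F.g_bd[OF t] F.u_bd[OF t] c0 T in \<open>auto simp: c_def\<close>)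
      qed measurable
      moreover have "B t = (\<lambda>x. 1 * g_lim t x * d_t \<phi> (t, y_lim t x) + u_lim t x * g_lim t x * d_x \<phi> (t, y_lim t x))"
        by (auto simp: B_def algebra_simps)
      ultimately show ?thesis by (simp add: Henstock_Kurzweil_Integration.integral_add)
    qed
    finally show ?thesis .
  qed
  have int: "integrable (lborel \<Otimes>\<^sub>M lborel) (\<lambda>z. indicator ({0..T} \<times> {- R..R}) z *\<^sub>R G z)"
    unfolding lborel_prod
  proof (rule borel_integrable_compact)
    have h: "continuous_on ({0..T} \<times> {- R..R}) h" if "continuous_on UNIV h" for h :: "real \<times> real \<Rightarrow> real"
      by (rule continuous_on_subset[OF that]) simp
    have "continuous_on ({0..T} \<times> {- R..R}) (\<lambda>(t, x). sol t x)"
      by (rule continuous_on_subset[OF sol_continuous]) auto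
    then have sc: "continuous_on ({0..T} \<times> {- R..R}) (\<lambda>z. sol (fst z) (snd z))" by (simp add: split_beta')
    show "continuous_on ({0..T} \<times> {- R..R}) G" unfolding G_def
      by (intro continuous_intros sc h[OF Ck_continuous[OF \<phi>xt]] h[OF Ck_continuous[OF \<phi>xx]])
  qed (intro compact_Times compact_Icc)
  have "(LINT z:{0<..} \<times> UNIV|lebesgue. G z) = (LINT z|lebesgue. indicator ({0..T} \<times> {- R..R}) z *\<^sub>R G z)"
    unfolding set_lebesgue_integral_def
  proof (rule Bochner_Integration.integral_cong[OF refl])
    fix z :: "real \<times> real"
    show "indicator ({0<..} \<times> UNIV) z *\<^sub>R G z = indicator ({0..T} \<times> {- R..R}) z *\<^sub>R G z"
      using R[of z] T z2[of z] by (cases "z \<in> S"; cases z) (auto simp: indicator_def G_def abs_le_iff)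
  qed
  also have "\<dots> = (LBINT z. indicator ({0..T} \<times> {- R..R}) z *\<^sub>R G z)"
    by (rule integral_completion) (use int in \<open>auto simp: lborel_prod\<close>)
  also have "\<dots> = (LBINT t. LBINT x. indicator ({0..T} \<times> {- R..R}) (t, x) *\<^sub>R G (t, x))"
    using lborel_pair.integral_fst'[OF int] by (simp add: lborel_prod)
  also have "\<dots> = (LBINT t:{0..T}. LBINT x. indicator ({0..T} \<times> {- R..R}) (t, x) *\<^sub>R G (t, x))"
    unfolding set_lebesgue_integral_def by (rule Bochner_Integration.integral_cong) (auto simp: indicator_times
      split: split_indicator)
  also have "\<dots> = integral {0..T} (\<lambda>t. LBINT x. indicator ({0..T} \<times> {- R..R}) (t, x) *\<^sub>R G (t, x))"
    by (rule set_borel_integral_eq_integral(2), unfold set_integrable_def)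
      (rule integrable_mult_indicator[OF _ lborel_pair.integrable_fst'[OF int]], simp)
  also have "\<dots> = integral {0..T} (\<lambda>t. - integral {\<xi>1..\<xi>2} (B t))"
    by (rule Henstock_Kurzweil_Integration.integral_cong) (use inner in auto)
  also have "\<dots> = - integral {\<xi>1..\<xi>2} (\<lambda>\<xi>. integral {0..T} (\<lambda>t. B t \<xi>))"
    unfolding Henstock_Kurzweil_Integration.integral_neg
    by (subst interval_swap[OF Bm]) (use Bb in auto)
  also have "\<dots> = - integral {\<xi>1..\<xi>2} (\<lambda>\<xi>. - integral {0..T} (\<lambda>t. C t \<xi>))"
    unfolding B_def C_def using weak_transport[OF T(1) \<phi>] z0 notS T by simp
  also have "\<dots> = integral {0..T} (\<lambda>t. integral {\<xi>1..\<xi>2} (C t))"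
    unfolding Henstock_Kurzweil_Integration.integral_neg
    by (subst interval_swap[OF Cm]) (use Cb in auto)
  finally have L: "(LINT z:{0<..} \<times> UNIV|lebesgue. G z) = integral {0..T} (\<lambda>t. integral {\<xi>1..\<xi>2} (C t))" .
  have Cs: "C t \<in> borel_measurable borel" for t using Cm by measurable
  have Ci: "(LBINT \<xi>:{\<xi>1..\<xi>2}. C t \<xi>) = integral {\<xi>1..\<xi>2} (C t)" if "0 \<le> t" "t \<le> T" for t
    by (rule bounded_Borel_integrable(4)[OF Cs Cb[OF that]])
  have nuC: "(LINT x|nu t. \<phi> (t, x)) = (LBINT \<xi>:{\<xi>1..\<xi>2}. C t \<xi>)" if t: "0 \<le> t" "t \<le> T" for t
  proof -
    have "continuous_on UNIV (\<lambda>x. \<phi> (t, x))"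
      by (rule continuous_on_compose2[OF Ck_continuous[OF \<phi>]]) (auto intro!: continuous_intros)
    then have [measurable]: "(\<lambda>x. \<phi> (t, x)) \<in> borel_measurable borel" by (rule borel_measurable_continuous_onI)
    have "(LINT x|nu t. \<phi> (t, x)) = (LINT \<xi>|density lborel (\<lambda>\<xi>. ennreal (e_lim t \<xi> / 2)). \<phi> (t, y_lim t \<xi>))"
      unfolding nu_def by (rule integral_distr) auto
    also have "\<dots> = (LBINT \<xi>. (e_lim t \<xi> / 2) *\<^sub>R \<phi> (t, y_lim t \<xi>))"
      by (rule integral_density) (use e_lim_bd in auto)
    also have "\<dots> = (LBINT \<xi>:{\<xi>1..\<xi>2}. C t \<xi>)"
      unfolding set_lebesgue_integral_def
    proof (rule Bochner_Integration.integral_cong[OF refl])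
      fix \<xi>
      show "(e_lim t \<xi> / 2) *\<^sub>R \<phi> (t, y_lim t \<xi>) = indicator {\<xi>1..\<xi>2} \<xi> *\<^sub>R C t \<xi>"
      proof (cases "\<xi> \<in> {\<xi>1..\<xi>2}")
        case False
        then have "(t, y_lim t \<xi>) \<notin> S" using low[OF t, of \<xi>] high[OF t, of \<xi>] by (intro notS) auto
        then show ?thesis using False z0 by (simp add: C_def)
      qed (simp add: C_def)
    qed
    finally show ?thesis .
  qed
  have Mm: "(\<lambda>t. LBINT \<xi>:{\<xi>1..\<xi>2}. C t \<xi>) \<in> borel_measurable borel"
    using LBINT_interval_measurable(1)[OF Cm, of \<xi>1] by measurable
  have "(LINT t:{0<..}|lebesgue. LINT x|nu t. \<phi> (t, x)) = (LINT t:{0..T}|lebesgue. LBINT \<xi>:{\<xi>1..\<xi>2}. C t \<xi>)"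
    unfolding set_lebesgue_integral_def[of lebesgue]
  proof (rule Bochner_Integration.integral_cong[OF refl])
    fix t
    have "(LINT x|nu t. \<phi> (t, x)) = 0" if "t \<le> 0 \<or> T < t"
    proof -
      have "(t, x) \<notin> S" for x using that T by (intro notS) auto
      then show ?thesis by (simp add: z0)
    qed
    then show "indicator {0<..} t *\<^sub>R (LINT x|nu t. \<phi> (t, x)) = indicator {0..T} t *\<^sub>R (LBINT \<xi>:{\<xi>1..\<xi>2}. C t \<xi>)"
      using nuC[of t] T by (cases "t = 0") (auto simp: indicator_def)
  qed
  also have "\<dots> = integral {0..T} (\<lambda>t. LBINT \<xi>:{\<xi>1..\<xi>2}. C t \<xi>)"
  proof (rule bounded_Borel_integrable(5)[OF Mm, where C="c * K0 * (\<xi>2 - \<xi>1)"])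
    fix t assume t: "0 \<le> t" "t \<le> T"
    have "norm (integral {\<xi>1..\<xi>2} (C t)) \<le> integral {\<xi>1..\<xi>2} (\<lambda>_. c * K0)"
      by (rule Henstock_Kurzweil_Integration.integral_norm_bound_integral)
        (use bounded_Borel_integrable(3)[OF Cs Cb[OF t]] Cb[OF t] in auto)
    then show "\<bar>LBINT \<xi>:{\<xi>1..\<xi>2}. C t \<xi>\<bar> \<le> c * K0 * (\<xi>2 - \<xi>1)" using le by (simp add: Ci[OF t] ac_simps)
  qed
  also have "\<dots> = integral {0..T} (\<lambda>t. integral {\<xi>1..\<xi>2} (C t))"
    by (rule Henstock_Kurzweil_Integration.integral_cong) (use Ci in auto)
  finally show "(LINT z:{0<..} \<times> UNIV|lebesgue. sol (fst z) (snd z) * d_t (d_x \<phi>) z + 1 / 2 * (sol (fst z) (snd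
    z))\<^sup>2 * d_x (d_x \<phi>) z)
    = (LINT t:{0<..}|lebesgue. LINT x|nu t. \<phi> (t, x))"
    using L unfolding G_def by simp
qed

end

section \<open>Borel versions of the Lagrangian unknowns\<close>

text \<open>Heine-Cantor for the essential sup distance, through a Lebesgue number for a cover of
  [0, T] by balls of continuity. The exceptional null set still depends on the two times.\<close>

lemma C_Linf_uniformly_continuous:
  assumes w: "C_Linf w" and "0 < \<eta>"
  obtains \<delta> where "0 < \<delta>" "\<And>s t. s \<in> {0..T} \<Longrightarrow> t \<in> {0..T} \<Longrightarrow> \<bar>s - t\<bar> < \<delta> \<Longrightarrow> AE \<xi> in lborel. \<bar>w s \<xi> - w t \<xi>\<bar> \<le> \<eta>"
proof -
  have "\<forall>t0. \<exists>d. 0 < d \<and> (0 \<le> t0 \<longrightarrow> (\<forall>t\<ge>0. \<bar>t - t0\<bar> < d \<longrightarrow> (AE \<xi> in lborel. \<bar>w t \<xi> - w t0 \<xi>\<bar> \<le> \<eta> / 2)))"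
  proof
    fix t0 :: real
    show "\<exists>d. 0 < d \<and> (0 \<le> t0 \<longrightarrow> (\<forall>t\<ge>0. \<bar>t - t0\<bar> < d \<longrightarrow> (AE \<xi> in lborel. \<bar>w t \<xi> - w t0 \<xi>\<bar> \<le> \<eta> / 2)))"
    proof (cases "0 \<le> t0")
      case True
      then have "\<forall>\<^sub>F t in at t0 within {0..}. AE \<xi> in lebesgue. \<bar>w t \<xi> - w t0 \<xi>\<bar> \<le> \<eta> / 2"
        using w \<open>0 < \<eta>\<close> unfolding C_Linf_def by (meson half_gt_zero)
      then obtain d where d: "0 < d" "\<And>t. 0 \<le> t \<Longrightarrow> t \<noteq> t0 \<Longrightarrow> dist t t0 < d \<Longrightarrow> AE \<xi> in lborel. \<bar>w t \<xi> - w t0 \<xi>\<bar> \<le> \<eta> / 2"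
        unfolding eventually_at AE_completion_iff by auto
      have "AE \<xi> in lborel. \<bar>w t \<xi> - w t0 \<xi>\<bar> \<le> \<eta> / 2" if "0 \<le> t" "\<bar>t - t0\<bar> < d" for t
        using d(2)[OF that(1)] that(2) \<open>0 < \<eta>\<close> by (cases "t = t0") (auto simp: dist_real_def)
      then show ?thesis using d(1) by blast
    qed (auto intro: exI[of _ 1])
  qed
  from choice[OF this] obtain d where d: "\<And>t0. 0 < d t0"
    "\<And>t0 t. 0 \<le> t0 \<Longrightarrow> 0 \<le> t \<Longrightarrow> \<bar>t - t0\<bar> < d t0 \<Longrightarrow> AE \<xi> in lborel. \<bar>w t \<xi> - w t0 \<xi>\<bar> \<le> \<eta> / 2"
    by blast
  obtain \<delta> where \<delta>: "0 < \<delta>" "\<And>x. x \<in> {0..T} \<Longrightarrow> \<exists>G\<in>(\<lambda>t. ball t (d t)) ` {0..T}. ball x \<delta> \<subseteq> G"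
    by (rule Heine_Borel_lemma[of "{0..T}" "(\<lambda>t. ball t (d t)) ` {0..T}"]) (use d(1) in auto)
  show ?thesis
  proof (rule that[OF \<delta>(1)])
    fix s t assume s: "s \<in> {0..T}" and t: "t \<in> {0..T}" and st: "\<bar>s - t\<bar> < \<delta>"
    obtain t0 where t0: "t0 \<in> {0..T}" "ball s \<delta> \<subseteq> ball t0 (d t0)" using \<delta>(2)[OF s] by blast
    have "s \<in> ball s \<delta>" "t \<in> ball s \<delta>" using \<delta>(1) st by (auto simp: dist_real_def)
    then have "s \<in> ball t0 (d t0)" "t \<in> ball t0 (d t0)" using t0(2) by blast+
    then have "\<bar>s - t0\<bar> < d t0" "\<bar>t - t0\<bar> < d t0" by (auto simp: dist_real_def abs_minus_commute)
    then have "AE \<xi> in lborel. \<bar>w s \<xi> - w t0 \<xi>\<bar> \<le> \<eta> / 2" "AE \<xi> in lborel. \<bar>w t \<xi> - w t0 \<xi>\<bar> \<le> \<eta> / 2"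
      using d(2) t0(1) s t by auto
    then show "AE \<xi> in lborel. \<bar>w s \<xi> - w t \<xi>\<bar> \<le> \<eta>" by eventually_elim linarith
  qed
qed

text \<open>Rounding down to multiples of 1 / (k + 1): rational times, countably many for each k,
  that converge to t without becoming negative for t \<ge> 0.\<close>

definition grid :: "nat \<Rightarrow> real \<Rightarrow> real" where
  "grid k t = of_int \<lfloor>t * real (Suc k)\<rfloor> / real (Suc k)"

lemma grid: "t - 1 / real (Suc k) \<le> grid k t" "grid k t \<le> t" "0 \<le> t \<Longrightarrow> 0 \<le> grid k t" "grid k t \<in> \<rat>" "(\<lambda>k. grid k t) \<longlonglongrightarrow> t"
proof -
  have p: "0 < real (Suc k)" for k by simp
  show lo: "t - 1 / real (Suc k) \<le> grid k t" for k
  proof -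
    have "(t - 1 / real (Suc k)) * real (Suc k) = t * real (Suc k) - 1" using p[of k] by (simp add: left_diff_distrib)
    also have "\<dots> \<le> of_int \<lfloor>t * real (Suc k)\<rfloor>" by linarith
    finally show ?thesis unfolding grid_def using p[of k] by (simp only: pos_le_divide_eq)
  qed
  show hi: "grid k t \<le> t" for k unfolding grid_def using p[of k] by (simp only: pos_divide_le_eq of_int_floor_le)
  show "0 \<le> t \<Longrightarrow> 0 \<le> grid k t" unfolding grid_def by (intro divide_nonneg_pos p) simp
  show "grid k t \<in> \<rat>" by (simp add: grid_def)
  have "(\<lambda>k. t - 1 / real (Suc k)) \<longlonglongrightarrow> t - 0"
    by (rule tendsto_diff[OF tendsto_const LIMSEQ_Suc[OF lim_const_over_n[of 1]]])
  then have l: "(\<lambda>k. t - 1 / real (Suc k)) \<longlonglongrightarrow> t" by (simp only: diff_zero)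
  show "(\<lambda>k. grid k t) \<longlonglongrightarrow> t"
    by (rule tendsto_sandwich[OF _ _ l tendsto_const]) (rule always_eventually, rule allI, rule lo hi)+
qed

text \<open>To obtain one null set for all times, agreement with Borel functions and the uniform
  estimates are imposed at rational times, of which there are countably many; continuity of each
  trajectory extends them. Joint measurability comes from sampling the time on the grids.\<close>

lemma C_Linf_Borel_version:
  assumes w: "C_Linf w" and N0: "N0 \<in> null_sets lborel"
    and cont: "\<And>\<xi> T. \<xi> \<notin> N0 \<Longrightarrow> 0 \<le> T \<Longrightarrow> continuous_on {0..T} (\<lambda>t. w t \<xi>)"
  obtains N where "N \<in> null_sets lborel" "N0 \<subseteq> N"
    "\<And>c. (\<lambda>(t, \<xi>). if 0 \<le> t \<and> \<xi> \<notin> N then w t \<xi> else c) \<in> borel_measurable (borel \<Otimes>\<^sub>M borel)"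
    "\<And>T \<eta>. 0 < \<eta> \<Longrightarrow> \<exists>\<delta>>0. \<forall>s\<in>{0..T}. \<forall>t\<in>{0..T}. \<bar>s - t\<bar> < \<delta> \<longrightarrow> (\<forall>\<xi>. \<xi> \<notin> N \<longrightarrow> \<bar>w s \<xi> - w t \<xi>\<bar> \<le> \<eta>)"
proof -
  have "\<exists>f. f \<in> borel_measurable borel \<and> (0 \<le> r \<longrightarrow> (AE \<xi> in lborel. w r \<xi> = f \<xi>))" for r
  proof (cases "0 \<le> r")
    case True
    then show ?thesis using completion_ex_borel_measurable_real[of "w r" lborel] w unfolding C_Linf_def by auto
  qed (auto intro: exI[of _ "\<lambda>_. 0"])
  then obtain f where f: "\<And>r. f r \<in> borel_measurable borel" "\<And>r. 0 \<le> r \<Longrightarrow> AE \<xi> in lborel. w r \<xi> = f r \<xi>" by metis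
  have "\<exists>\<delta>>0. \<forall>s\<in>{0..real m}. \<forall>t\<in>{0..real m}. \<bar>s - t\<bar> < \<delta> \<longrightarrow> (AE \<xi> in lborel. \<bar>w s \<xi> - w t \<xi>\<bar> \<le> 1 / real (Suc n))" for m n
    by (rule C_Linf_uniformly_continuous[OF w, of "1 / real (Suc n)" "real m"]) (simp, blast)
  then have "\<forall>m. \<exists>d. \<forall>n. 0 < d n \<and> (\<forall>s\<in>{0..real m}. \<forall>t\<in>{0..real m}. \<bar>s - t\<bar> < d n
    \<longrightarrow> (AE \<xi> in lborel. \<bar>w s \<xi> - w t \<xi>\<bar> \<le> 1 / real (Suc n)))"
    by (intro allI choice) blast
  from choice[OF this] obtain \<delta> where \<delta>: "\<And>m n. 0 < \<delta> m n"
    "\<And>m n s t. s \<in> {0..real m} \<Longrightarrow> t \<in> {0..real m} \<Longrightarrow> \<bar>s - t\<bar> < \<delta> m n \<Longrightarrow> AE \<xi> in lborel. \<bar>w s \<xi> - w t \<xi>\<bar> \<le> 1 / real (Suc n)"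
    by blast
  have cr: "countable (\<rat> :: real set)" by (rule countable_rat)
  define good where "good \<xi> \<longleftrightarrow> (\<forall>r\<in>\<rat>. 0 \<le> r \<longrightarrow> w r \<xi> = f r \<xi>) \<and>
    (\<forall>m n. \<forall>s\<in>\<rat>. \<forall>t\<in>\<rat>. s \<in> {0..real m} \<and> t \<in> {0..real m} \<and> \<bar>s - t\<bar> < \<delta> m n \<longrightarrow> \<bar>w s \<xi> - w t \<xi>\<bar> \<le> 1 / real (Suc n))" for \<xi>
  have "AE \<xi> in lborel. good \<xi>"
    unfolding good_def
  proof (intro AE_conjI AE_all_countable[THEN iffD2] AE_ball_countable[OF cr, THEN iffD2] allI ballI)
    show "AE \<xi> in lborel. 0 \<le> r \<longrightarrow> w r \<xi> = f r \<xi>" for r using f(2)[of r] by (cases "0 \<le> r") auto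
    show "AE \<xi> in lborel. s \<in> {0..real m} \<and> t \<in> {0..real m} \<and> \<bar>s - t\<bar> < \<delta> m n \<longrightarrow> \<bar>w s \<xi> - w t \<xi>\<bar> \<le> 1 / real (Suc n)"
      for m n s t
      using \<delta>(2)[of s m t n] by (cases "s \<in> {0..real m} \<and> t \<in> {0..real m} \<and> \<bar>s - t\<bar> < \<delta> m n") auto
  qed
  then obtain N1 where N1: "N1 \<in> null_sets lborel" and gd: "\<And>\<xi>. \<xi> \<in> space lborel - N1 \<Longrightarrow> good \<xi>"
    by (rule AE_E3) blast
  have N1r: "w r \<xi> = f r \<xi>" if "\<xi> \<notin> N1" "r \<in> \<rat>" "0 \<le> r" for \<xi> r
    using gd[of \<xi>] that unfolding good_def by auto
  have N1u: "\<bar>w s \<xi> - w t \<xi>\<bar> \<le> 1 / real (Suc n)"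
    if "\<xi> \<notin> N1" "s \<in> \<rat>" "t \<in> \<rat>" "s \<in> {0..real m}" "t \<in> {0..real m}" "\<bar>s - t\<bar> < \<delta> m n" for \<xi> m n s t
  proof -
    have "good \<xi>" using gd[of \<xi>] that(1) by simp
    then show ?thesis using that(2-) unfolding good_def by blast
  qed
  define N where "N = N0 \<union> N1"
  have N: "N \<in> null_sets lborel" unfolding N_def by (intro null_sets.Un N0 N1)
  have Nm: "N \<in> sets borel" using null_setsD2[OF N] by simp
  have lim: "(\<lambda>k. w (grid k t) \<xi>) \<longlonglongrightarrow> w t \<xi>" if "\<xi> \<notin> N" "0 \<le> t" for t \<xi>
    by (rule continuous_on_tendsto_compose[OF cont grid(5)]) (use that grid(2,3) in \<open>auto simp: N_def\<close>)
  show ?thesis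
  proof (rule that[OF N])
    show "N0 \<subseteq> N" by (simp add: N_def)
    fix c :: real
    show "(\<lambda>(t, \<xi>). if 0 \<le> t \<and> \<xi> \<notin> N then w t \<xi> else c) \<in> borel_measurable (borel \<Otimes>\<^sub>M borel)"
    proof (rule borel_measurable_LIMSEQ_real[where u="\<lambda>k (t, \<xi>). if 0 \<le> t \<and> \<xi> \<notin> N then f (grid k t) \<xi> else c"])
      fix z :: "real \<times> real"
      obtain t \<xi> where z: "z = (t, \<xi>)" by (cases z)
      show "(\<lambda>k. case z of (t, \<xi>) \<Rightarrow> if 0 \<le> t \<and> \<xi> \<notin> N then f (grid k t) \<xi> else c) \<longlonglongrightarrow> (case z of (t, \<xi>) \<Rightarrow> if 0
        \<le> t \<and> \<xi> \<notin> N then w t \<xi> else c)"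
      proof (cases "0 \<le> t \<and> \<xi> \<notin> N")
        case True
        then have "f (grid k t) \<xi> = w (grid k t) \<xi>" for k
          using N1r[OF _ grid(4) grid(3)] by (simp add: N_def)
        then show ?thesis using True lim[of \<xi> t] by (simp add: z)
      qed (auto simp: z)
    next
      fix k
      have "(\<lambda>z. f (of_int \<lfloor>fst z * real (Suc k)\<rfloor> / real (Suc k)) (snd z)) \<in> borel_measurable (borel \<Otimes>\<^sub>M borel)"
      proof (rule measurable_compose_countable[where f="\<lambda>i z. f (of_int i / real (Suc k)) (snd z)"
        and g="\<lambda>z. \<lfloor>fst z * real (Suc k)\<rfloor>"])
        show "(\<lambda>z. f (of_int i / real (Suc k)) (snd z)) \<in> borel_measurable (borel \<Otimes>\<^sub>M borel)" for i :: int
          by (rule measurable_compose[OF measurable_snd f(1)])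
        show "(\<lambda>z. \<lfloor>fst z * real (Suc k)\<rfloor>) \<in> measurable (borel \<Otimes>\<^sub>M borel) (count_space UNIV)" by measurable
      qed
      then have [measurable]: "(\<lambda>z. f (grid k (fst z)) (snd z)) \<in> borel_measurable (borel \<Otimes>\<^sub>M borel)" by (simp add: grid_def)
      show "(\<lambda>(t, \<xi>). if 0 \<le> t \<and> \<xi> \<notin> N then f (grid k t) \<xi> else c) \<in> borel_measurable (borel \<Otimes>\<^sub>M borel)"
        unfolding split_beta' using Nm by measurable
    qed
  next
    fix T \<eta> :: real assume \<eta>: "0 < \<eta>"
    obtain m :: nat where m: "T \<le> real m" using real_arch_simple by blast
    obtain n where n: "1 / real (Suc n) < \<eta>" using \<eta> by (metis nat_approx_posE)
    have "\<bar>w s \<xi> - w t \<xi>\<bar> \<le> \<eta>" if s: "s \<in> {0..T}" and t: "t \<in> {0..T}" and st: "\<bar>s - t\<bar> < \<delta> m n" and \<xi>: "\<xi> \<notin> N" for s t \<xi>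
    proof -
      have "(\<lambda>k. \<bar>grid k s - grid k t\<bar>) \<longlonglongrightarrow> \<bar>s - t\<bar>" by (intro tendsto_intros grid(5))
      then have "\<forall>\<^sub>F k in sequentially. \<bar>grid k s - grid k t\<bar> < \<delta> m n" using st by (rule order_tendstoD(2))
      then have ev: "\<forall>\<^sub>F k in sequentially. \<bar>w (grid k s) \<xi> - w (grid k t) \<xi>\<bar> \<le> 1 / real (Suc n)"
      proof eventually_elim
        case (elim k)
        have "grid k s \<in> {0..real m}" "grid k t \<in> {0..real m}"
          using grid(2)[of k s] grid(2)[of k t] grid(3)[of s k] grid(3)[of t k] s t m by auto
        then show ?case using N1u[OF _ grid(4) grid(4) _ _ elim] \<xi> by (simp add: N_def)
      qed
      have "(\<lambda>k. \<bar>w (grid k s) \<xi> - w (grid k t) \<xi>\<bar>) \<longlonglongrightarrow> \<bar>w s \<xi> - w t \<xi>\<bar>"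
        using s t by (intro tendsto_intros lim[OF \<xi>]) auto
      from tendsto_upperbound[OF this ev] have "\<bar>w s \<xi> - w t \<xi>\<bar> \<le> 1 / real (Suc n)" by simp
      then show ?thesis using n by linarith
    qed
    then show "\<exists>\<delta>>0. \<forall>s\<in>{0..T}. \<forall>t\<in>{0..T}. \<bar>s - t\<bar> < \<delta> \<longrightarrow> (\<forall>\<xi>. \<xi> \<notin> N \<longrightarrow> \<bar>w s \<xi> - w t \<xi>\<bar> \<le> \<eta>)"
      using \<delta>(1)[of m n] by blast
  qed
qed

text \<open>Equal steps shorter than \<delta> lead from 0 to t, each changing w by at most 1. It
  turns uniform continuity into a uniform bound on q, which starts at 1.\<close>

lemma chain_bound:
  fixes w :: "real \<Rightarrow> real"
  assumes "0 < \<delta>" and step: "\<And>s t. s \<in> {0..T} \<Longrightarrow> t \<in> {0..T} \<Longrightarrow> \<bar>s - t\<bar> < \<delta> \<Longrightarrow> \<bar>w s - w t\<bar> \<le> 1"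
    and n: "T < real n * \<delta>" and t: "t \<in> {0..T}"
  shows "\<bar>w t - w 0\<bar> \<le> real n"
proof -
  have n0: "0 < real n"
  proof (rule ccontr)
    assume "\<not> 0 < real n"
    then show False using n t by simp
  qed
  define h where "h = t / real n"
  have h: "h < \<delta>" "0 \<le> h" "real n * h = t"
    unfolding h_def using t n n0 by (simp_all add: pos_divide_less_eq mult.commute)
  have "i \<le> n \<Longrightarrow> \<bar>w (real i * h) - w 0\<bar> \<le> real i" for i
  proof (induction i)
    case (Suc i)
    have r: "real j * h \<in> {0..T}" if "j \<le> n" for j
      using mult_right_mono[of "real j" "real n" h] that h t by auto
    have "\<bar>w (real (Suc i) * h) - w (real i * h)\<bar> \<le> 1"
      by (rule step[OF r r]) (use Suc.prems h in \<open>auto simp: distrib_right\<close>)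
    then show ?case using Suc by simp
  qed simp
  from this[of n] show ?thesis by (simp add: h)
qed

section \<open>Changing the unknowns on a null set\<close>

text \<open>Integrability has to be transferred along with the value, because a Bochner integral is
  0 for a non-integrable function; the equality includes that case.\<close>

lemma LINT_spike:
  fixes f g :: "real \<Rightarrow> real"
  assumes N: "negligible N" and eq: "\<And>x. x \<notin> N \<Longrightarrow> f x = g x"
  shows "integrable lebesgue f \<longleftrightarrow> integrable lebesgue g" "(LINT x|lebesgue. f x) = (LINT x|lebesgue. g x)"
proof -
  have i: "integrable lebesgue h \<longleftrightarrow> h absolutely_integrable_on UNIV" for h :: "real \<Rightarrow> real"
    by (simp add: set_integrable_def)
  have sp: "f absolutely_integrable_on UNIV \<longleftrightarrow> g absolutely_integrable_on UNIV"
    by (intro iffI; erule absolutely_integrable_spike[OF _ N]) (simp_all add: eq)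
  then show "integrable lebesgue f \<longleftrightarrow> integrable lebesgue g" unfolding i .
  show "(LINT x|lebesgue. f x) = (LINT x|lebesgue. g x)"
  proof (cases "integrable lebesgue f")
    case True
    then have a: "f absolutely_integrable_on UNIV" "g absolutely_integrable_on UNIV" using i sp by auto
    have "(LINT x|lebesgue. h x) = integral UNIV h" if "h absolutely_integrable_on UNIV" for h :: "real \<Rightarrow> real"
      using set_lebesgue_integral_eq_integral(2)[OF that] by (simp add: set_lebesgue_integral_def)
    moreover have "integral UNIV f = integral UNIV g" by (rule integral_spike[OF N]) (use eq in auto)
    ultimately show ?thesis using a by simp
  next
    case False
    then show ?thesis using sp i by (simp add: not_integrable_integral_eq)
  qed
qed

lemma set_LINT_spike:
  fixes f g :: "real \<Rightarrow> real"
  assumes N: "negligible N" and eq: "\<And>x. x \<notin> N \<Longrightarrow> f x = g x"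
  shows "(LINT x:S|lebesgue. f x) = (LINT x:S|lebesgue. g x)"
  unfolding set_lebesgue_integral_def by (rule LINT_spike(2)[OF N]) (simp add: eq)

text \<open>The pressure uses v and q only under integrals in the label, so it is unchanged at every
  \<xi>, including those in the null set.\<close>

lemma pressure_spike:
  assumes N: "negligible N" and eq: "\<And>\<xi>. \<xi> \<notin> N \<Longrightarrow> v \<xi> = v' \<xi>" "\<And>\<xi>. \<xi> \<notin> N \<Longrightarrow> q \<xi> = q' \<xi>"
  shows "Pfun l v q \<xi> = Pfun l v' q' \<xi>" "Pxfun l v q \<xi> = Pxfun l v' q' \<xi>"
    "integrable lebesgue (P_integrand l v q \<xi>) \<longleftrightarrow> integrable lebesgue (P_integrand l v' q' \<xi>)"
proof -
  have k: "kern l v q \<xi> \<eta> = kern l v' q' \<xi> \<eta>" for \<eta>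
    unfolding kern_def interval_lebesgue_integral_def
    by (intro arg_cong2[where f="\<lambda>a b. exp (a * \<bar>b\<bar>)"] if_cong refl arg_cong[where f=uminus] set_LINT_spike[OF N])
      (auto simp: qbar_def eq)
  have P: "P_integrand l v q \<xi> \<eta> = P_integrand l v' q' \<xi> \<eta>" if "\<eta> \<notin> N" for \<eta>
    using eq[OF that] by (simp add: P_integrand_def k qbar_def)
  show "Pfun l v q \<xi> = Pfun l v' q' \<xi>" unfolding Pfun_def
    by (rule arg_cong[where f="\<lambda>x. 1 / (4 * l) * x"], rule LINT_spike(2)[OF N], erule P)
  show "Pxfun l v q \<xi> = Pxfun l v' q' \<xi>" unfolding Pxfun_def
    by (rule arg_cong2[where f="\<lambda>x y. 1 / (4 * l\<^sup>2) * (x - y)"]; rule set_LINT_spike[OF N], erule P)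
  show "integrable lebesgue (P_integrand l v q \<xi>) \<longleftrightarrow> integrable lebesgue (P_integrand l v' q' \<xi>)"
    by (rule LINT_spike(1)[OF N], erule P)
qed

lemma AC_on_LINT:
  assumes "\<And>t. 0 \<le> t \<Longrightarrow> set_integrable lebesgue {0..t} f" "\<And>t. 0 \<le> t \<Longrightarrow> F t = c + (LINT s:{0..t}|lebesgue. f s)" "0 \<le> T"
  shows "AC_on 0 T F f" "F 0 = c"
proof -
  have F: "F t = c + integral {0..t} f" if "0 \<le> t" for t
    using assms(2)[OF that] set_lebesgue_integral_eq_integral(2)[OF assms(1)[OF that]] by simp
  then show "F 0 = c" by simp
  then show "AC_on 0 T F f" unfolding AC_on_def using F assms(1)[OF assms(3)] by auto
qed

context lagrangian_datum
begin

text \<open>Three nested exceptional sets: where the equations fail, where v is irregular in time,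
  and where q is. On the largest one the unknowns are overwritten, and the pressure keeps its values
  at every particle.\<close>

lemma regularized_version:
  assumes l: "0 < l" and sol: "lagrangian_solution l v0 v q" and v0: "AE \<xi> in lborel. v0 \<xi> = 2 * arctan (w0 \<xi>)"
  obtains v' q' N where "regularized w0 ub0 y0 l v' q' N"
    "\<And>t \<xi>. 0 \<le> t \<Longrightarrow> Pxfun l (v t) (q t) \<xi> = Pxfun l (v' t) (q' t) \<xi>"
proof -
  have C: "C_Linf v" "C_Linf q" and Pi: "\<And>t \<xi>. 0 \<le> t \<Longrightarrow> integrable lebesgue (P_integrand l (v t) (q t) \<xi>)"
    using sol by (auto simp: lagrangian_solution_def)
  have ode: "AE \<xi> in lborel. (\<forall>t\<ge>0.
        set_integrable lebesgue {0..t} (\<lambda>s. v_rhs l (v s) (q s) \<xi>) \<and>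
        set_integrable lebesgue {0..t} (\<lambda>s. q_rhs l (v s) (q s) \<xi>) \<and>
        v t \<xi> = v0 \<xi> + (LINT s:{0..t}|lebesgue. v_rhs l (v s) (q s) \<xi>) \<and>
        q t \<xi> = 1 + (LINT s:{0..t}|lebesgue. q_rhs l (v s) (q s) \<xi>))"
    using sol by (simp add: lagrangian_solution_def AE_completion_iff)
  define good where "good \<xi> \<longleftrightarrow> (\<forall>T\<ge>0. AC_on 0 T (\<lambda>t. v t \<xi>) (\<lambda>s. v_rhs l (v s) (q s) \<xi>) \<and>
    AC_on 0 T (\<lambda>t. q t \<xi>) (\<lambda>s. q_rhs l (v s) (q s) \<xi>)) \<and> v 0 \<xi> = 2 * arctan (w0 \<xi>) \<and> q 0 \<xi> = 1" for \<xi>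
  have "AE \<xi> in lborel. good \<xi>" using ode v0
  proof eventually_elim
    case (elim \<xi>)
    note V = AC_on_LINT[of "\<lambda>s. v_rhs l (v s) (q s) \<xi>" "\<lambda>t. v t \<xi>" "v0 \<xi>"]
      and Q = AC_on_LINT[of "\<lambda>s. q_rhs l (v s) (q s) \<xi>" "\<lambda>t. q t \<xi>" 1]
    show ?case using elim V(2)[OF _ _ order_refl] Q(2)[OF _ _ order_refl] unfolding good_def by (auto intro!: V(1) Q(1))
  qed
  then obtain N0 where N0n: "N0 \<in> null_sets lborel" and gd: "\<And>\<xi>. \<xi> \<in> space lborel - N0 \<Longrightarrow> good \<xi>"
    by (rule AE_E3) blast
  have N0: "N0 \<in> null_sets lborel"
    "\<And>\<xi> T. \<xi> \<notin> N0 \<Longrightarrow> 0 \<le> T \<Longrightarrow> AC_on 0 T (\<lambda>t. v t \<xi>) (\<lambda>s. v_rhs l (v s) (q s) \<xi>)"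
    "\<And>\<xi> T. \<xi> \<notin> N0 \<Longrightarrow> 0 \<le> T \<Longrightarrow> AC_on 0 T (\<lambda>t. q t \<xi>) (\<lambda>s. q_rhs l (v s) (q s) \<xi>)"
    "\<And>\<xi>. \<xi> \<notin> N0 \<Longrightarrow> v 0 \<xi> = 2 * arctan (w0 \<xi>)" "\<And>\<xi>. \<xi> \<notin> N0 \<Longrightarrow> q 0 \<xi> = 1"
    using N0n gd unfolding good_def by simp_all
  obtain N1 where N1: "N1 \<in> null_sets lborel" "N0 \<subseteq> N1"
    "\<And>c. (\<lambda>(t, \<xi>). if 0 \<le> t \<and> \<xi> \<notin> N1 then v t \<xi> else c) \<in> borel_measurable (borel \<Otimes>\<^sub>M borel)"
    "\<And>T \<eta>. 0 < \<eta> \<Longrightarrow> \<exists>\<delta>>0. \<forall>s\<in>{0..T}. \<forall>t\<in>{0..T}. \<bar>s - t\<bar> < \<delta> \<longrightarrow> (\<forall>\<xi>. \<xi> \<notin> N1 \<longrightarrow> \<bar>v s \<xi> - v t \<xi>\<bar> \<le> \<eta>)"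
    by (rule C_Linf_Borel_version[OF C(1) N0(1) AC_on_continuous[OF N0(2)]]) (assumption+, rule that)
  have qc: "continuous_on {0..T} (\<lambda>t. q t \<xi>)" if "\<xi> \<notin> N1" "0 \<le> T" for \<xi> T
    using AC_on_continuous[OF N0(3)] that N1(2) by blast
  obtain N where N: "N \<in> null_sets lborel" "N1 \<subseteq> N"
    "\<And>c. (\<lambda>(t, \<xi>). if 0 \<le> t \<and> \<xi> \<notin> N then q t \<xi> else c) \<in> borel_measurable (borel \<Otimes>\<^sub>M borel)"
    "\<And>T \<eta>. 0 < \<eta> \<Longrightarrow> \<exists>\<delta>>0. \<forall>s\<in>{0..T}. \<forall>t\<in>{0..T}. \<bar>s - t\<bar> < \<delta> \<longrightarrow> (\<forall>\<xi>. \<xi> \<notin> N \<longrightarrow> \<bar>q s \<xi> - q t \<xi>\<bar> \<le> \<eta>)"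
    by (rule C_Linf_Borel_version[OF C(2) N1(1) qc]) (assumption+, rule that)
  have Nm: "N \<in> sets borel" using null_setsD2[OF N(1)] by simp
  have sub: "\<xi> \<notin> N \<Longrightarrow> \<xi> \<notin> N0" "\<xi> \<notin> N \<Longrightarrow> \<xi> \<notin> N1" for \<xi> using N1(2) N(2) by auto
  have neg: "negligible N" unfolding negligible_iff_null_sets by (rule null_sets_completionI[OF N(1)])
  \<comment> \<open>At v = -pi both right-hand sides are 0, so the constant pair solves the
    equations, and the cut-off makes it carry no energy.\<close>
  define v' where "v' t \<xi> = (if 0 \<le> t \<and> \<xi> \<notin> N then v t \<xi> else - pi)" for t \<xi>
  define q' where "q' t \<xi> = (if 0 \<le> t \<and> \<xi> \<notin> N then q t \<xi> else 1)" for t \<xi>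
  have sp: "Pfun l (v t) (q t) \<xi> = Pfun l (v' t) (q' t) \<xi>" "Pxfun l (v t) (q t) \<xi> = Pxfun l (v' t) (q' t) \<xi>"
    "integrable lebesgue (P_integrand l (v t) (q t) \<xi>) \<longleftrightarrow> integrable lebesgue (P_integrand l (v' t) (q' t) \<xi>)"
    if "0 \<le> t" for t \<xi> using pressure_spike[OF neg, of "v t" "v' t" "q t" "q' t"] that by (auto simp: v'_def q'_def)
  \<comment> \<open>Off N the value of q starts from 1 and moves by at most 1 over each short step,
    which gives one bound for all particles and times in [0, T].\<close>
  have q_bd: "\<exists>Q. \<forall>t\<in>{0..T}. \<forall>\<xi>. \<bar>q' t \<xi>\<bar> \<le> Q" if T: "0 \<le> T" for T
  proof -
    obtain \<delta> where \<delta>: "\<delta> > 0" "\<And>s t \<xi>. s \<in> {0..T} \<Longrightarrow> t \<in> {0..T} \<Longrightarrow> \<bar>s - t\<bar> < \<delta> \<Longrightarrow> \<xi> \<notin> N \<Longrightarrow> \<bar>q s \<xi> - q t \<xi>\<bar> \<le> 1"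
      using N(4)[of 1 T] by auto
    obtain n :: nat where n: "T < real n * \<delta>" using reals_Archimedean3[OF \<delta>(1)] by blast
    have "\<bar>q t \<xi> - q 0 \<xi>\<bar> \<le> real n" if "t \<in> {0..T}" "\<xi> \<notin> N" for t \<xi>
      by (rule chain_bound[OF \<delta>(1) \<delta>(2)[OF _ _ _ that(2)] n that(1)])
    then have "\<bar>q' t \<xi>\<bar> \<le> real n + 1" if "t \<in> {0..T}" for t \<xi>
      using that N0(5)[OF sub(1), of \<xi>] by (cases "\<xi> \<in> N") (force simp: q'_def)+
    then show ?thesis by blast
  qed
  have vm: "jointly_Borel v'"
  proof -
    have [measurable]: "(\<lambda>p. if 0 \<le> fst p \<and> snd p \<notin> N1 then v (fst p) (snd p) else - pi)
      \<in> borel_measurable (borel \<Otimes>\<^sub>M borel)"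
      using N1(3)[of "- pi"] by (simp add: split_beta')
    have "(\<lambda>p. if snd p \<in> N then - pi else if 0 \<le> fst p \<and> snd p \<notin> N1 then v (fst p) (snd p) else - pi)
      \<in> borel_measurable (borel \<Otimes>\<^sub>M borel)"
      using Nm by measurable
    also have "(\<lambda>p. if snd p \<in> N then - pi else if 0 \<le> fst p \<and> snd p \<notin> N1 then v (fst p) (snd p) else - pi)
      = (\<lambda>(t, \<xi>). v' t \<xi>)"
      using sub(2) by (auto simp: v'_def fun_eq_iff)
    finally show ?thesis .
  qed
  have qm: "jointly_Borel q'" unfolding q'_def by (rule N(3))
  have "regularized w0 ub0 y0 l v' q' N"
  proof (intro regularized.intro regularized_axioms.intro lagrangian_datum_axioms l vm qm N(1))
    show "v' 0 \<xi> = 2 * arctan (w0 \<xi>)" if "\<xi> \<notin> N" for \<xi> using N0(4)[OF sub(1)[OF that]] that by (simp add: v'_def)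
    show "v' 0 \<xi> = - pi" if "\<xi> \<in> N" for \<xi> using that by (simp add: v'_def)
    show "q' 0 \<xi> = 1" for \<xi> using N0(5)[OF sub(1), of \<xi>] by (simp add: q'_def)
    show "\<exists>Q. \<forall>t\<in>{0..T}. \<forall>\<xi>. \<bar>q' t \<xi>\<bar> \<le> Q" if "0 \<le> T" for T by (rule q_bd[OF that])
    show "\<exists>\<delta>>0. \<forall>s\<in>{0..T}. \<forall>t\<in>{0..T}. \<bar>s - t\<bar> \<le> \<delta> \<longrightarrow> (\<forall>\<xi>. \<bar>v' s \<xi> - v' t \<xi>\<bar> \<le> 1 / 10)" if "0 \<le> T" for T
    proof -
      obtain \<delta> where \<delta>: "\<delta> > 0" "\<And>s t \<xi>. s \<in> {0..T} \<Longrightarrow> t \<in> {0..T} \<Longrightarrow> \<bar>s - t\<bar> < \<delta> \<Longrightarrow> \<xi> \<notin> N1 \<Longrightarrow> \<bar>v s \<xi> - v t \<xi>\<bar> \<le> 1 / 10"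
        using N1(4)[of "1 / 10" T] by auto
      have "\<bar>v' s \<xi> - v' t \<xi>\<bar> \<le> 1 / 10" if "s \<in> {0..T}" "t \<in> {0..T}" "\<bar>s - t\<bar> \<le> \<delta> / 2" for s t \<xi>
        using \<delta>(2)[of s t \<xi>] that sub(2)[of \<xi>] \<delta>(1) by (auto simp: v'_def)
      then show ?thesis using \<delta>(1) by (intro exI[of _ "\<delta> / 2"]) auto
    qed
    show "integrable lborel (P_integrand l (v' t) (q' t) \<xi>)" if t: "0 \<le> t" for t \<xi>
    proof -
      obtain Q where Q: "\<And>\<xi>. \<bar>q' t \<xi>\<bar> \<le> Q" using q_bd[OF t] t by (metis atLeastAtMost_iff order_refl)
      have [measurable]: "v' t \<in> borel_measurable borel" "q' t \<in> borel_measurable borel" using vm qm by measurable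
      define \<alpha> where "\<alpha> = (\<lambda>s. qbar (v' t) (q' t) s * (cos (v' t s / 2))\<^sup>2)"
      have qm1: "qbar (v' t) (q' t) \<in> borel_measurable borel" unfolding qbar_def by measurable
      then have \<alpha>m: "\<alpha> \<in> borel_measurable borel" unfolding \<alpha>_def by measurable
      have "\<bar>\<alpha> s\<bar> \<le> Q * 1" for s unfolding \<alpha>_def abs_mult
        by (intro mult_mono) (use Q[of s] in \<open>auto simp: qbar_def abs_square_le_1\<close>)
      then have i: "set_integrable lborel {x..y} \<alpha>" for x y by (intro bounded_Borel_integrable(1)[OF \<alpha>m, where C=Q]) auto
      have "(LINT s=ereal \<xi>..ereal \<eta>|lebesgue. \<alpha> s) = prim \<alpha> \<eta> - prim \<alpha> \<xi>" for \<eta>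
        by (rule interval_LINT_eq_prim[OF \<alpha>m i]) (use \<alpha>m in \<open>auto simp: measurable_completion\<close>)
      then have "P_integrand l (v' t) (q' t) \<xi>
        = (\<lambda>\<eta>. exp (- (1 / l) * \<bar>prim \<alpha> \<eta> - prim \<alpha> \<xi>\<bar>) * qbar (v' t) (q' t) \<eta> * (sin (v' t \<eta> / 2))\<^sup>2)"
        by (simp add: fun_eq_iff P_integrand_def kern_def \<alpha>_def)
      moreover have "prim \<alpha> \<in> borel_measurable borel"
      proof -
        have "(\<lambda>(t::real, x). \<alpha> x) \<in> borel_measurable (borel \<Otimes>\<^sub>M borel)"
          unfolding split_beta' by (rule measurable_compose[OF measurable_snd \<alpha>m])
        then have "(\<lambda>(t::real, x). prim \<alpha> x) \<in> borel_measurable (borel \<Otimes>\<^sub>M borel)"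
          by (rule prim_measurable)
        from measurable_compose[OF measurable_Pair1' this, of 0] show ?thesis by simp
      qed
      ultimately have "P_integrand l (v' t) (q' t) \<xi> \<in> borel_measurable borel" using qm1 by simp
      then have "P_integrand l (v' t) (q' t) \<xi> \<in> borel_measurable lborel" by simp
      from integrable_completion[OF this] show ?thesis using Pi[OF t, of \<xi>] sp(3)[OF t, of \<xi>] by blast
    qed
    show "AC_on 0 T (\<lambda>t. v' t \<xi>) (\<lambda>s. v_rhs l (v' s) (q' s) \<xi>)" if T: "0 \<le> T" for T \<xi>
    proof (cases "\<xi> \<in> N")
      case True
      then show ?thesis using AC_on_const[of 0 T "- pi"] by (simp add: v'_def v_rhs_def)
    next
      case False
      from N0(2)[OF sub(1)[OF this] T] show ?thesis
        by (rule AC_on_cong) (use False in \<open>auto simp: v_rhs_def sp(1), auto simp: v'_def q'_def\<close>)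
    qed
    show "AC_on 0 T (\<lambda>t. q' t \<xi>) (\<lambda>s. q_rhs l (v' s) (q' s) \<xi>)" if T: "0 \<le> T" for T \<xi>
    proof (cases "\<xi> \<in> N")
      case True
      then show ?thesis using AC_on_const[of 0 T 1] by (simp add: v'_def q'_def q_rhs_def)
    next
      case False
      from N0(3)[OF sub(1)[OF this] T] show ?thesis
        by (rule AC_on_cong) (use False in \<open>auto simp: q_rhs_def sp(1), auto simp: v'_def q'_def\<close>)
    qed
  qed
  then show ?thesis using that sp(2) by blast
qed

end

text \<open>Besides the initial data, the constructed velocity and position involve the unknowns
  only through P_x, so the Borel version has the same trajectories at every label.\<close>

lemma (in regularized) lag_eq:
  assumes sp: "\<And>t \<xi>. 0 \<le> t \<Longrightarrow> Pxfun l (v1 t) (q1 t) \<xi> = Pxfun l (v t) (q t) \<xi>"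
    and ub0: "\<And>\<xi>. ub0 \<xi> = u\<^sub>0 (y0 \<xi>)" and t: "0 \<le> t"
  shows "u_lag l u\<^sub>0 y0 v1 q1 t \<xi> = flow_u ub0 D t \<xi>" "y_lag l u\<^sub>0 y0 v1 q1 t \<xi> = flow_y y0 ub0 D t \<xi>"
proof -
  obtain C E where "lagrangian_flow t C E a g e h D ub0 y0" by (rule flow_exists[OF t])
  then interpret F: lagrangian_flow t C E a g e h D ub0 y0 .
  have u: "u_lag l u\<^sub>0 y0 v1 q1 s \<xi> = flow_u ub0 D s \<xi>" if s: "0 \<le> s" "s \<le> t" for s
  proof -
    have "(LINT r:{0..s}|lebesgue. l\<^sup>2 * Pxfun l (v1 r) (q1 r) \<xi>) = (LINT r:{0..s}|lebesgue. - D r \<xi>)"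
      unfolding set_lebesgue_integral_def
      by (rule Bochner_Integration.integral_cong[OF refl]) (auto simp: indicator_def sp Pxfun_eq)
    also have "\<dots> = - (LINT r:{0..s}|lebesgue. D r \<xi>)" by (simp add: set_lebesgue_integral_def)
    also have "(LINT r:{0..s}|lebesgue. D r \<xi>) = integral {0..s} (\<lambda>r. D r \<xi>)"
      by (rule bounded_Borel_integrable(5)[OF F.sec_meas(8), where C=C]) (use F.D_bd s in auto)
    finally show ?thesis by (simp add: u_lag_def flow_u_def ub0)
  qed
  show "u_lag l u\<^sub>0 y0 v1 q1 t \<xi> = flow_u ub0 D t \<xi>" by (rule u[OF t order_refl])
  have "(LINT s:{0..t}|lebesgue. u_lag l u\<^sub>0 y0 v1 q1 s \<xi>) = (LINT s:{0..t}|lebesgue. flow_u ub0 D s \<xi>)"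
    unfolding set_lebesgue_integral_def
    by (rule Bochner_Integration.integral_cong[OF refl]) (auto simp: indicator_def u)
  also have "\<dots> = integral {0..t} (\<lambda>s. flow_u ub0 D s \<xi>)"
    by (rule set_lebesgue_integral_eq_integral(2)[OF absolutely_integrable_continuous_real[OF F.u_cont]])
  finally show "y_lag l u\<^sub>0 y0 v1 q1 t \<xi> = flow_y y0 ub0 D t \<xi>" by (simp add: y_lag_def flow_y_def)
qed

theorem theorem7p6:
  fixes u\<^sub>0 u\<^sub>0' :: "real \<Rightarrow> real"
    and M :: real
    and U :: "real \<Rightarrow> real \<Rightarrow> real \<Rightarrow> real"
  assumes "H1 u\<^sub>0 u\<^sub>0'"
    and "integrable lebesgue u\<^sub>0'"
    and "AE x in lebesgue. u\<^sub>0' x \<le> M"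
    and "\<And>l. l > 0 \<Longrightarrow> dissipative_solution l u\<^sub>0 u\<^sub>0' (U l)"
  shows "\<exists>u :: real \<Rightarrow> real \<Rightarrow> real.
           (\<forall>T>0. Linf_BV T u) \<and>
           (\<exists>\<Lambda> :: nat \<Rightarrow> real.
              (\<forall>n. \<Lambda> n > 0) \<and> filterlim \<Lambda> at_top sequentially \<and>
              (\<forall>T>0. \<forall>I. is_interval I \<and> bounded I \<longrightarrow> C_L1_tendsto T I (\<lambda>n. U (\<Lambda> n)) u)) \<and>
           (\<exists>\<nu>. Linf_M1_nonneg \<nu> \<and> limit_equation u \<nu>) \<and>
           (\<forall>t\<ge>0. distr_deriv_le (u t) (2 * M / (M * t + 2)))"
proof -
  \<comment> \<open>The shift by 1 makes the parameter positive already at n = 0.\<close>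
  define L where "L n = real n + 1" for n :: nat
  have L: "L n > 0" for n by (simp add: L_def)
  have Llim: "filterlim L at_top sequentially"
    unfolding L_def[abs_def]
    by (rule filterlim_at_top_mono[OF filterlim_real_sequentially]) simp
  define sol_at where "sol_at n y v q \<longleftrightarrow> (\<forall>\<xi>. (LINT x=0..ereal (y \<xi>)|lebesgue. (1 + (u\<^sub>0' x)\<^sup>2)) = \<xi>) \<and>
      lagrangian_solution (L n) (\<lambda>\<xi>. 2 * arctan (u\<^sub>0' (y \<xi>))) v q \<and>
      (\<forall>t\<ge>0. \<forall>\<xi>. U (L n) t (y_lag (L n) u\<^sub>0 y v q t \<xi>) = u_lag (L n) u\<^sub>0 y v q t \<xi>)" for n y v q
  have "\<exists>y v q. sol_at n y v q" for n
    using assms(4)[OF L[of n]] by (simp add: dissipative_solution_def sol_at_def)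
  then obtain Y v q where sol: "\<And>n. sol_at n (Y n) (v n) (q n)" by metis
  have Y: "(LINT x=0..ereal (Y n \<xi>)|lebesgue. (1 + (u\<^sub>0' x)\<^sup>2)) = \<xi>"
    and vq: "lagrangian_solution (L n) (\<lambda>\<xi>. 2 * arctan (u\<^sub>0' (Y n \<xi>))) (v n) (q n)"
    and U: "0 \<le> t \<Longrightarrow> U (L n) t (y_lag (L n) u\<^sub>0 (Y n) (v n) (q n) t \<xi>) = u_lag (L n) u\<^sub>0 (Y n) (v n) (q n) t \<xi>" for n t \<xi>
    using sol[of n] unfolding sol_at_def by blast+
  \<comment> \<open>Each parameter comes with a coordinate map of its own; uniqueness identifies all
    of them with the one at n = 0.\<close>
  define y0 where "y0 = Y 0"
  obtain w0 where w0: "lagrangian_datum w0 (\<lambda>\<xi>. u\<^sub>0 (y0 \<xi>)) y0" "AE \<xi> in lborel. u\<^sub>0' (y0 \<xi>) = w0 \<xi>"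
    and w0M: "AE x in lebesgue. u\<^sub>0' x \<le> M \<Longrightarrow> AE \<xi> in lborel. w0 \<xi> \<le> M"
    and uniq: "\<And>y1 :: real \<Rightarrow> real. (\<And>\<xi>. (LINT x=0..ereal (y1 \<xi>)|lebesgue. (1 + (u\<^sub>0' x)\<^sup>2)) = \<xi>) \<Longrightarrow> y1 = y0"
    by (rule lagrangian_coordinate[OF assms(1,2) Y[of 0, folded y0_def]]) blast
  have Y0: "Y n = y0" for n by (rule uniq) (rule Y)
  interpret lagrangian_datum w0 "\<lambda>\<xi>. u\<^sub>0 (y0 \<xi>)" y0 by (rule w0(1))
  have v0: "AE \<xi> in lborel. 2 * arctan (u\<^sub>0' (y0 \<xi>)) = 2 * arctan (w0 \<xi>)" using w0(2) by eventually_elim simp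
  define version where "version n v' q' N \<longleftrightarrow> regularized w0 (\<lambda>\<xi>. u\<^sub>0 (y0 \<xi>)) y0 (L n) v' q' N \<and>
    (\<forall>t \<xi>. 0 \<le> t \<longrightarrow> Pxfun (L n) (v n t) (q n t) \<xi> = Pxfun (L n) (v' t) (q' t) \<xi>)" for n v' q' N
  have "\<exists>v' q' N. version n v' q' N" for n
    by (rule regularized_version[OF L[of n] vq[of n, unfolded Y0] v0]) (unfold version_def, blast)
  then obtain v' q' N where ver: "\<And>n. version n (v' n) (q' n) (N n)" by metis
  have reg: "regularized w0 (\<lambda>\<xi>. u\<^sub>0 (y0 \<xi>)) y0 (L n) (v' n) (q' n) (N n)"
    and Px: "0 \<le> t \<Longrightarrow> Pxfun (L n) (v n t) (q n t) \<xi> = Pxfun (L n) (v' n t) (q' n t) \<xi>" for n t \<xi>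
    using ver[of n] unfolding version_def by blast+
  interpret regularized_sequence w0 "\<lambda>\<xi>. u\<^sub>0 (y0 \<xi>)" y0 L v' q' N
    by (intro regularized_sequence.intro w0(1) regularized_sequence_axioms.intro reg Llim)
  have W: "U (L n) t (yn n t \<xi>) = un n t \<xi>" if "0 \<le> t" for n t \<xi>
    using U[OF that, of n \<xi>] regularized.lag_eq[OF reg Px refl that] by (simp add: Y0)
  show ?thesis
  proof (intro exI[of _ sol] conjI allI impI)
    show "Linf_BV T sol" if "0 < T" for T by (rule sol_Linf_BV[OF that])
    have "C_L1_tendsto T I (\<lambda>n. U (L n)) sol" if "0 < T" "is_interval I \<and> bounded I" for T I
      by (rule convergence[OF W]) (use that in auto)
    then show "\<exists>\<Lambda>. (\<forall>n. 0 < \<Lambda> n) \<and> filterlim \<Lambda> at_top sequentially \<and>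
        (\<forall>T>0. \<forall>I. is_interval I \<and> bounded I \<longrightarrow> C_L1_tendsto T I (\<lambda>n. U (\<Lambda> n)) sol)"
      using L Llim by blast
    show "\<exists>\<nu>. Linf_M1_nonneg \<nu> \<and> limit_equation sol \<nu>" using nu_Linf limit_equation_sol by blast
    show "distr_deriv_le (sol t) (2 * M / (M * t + 2))" if "0 \<le> t" for t by (rule oleinik[OF w0M[OF assms(3)] that])
  qed
qed

end
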